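(* Let $G=\langle g\rangle\cong\mathbb{Z}_2$. Let $(\Gamma,Q)$ be a discriminant form, let $(\sigma,\omega)$ be a special representing abelian $3$-cocycle for $(\Gamma,Q)$, let $(q,\bar\delta)$ be a compatible square root datum, let $\varepsilon\in\{\pm1\}$, let $\alpha$ be a square root of $\varepsilon\,G_{\bar\delta}(\Gamma,q^{-1})$ and let $\beta\in\{\alpha^{-1},-\alpha^{-1}\}$ (all notions as in the context). Then the data (tensor product, associator, $\mathbb{Z}_2$-action, $\mathbb{Z}_2$-braiding, $\mathbb{Z}_2$-ribbon twist) listed in the context define a $\mathbb{Z}_2$-crossed ribbon fusion category (that is, a braided $\mathbb{Z}_2$-crossed tensor category which is a fusion category, together with a $\mathbb{Z}_2$-ribbon) $$\mathcal{C}=\mathcal{C}_1\oplus\mathcal{C}_g=\mathrm{Vect}_\Gamma\oplus\mathrm{Vect}_{\Gamma/2\Gamma},$$ which is a braided $\mathbb{Z}_2$-crossed extension of the modular tensor category $\mathrm{Vect}_\Gamma^Q$, represented by $\mathrm{Vect}_\Gamma^{\sigma,\omega}$, with the categorical $\mathbb{Z}_2$-action on it given by $g_*\mathbb{C}_a=\mathbb{C}_{-a}$ with tensor structure $g_*(\mathbb{C}_a\otimes\mathbb{C}_b)\to g_*\mathbb{C}_a\otimes g_*\mathbb{C}_b$ given by $\omega(a,b,-b)$ for $a,b\in\Gamma$. Moreover, with this ribbon twist all simple objects have positive quantum dimension if and only if $\alpha\beta=\varepsilon$.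
   Context: All categories are $\mathbb{C}$-linear. **Input data.** A discriminant form $(\Gamma,Q)$ is a finite abelian group $\Gamma$ (written additively) with a nondegenerate quadratic form $Q\colon\Gamma\to\mathbb{C}^\times$: $Q(na)=Q(a)^{n^2}$ for $n\in\mathbb{Z}$, and $B_Q(a,b)=Q(a+b)Q(a)^{-1}Q(b)^{-1}$ is bimultiplicative and nondegenerate. A *special representing abelian $3$-cocycle* for $(\Gamma,Q)$ is a pair of functions $\sigma\colon\Gamma^2\to\mathbb{C}^\times$, $\omega\colon\Gamma^3\to\{\pm1\}$ with: $\sigma(a,a)=Q(a)$; $\sigma(a,0)=\sigma(0,a)=1$; $\sigma(a,b)=\sigma(b,a)$; $\omega(a,b,c)=\sigma(a,b+c)\sigma(a,b)^{-1}\sigma(a,c)^{-1}$; and for fixed $b,c$ the map $\omega(\cdot,b,c)\colon\Gamma\to\{\pm1\}$ is a group homomorphism. Then $\omega$ is symmetric in its last two arguments and depends on its first argument only modulo $2\Gamma$; we allow its first argument to lie in $\Gamma/2\Gamma$. For $x\in\Gamma$, $\bar x$ denotes its class in $\Gamma/2\Gamma$. A *compatible square root datum* is a pair $(q,\bar\delta)$, $q\colon\Gamma\to\mathbb{C}^\times$, $\bar\delta\in\Gamma/2\Gamma$, with $q(a)^2=Q(a)$ and $q(a+b)q(a)^{-1}q(b)^{-1}=\sigma(a,b)\,\omega(a+b,a,b)\,\omega(\bar\delta,a,b)$ for all $a,b\in\Gamma$. Put $G_{\bar\delta}(\Gamma,q^{-1})=|2\Gamma|^{-1/2}\sum_{a\in\bar\delta}q(a)^{-1}$.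 $\mathrm{Vect}_\Gamma^{\sigma,\omega}$ is the braided fusion category with simple objects $\mathbb{C}_a$ ($a\in\Gamma$), $\mathbb{C}_a\otimes\mathbb{C}_b=\mathbb{C}_{a+b}$, associator $\omega(a,b,c)$ and braiding $\sigma(a,b)$; it represents the braided category $\mathrm{Vect}_\Gamma^Q$ attached to $Q$ (self-braiding $\sigma(a,a)=Q(a)$). **The category $\mathcal{C}$.** It is semisimple, with simple objects $\mathbb{C}_a$ ($a\in\Gamma$) in $\mathcal{C}_1$ and $\mathsf{X}^{\bar x}$ ($\bar x\in\Gamma/2\Gamma$) in $\mathcal{C}_g$. Tensor product: $\mathbb{C}_a\otimes\mathbb{C}_b=\mathbb{C}_{a+b}$, $\mathbb{C}_a\otimes\mathsf{X}^{\bar x}=\mathsf{X}^{\bar a+\bar x}=\mathsf{X}^{\bar x}\otimes\mathbb{C}_a$, $\mathsf{X}^{\bar x}\otimes\mathsf{X}^{\bar y}=\bigoplus_{t\in\bar\delta+\bar x+\bar y}\mathbb{C}_t$ (sum over $t\in\Gamma$ in this coset). Associator $(A\otimes B)\otimes C\to A\otimes(B\otimes C)$: - $(\mathbb{C}_a,\mathbb{C}_b,\mathbb{C}_c)$: $\omega(a,b,c)$; - $(\mathsf{X}^{\bar x},\mathbb{C}_a,\mathbb{C}_b)$: $\omega(\bar x+\bar\delta,a,b)$; - $(\mathbb{C}_a,\mathsf{X}^{\bar x},\mathbb{C}_b)$: $\sigma(a,b)$; - $(\mathbb{C}_a,\mathbb{C}_b,\mathsf{X}^{\bar x})$: $\omega(\bar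 a+\bar b+\bar x,a,b)$; - $(\mathbb{C}_a,\mathsf{X}^{\bar x},\mathsf{X}^{\bar y})$: $e_{a+t}\mapsto\omega(\bar a+\bar x,a,t)\,e_a\otimes e_t$; - $(\mathsf{X}^{\bar x},\mathsf{X}^{\bar y},\mathbb{C}_a)$: $e_t\otimes e_a\mapsto\omega(\bar x,t,a)\,e_{t+a}$; - $(\mathsf{X}^{\bar x},\mathbb{C}_a,\mathsf{X}^{\bar y})$: $e_t\mapsto\sigma(a,t)\,e_t$; - $(\mathsf{X}^{\bar x},\mathsf{X}^{\bar y},\mathsf{X}^{\bar z})$: the map $\bigoplus_{t\in\bar\delta+\bar x+\bar y}\mathsf{X}^{\bar t+\bar z}\to\bigoplus_{r\in\bar\delta+\bar y+\bar z}\mathsf{X}^{\bar x+\bar r}$ whose component from the $t$-summand to the $r$-summand is $\varepsilon|2\Gamma|^{-1/2}\sigma(t,r)^{-1}$. Here $e_t$ denotes the basis vector of the summand $\mathbb{C}_t$ of a product of two $\mathsf{X}$'s. Duals: $\mathbb{C}_a^*=\mathbb{C}_{-a}$, $(\mathsf{X}^{\bar x})^*=\mathsf{X}^{-\bar x-\bar\delta}$, with $\mathrm{coev}_{\mathsf{X}^{\bar x}}$ the inclusion of the summand $\mathbb{C}_0$ and $\mathrm{ev}_{\mathsf{X}^{\bar x}}=\varepsilon|2\Gamma|^{1/2}$ times the projection to $\mathbb{C}_0$. $\mathbb{Z}_2$-action: $g_*\mathbb{C}_a=\mathbb{C}_{-a}$, $g_*\mathsf{X}^{\bar x}=\mathsf{X}^{\bar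 x}$, with strict composition ($g_*g_*=\mathrm{id}$, i.e. $T_2=\mathrm{id}$) and tensor structure $\tau^g\colon g_*(A\otimes B)\to g_*A\otimes g_*B$: - $(\mathbb{C}_a,\mathbb{C}_b)$: $\omega(a,b,-b)$; - $(\mathbb{C}_a,\mathsf{X}^{\bar x})$: $\omega(\bar a+\bar x,a,-a)$; - $(\mathsf{X}^{\bar x},\mathbb{C}_a)$: $\omega(\bar x+\bar\delta,a,-a)$; - $(\mathsf{X}^{\bar x},\mathsf{X}^{\bar y})$: $\omega(\bar x,t,-t)$ on the summand indexed by $t$. $\mathbb{Z}_2$-braiding $c_{A,B}\colon A\otimes B\to h_*(B)\otimes A$ for $A\in\mathcal{C}_h$: - $\mathbb{C}_a\otimes\mathbb{C}_b\to\mathbb{C}_b\otimes\mathbb{C}_a$: $\sigma(a,b)$; - $\mathbb{C}_a\otimes\mathsf{X}^{\bar x}\to\mathsf{X}^{\bar x}\otimes\mathbb{C}_a$: $q(a)^{-1}$; - $\mathsf{X}^{\bar x}\otimes\mathbb{C}_a\to\mathbb{C}_{-a}\otimes\mathsf{X}^{\bar x}$: $q(a)^{-1}\omega(\bar x+\bar a,a,-a)$; - $\mathsf{X}^{\bar x}\otimes\mathsf{X}^{\bar y}\to\mathsf{X}^{\bar y}\otimes\mathsf{X}^{\bar x}$: $\alpha\,q(t)$ on the summand $\mathbb{C}_t$. $\mathbb{Z}_2$-ribbon twist $\theta_A\colon A\to h_*(A)$ for $A\in\mathcal{C}_h$: $\theta_{\mathbb{C}_a}=\sigma(a,a)$, $\theta_{\mathsf{X}^{\bar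 x}}=\beta$. **Definitions (for a finite group $G$ acting on $\mathcal{C}$ with strict composition $T_2=\mathrm{id}$; associators suppressed).** A *$G$-action*: functors $h_*$ ($h\in G$) with tensor structures $\tau^h$ compatible with the associator and with composition. A *braided $G$-crossed tensor category*: a tensor category with faithful $G$-grading $\mathcal{C}=\bigoplus_{h\in G}\mathcal{C}_h$, a $G$-action with $h_*(\mathcal{C}_k)\subset\mathcal{C}_{hkh^{-1}}$, and natural isomorphisms $c_{X,Y}\colon X\otimes Y\to h_*(Y)\otimes X$ ($X\in\mathcal{C}_h$) such that (i) $\tau^k_{h_*Y,X}\circ k_*(c_{X,Y})=c_{k_*X,k_*Y}\circ\tau^k_{X,Y}$ for $X\in\mathcal{C}_h$, $k\in G$; (ii) $(\tau^h_{Y,Z}\otimes\mathrm{id})\circ c_{X,Y\otimes Z}=(\mathrm{id}\otimes c_{X,Z})\circ(c_{X,Y}\otimes\mathrm{id})$ for $X\in\mathcal{C}_h$; (iii) $c_{X\otimes Y,Z}=(c_{X,k_*Z}\otimes\mathrm{id})\circ(\mathrm{id}\otimes c_{Y,Z})$ for $Y\in\mathcal{C}_k$. It is a *braided $G$-crossed extension* of a braided tensor category $\mathcal{B}$ with $G$-action if $\mathcal{C}_1=\mathcal{B}$ as braided tensor category with $G$-action. A *$G$-twist*: natural isomorphisms $\theta_X\colon X\to h_*X$ ($X\in\mathcal{C}_h$) with $\theta_{\mathbf 1}=\mathrm{id}$, $\tau^{hk}_{X,Y}\circ\theta_{X\otimes Y}=\big((hkh^{-1})_*(\theta_X)\otimes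 h_*(\theta_Y)\big)\circ c_{h_*Y,X}\circ c_{X,Y}$ for $X\in\mathcal{C}_h,Y\in\mathcal{C}_k$, and $h_*(\theta_Y)=\theta_{h_*Y}$. It is a *$G$-ribbon* (for $\mathcal{C}$ rigid) if $(\mathrm{id}_X\otimes\theta_{X^*})\circ\mathrm{coev}_X=\tau^{h^{-1}}_{h_*X,X^*}\circ (h^{-1})_*(\theta_X\otimes\mathrm{id}_{X^*})\circ (h^{-1})_*(\mathrm{coev}_X)$ for $X\in\mathcal{C}_h$. The quantum dimension of $\mathsf{X}^{\bar x}$ is the scalar $\mathrm{ev}_{\mathsf{X}^{\bar x}}\circ c_{\mathsf{X}^{\bar x},(\mathsf{X}^{\bar x})^*}\circ(\theta_{\mathsf{X}^{\bar x}}\otimes\mathrm{id})\circ\mathrm{coev}_{\mathsf{X}^{\bar x}}$ (using $g_*\mathsf{X}^{\bar y}=\mathsf{X}^{\bar y}$), and analogously for $\mathbb{C}_a$. *)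

theory Defs
  imports Complex_Main "HOL-Algebra.Group"
begin

section \<open>Linear, abelian and fusion categories\<close>

record ('o, 'm) lin_category =
  Ob :: "'o set"
  Arr :: "'m set"
  Dom :: "'m \<Rightarrow> 'o"
  Cod :: "'m \<Rightarrow> 'o"
  Id :: "'o \<Rightarrow> 'm"
  Comp :: "'m \<Rightarrow> 'm \<Rightarrow> 'm"  (infixl "\<cdot>\<index>" 68)
  Zero :: "'o \<Rightarrow> 'o \<Rightarrow> 'm"
  Add :: "'m \<Rightarrow> 'm \<Rightarrow> 'm"  (infixl "\<boxplus>\<index>" 65)
  Smul :: "complex \<Rightarrow> 'm \<Rightarrow> 'm"  (infixr "\<star>\<index>" 72)

definition homs :: "('o, 'm, 'e) lin_category_scheme \<Rightarrow> 'o \<Rightarrow> 'o \<Rightarrow> 'm set" where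
  "homs C A B = {f \<in> Arr C. Dom C f = A \<and> Cod C f = B}"

primrec msum :: "('o, 'm, 'e) lin_category_scheme \<Rightarrow> 'o \<Rightarrow> 'o \<Rightarrow> (nat \<Rightarrow> 'm) \<Rightarrow> nat \<Rightarrow> 'm" where
  "msum C A B f 0 = Zero C A B"
| "msum C A B f (Suc n) = Add C (msum C A B f n) (f n)"

definition inverse_arrows :: "('o, 'm, 'e) lin_category_scheme \<Rightarrow> 'm \<Rightarrow> 'm \<Rightarrow> bool" where
  "inverse_arrows C f g \<longleftrightarrow> f \<in> Arr C \<and> g \<in> homs C (Cod C f) (Dom C f) \<and>
     Comp C g f = Id C (Dom C f) \<and> Comp C f g = Id C (Cod C f)"

definition iso_arrow :: "('o, 'm, 'e) lin_category_scheme \<Rightarrow> 'm \<Rightarrow> bool" where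
  "iso_arrow C f \<longleftrightarrow> (\<exists>g. inverse_arrows C f g)"

definition inv_arrow :: "('o, 'm, 'e) lin_category_scheme \<Rightarrow> 'm \<Rightarrow> 'm" where
  "inv_arrow C f = (THE g. inverse_arrows C f g)"

definition isomorphic :: "('o, 'm, 'e) lin_category_scheme \<Rightarrow> 'o \<Rightarrow> 'o \<Rightarrow> bool" where
  "isomorphic C A B \<longleftrightarrow> (\<exists>f \<in> homs C A B. iso_arrow C f)"

definition zero_object :: "('o, 'm, 'e) lin_category_scheme \<Rightarrow> 'o \<Rightarrow> bool" where
  "zero_object C A \<longleftrightarrow> A \<in> Ob C \<and>
     (\<forall>B \<in> Ob C. (\<exists>!f. f \<in> homs C A B) \<and> (\<exists>!f. f \<in> homs C B A))"

definition mono_arrow :: "('o, 'm, 'e) lin_category_scheme \<Rightarrow> 'm \<Rightarrow> bool" where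
  "mono_arrow C f \<longleftrightarrow> f \<in> Arr C \<and>
     (\<forall>A. \<forall>u \<in> homs C A (Dom C f). \<forall>v \<in> homs C A (Dom C f). Comp C f u = Comp C f v \<longrightarrow> u = v)"

definition epi_arrow :: "('o, 'm, 'e) lin_category_scheme \<Rightarrow> 'm \<Rightarrow> bool" where
  "epi_arrow C f \<longleftrightarrow> f \<in> Arr C \<and>
     (\<forall>B. \<forall>u \<in> homs C (Cod C f) B. \<forall>v \<in> homs C (Cod C f) B. Comp C u f = Comp C v f \<longrightarrow> u = v)"

definition is_kernel :: "('o, 'm, 'e) lin_category_scheme \<Rightarrow> 'm \<Rightarrow> 'm \<Rightarrow> bool" where
  "is_kernel C f k \<longleftrightarrow> k \<in> Arr C \<and> Cod C k = Dom C f \<and>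
     Comp C f k = Zero C (Dom C k) (Cod C f) \<and>
     (\<forall>A. \<forall>u \<in> homs C A (Dom C f). Comp C f u = Zero C A (Cod C f) \<longrightarrow>
        (\<exists>!v. v \<in> homs C A (Dom C k) \<and> Comp C k v = u))"

definition is_cokernel :: "('o, 'm, 'e) lin_category_scheme \<Rightarrow> 'm \<Rightarrow> 'm \<Rightarrow> bool" where
  "is_cokernel C f k \<longleftrightarrow> k \<in> Arr C \<and> Dom C k = Cod C f \<and>
     Comp C k f = Zero C (Dom C f) (Cod C k) \<and>
     (\<forall>B. \<forall>u \<in> homs C (Cod C f) B. Comp C u f = Zero C (Dom C f) B \<longrightarrow>
        (\<exists>!v. v \<in> homs C (Cod C k) B \<and> Comp C v k = u))"

definition is_direct_sum ::
  "('o, 'm, 'e) lin_category_scheme \<Rightarrow> 'o \<Rightarrow> nat \<Rightarrow> (nat \<Rightarrow> 'o) \<Rightarrow> (nat \<Rightarrow> 'm) \<Rightarrow> (nat \<Rightarrow> 'm) \<Rightarrow> bool" where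
  "is_direct_sum C A n B i p \<longleftrightarrow> A \<in> Ob C \<and>
     (\<forall>k<n. B k \<in> Ob C \<and> i k \<in> homs C (B k) A \<and> p k \<in> homs C A (B k)) \<and>
     (\<forall>k<n. \<forall>l<n. Comp C (p k) (i l) = (if k = l then Id C (B k) else Zero C (B l) (B k))) \<and>
     msum C A A (\<lambda>k. Comp C (i k) (p k)) n = Id C A"

definition simple_object :: "('o, 'm, 'e) lin_category_scheme \<Rightarrow> 'o \<Rightarrow> bool" where
  "simple_object C A \<longleftrightarrow> A \<in> Ob C \<and> \<not> zero_object C A \<and>
     (\<forall>f. mono_arrow C f \<and> Cod C f = A \<longrightarrow> zero_object C (Dom C f) \<or> iso_arrow C f)"

locale linear_category =
  fixes C :: "('o, 'm, 'e) lin_category_scheme" (structure)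
  assumes dom_ob: "f \<in> Arr C \<Longrightarrow> Dom C f \<in> Ob C"
    and cod_ob: "f \<in> Arr C \<Longrightarrow> Cod C f \<in> Ob C"
    and id_homs: "A \<in> Ob C \<Longrightarrow> Id C A \<in> homs C A A"
    and comp_homs: "\<lbrakk>f \<in> homs C A B; g \<in> homs C B D\<rbrakk> \<Longrightarrow> g \<cdot> f \<in> homs C A D"
    and comp_id: "f \<in> homs C A B \<Longrightarrow> f \<cdot> Id C A = f"
    and id_comp: "f \<in> homs C A B \<Longrightarrow> Id C B \<cdot> f = f"
    and comp_assoc: "\<lbrakk>f \<in> homs C A B; g \<in> homs C B D; h \<in> homs C D E\<rbrakk>
          \<Longrightarrow> (h \<cdot> g) \<cdot> f = h \<cdot> (g \<cdot> f)"
    and zero_homs: "\<lbrakk>A \<in> Ob C; B \<in> Ob C\<rbrakk> \<Longrightarrow> Zero C A B \<in> homs C A B"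
    and add_homs: "\<lbrakk>f \<in> homs C A B; g \<in> homs C A B\<rbrakk> \<Longrightarrow> f \<boxplus> g \<in> homs C A B"
    and smul_homs: "f \<in> homs C A B \<Longrightarrow> c \<star> f \<in> homs C A B"
    and add_assoc: "\<lbrakk>f \<in> homs C A B; g \<in> homs C A B; h \<in> homs C A B\<rbrakk>
          \<Longrightarrow> (f \<boxplus> g) \<boxplus> h = f \<boxplus> (g \<boxplus> h)"
    and add_comm: "\<lbrakk>f \<in> homs C A B; g \<in> homs C A B\<rbrakk> \<Longrightarrow> f \<boxplus> g = g \<boxplus> f"
    and add_zero: "f \<in> homs C A B \<Longrightarrow> f \<boxplus> Zero C A B = f"
    and add_neg: "f \<in> homs C A B \<Longrightarrow> f \<boxplus> (-1) \<star> f = Zero C A B"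
    and smul_add: "\<lbrakk>f \<in> homs C A B; g \<in> homs C A B\<rbrakk> \<Longrightarrow> c \<star> (f \<boxplus> g) = c \<star> f \<boxplus> c \<star> g"
    and add_smul: "f \<in> homs C A B \<Longrightarrow> (c + d) \<star> f = c \<star> f \<boxplus> d \<star> f"
    and smul_smul: "f \<in> homs C A B \<Longrightarrow> (c * d) \<star> f = c \<star> (d \<star> f)"
    and one_smul: "f \<in> homs C A B \<Longrightarrow> 1 \<star> f = f"
    and comp_add: "\<lbrakk>f \<in> homs C A B; f' \<in> homs C A B; g \<in> homs C B D\<rbrakk>
          \<Longrightarrow> g \<cdot> (f \<boxplus> f') = g \<cdot> f \<boxplus> g \<cdot> f'"
    and add_comp: "\<lbrakk>f \<in> homs C A B; g \<in> homs C B D; g' \<in> homs C B D\<rbrakk>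
          \<Longrightarrow> (g \<boxplus> g') \<cdot> f = g \<cdot> f \<boxplus> g' \<cdot> f"
    and comp_smul: "\<lbrakk>f \<in> homs C A B; g \<in> homs C B D\<rbrakk> \<Longrightarrow> g \<cdot> (c \<star> f) = c \<star> (g \<cdot> f)"
    and smul_comp: "\<lbrakk>f \<in> homs C A B; g \<in> homs C B D\<rbrakk> \<Longrightarrow> (c \<star> g) \<cdot> f = c \<star> (g \<cdot> f)"

locale linear_abelian_category = linear_category +
  assumes ex_direct_sum: "(\<And>k. k < n \<Longrightarrow> F k \<in> Ob C) \<Longrightarrow> \<exists>A i p. is_direct_sum C A n F i p"
    and ex_kernel: "f \<in> Arr C \<Longrightarrow> \<exists>k. is_kernel C f k"
    and ex_cokernel: "f \<in> Arr C \<Longrightarrow> \<exists>k. is_cokernel C f k"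
    and mono_kernel: "mono_arrow C f \<Longrightarrow> \<exists>g \<in> Arr C. is_kernel C g f"
    and epi_cokernel: "epi_arrow C f \<Longrightarrow> \<exists>g \<in> Arr C. is_cokernel C g f"

text \<open>The duals are carried as data, because the ribbon axiom and the quantum dimensions refer
  to chosen coevaluations.\<close>

record ('o, 'm) tensor_category = "('o, 'm) lin_category" +
  Tens :: "'o \<Rightarrow> 'o \<Rightarrow> 'o"  (infixr "\<boxtimes>\<index>" 75)
  TensM :: "'m \<Rightarrow> 'm \<Rightarrow> 'm"  (infixr "\<odot>\<index>" 75)
  Unit :: "'o"
  Assoc :: "'o \<Rightarrow> 'o \<Rightarrow> 'o \<Rightarrow> 'm"
  LUnit :: "'o \<Rightarrow> 'm"
  RUnit :: "'o \<Rightarrow> 'm"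
  Dual :: "'o \<Rightarrow> 'o"
  Ev :: "'o \<Rightarrow> 'm"
  Coev :: "'o \<Rightarrow> 'm"

locale monoidal_category = linear_category C
  for C :: "('o, 'm, 'e) tensor_category_scheme" (structure) +
  assumes unit_ob: "Unit C \<in> Ob C"
    and tens_ob: "\<lbrakk>A \<in> Ob C; B \<in> Ob C\<rbrakk> \<Longrightarrow> A \<boxtimes> B \<in> Ob C"
    and tensm_homs: "\<lbrakk>f \<in> homs C A A'; g \<in> homs C B B'\<rbrakk> \<Longrightarrow> f \<odot> g \<in> homs C (A \<boxtimes> B) (A' \<boxtimes> B')"
    and tensm_id: "\<lbrakk>A \<in> Ob C; B \<in> Ob C\<rbrakk> \<Longrightarrow> Id C A \<odot> Id C B = Id C (A \<boxtimes> B)"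
    and tensm_comp: "\<lbrakk>f \<in> homs C A A'; f' \<in> homs C A' A''; g \<in> homs C B B'; g' \<in> homs C B' B''\<rbrakk>
          \<Longrightarrow> (f' \<cdot> f) \<odot> (g' \<cdot> g) = (f' \<odot> g') \<cdot> (f \<odot> g)"
    and tensm_add_left: "\<lbrakk>f \<in> homs C A A'; f' \<in> homs C A A'; g \<in> homs C B B'\<rbrakk>
          \<Longrightarrow> (f \<boxplus> f') \<odot> g = (f \<odot> g) \<boxplus> (f' \<odot> g)"
    and tensm_add_right: "\<lbrakk>f \<in> homs C A A'; g \<in> homs C B B'; g' \<in> homs C B B'\<rbrakk>
          \<Longrightarrow> f \<odot> (g \<boxplus> g') = (f \<odot> g) \<boxplus> (f \<odot> g')"
    and tensm_smul_left: "\<lbrakk>f \<in> homs C A A'; g \<in> homs C B B'\<rbrakk> \<Longrightarrow> (c \<star> f) \<odot> g = c \<star> (f \<odot> g)"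
    and tensm_smul_right: "\<lbrakk>f \<in> homs C A A'; g \<in> homs C B B'\<rbrakk> \<Longrightarrow> f \<odot> (c \<star> g) = c \<star> (f \<odot> g)"
    and assoc_homs: "\<lbrakk>A \<in> Ob C; B \<in> Ob C; D \<in> Ob C\<rbrakk>
          \<Longrightarrow> Assoc C A B D \<in> homs C ((A \<boxtimes> B) \<boxtimes> D) (A \<boxtimes> (B \<boxtimes> D))"
    and assoc_iso: "\<lbrakk>A \<in> Ob C; B \<in> Ob C; D \<in> Ob C\<rbrakk> \<Longrightarrow> iso_arrow C (Assoc C A B D)"
    and assoc_natural: "\<lbrakk>f \<in> homs C A A'; g \<in> homs C B B'; h \<in> homs C D D'\<rbrakk>
          \<Longrightarrow> Assoc C A' B' D' \<cdot> ((f \<odot> g) \<odot> h) = (f \<odot> (g \<odot> h)) \<cdot> Assoc C A B D"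
    and lunit_homs: "A \<in> Ob C \<Longrightarrow> LUnit C A \<in> homs C (Unit C \<boxtimes> A) A"
    and lunit_iso: "A \<in> Ob C \<Longrightarrow> iso_arrow C (LUnit C A)"
    and lunit_natural: "f \<in> homs C A A' \<Longrightarrow> LUnit C A' \<cdot> (Id C (Unit C) \<odot> f) = f \<cdot> LUnit C A"
    and runit_homs: "A \<in> Ob C \<Longrightarrow> RUnit C A \<in> homs C (A \<boxtimes> Unit C) A"
    and runit_iso: "A \<in> Ob C \<Longrightarrow> iso_arrow C (RUnit C A)"
    and runit_natural: "f \<in> homs C A A' \<Longrightarrow> RUnit C A' \<cdot> (f \<odot> Id C (Unit C)) = f \<cdot> RUnit C A"
    and triangle: "\<lbrakk>A \<in> Ob C; B \<in> Ob C\<rbrakk>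
          \<Longrightarrow> (Id C A \<odot> LUnit C B) \<cdot> Assoc C A (Unit C) B = RUnit C A \<odot> Id C B"
    and pentagon: "\<lbrakk>A \<in> Ob C; B \<in> Ob C; D \<in> Ob C; E \<in> Ob C\<rbrakk>
          \<Longrightarrow> (Id C A \<odot> Assoc C B D E) \<cdot> Assoc C A (B \<boxtimes> D) E \<cdot> (Assoc C A B D \<odot> Id C E)
             = Assoc C A B (D \<boxtimes> E) \<cdot> Assoc C (A \<boxtimes> B) D E"

definition is_dual ::
  "('o, 'm, 'e) tensor_category_scheme \<Rightarrow> 'o \<Rightarrow> 'o \<Rightarrow> 'm \<Rightarrow> 'm \<Rightarrow> bool" where
  "is_dual C A A' e c \<longleftrightarrow> A' \<in> Ob C \<and>
     e \<in> homs C (Tens C A' A) (Unit C) \<and> c \<in> homs C (Unit C) (Tens C A A') \<and>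
     RUnit C A \<cdot>\<^bsub>C\<^esub> (Id C A \<odot>\<^bsub>C\<^esub> e) \<cdot>\<^bsub>C\<^esub> Assoc C A A' A \<cdot>\<^bsub>C\<^esub> (c \<odot>\<^bsub>C\<^esub> Id C A) = LUnit C A \<and>
     LUnit C A' \<cdot>\<^bsub>C\<^esub> (e \<odot>\<^bsub>C\<^esub> Id C A') \<cdot>\<^bsub>C\<^esub> inv_arrow C (Assoc C A' A A') \<cdot>\<^bsub>C\<^esub> (Id C A' \<odot>\<^bsub>C\<^esub> c)
       = RUnit C A'"

locale fusion_category = linear_abelian_category C + monoidal_category C
  for C :: "('o, 'm, 'e) tensor_category_scheme" (structure) +
  assumes semisimple: "A \<in> Ob C \<Longrightarrow>
          \<exists>n F i p. is_direct_sum C A n F i p \<and> (\<forall>k<n. simple_object C (F k))"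
    and finitely_many_simples: "\<exists>S. finite S \<and> S \<subseteq> {A. simple_object C A} \<and>
          (\<forall>A. simple_object C A \<longrightarrow> (\<exists>B \<in> S. isomorphic C A B))"
    and finite_dimensional: "\<lbrakk>A \<in> Ob C; B \<in> Ob C\<rbrakk> \<Longrightarrow>
          \<exists>n b. (\<forall>k<n. b k \<in> homs C A B) \<and>
            (\<forall>f \<in> homs C A B. \<exists>c. f = msum C A B (\<lambda>k. c k \<star> b k) n)"
    and unit_simple: "simple_object C (Unit C)"
    and unit_endo: "f \<in> homs C (Unit C) (Unit C) \<Longrightarrow> \<exists>c. f = c \<star> Id C (Unit C)"
    and dual: "A \<in> Ob C \<Longrightarrow> is_dual C A (Dual C A) (Ev C A) (Coev C A)"
    and ex_right_dual: "A \<in> Ob C \<Longrightarrow> \<exists>A' e c. A' \<in> Ob C \<and> is_dual C A' A e c"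

section \<open>Group actions and crossed braidings\<close>

record ('g, 'o, 'm) action_category = "('o, 'm) tensor_category" +
  Act :: "'g \<Rightarrow> 'o \<Rightarrow> 'o"
  ActM :: "'g \<Rightarrow> 'm \<Rightarrow> 'm"
  ActT :: "'g \<Rightarrow> 'o \<Rightarrow> 'o \<Rightarrow> 'm"

text \<open>Composition of the action is strict, and the unit constraints of the functors $h_*$ are
  identities: the axioms for twists and ribbons below identify $h_*(\mathbf 1)$ with $\mathbf 1$.\<close>

locale tensor_action = group G + monoidal_category C
  for G :: "('g, 'b) monoid_scheme" and C :: "('g, 'o, 'm, 'e) action_category_scheme" (structure) +
  assumes finite_group: "finite (carrier G)"
    and act_ob: "\<lbrakk>h \<in> carrier G; A \<in> Ob C\<rbrakk> \<Longrightarrow> Act C h A \<in> Ob C"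
    and actm_homs: "\<lbrakk>h \<in> carrier G; f \<in> homs C A B\<rbrakk>
          \<Longrightarrow> ActM C h f \<in> homs C (Act C h A) (Act C h B)"
    and actm_id: "\<lbrakk>h \<in> carrier G; A \<in> Ob C\<rbrakk> \<Longrightarrow> ActM C h (Id C A) = Id C (Act C h A)"
    and actm_comp: "\<lbrakk>h \<in> carrier G; f \<in> homs C A B; f' \<in> homs C B D\<rbrakk>
          \<Longrightarrow> ActM C h (f' \<cdot> f) = ActM C h f' \<cdot> ActM C h f"
    and actm_add: "\<lbrakk>h \<in> carrier G; f \<in> homs C A B; f' \<in> homs C A B\<rbrakk>
          \<Longrightarrow> ActM C h (f \<boxplus> f') = ActM C h f \<boxplus> ActM C h f'"
    and actm_smul: "\<lbrakk>h \<in> carrier G; f \<in> homs C A B\<rbrakk> \<Longrightarrow> ActM C h (c \<star> f) = c \<star> ActM C h f"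
    and actt_homs: "\<lbrakk>h \<in> carrier G; A \<in> Ob C; B \<in> Ob C\<rbrakk>
          \<Longrightarrow> ActT C h A B \<in> homs C (Act C h (A \<boxtimes> B)) (Act C h A \<boxtimes> Act C h B)"
    and actt_iso: "\<lbrakk>h \<in> carrier G; A \<in> Ob C; B \<in> Ob C\<rbrakk> \<Longrightarrow> iso_arrow C (ActT C h A B)"
    and actt_natural: "\<lbrakk>h \<in> carrier G; f \<in> homs C A A'; f' \<in> homs C B B'\<rbrakk>
          \<Longrightarrow> ActT C h A' B' \<cdot> ActM C h (f \<odot> f') = (ActM C h f \<odot> ActM C h f') \<cdot> ActT C h A B"
    and actt_assoc: "\<lbrakk>h \<in> carrier G; A \<in> Ob C; B \<in> Ob C; D \<in> Ob C\<rbrakk>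
          \<Longrightarrow> Assoc C (Act C h A) (Act C h B) (Act C h D)
                \<cdot> (ActT C h A B \<odot> Id C (Act C h D)) \<cdot> ActT C h (A \<boxtimes> B) D
             = (Id C (Act C h A) \<odot> ActT C h B D) \<cdot> ActT C h A (B \<boxtimes> D) \<cdot> ActM C h (Assoc C A B D)"
    and act_unit: "h \<in> carrier G \<Longrightarrow> Act C h (Unit C) = Unit C"
    and actt_lunit: "\<lbrakk>h \<in> carrier G; A \<in> Ob C\<rbrakk>
          \<Longrightarrow> LUnit C (Act C h A) \<cdot> ActT C h (Unit C) A = ActM C h (LUnit C A)"
    and actt_runit: "\<lbrakk>h \<in> carrier G; A \<in> Ob C\<rbrakk>
          \<Longrightarrow> RUnit C (Act C h A) \<cdot> ActT C h A (Unit C) = ActM C h (RUnit C A)"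
    and act_one: "A \<in> Ob C \<Longrightarrow> Act C \<one>\<^bsub>G\<^esub> A = A"
    and actm_one: "f \<in> Arr C \<Longrightarrow> ActM C \<one>\<^bsub>G\<^esub> f = f"
    and actt_one: "\<lbrakk>A \<in> Ob C; B \<in> Ob C\<rbrakk> \<Longrightarrow> ActT C \<one>\<^bsub>G\<^esub> A B = Id C (A \<boxtimes> B)"
    and act_mult: "\<lbrakk>h \<in> carrier G; k \<in> carrier G; A \<in> Ob C\<rbrakk>
          \<Longrightarrow> Act C (h \<otimes>\<^bsub>G\<^esub> k) A = Act C h (Act C k A)"
    and actm_mult: "\<lbrakk>h \<in> carrier G; k \<in> carrier G; f \<in> Arr C\<rbrakk>
          \<Longrightarrow> ActM C (h \<otimes>\<^bsub>G\<^esub> k) f = ActM C h (ActM C k f)"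
    and actt_mult: "\<lbrakk>h \<in> carrier G; k \<in> carrier G; A \<in> Ob C; B \<in> Ob C\<rbrakk>
          \<Longrightarrow> ActT C (h \<otimes>\<^bsub>G\<^esub> k) A B = ActT C h (Act C k A) (Act C k B) \<cdot> ActM C h (ActT C k A B)"

text \<open>\<open>Braid C h A B\<close> and \<open>Twist C h A\<close> are meaningful for \<open>A\<close> of degree \<open>h\<close>; the degree is an
  argument since a zero object has every degree.\<close>

record ('g, 'o, 'm) crossed_category = "('g, 'o, 'm) action_category" +
  Grade :: "'g \<Rightarrow> 'o set"
  Braid :: "'g \<Rightarrow> 'o \<Rightarrow> 'o \<Rightarrow> 'm"
  Twist :: "'g \<Rightarrow> 'o \<Rightarrow> 'm"

locale braided_crossed_category = tensor_action G C
  for G :: "('g, 'b) monoid_scheme" and C :: "('g, 'o, 'm, 'e) crossed_category_scheme" (structure) +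
  assumes grade_ob: "h \<in> carrier G \<Longrightarrow> Grade C h \<subseteq> Ob C"
    and grade_orthogonal: "\<lbrakk>h \<in> carrier G; k \<in> carrier G; h \<noteq> k; A \<in> Grade C h; B \<in> Grade C k;
          f \<in> homs C A B\<rbrakk> \<Longrightarrow> f = Zero C A B"
    and grade_decompose: "A \<in> Ob C \<Longrightarrow> \<exists>n F i p. is_direct_sum C A n F i p \<and>
          (\<forall>k<n. \<exists>h \<in> carrier G. F k \<in> Grade C h)"
    and grade_direct_sum: "\<lbrakk>h \<in> carrier G; is_direct_sum C A n F i p; \<And>k. k < n \<Longrightarrow> F k \<in> Grade C h\<rbrakk>
          \<Longrightarrow> A \<in> Grade C h"
    and grade_faithful: "h \<in> carrier G \<Longrightarrow> \<exists>A \<in> Grade C h. \<not> zero_object C A"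
    and grade_unit: "Unit C \<in> Grade C \<one>\<^bsub>G\<^esub>"
    and grade_tens: "\<lbrakk>h \<in> carrier G; k \<in> carrier G; A \<in> Grade C h; B \<in> Grade C k\<rbrakk>
          \<Longrightarrow> A \<boxtimes> B \<in> Grade C (h \<otimes>\<^bsub>G\<^esub> k)"
    and grade_act: "\<lbrakk>h \<in> carrier G; k \<in> carrier G; A \<in> Grade C k\<rbrakk>
          \<Longrightarrow> Act C h A \<in> Grade C (h \<otimes>\<^bsub>G\<^esub> k \<otimes>\<^bsub>G\<^esub> inv\<^bsub>G\<^esub> h)"
    and braid_homs: "\<lbrakk>h \<in> carrier G; X \<in> Grade C h; Y \<in> Ob C\<rbrakk>
          \<Longrightarrow> Braid C h X Y \<in> homs C (X \<boxtimes> Y) (Act C h Y \<boxtimes> X)"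
    and braid_iso: "\<lbrakk>h \<in> carrier G; X \<in> Grade C h; Y \<in> Ob C\<rbrakk> \<Longrightarrow> iso_arrow C (Braid C h X Y)"
    and braid_natural: "\<lbrakk>h \<in> carrier G; X \<in> Grade C h; X' \<in> Grade C h;
          f \<in> homs C X X'; f' \<in> homs C Y Y'\<rbrakk>
          \<Longrightarrow> Braid C h X' Y' \<cdot> (f \<odot> f') = (ActM C h f' \<odot> f) \<cdot> Braid C h X Y"
    and braid_act: "\<lbrakk>h \<in> carrier G; k \<in> carrier G; X \<in> Grade C h; Y \<in> Ob C\<rbrakk>
          \<Longrightarrow> ActT C k (Act C h Y) X \<cdot> ActM C k (Braid C h X Y)
             = Braid C (k \<otimes>\<^bsub>G\<^esub> h \<otimes>\<^bsub>G\<^esub> inv\<^bsub>G\<^esub> k) (Act C k X) (Act C k Y) \<cdot> ActT C k X Y"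
    and braid_tens_right: "\<lbrakk>h \<in> carrier G; X \<in> Grade C h; Y \<in> Ob C; Z \<in> Ob C\<rbrakk>
          \<Longrightarrow> (ActT C h Y Z \<odot> Id C X) \<cdot> Braid C h X (Y \<boxtimes> Z)
             = inv_arrow C (Assoc C (Act C h Y) (Act C h Z) X)
               \<cdot> (Id C (Act C h Y) \<odot> Braid C h X Z) \<cdot> Assoc C (Act C h Y) X Z
               \<cdot> (Braid C h X Y \<odot> Id C Z) \<cdot> inv_arrow C (Assoc C X Y Z)"
    and braid_tens_left: "\<lbrakk>h \<in> carrier G; k \<in> carrier G; X \<in> Grade C h; Y \<in> Grade C k; Z \<in> Ob C\<rbrakk>
          \<Longrightarrow> Braid C (h \<otimes>\<^bsub>G\<^esub> k) (X \<boxtimes> Y) Z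
             = Assoc C (Act C (h \<otimes>\<^bsub>G\<^esub> k) Z) X Y
               \<cdot> (Braid C h X (Act C k Z) \<odot> Id C Y) \<cdot> inv_arrow C (Assoc C X (Act C k Z) Y)
               \<cdot> (Id C X \<odot> Braid C k Y Z) \<cdot> Assoc C X Y Z"

locale crossed_twist = braided_crossed_category G C
  for G :: "('g, 'b) monoid_scheme" and C :: "('g, 'o, 'm, 'e) crossed_category_scheme" (structure) +
  assumes twist_homs: "\<lbrakk>h \<in> carrier G; X \<in> Grade C h\<rbrakk> \<Longrightarrow> Twist C h X \<in> homs C X (Act C h X)"
    and twist_iso: "\<lbrakk>h \<in> carrier G; X \<in> Grade C h\<rbrakk> \<Longrightarrow> iso_arrow C (Twist C h X)"
    and twist_natural: "\<lbrakk>h \<in> carrier G; X \<in> Grade C h; X' \<in> Grade C h; f \<in> homs C X X'\<rbrakk>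
          \<Longrightarrow> Twist C h X' \<cdot> f = ActM C h f \<cdot> Twist C h X"
    and twist_unit: "Twist C \<one>\<^bsub>G\<^esub> (Unit C) = Id C (Unit C)"
    and twist_tens: "\<lbrakk>h \<in> carrier G; k \<in> carrier G; X \<in> Grade C h; Y \<in> Grade C k\<rbrakk>
          \<Longrightarrow> ActT C (h \<otimes>\<^bsub>G\<^esub> k) X Y \<cdot> Twist C (h \<otimes>\<^bsub>G\<^esub> k) (X \<boxtimes> Y)
             = (ActM C (h \<otimes>\<^bsub>G\<^esub> k \<otimes>\<^bsub>G\<^esub> inv\<^bsub>G\<^esub> h) (Twist C h X) \<odot> ActM C h (Twist C k Y))
               \<cdot> Braid C (h \<otimes>\<^bsub>G\<^esub> k \<otimes>\<^bsub>G\<^esub> inv\<^bsub>G\<^esub> h) (Act C h Y) X \<cdot> Braid C h X Y"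
    and twist_act: "\<lbrakk>h \<in> carrier G; k \<in> carrier G; Y \<in> Grade C k\<rbrakk>
          \<Longrightarrow> ActM C h (Twist C k Y) = Twist C (h \<otimes>\<^bsub>G\<^esub> k \<otimes>\<^bsub>G\<^esub> inv\<^bsub>G\<^esub> h) (Act C h Y)"

locale crossed_ribbon_fusion_category = crossed_twist G C + fusion_category C
  for G :: "('g, 'b) monoid_scheme" and C :: "('g, 'o, 'm, 'e) crossed_category_scheme" (structure) +
  assumes ribbon: "\<lbrakk>h \<in> carrier G; X \<in> Grade C h\<rbrakk>
          \<Longrightarrow> (Id C X \<odot> Twist C (inv\<^bsub>G\<^esub> h) (Dual C X)) \<cdot> Coev C X
             = ActT C (inv\<^bsub>G\<^esub> h) (Act C h X) (Dual C X)
               \<cdot> ActM C (inv\<^bsub>G\<^esub> h) (Twist C h X \<odot> Id C (Dual C X)) \<cdot> ActM C (inv\<^bsub>G\<^esub> h) (Coev C X)"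

text \<open>The composite defining the quantum dimension typechecks for \<open>X\<close> of degree \<open>h\<close> with
  $h_*X = X$ and $h_*X^* = X^*$, which covers the simple objects considered below.\<close>

definition quantum_dim :: "('g, 'o, 'm, 'e) crossed_category_scheme \<Rightarrow> 'g \<Rightarrow> 'o \<Rightarrow> complex" where
  "quantum_dim C h X = (THE d. Ev C X \<cdot>\<^bsub>C\<^esub> Braid C h X (Dual C X)
       \<cdot>\<^bsub>C\<^esub> (Twist C h X \<odot>\<^bsub>C\<^esub> Id C (Dual C X)) \<cdot>\<^bsub>C\<^esub> Coev C X = d \<star>\<^bsub>C\<^esub> Id C (Unit C))"

section \<open>Braided categories with an action, modular categories and crossed extensions\<close>

record ('g, 'o, 'm) braided_category = "('g, 'o, 'm) action_category" +
  Brd :: "'o \<Rightarrow> 'o \<Rightarrow> 'm"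
  Twi :: "'o \<Rightarrow> 'm"

locale braided_tensor_category = monoidal_category C
  for C :: "('g, 'o, 'm, 'e) braided_category_scheme" (structure) +
  assumes brd_homs: "\<lbrakk>X \<in> Ob C; Y \<in> Ob C\<rbrakk> \<Longrightarrow> Brd C X Y \<in> homs C (X \<boxtimes> Y) (Y \<boxtimes> X)"
    and brd_iso: "\<lbrakk>X \<in> Ob C; Y \<in> Ob C\<rbrakk> \<Longrightarrow> iso_arrow C (Brd C X Y)"
    and brd_natural: "\<lbrakk>f \<in> homs C X X'; f' \<in> homs C Y Y'\<rbrakk>
          \<Longrightarrow> Brd C X' Y' \<cdot> (f \<odot> f') = (f' \<odot> f) \<cdot> Brd C X Y"
    and hexagon_right: "\<lbrakk>X \<in> Ob C; Y \<in> Ob C; Z \<in> Ob C\<rbrakk>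
          \<Longrightarrow> Assoc C Y Z X \<cdot> Brd C X (Y \<boxtimes> Z) \<cdot> Assoc C X Y Z
             = (Id C Y \<odot> Brd C X Z) \<cdot> Assoc C Y X Z \<cdot> (Brd C X Y \<odot> Id C Z)"
    and hexagon_left: "\<lbrakk>X \<in> Ob C; Y \<in> Ob C; Z \<in> Ob C\<rbrakk>
          \<Longrightarrow> inv_arrow C (Assoc C Z X Y) \<cdot> Brd C (X \<boxtimes> Y) Z \<cdot> inv_arrow C (Assoc C X Y Z)
             = (Brd C X Z \<odot> Id C Y) \<cdot> inv_arrow C (Assoc C X Z Y) \<cdot> (Id C X \<odot> Brd C Y Z)"

locale braided_tensor_category_with_action = tensor_action G C + braided_tensor_category C
  for G :: "('g, 'b) monoid_scheme" and C :: "('g, 'o, 'm, 'e) braided_category_scheme" (structure) +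
  assumes brd_act: "\<lbrakk>h \<in> carrier G; X \<in> Ob C; Y \<in> Ob C\<rbrakk>
          \<Longrightarrow> ActT C h Y X \<cdot> ActM C h (Brd C X Y) = Brd C (Act C h X) (Act C h Y) \<cdot> ActT C h X Y"

definition ribbon_trace :: "('g, 'o, 'm, 'e) braided_category_scheme \<Rightarrow> 'o \<Rightarrow> 'm \<Rightarrow> complex" where
  "ribbon_trace C X f = (THE d. Ev C X \<cdot>\<^bsub>C\<^esub> Brd C X (Dual C X)
       \<cdot>\<^bsub>C\<^esub> ((Twi C X \<cdot>\<^bsub>C\<^esub> f) \<odot>\<^bsub>C\<^esub> Id C (Dual C X)) \<cdot>\<^bsub>C\<^esub> Coev C X = d \<star>\<^bsub>C\<^esub> Id C (Unit C))"

definition S_matrix :: "('g, 'o, 'm, 'e) braided_category_scheme \<Rightarrow> 'o \<Rightarrow> 'o \<Rightarrow> complex" where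
  "S_matrix C X Y = ribbon_trace C (Tens C X Y) (Brd C Y X \<cdot>\<^bsub>C\<^esub> Brd C X Y)"

definition simple_representatives ::
  "('o, 'm, 'e) lin_category_scheme \<Rightarrow> 'o set \<Rightarrow> 'i set \<Rightarrow> ('i \<Rightarrow> 'o) \<Rightarrow> bool" where
  "simple_representatives C D I S \<longleftrightarrow> (\<forall>i \<in> I. S i \<in> D \<and> simple_object C (S i)) \<and>
     (\<forall>A \<in> D. simple_object C A \<longrightarrow> (\<exists>!i. i \<in> I \<and> isomorphic C A (S i)))"

locale modular_category = fusion_category C + braided_tensor_category C
  for C :: "('g, 'o, 'm, 'e) braided_category_scheme" (structure) +
  assumes twi_homs: "X \<in> Ob C \<Longrightarrow> Twi C X \<in> homs C X X"
    and twi_iso: "X \<in> Ob C \<Longrightarrow> iso_arrow C (Twi C X)"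
    and twi_natural: "f \<in> homs C X Y \<Longrightarrow> Twi C Y \<cdot> f = f \<cdot> Twi C X"
    and twi_tens: "\<lbrakk>X \<in> Ob C; Y \<in> Ob C\<rbrakk>
          \<Longrightarrow> Twi C (X \<boxtimes> Y) = (Twi C X \<odot> Twi C Y) \<cdot> Brd C Y X \<cdot> Brd C X Y"
    and twi_dual: "X \<in> Ob C \<Longrightarrow>
          (Id C X \<odot> Twi C (Dual C X)) \<cdot> Coev C X = (Twi C X \<odot> Id C (Dual C X)) \<cdot> Coev C X"
    and S_nondegenerate: "\<lbrakk>simple_representatives C (Ob C) S (\<lambda>X. X);
          \<And>X. X \<in> S \<Longrightarrow> (\<Sum>Y \<in> S. S_matrix C X Y * v Y) = 0; Y \<in> S\<rbrakk> \<Longrightarrow> v Y = 0"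

text \<open>\<open>B\<close> represents the pointed braided category attached to the quadratic form \<open>Q\<close>.\<close>

definition represents_quadratic_form ::
  "('a::ab_group_add \<Rightarrow> complex) \<Rightarrow> ('g, 'o, 'm, 'e) braided_category_scheme \<Rightarrow> bool" where
  "represents_quadratic_form Q B \<longleftrightarrow> (\<exists>S :: 'a \<Rightarrow> 'o.
     simple_representatives B (Ob B) UNIV S \<and>
     isomorphic B (S 0) (Unit B) \<and>
     (\<forall>a b. isomorphic B (Tens B (S a) (S b)) (S (a + b))) \<and>
     (\<forall>a. Brd B (S a) (S a) = Q a \<star>\<^bsub>B\<^esub> Id B (Tens B (S a) (S a))))"

text \<open>The neutral component of \<open>C\<close> equals \<open>B\<close> as a braided tensor category with action: all
  structure maps agree where they are meaningful.\<close>

definition neutral_component_eq ::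
  "('g, 'b) monoid_scheme \<Rightarrow> ('g, 'o, 'm, 'e) crossed_category_scheme
     \<Rightarrow> ('g, 'o, 'm, 'f) braided_category_scheme \<Rightarrow> bool" where
  "neutral_component_eq G C B \<longleftrightarrow>
     Ob B = Grade C \<one>\<^bsub>G\<^esub> \<and>
     Arr B = {f \<in> Arr C. Dom C f \<in> Grade C \<one>\<^bsub>G\<^esub> \<and> Cod C f \<in> Grade C \<one>\<^bsub>G\<^esub>} \<and>
     (\<forall>f \<in> Arr B. Dom B f = Dom C f \<and> Cod B f = Cod C f) \<and>
     (\<forall>A \<in> Ob B. Id B A = Id C A) \<and>
     (\<forall>f \<in> Arr B. \<forall>f' \<in> Arr B. Dom B f' = Cod B f \<longrightarrow> Comp B f' f = Comp C f' f) \<and>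
     (\<forall>A \<in> Ob B. \<forall>A' \<in> Ob B. Zero B A A' = Zero C A A') \<and>
     (\<forall>f \<in> Arr B. \<forall>f' \<in> Arr B. Dom B f = Dom B f' \<and> Cod B f = Cod B f' \<longrightarrow> Add B f f' = Add C f f') \<and>
     (\<forall>f \<in> Arr B. \<forall>c. Smul B c f = Smul C c f) \<and>
     (\<forall>X \<in> Ob B. \<forall>Y \<in> Ob B. Tens B X Y = Tens C X Y) \<and>
     (\<forall>f \<in> Arr B. \<forall>f' \<in> Arr B. TensM B f f' = TensM C f f') \<and>
     Unit B = Unit C \<and>
     (\<forall>X \<in> Ob B. \<forall>Y \<in> Ob B. \<forall>Z \<in> Ob B. Assoc B X Y Z = Assoc C X Y Z) \<and>
     (\<forall>X \<in> Ob B. LUnit B X = LUnit C X \<and> RUnit B X = RUnit C X) \<and>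
     (\<forall>h \<in> carrier G. \<forall>X \<in> Ob B. Act B h X = Act C h X) \<and>
     (\<forall>h \<in> carrier G. \<forall>f \<in> Arr B. ActM B h f = ActM C h f) \<and>
     (\<forall>h \<in> carrier G. \<forall>X \<in> Ob B. \<forall>Y \<in> Ob B. ActT B h X Y = ActT C h X Y) \<and>
     (\<forall>X \<in> Ob B. \<forall>Y \<in> Ob B. Brd B X Y = Braid C \<one>\<^bsub>G\<^esub> X Y)"

definition braided_crossed_extension ::
  "('g, 'b) monoid_scheme \<Rightarrow> ('g, 'o, 'm, 'e) crossed_category_scheme
     \<Rightarrow> ('g, 'o, 'm, 'f) braided_category_scheme \<Rightarrow> bool" where
  "braided_crossed_extension G C B \<longleftrightarrow> braided_crossed_category G C \<and>
     braided_tensor_category_with_action G B \<and> neutral_component_eq G C B"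

section \<open>Categories of formal direct sums\<close>

text \<open>
  A table lists, for a set of labels of simple objects with multiplicity-free fusion, the components
  of all structure morphisms on simple objects:
    \<^item> \<open>Fus D s s'\<close>: the labels of the summands of $s \otimes s'$;
    \<^item> \<open>Fsym D s\<^sub>1 s\<^sub>2 s\<^sub>3 u t r\<close>: the component of the associator between the copies of \<open>u\<close> in the
      summand $t \otimes s_3$ of $(s_1 \otimes s_2) \otimes s_3$ and in the summand $s_1 \otimes r$ of
      $s_1 \otimes (s_2 \otimes s_3)$;
    \<^item> \<open>Stau D h s s' t\<close> and \<open>Sbraid D s s' t\<close>: the components on the summand \<open>t\<close> of $s \otimes s'$;
    \<^item> \<open>Sev D s\<close>: the scalar of the evaluation; coevaluations are inclusions of summands.
\<close>

record ('g, 's) table =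
  Slab :: "'s set"
  Sunit :: 's
  Fus :: "'s \<Rightarrow> 's \<Rightarrow> 's set"
  Fsym :: "'s \<Rightarrow> 's \<Rightarrow> 's \<Rightarrow> 's \<Rightarrow> 's \<Rightarrow> 's \<Rightarrow> complex"
  Sdual :: "'s \<Rightarrow> 's"
  Sev :: "'s \<Rightarrow> complex"
  Sact :: "'g \<Rightarrow> 's \<Rightarrow> 's"
  Stau :: "'g \<Rightarrow> 's \<Rightarrow> 's \<Rightarrow> 's \<Rightarrow> complex"
  Sdeg :: "'s \<Rightarrow> 'g"
  Sbraid :: "'s \<Rightarrow> 's \<Rightarrow> 's \<Rightarrow> complex"
  Stwist :: "'s \<Rightarrow> complex"

text \<open>
  An object is a finite formal direct sum of simple objects: a finite set of named summands, each a
  pair of a name and a label. A morphism is a matrix with domain and codomain which vanishes between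
  summands with different labels. The summand of $A \otimes B$ with label \<open>u\<close> in the product of the
  summands \<open>a\<close> of \<open>A\<close> and \<open>b\<close> of \<open>B\<close> is \<open>(Node a b, u)\<close>, so all bifunctors and structure morphisms
  are the additive extensions of the components in the table.
\<close>

datatype 's name = Leaf nat | Node "'s name \<times> 's" "'s name \<times> 's"

type_synonym 's summand = "'s name \<times> 's"
type_synonym 's fob = "'s summand set"
type_synonym 's farr = "'s fob \<times> 's fob \<times> ('s summand \<Rightarrow> 's summand \<Rightarrow> complex)"

abbreviation fdom :: "'s farr \<Rightarrow> 's fob" where "fdom f \<equiv> fst f"
abbreviation fcod :: "'s farr \<Rightarrow> 's fob" where "fcod f \<equiv> fst (snd f)"
abbreviation entry :: "'s farr \<Rightarrow> 's summand \<Rightarrow> 's summand \<Rightarrow> complex" where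
  "entry f \<equiv> snd (snd f)"

text \<open>\<open>entry f y x\<close> is the component from the summand \<open>x\<close> of the domain to the summand \<open>y\<close> of the
  codomain.\<close>

definition block :: "'s fob \<Rightarrow> 's fob \<Rightarrow> ('s summand \<Rightarrow> 's summand \<Rightarrow> complex) \<Rightarrow> 's farr" where
  "block A B M = (A, B, \<lambda>y x. if y \<in> B \<and> x \<in> A \<and> snd y = snd x then M y x else 0)"

definition simple_sum :: "'s \<Rightarrow> 's fob" where
  "simple_sum s = {(Leaf 0, s)}"

definition fs_ob :: "('g, 's) table \<Rightarrow> 's fob set" where
  "fs_ob D = {A. finite A \<and> snd ` A \<subseteq> Slab D}"

definition fs_tens :: "('g, 's) table \<Rightarrow> 's fob \<Rightarrow> 's fob \<Rightarrow> 's fob" where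
  "fs_tens D A B = {(Node a b, u) | a b u. a \<in> A \<and> b \<in> B \<and> u \<in> Fus D (snd a) (snd b)}"

definition relabel :: "('s \<Rightarrow> 's) \<Rightarrow> 's summand \<Rightarrow> 's summand" where
  "relabel \<phi> a = (fst a, \<phi> (snd a))"

definition fs_tensor_category :: "('g, 's) table \<Rightarrow> ('s fob, 's farr) tensor_category" where
  "fs_tensor_category D = \<lparr>
     Ob = fs_ob D,
     Arr = {f. fdom f \<in> fs_ob D \<and> fcod f \<in> fs_ob D \<and>
               (\<forall>y x. entry f y x \<noteq> 0 \<longrightarrow> y \<in> fcod f \<and> x \<in> fdom f \<and> snd y = snd x)},
     Dom = fdom,
     Cod = fcod,
     Id = (\<lambda>A. block A A (\<lambda>y x. if y = x then 1 else 0)),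
     Comp = (\<lambda>g f. block (fdom f) (fcod g) (\<lambda>z x. \<Sum>y \<in> fcod f. entry g z y * entry f y x)),
     Zero = (\<lambda>A B. block A B (\<lambda>y x. 0)),
     Add = (\<lambda>f g. block (fdom f) (fcod f) (\<lambda>y x. entry f y x + entry g y x)),
     Smul = (\<lambda>c f. block (fdom f) (fcod f) (\<lambda>y x. c * entry f y x)),
     Tens = fs_tens D,
     TensM = (\<lambda>f g. block (fs_tens D (fdom f) (fdom g)) (fs_tens D (fcod f) (fcod g))
        (\<lambda>y x. case (fst x, fst y) of
            (Node a b, Node a' b') \<Rightarrow> entry f a' a * entry g b' b
          | _ \<Rightarrow> 0)),
     Unit = simple_sum (Sunit D),
     Assoc = (\<lambda>A B E. block (fs_tens D (fs_tens D A B) E) (fs_tens D A (fs_tens D B E))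
        (\<lambda>y x. case (x, y) of
            ((Node (Node a b, t) e, u), (Node a' (Node b' e', r), u')) \<Rightarrow>
               if a' = a \<and> b' = b \<and> e' = e then Fsym D (snd a) (snd b) (snd e) u t r else 0
          | _ \<Rightarrow> 0)),
     LUnit = (\<lambda>A. block (fs_tens D (simple_sum (Sunit D)) A) A
        (\<lambda>y x. case fst x of Node e a \<Rightarrow> if y = a then 1 else 0 | _ \<Rightarrow> 0)),
     RUnit = (\<lambda>A. block (fs_tens D A (simple_sum (Sunit D))) A
        (\<lambda>y x. case fst x of Node a e \<Rightarrow> if y = a then 1 else 0 | _ \<Rightarrow> 0)),
     Dual = (\<lambda>A. relabel (Sdual D) ` A),
     Ev = (\<lambda>A. block (fs_tens D (relabel (Sdual D) ` A) A) (simple_sum (Sunit D))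
        (\<lambda>y x. case fst x of
            Node a' a \<Rightarrow> if a' = relabel (Sdual D) a then Sev D (snd a) else 0
          | _ \<Rightarrow> 0)),
     Coev = (\<lambda>A. block (simple_sum (Sunit D)) (fs_tens D A (relabel (Sdual D) ` A))
        (\<lambda>y x. case fst y of
            Node a a' \<Rightarrow> if a' = relabel (Sdual D) a then 1 else 0
          | _ \<Rightarrow> 0)) \<rparr>"

definition fs_act :: "('g, 's) table \<Rightarrow> 'g \<Rightarrow> 's fob \<Rightarrow> 's fob" where
  "fs_act D h A = relabel (Sact D h) ` A"

definition fs_braid :: "('g, 's) table \<Rightarrow> 'g \<Rightarrow> 's fob \<Rightarrow> 's fob \<Rightarrow> 's farr" where
  "fs_braid D h A B = block (fs_tens D A B) (fs_tens D (fs_act D h B) A)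
     (\<lambda>y x. case (fst x, fst y) of
         (Node a b, Node b' a') \<Rightarrow>
            if a' = a \<and> b' = relabel (Sact D h) b then Sbraid D (snd a) (snd b) (snd x) else 0
       | _ \<Rightarrow> 0)"

definition fs_twist :: "('g, 's) table \<Rightarrow> 'g \<Rightarrow> 's fob \<Rightarrow> 's farr" where
  "fs_twist D h A = block A (fs_act D h A)
     (\<lambda>y x. if y = relabel (Sact D h) x then Stwist D (snd x) else 0)"

text \<open>A summand \<open>x\<close> of $h_*(A \otimes B)$ comes from the summand of $A \otimes B$ with label
  \<open>Sact D (inv h) (snd x)\<close>.\<close>

definition fs_action_category ::
  "('g, 'b) monoid_scheme \<Rightarrow> ('g, 's) table \<Rightarrow> ('g, 's fob, 's farr) action_category" where
  "fs_action_category G D = tensor_category.extend (fs_tensor_category D)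
     (action_category.fields
        (fs_act D)
        (\<lambda>h f. block (fs_act D h (fdom f)) (fs_act D h (fcod f))
           (\<lambda>y x. entry f (relabel (Sact D (inv\<^bsub>G\<^esub> h)) y) (relabel (Sact D (inv\<^bsub>G\<^esub> h)) x)))
        (\<lambda>h A B. block (fs_act D h (fs_tens D A B)) (fs_tens D (fs_act D h A) (fs_act D h B))
           (\<lambda>y x. case (fst x, fst y) of
               (Node a b, Node a' b') \<Rightarrow>
                  if a' = relabel (Sact D h) a \<and> b' = relabel (Sact D h) b
                  then Stau D h (snd a) (snd b) (Sact D (inv\<^bsub>G\<^esub> h) (snd x)) else 0
             | _ \<Rightarrow> 0)))"

definition fs_crossed_category ::
  "('g, 'b) monoid_scheme \<Rightarrow> ('g, 's) table \<Rightarrow> ('g, 's fob, 's farr) crossed_category" where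
  "fs_crossed_category G D = action_category.extend (fs_action_category G D)
     (crossed_category.fields
        (\<lambda>h. {A \<in> fs_ob D. \<forall>a \<in> A. Sdeg D (snd a) = h})
        (fs_braid D)
        (fs_twist D))"

definition fs_braided_category ::
  "('g, 'b) monoid_scheme \<Rightarrow> ('g, 's) table \<Rightarrow> ('g, 's fob, 's farr) braided_category" where
  "fs_braided_category G D = action_category.extend (fs_action_category G D)
     (braided_category.fields (fs_braid D \<one>\<^bsub>G\<^esub>) (fs_twist D \<one>\<^bsub>G\<^esub>))"

section \<open>Discriminant forms and abelian cocycles\<close>

definition zmult :: "int \<Rightarrow> 'a::ab_group_add \<Rightarrow> 'a" where
  "zmult n a = (if 0 \<le> n then ((+) a ^^ nat n) 0 else - (((+) a ^^ nat (- n)) 0))"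

definition assoc_bilinear :: "('a::ab_group_add \<Rightarrow> complex) \<Rightarrow> 'a \<Rightarrow> 'a \<Rightarrow> complex" where
  "assoc_bilinear Q a b = Q (a + b) * inverse (Q a) * inverse (Q b)"

definition discriminant_form :: "('a::{ab_group_add, finite} \<Rightarrow> complex) \<Rightarrow> bool" where
  "discriminant_form Q \<longleftrightarrow>
     (\<forall>a. Q a \<noteq> 0) \<and>
     (\<forall>n a. Q (zmult n a) = Q a powi (n^2)) \<and>
     (\<forall>a a' b. assoc_bilinear Q (a + a') b = assoc_bilinear Q a b * assoc_bilinear Q a' b) \<and>
     (\<forall>a b b'. assoc_bilinear Q a (b + b') = assoc_bilinear Q a b * assoc_bilinear Q a b') \<and>
     (\<forall>a. (\<forall>b. assoc_bilinear Q a b = 1) \<longrightarrow> a = 0)"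

definition special_abelian_cocycle ::
  "('a::ab_group_add \<Rightarrow> complex) \<Rightarrow> ('a \<Rightarrow> 'a \<Rightarrow> complex) \<Rightarrow> ('a \<Rightarrow> 'a \<Rightarrow> 'a \<Rightarrow> complex) \<Rightarrow> bool" where
  "special_abelian_cocycle Q \<sigma> \<omega> \<longleftrightarrow>
     (\<forall>a b. \<sigma> a b \<noteq> 0) \<and>
     (\<forall>a b c. \<omega> a b c \<in> {1, -1}) \<and>
     (\<forall>a. \<sigma> a a = Q a) \<and>
     (\<forall>a. \<sigma> a 0 = 1 \<and> \<sigma> 0 a = 1) \<and>
     (\<forall>a b. \<sigma> a b = \<sigma> b a) \<and>
     (\<forall>a b c. \<omega> a b c = \<sigma> a (b + c) * inverse (\<sigma> a b) * inverse (\<sigma> a c)) \<and>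
     (\<forall>a a' b c. \<omega> (a + a') b c = \<omega> a b c * \<omega> a' b c)"

definition mod2_rel :: "'a::ab_group_add \<Rightarrow> 'a \<Rightarrow> bool" where
  "mod2_rel a b \<longleftrightarrow> (\<exists>c. a - b = c + c)"

lemma equivp_mod2_rel: "equivp (mod2_rel :: 'a::ab_group_add \<Rightarrow> 'a \<Rightarrow> bool)" (is "equivp ?r")
proof (rule equivpI)
  show "reflp ?r"
    by (rule reflpI) (auto simp: mod2_rel_def intro: exI[of _ 0])
  show "symp ?r"
  proof (rule sympI)
    fix a b :: 'a assume "mod2_rel a b"
    then obtain c where "a - b = c + c" by (auto simp: mod2_rel_def)
    then have "b - a = - c + - c" by (simp add: algebra_simps)
    then show "mod2_rel b a" unfolding mod2_rel_def by blast
  qed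
  show "transp ?r"
  proof (rule transpI)
    fix a b d :: 'a assume "mod2_rel a b" "mod2_rel b d"
    then obtain c e where "a - b = c + c" "b - d = e + e" by (auto simp: mod2_rel_def)
    then have "a - d = (c + e) + (c + e)" by (simp add: algebra_simps)
    then show "mod2_rel a d" unfolding mod2_rel_def by blast
  qed
qed

quotient_type (overloaded) 'a mod2 = "'a::ab_group_add" / mod2_rel
  by (rule equivp_mod2_rel)

lift_definition cls :: "'a::ab_group_add \<Rightarrow> 'a mod2" is "\<lambda>a. a" .

instantiation mod2 :: (ab_group_add) ab_group_add
begin

lift_definition zero_mod2 :: "'a mod2" is 0 .

lift_definition plus_mod2 :: "'a mod2 \<Rightarrow> 'a mod2 \<Rightarrow> 'a mod2" is "(+)"
proof -
  fix a a' b b' :: 'a assume "mod2_rel a a'" "mod2_rel b b'"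
  then obtain c e where "a - a' = c + c" "b - b' = e + e" by (auto simp: mod2_rel_def)
  then have "(a + b) - (a' + b') = (c + e) + (c + e)" by (simp add: algebra_simps)
  then show "mod2_rel (a + b) (a' + b')" unfolding mod2_rel_def by blast
qed

lift_definition uminus_mod2 :: "'a mod2 \<Rightarrow> 'a mod2" is uminus
proof -
  fix a a' :: 'a assume "mod2_rel a a'"
  then obtain c where "a - a' = c + c" by (auto simp: mod2_rel_def)
  then have "- a - - a' = - c + - c" by (simp add: algebra_simps)
  then show "mod2_rel (- a) (- a')" unfolding mod2_rel_def by blast
qed

definition minus_mod2 :: "'a mod2 \<Rightarrow> 'a mod2 \<Rightarrow> 'a mod2" where
  "minus_mod2 x y = x + - y"

instance
proof
  fix x y z :: "'a mod2"
  show "x + y + z = x + (y + z)" by transfer (auto simp: add.assoc mod2_rel_def intro: exI[of _ 0])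
  show "x + y = y + x" by transfer (auto simp: add.commute mod2_rel_def intro: exI[of _ 0])
  show "0 + x = x" by transfer (auto simp: mod2_rel_def intro: exI[of _ 0])
  show "- x + x = 0" by transfer (auto simp: mod2_rel_def intro: exI[of _ 0])
  show "x - y = x + - y" by (rule minus_mod2_def)
qed

end

text \<open>For \<open>\<omega>\<close> depending only on the class of its first argument modulo $2\Gamma$.\<close>

definition on_cls :: "('a::ab_group_add \<Rightarrow> 'a \<Rightarrow> 'a \<Rightarrow> complex) \<Rightarrow> 'a mod2 \<Rightarrow> 'a \<Rightarrow> 'a \<Rightarrow> complex" where
  "on_cls \<omega> x b c = (THE w. \<forall>a. cls a = x \<longrightarrow> \<omega> a b c = w)"

definition sqrt_datum ::
  "('a::ab_group_add \<Rightarrow> complex) \<Rightarrow> ('a \<Rightarrow> 'a \<Rightarrow> complex) \<Rightarrow> ('a \<Rightarrow> 'a \<Rightarrow> 'a \<Rightarrow> complex)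
     \<Rightarrow> ('a \<Rightarrow> complex) \<Rightarrow> 'a mod2 \<Rightarrow> bool" where
  "sqrt_datum Q \<sigma> \<omega> q \<delta> \<longleftrightarrow>
     (\<forall>a. q a \<noteq> 0) \<and>
     (\<forall>a. (q a)^2 = Q a) \<and>
     (\<forall>a b. q (a + b) * inverse (q a) * inverse (q b) = \<sigma> a b * \<omega> (a + b) a b * on_cls \<omega> \<delta> a b)"

definition card_double :: "'a::ab_group_add itself \<Rightarrow> nat" where
  "card_double _ = card (range (\<lambda>a::'a. a + a))"

definition gauss_sum :: "'a::ab_group_add mod2 \<Rightarrow> ('a \<Rightarrow> complex) \<Rightarrow> complex" where
  "gauss_sum \<delta> f = complex_of_real (1 / sqrt (real (card_double TYPE('a)))) * (\<Sum>a | cls a = \<delta>. f a)"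

section \<open>The data of the extension\<close>

datatype ('a, 'x) sum_label = Cs 'a | Xs 'x

type_synonym 'a label = "('a, 'a mod2) sum_label"

definition label_act :: "('g, 'b) monoid_scheme \<Rightarrow> 'g \<Rightarrow> 'a::ab_group_add label \<Rightarrow> 'a label" where
  "label_act G h s = (if h = \<one>\<^bsub>G\<^esub> then s else case s of Cs a \<Rightarrow> Cs (- a) | Xs x \<Rightarrow> Xs x)"

fun label_fus :: "'a::ab_group_add mod2 \<Rightarrow> 'a label \<Rightarrow> 'a label \<Rightarrow> 'a label set" where
  "label_fus \<delta> (Cs a) (Cs b) = {Cs (a + b)}"
| "label_fus \<delta> (Cs a) (Xs x) = {Xs (cls a + x)}"
| "label_fus \<delta> (Xs x) (Cs a) = {Xs (cls a + x)}"
| "label_fus \<delta> (Xs x) (Xs y) = {Cs t | t. cls t = \<delta> + x + y}"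

fun label_assoc ::
  "('a::ab_group_add \<Rightarrow> 'a \<Rightarrow> complex) \<Rightarrow> ('a \<Rightarrow> 'a \<Rightarrow> 'a \<Rightarrow> complex) \<Rightarrow> 'a mod2 \<Rightarrow> complex
     \<Rightarrow> 'a label \<Rightarrow> 'a label \<Rightarrow> 'a label \<Rightarrow> 'a label \<Rightarrow> 'a label \<Rightarrow> 'a label \<Rightarrow> complex" where
  "label_assoc \<sigma> \<omega> \<delta> \<epsilon> (Cs a) (Cs b) (Cs c) _ _ _ = \<omega> a b c"
| "label_assoc \<sigma> \<omega> \<delta> \<epsilon> (Xs x) (Cs a) (Cs b) _ _ _ = on_cls \<omega> (x + \<delta>) a b"
| "label_assoc \<sigma> \<omega> \<delta> \<epsilon> (Cs a) (Xs x) (Cs b) _ _ _ = \<sigma> a b"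
| "label_assoc \<sigma> \<omega> \<delta> \<epsilon> (Cs a) (Cs b) (Xs x) _ _ _ = on_cls \<omega> (cls a + cls b + x) a b"
| "label_assoc \<sigma> \<omega> \<delta> \<epsilon> (Cs a) (Xs x) (Xs y) _ _ (Cs t) = on_cls \<omega> (cls a + x) a t"
| "label_assoc \<sigma> \<omega> \<delta> \<epsilon> (Xs x) (Xs y) (Cs a) _ (Cs t) _ = on_cls \<omega> x t a"
| "label_assoc \<sigma> \<omega> \<delta> \<epsilon> (Xs x) (Cs a) (Xs y) (Cs t) _ _ = \<sigma> a t"
| "label_assoc \<sigma> \<omega> \<delta> \<epsilon> (Xs x) (Xs y) (Xs z) _ (Cs t) (Cs r) =
     \<epsilon> * complex_of_real (1 / sqrt (real (card_double TYPE('a)))) * inverse (\<sigma> t r)"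
| "label_assoc \<sigma> \<omega> \<delta> \<epsilon> _ _ _ _ _ _ = 0"

fun label_dual :: "'a::ab_group_add mod2 \<Rightarrow> 'a label \<Rightarrow> 'a label" where
  "label_dual \<delta> (Cs a) = Cs (- a)"
| "label_dual \<delta> (Xs x) = Xs (- x - \<delta>)"

text \<open>With $\mathrm{coev}$ the inclusion, the duality axioms force the scalar
  $\omega(a,-a,a)$ for the evaluation of $\mathbb C_a$.\<close>

fun label_ev :: "('a::ab_group_add \<Rightarrow> 'a \<Rightarrow> 'a \<Rightarrow> complex) \<Rightarrow> complex \<Rightarrow> 'a label \<Rightarrow> complex" where
  "label_ev \<omega> \<epsilon> (Cs a) = \<omega> a (- a) a"
| "label_ev \<omega> \<epsilon> (Xs x) = \<epsilon> * complex_of_real (sqrt (real (card_double TYPE('a))))"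

fun label_tau ::
  "('a::ab_group_add \<Rightarrow> 'a \<Rightarrow> 'a \<Rightarrow> complex) \<Rightarrow> 'a mod2 \<Rightarrow> 'a label \<Rightarrow> 'a label \<Rightarrow> 'a label \<Rightarrow> complex" where
  "label_tau \<omega> \<delta> (Cs a) (Cs b) _ = \<omega> a b (- b)"
| "label_tau \<omega> \<delta> (Cs a) (Xs x) _ = on_cls \<omega> (cls a + x) a (- a)"
| "label_tau \<omega> \<delta> (Xs x) (Cs a) _ = on_cls \<omega> (x + \<delta>) a (- a)"
| "label_tau \<omega> \<delta> (Xs x) (Xs y) (Cs t) = on_cls \<omega> x t (- t)"
| "label_tau \<omega> \<delta> (Xs x) (Xs y) (Xs z) = 0"

fun label_braid ::
  "('a::ab_group_add \<Rightarrow> 'a \<Rightarrow> complex) \<Rightarrow> ('a \<Rightarrow> 'a \<Rightarrow> 'a \<Rightarrow> complex) \<Rightarrow> ('a \<Rightarrow> complex) \<Rightarrow> complex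
     \<Rightarrow> 'a label \<Rightarrow> 'a label \<Rightarrow> 'a label \<Rightarrow> complex" where
  "label_braid \<sigma> \<omega> q \<alpha> (Cs a) (Cs b) _ = \<sigma> a b"
| "label_braid \<sigma> \<omega> q \<alpha> (Cs a) (Xs x) _ = inverse (q a)"
| "label_braid \<sigma> \<omega> q \<alpha> (Xs x) (Cs a) _ = inverse (q a) * on_cls \<omega> (x + cls a) a (- a)"
| "label_braid \<sigma> \<omega> q \<alpha> (Xs x) (Xs y) (Cs t) = \<alpha> * q t"
| "label_braid \<sigma> \<omega> q \<alpha> (Xs x) (Xs y) (Xs z) = 0"

fun label_twist :: "('a \<Rightarrow> 'a \<Rightarrow> complex) \<Rightarrow> complex \<Rightarrow> 'a label \<Rightarrow> complex" where
  "label_twist \<sigma> \<beta> (Cs a) = \<sigma> a a"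
| "label_twist \<sigma> \<beta> (Xs x) = \<beta>"

definition extension_table ::
  "('g, 'b) monoid_scheme \<Rightarrow> 'g \<Rightarrow> ('a::ab_group_add \<Rightarrow> 'a \<Rightarrow> complex) \<Rightarrow> ('a \<Rightarrow> 'a \<Rightarrow> 'a \<Rightarrow> complex)
     \<Rightarrow> ('a \<Rightarrow> complex) \<Rightarrow> 'a mod2 \<Rightarrow> complex \<Rightarrow> complex \<Rightarrow> complex \<Rightarrow> ('g, 'a label) table" where
  "extension_table G g \<sigma> \<omega> q \<delta> \<epsilon> \<alpha> \<beta> = \<lparr>
     Slab = UNIV,
     Sunit = Cs 0,
     Fus = label_fus \<delta>,
     Fsym = label_assoc \<sigma> \<omega> \<delta> \<epsilon>,
     Sdual = label_dual \<delta>,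
     Sev = label_ev \<omega> \<epsilon>,
     Sact = label_act G,
     Stau = (\<lambda>h s s' t. if h = \<one>\<^bsub>G\<^esub> then 1 else label_tau \<omega> \<delta> s s' t),
     Sdeg = (\<lambda>s. case s of Cs a \<Rightarrow> \<one>\<^bsub>G\<^esub> | Xs x \<Rightarrow> g),
     Sbraid = label_braid \<sigma> \<omega> q \<alpha>,
     Stwist = label_twist \<sigma> \<beta> \<rparr>"

definition extension_category ::
  "('g, 'b) monoid_scheme \<Rightarrow> 'g \<Rightarrow> ('a::ab_group_add \<Rightarrow> 'a \<Rightarrow> complex) \<Rightarrow> ('a \<Rightarrow> 'a \<Rightarrow> 'a \<Rightarrow> complex)
     \<Rightarrow> ('a \<Rightarrow> complex) \<Rightarrow> 'a mod2 \<Rightarrow> complex \<Rightarrow> complex \<Rightarrow> complex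
     \<Rightarrow> ('g, 'a label fob, 'a label farr) crossed_category" where
  "extension_category G g \<sigma> \<omega> q \<delta> \<epsilon> \<alpha> \<beta> =
     fs_crossed_category G (extension_table G g \<sigma> \<omega> q \<delta> \<epsilon> \<alpha> \<beta>)"

text \<open>The category $\mathrm{Vect}_\Gamma^{\sigma,\omega}$ with its action. Only labels \<open>Cs a\<close> occur; the
  table entries at labels \<open>Xs x\<close> are irrelevant.\<close>

fun val :: "'a label \<Rightarrow> 'a" where
  "val (Cs a) = a"
| "val (Xs x) = undefined"

definition vect_table ::
  "('g, 'b) monoid_scheme \<Rightarrow> ('a::ab_group_add \<Rightarrow> 'a \<Rightarrow> complex) \<Rightarrow> ('a \<Rightarrow> 'a \<Rightarrow> 'a \<Rightarrow> complex)
     \<Rightarrow> ('g, 'a label) table" where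
  "vect_table G \<sigma> \<omega> = \<lparr>
     Slab = range Cs,
     Sunit = Cs 0,
     Fus = (\<lambda>s s'. {Cs (val s + val s')}),
     Fsym = (\<lambda>s s' s'' u t r. \<omega> (val s) (val s') (val s'')),
     Sdual = (\<lambda>s. Cs (- val s)),
     Sev = (\<lambda>s. \<omega> (val s) (- val s) (val s)),
     Sact = (\<lambda>h s. if h = \<one>\<^bsub>G\<^esub> then s else Cs (- val s)),
     Stau = (\<lambda>h s s' t. if h = \<one>\<^bsub>G\<^esub> then 1 else \<omega> (val s) (val s') (- val s')),
     Sdeg = (\<lambda>s. \<one>\<^bsub>G\<^esub>),
     Sbraid = (\<lambda>s s' t. \<sigma> (val s) (val s')),
     Stwist = (\<lambda>s. \<sigma> (val s) (val s)) \<rparr>"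

definition vect_category ::
  "('g, 'b) monoid_scheme \<Rightarrow> ('a::ab_group_add \<Rightarrow> 'a \<Rightarrow> complex) \<Rightarrow> ('a \<Rightarrow> 'a \<Rightarrow> 'a \<Rightarrow> complex)
     \<Rightarrow> ('g, 'a label fob, 'a label farr) braided_category" where
  "vect_category G \<sigma> \<omega> = fs_braided_category G (vect_table G \<sigma> \<omega>)"

end

theory Submission
  imports Defs
begin

text \<open>
  A morphism between formal sums is determined by how it pulls back functionals from the summands of
  its codomain to those of its domain. Pulling back along a composite is iterated pulling back, and on
  structure morphisms it is a finite sum over fusion channels, so each axiom reduces to an identity
  between the entries of the table at simple labels. The abelian axioms follow from the fact that
  every morphism factors as a split epimorphism followed by a split monomorphism.

  For the table at hand, identities involving at most two labels in the nontrivial component are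
  consequences of the cocycle equations. The invertibility of the associator on three $\mathsf X$'s and
  the pentagon on four of them are orthogonality relations: on the cosets of $2\Gamma$ the functions
  $\sigma(t,\cdot)$, for $t$ in a fixed class, are orthogonal because $B_Q = \sigma^2$ is
  nondegenerate. The hexagons on three $\mathsf X$'s amount to completing the square in the Gauss sum of
  $q^{-1}$, which is what forces $\alpha^2 = \varepsilon\, G_{\bar\delta}(\Gamma, q^{-1})$. The
  dimension of $\mathsf X^{\bar x}$ comes out as $\alpha\beta\varepsilon\,|2\Gamma|^{1/2}$.
\<close>

text \<open>Splitting summands into name and label would keep rules about \<open>relabel\<close> from applying.\<close>

declare split_paired_All [simp del] split_paired_Ex [simp del]

section \<open>Matrices as operators on functionals\<close>

text \<open>The obstacle is that \<sigma> is not bimultiplicative: it fails by signs \<omega>, which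
  see one argument only modulo 2\<Gamma>. For fixed remaining arguments they are constant on a
  class, and \<sigma>(c+c, .) is an honest character, nontrivial on 2\<Gamma> for c+c \<noteq> 0
  since \<sigma>(c+c, d+d) = \<sigma>(c+c, d)^2 = B_Q(c+c, d). So Fourier analysis works on every
  coset of 2\<Gamma>, and |2\<Gamma>|^(-1/2) is its normalisation. Completing the square also
  produces signs; they cancel precisely on the class that the shift by \<delta> in the product of
  two X's assigns to the channels. The step from scalars to categories is independent of all this.
  It is made once for arbitrary tables and used twice: for the extension and for the pointed
  category that is its neutral component. The inverse associator is an explicit parameter
  \<open>Finv\<close> of a table, because the hexagons contain inverse associators and a definite
  description gives no components to compute with.\<close>

definition fits :: "'s farr \<Rightarrow> bool" where
  "fits f \<longleftrightarrow> (\<forall>y x. entry f y x \<noteq> 0 \<longrightarrow> y \<in> fcod f \<and> x \<in> fdom f \<and> snd y = snd x)"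

text \<open>The transpose of the matrix acting on a functional. Evaluated at a concrete summand it
  traces that basis vector through a composite, so that one rewrite rule per structure morphism,
  matching the shape of the summand, computes every composite.\<close>

definition pull :: "'s farr \<Rightarrow> ('s summand \<Rightarrow> complex) \<Rightarrow> 's summand \<Rightarrow> complex" where
  "pull f \<Phi> x = (\<Sum>y\<in>fcod f. entry f y x * \<Phi> y)"

lemma fdom_block [simp]: "fdom (block A B M) = A"
  and fcod_block [simp]: "fcod (block A B M) = B"
  by (simp_all add: block_def)

lemma entry_block: "entry (block A B M) y x = (if y \<in> B \<and> x \<in> A \<and> snd y = snd x then M y x else 0)"
  by (simp add: block_def)

lemma fits_block [simp]: "fits (block A B M)"
  by (auto simp: fits_def block_def)

lemma fitsD: "fits f \<Longrightarrow> entry f y x \<noteq> 0 \<Longrightarrow> y \<in> fcod f \<and> x \<in> fdom f \<and> snd y = snd x"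
  unfolding fits_def by blast

lemma fits_entry_eq_0:
  "fits f \<Longrightarrow> \<not> (y \<in> fcod f \<and> x \<in> fdom f \<and> snd y = snd x) \<Longrightarrow> entry f y x = 0"
  unfolding fits_def by blast

text \<open>Only the values of the functional at summands with the label of \<open>x\<close> matter; as a congruence rule
  this makes the labels of all intermediate summands available to the simplifier.\<close>

lemma pull_cong [cong]:
  assumes "f = f'" "x = x'" "fcod f' = S" "snd x' = s"
    and "\<And>y. \<lbrakk>y \<in> S; fits f' \<Longrightarrow> snd y = s\<rbrakk> \<Longrightarrow> \<Phi> y = \<Phi>' y"
  shows "pull f \<Phi> x = pull f' \<Phi>' x'"
proof -
  have "entry f' y x' * \<Phi> y = entry f' y x' * \<Phi>' y" if "y \<in> fcod f'" for y
    using assms(3-5) that fitsD[of f' y x'] by (cases "entry f' y x' = 0") auto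
  then show ?thesis
    unfolding pull_def assms(1,2) by (rule sum.cong[OF refl])
qed

lemma pull_block:
  "pull (block A B M) \<Phi> x = (if x \<in> A then \<Sum>y \<in> {y \<in> B. snd y = snd x}. M y x * \<Phi> y else 0)"
  if "finite B"
  using that unfolding pull_def
  by (auto simp: entry_block sum.inter_filter intro!: sum.cong)

lemma pull_add: "pull f (\<lambda>y. \<Phi> y + \<Psi> y) x = pull f \<Phi> x + pull f \<Psi> x"
  by (simp add: pull_def sum.distrib algebra_simps)

lemma pull_scale: "pull f (\<lambda>y. c * \<Phi> y) x = c * pull f \<Phi> x"
  by (simp add: pull_def sum_distrib_left algebra_simps)

lemma pull_sum: "pull f (\<lambda>y. \<Sum>k\<in>K. \<Phi> k y) x = (\<Sum>k\<in>K. pull f (\<Phi> k) x)"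
  unfolding pull_def sum_distrib_left by (rule sum.swap)

lemma entry_pull: "finite (fcod f) \<Longrightarrow> y \<in> fcod f \<Longrightarrow> entry f y x = pull f (\<lambda>z. if z = y then 1 else 0) x"
  by (simp add: pull_def if_distrib[where f = "\<lambda>c. _ * c"] cong: if_cong)

text \<open>Indicator functionals recover the entries inside domain and codomain, and
  \<open>fits\<close> makes all other entries zero.\<close>

lemma fits_eqI:
  assumes "fits f" "fits g" "fdom f = fdom g" "fcod f = fcod g" "finite (fcod f)"
    and "\<And>x \<Phi>. x \<in> fdom f \<Longrightarrow> pull f \<Phi> x = pull g \<Phi> x"
  shows "f = g"
proof -
  have "entry f y x = entry g y x" for y x
  proof (cases "y \<in> fcod f \<and> x \<in> fdom f")
    case True
    then show ?thesis
      using assms by (simp add: entry_pull)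
  next
    case False
    then show ?thesis
      using assms unfolding fits_def by metis
  qed
  then have "entry f = entry g" by blast
  then show ?thesis
    using assms by (simp add: prod_eq_iff)
qed

lemma mem_fs_tens [simp]:
  "(Node a b, u) \<in> fs_tens D A B \<longleftrightarrow> a \<in> A \<and> b \<in> B \<and> u \<in> Fus D (snd a) (snd b)"
  by (auto simp: fs_tens_def)

lemma fs_tensE:
  assumes "x \<in> fs_tens D A B"
  obtains a b u where "x = (Node a b, u)" "a \<in> A" "b \<in> B" "u \<in> Fus D (snd a) (snd b)"
  using assms by (auto simp: fs_tens_def)

lemma mem_simple_sum [simp]: "x \<in> simple_sum s \<longleftrightarrow> x = (Leaf 0, s)"
  by (simp add: simple_sum_def)

lemma finite_simple_sum [simp]: "finite (simple_sum s)"
  by (simp add: simple_sum_def)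

lemma fst_relabel [simp]: "fst (relabel \<phi> a) = fst a"
  and snd_relabel [simp]: "snd (relabel \<phi> a) = \<phi> (snd a)"
  and relabel_Pair [simp]: "relabel \<phi> (n, s) = (n, \<phi> s)"
  by (simp_all add: relabel_def)

section \<open>The linear abelian category of formal sums\<close>

text \<open>Phrased through truncation so that the record may carry further fields: the action,
  crossed and braided categories are all instances.\<close>

locale formal_sums =
  fixes D :: "('g, 's) table" and C :: "('s fob, 's farr, 'e) tensor_category_scheme" (structure)
  assumes truncate_eq: "tensor_category.truncate C = fs_tensor_category D"
begin

lemma Ob_eq [simp]: "Ob C = fs_ob D"
  and Arr_eq: "Arr C = {f. fdom f \<in> fs_ob D \<and> fcod f \<in> fs_ob D \<and> fits f}"
  and Dom_eq [simp]: "Dom C = fdom"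
  and Cod_eq [simp]: "Cod C = fcod"
  and Id_eq: "Id C A = block A A (\<lambda>y x. if y = x then 1 else 0)"
  and Comp_eq: "Comp C g f = block (fdom f) (fcod g) (\<lambda>z x. \<Sum>y \<in> fcod f. entry g z y * entry f y x)"
  and Zero_eq: "Zero C A B = block A B (\<lambda>y x. 0)"
  and Add_eq: "Add C f g = block (fdom f) (fcod f) (\<lambda>y x. entry f y x + entry g y x)"
  and Smul_eq: "Smul C c f = block (fdom f) (fcod f) (\<lambda>y x. c * entry f y x)"
  and Tens_eq [simp]: "Tens C = fs_tens D"
  and TensM_eq: "TensM C f g = block (fs_tens D (fdom f) (fdom g)) (fs_tens D (fcod f) (fcod g))
        (\<lambda>y x. case (fst x, fst y) of
            (Node a b, Node a' b') \<Rightarrow> entry f a' a * entry g b' b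
          | _ \<Rightarrow> 0)"
  and Unit_eq [simp]: "Unit C = simple_sum (Sunit D)"
  and Assoc_eq: "Assoc C A B E = block (fs_tens D (fs_tens D A B) E) (fs_tens D A (fs_tens D B E))
        (\<lambda>y x. case (x, y) of
            ((Node (Node a b, t) e, u), (Node a' (Node b' e', r), u')) \<Rightarrow>
               if a' = a \<and> b' = b \<and> e' = e then Fsym D (snd a) (snd b) (snd e) u t r else 0
          | _ \<Rightarrow> 0)"
  and LUnit_eq: "LUnit C A = block (fs_tens D (simple_sum (Sunit D)) A) A
        (\<lambda>y x. case fst x of Node e a \<Rightarrow> if y = a then 1 else 0 | _ \<Rightarrow> 0)"
  and RUnit_eq: "RUnit C A = block (fs_tens D A (simple_sum (Sunit D))) A
        (\<lambda>y x. case fst x of Node a e \<Rightarrow> if y = a then 1 else 0 | _ \<Rightarrow> 0)"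
  and Dual_eq [simp]: "Dual C A = relabel (Sdual D) ` A"
  and Ev_eq: "Ev C A = block (fs_tens D (relabel (Sdual D) ` A) A) (simple_sum (Sunit D))
        (\<lambda>y x. case fst x of
            Node a' a \<Rightarrow> if a' = relabel (Sdual D) a then Sev D (snd a) else 0
          | _ \<Rightarrow> 0)"
  and Coev_eq: "Coev C A = block (simple_sum (Sunit D)) (fs_tens D A (relabel (Sdual D) ` A))
        (\<lambda>y x. case fst y of
            Node a a' \<Rightarrow> if a' = relabel (Sdual D) a then 1 else 0
          | _ \<Rightarrow> 0)"
  using truncate_eq
  by (simp_all add: tensor_category.truncate_def fs_tensor_category_def fits_def fun_eq_iff)

lemma fdom_simps [simp]:
  "fdom (Id C A) = A" "fdom (Comp C g f) = fdom f" "fdom (Zero C A B) = A" "fdom (Add C f g) = fdom f"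
  "fdom (Smul C c f) = fdom f" "fdom (TensM C f g) = fs_tens D (fdom f) (fdom g)"
  "fdom (Assoc C A B E) = fs_tens D (fs_tens D A B) E"
  "fdom (LUnit C A) = fs_tens D (simple_sum (Sunit D)) A"
  "fdom (RUnit C A) = fs_tens D A (simple_sum (Sunit D))"
  "fdom (Ev C A) = fs_tens D (relabel (Sdual D) ` A) A"
  "fdom (Coev C A) = simple_sum (Sunit D)"
  by (simp_all add: Id_eq Comp_eq Zero_eq Add_eq Smul_eq TensM_eq Assoc_eq LUnit_eq RUnit_eq
      Ev_eq Coev_eq)

lemma fcod_simps [simp]:
  "fcod (Id C A) = A" "fcod (Comp C g f) = fcod g" "fcod (Zero C A B) = B" "fcod (Add C f g) = fcod f"
  "fcod (Smul C c f) = fcod f" "fcod (TensM C f g) = fs_tens D (fcod f) (fcod g)"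
  "fcod (Assoc C A B E) = fs_tens D A (fs_tens D B E)"
  "fcod (LUnit C A) = A" "fcod (RUnit C A) = A"
  "fcod (Ev C A) = simple_sum (Sunit D)"
  "fcod (Coev C A) = fs_tens D A (relabel (Sdual D) ` A)"
  by (simp_all add: Id_eq Comp_eq Zero_eq Add_eq Smul_eq TensM_eq Assoc_eq LUnit_eq RUnit_eq
      Ev_eq Coev_eq)

lemma fits_simps [simp]:
  "fits (Id C A)" "fits (Comp C g f)" "fits (Zero C A B)" "fits (Add C f g)"
  "fits (Smul C c f)" "fits (TensM C f g)" "fits (Assoc C A B E)"
  "fits (LUnit C A)" "fits (RUnit C A)" "fits (Ev C A)" "fits (Coev C A)"
  by (simp_all add: Id_eq Comp_eq Zero_eq Add_eq Smul_eq TensM_eq Assoc_eq LUnit_eq RUnit_eq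
      Ev_eq Coev_eq)

lemma homs_iff:
  "f \<in> homs C A B \<longleftrightarrow> fdom f = A \<and> fcod f = B \<and> fits f \<and> A \<in> fs_ob D \<and> B \<in> fs_ob D"
  by (auto simp: homs_def Arr_eq)

lemma fs_obI: "finite A \<Longrightarrow> (\<And>a. a \<in> A \<Longrightarrow> snd a \<in> Slab D) \<Longrightarrow> A \<in> fs_ob D"
  and lab_ob: "A \<in> fs_ob D \<Longrightarrow> a \<in> A \<Longrightarrow> snd a \<in> Slab D"
  and fs_ob_subset: "A \<in> fs_ob D \<Longrightarrow> B \<subseteq> A \<Longrightarrow> B \<in> fs_ob D"
  and single_ob [simp]: "{x} \<in> fs_ob D \<longleftrightarrow> snd x \<in> Slab D"
  and empty_ob [simp]: "{} \<in> fs_ob D"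
  and finite_ob [simp]: "A \<in> fs_ob D \<Longrightarrow> finite A"
  by (auto simp: fs_ob_def finite_subset)

lemma hom_eqI:
  assumes "f \<in> homs C A B" "g \<in> homs C A B"
    and "\<And>x \<Phi>. x \<in> A \<Longrightarrow> pull f \<Phi> x = pull g \<Phi> x"
  shows "f = g"
  using assms by (intro fits_eqI) (auto simp: homs_iff)

lemma pull_Id [simp]: "A \<in> fs_ob D \<Longrightarrow> x \<in> A \<Longrightarrow> pull (Id C A) \<Phi> x = \<Phi> x"
  by (simp add: Id_eq pull_block if_distrib[where f = "\<lambda>c. c * _"] cong: if_cong)

text \<open>The cut-off by \<open>block\<close> in the composition is invisible here: a nonzero
  product of entries already forces equal labels along the path.\<close>

lemma entry_Comp:
  assumes "fits f" "fits g"
  shows "entry (Comp C g f) z x = (\<Sum>y \<in> fcod f. entry g z y * entry f y x)"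
proof (cases "z \<in> fcod g \<and> x \<in> fdom f \<and> snd z = snd x")
  case True
  then show ?thesis by (simp add: Comp_eq entry_block)
next
  case False
  then have "entry g z y * entry f y x = 0" for y
    using fits_entry_eq_0[OF assms(1), of y x] fits_entry_eq_0[OF assms(2), of z y] by fastforce
  then have "(\<Sum>y \<in> fcod f. entry g z y * entry f y x) = 0"
    by (intro sum.neutral) blast
  with False show ?thesis by (auto simp: Comp_eq entry_block)
qed

lemma pull_Comp [simp]:
  assumes "fits f" "fits g" "fcod f = fdom g"
  shows "pull (Comp C g f) \<Phi> x = pull f (pull g \<Phi>) x"
proof -
  have "pull (Comp C g f) \<Phi> x = (\<Sum>z\<in>fcod g. \<Sum>y\<in>fcod f. entry g z y * entry f y x * \<Phi> z)"
    by (simp add: pull_def entry_Comp[OF assms(1,2)] sum_distrib_right)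
  also have "\<dots> = (\<Sum>y\<in>fcod f. \<Sum>z\<in>fcod g. entry g z y * entry f y x * \<Phi> z)"
    by (rule sum.swap)
  finally show ?thesis
    by (simp add: pull_def sum_distrib_left algebra_simps)
qed

lemma pull_Zero [simp]: "pull (Zero C A B) \<Phi> x = 0"
  by (simp add: Zero_eq pull_def entry_block)

lemma pull_Add [simp]:
  "fits f \<Longrightarrow> fits g \<Longrightarrow> fdom f = fdom g \<Longrightarrow> fcod f = fcod g
    \<Longrightarrow> pull (Add C f g) \<Phi> x = pull f \<Phi> x + pull g \<Phi> x"
  by (auto simp: pull_def Add_eq sum.distrib[symmetric] entry_block algebra_simps fits_entry_eq_0
      intro!: sum.cong)

lemma pull_Smul [simp]: "fits f \<Longrightarrow> pull (Smul C c f) \<Phi> x = c * pull f \<Phi> x"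
  unfolding pull_def Smul_eq sum_distrib_left
  by (rule sum.cong) (auto simp: entry_block fits_def algebra_simps)

sublocale linear_category C
proof
  show "f \<in> Arr C \<Longrightarrow> Dom C f \<in> Ob C" "f \<in> Arr C \<Longrightarrow> Cod C f \<in> Ob C" for f
    by (simp_all add: Arr_eq)
  show "f \<in> homs C A B \<Longrightarrow> f \<boxplus> (-1) \<star> f = Zero C A B" for f A B
    by (rule hom_eqI[of _ A B]) (auto simp: homs_iff)
  show "\<lbrakk>f \<in> homs C A B; g \<in> homs C B E; h \<in> homs C E F\<rbrakk> \<Longrightarrow> (h \<cdot> g) \<cdot> f = h \<cdot> (g \<cdot> f)"
    for f g h A B E F
    by (rule hom_eqI[of _ A F]) (auto simp: homs_iff)
  show "f \<in> homs C A B \<Longrightarrow> f \<cdot> Id C A = f" for f A B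
    by (rule hom_eqI[of _ A B]) (auto simp: homs_iff)
  show "f \<in> homs C A B \<Longrightarrow> Id C B \<cdot> f = f" for f A B
    by (rule hom_eqI[of _ A B]) (auto simp: homs_iff)
  show "\<lbrakk>f \<in> homs C A B; g \<in> homs C A B; h \<in> homs C A B\<rbrakk> \<Longrightarrow> (f \<boxplus> g) \<boxplus> h = f \<boxplus> (g \<boxplus> h)"
    for f g h A B
    by (rule hom_eqI[of _ A B]) (auto simp: homs_iff)
  show "\<lbrakk>f \<in> homs C A B; g \<in> homs C A B\<rbrakk> \<Longrightarrow> f \<boxplus> g = g \<boxplus> f" for f g A B
    by (rule hom_eqI[of _ A B]) (auto simp: homs_iff)
  show "f \<in> homs C A B \<Longrightarrow> f \<boxplus> Zero C A B = f" for f A B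
    by (rule hom_eqI[of _ A B]) (auto simp: homs_iff)
  show "\<lbrakk>f \<in> homs C A B; g \<in> homs C A B\<rbrakk> \<Longrightarrow> c \<star> (f \<boxplus> g) = c \<star> f \<boxplus> c \<star> g" for c f g A B
    by (rule hom_eqI[of _ A B]) (auto simp: homs_iff algebra_simps)
  show "f \<in> homs C A B \<Longrightarrow> (c + d) \<star> f = c \<star> f \<boxplus> d \<star> f" for c d f A B
    by (rule hom_eqI[of _ A B]) (auto simp: homs_iff algebra_simps)
  show "f \<in> homs C A B \<Longrightarrow> (c * d) \<star> f = c \<star> (d \<star> f)" for c d f A B
    by (rule hom_eqI[of _ A B]) (auto simp: homs_iff algebra_simps)
  show "f \<in> homs C A B \<Longrightarrow> 1 \<star> f = f" for f A B
    by (rule hom_eqI[of _ A B]) (auto simp: homs_iff algebra_simps)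
  show "\<lbrakk>f \<in> homs C A B; f' \<in> homs C A B; g \<in> homs C B E\<rbrakk> \<Longrightarrow> g \<cdot> (f \<boxplus> f') = g \<cdot> f \<boxplus> g \<cdot> f'"
    for f f' g A B E
    by (rule hom_eqI[of _ A E]) (auto simp: homs_iff)
  show "\<lbrakk>f \<in> homs C A B; g \<in> homs C B E; g' \<in> homs C B E\<rbrakk> \<Longrightarrow> (g \<boxplus> g') \<cdot> f = g \<cdot> f \<boxplus> g' \<cdot> f"
    for f g g' A B E
    by (rule hom_eqI[of _ A E]) (auto simp: homs_iff pull_add)
  show "\<lbrakk>f \<in> homs C A B; g \<in> homs C B E\<rbrakk> \<Longrightarrow> g \<cdot> (c \<star> f) = c \<star> (g \<cdot> f)" for c f g A B E
    by (rule hom_eqI[of _ A E]) (auto simp: homs_iff)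
  show "\<lbrakk>f \<in> homs C A B; g \<in> homs C B E\<rbrakk> \<Longrightarrow> (c \<star> g) \<cdot> f = c \<star> (g \<cdot> f)" for c f g A B E
    by (rule hom_eqI[of _ A E]) (auto simp: homs_iff pull_scale)
  show "A \<in> Ob C \<Longrightarrow> Id C A \<in> homs C A A" for A
    by (simp add: homs_iff)
  show "\<lbrakk>f \<in> homs C A B; g \<in> homs C B E\<rbrakk> \<Longrightarrow> g \<cdot> f \<in> homs C A E" for f g A B E
    by (simp add: homs_iff)
  show "\<lbrakk>A \<in> Ob C; B \<in> Ob C\<rbrakk> \<Longrightarrow> Zero C A B \<in> homs C A B" for A B
    by (simp add: homs_iff)
  show "\<lbrakk>f \<in> homs C A B; g \<in> homs C A B\<rbrakk> \<Longrightarrow> f \<boxplus> g \<in> homs C A B" for f g A B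
    by (simp add: homs_iff)
  show "f \<in> homs C A B \<Longrightarrow> c \<star> f \<in> homs C A B" for c f A B
    by (simp add: homs_iff)
qed

end

section \<open>Split image factorisations\<close>

text \<open>Gaussian elimination by columns: a new column either lies in the span of the previous image or
  enlarges the index set of the image by one.\<close>

lemma matrix_split_image:
  fixes M :: "'y \<Rightarrow> 'x \<Rightarrow> complex" and l :: "'x \<Rightarrow> 'l" and l' :: "'y \<Rightarrow> 'l"
  assumes "finite A" and B: "finite B"
    and "\<forall>y\<in>B. \<forall>x\<in>A. M y x \<noteq> 0 \<longrightarrow> l' y = l x"
  shows "\<exists>I P S J R. I \<subseteq> A
    \<and> (\<forall>i\<in>I. \<forall>x\<in>A. (P i x \<noteq> 0 \<longrightarrow> l i = l x) \<and> (S x i \<noteq> 0 \<longrightarrow> l x = l i))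
    \<and> (\<forall>i\<in>I. \<forall>y\<in>B. (J y i \<noteq> 0 \<longrightarrow> l' y = l i) \<and> (R i y \<noteq> 0 \<longrightarrow> l i = l' y))
    \<and> (\<forall>i\<in>I. \<forall>k\<in>I. (\<Sum>x\<in>A. P i x * S x k) = (if i = k then 1 else 0))
    \<and> (\<forall>i\<in>I. \<forall>k\<in>I. (\<Sum>y\<in>B. R i y * J y k) = (if i = k then 1 else 0))
    \<and> (\<forall>y\<in>B. \<forall>x\<in>A. M y x = (\<Sum>i\<in>I. J y i * P i x))"
  using assms(1,3)
proof (induction A rule: finite_induct)
  case empty
  then show ?case by (intro exI[of _ "{}"]) auto
next
  case (insert x0 A)
  have "\<forall>y\<in>B. \<forall>x\<in>A. M y x \<noteq> 0 \<longrightarrow> l' y = l x"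
    using insert.prems by blast
  from insert.IH[OF this] obtain I P S J R where I: "I \<subseteq> A"
    and PS: "\<forall>i\<in>I. \<forall>x\<in>A. (P i x \<noteq> 0 \<longrightarrow> l i = l x) \<and> (S x i \<noteq> 0 \<longrightarrow> l x = l i)"
    and JR: "\<forall>i\<in>I. \<forall>y\<in>B. (J y i \<noteq> 0 \<longrightarrow> l' y = l i) \<and> (R i y \<noteq> 0 \<longrightarrow> l i = l' y)"
    and PS1: "\<forall>i\<in>I. \<forall>k\<in>I. (\<Sum>x\<in>A. P i x * S x k) = (if i = k then 1 else 0)"
    and RJ1: "\<forall>i\<in>I. \<forall>k\<in>I. (\<Sum>y\<in>B. R i y * J y k) = (if i = k then 1 else 0)"
    and M: "\<forall>y\<in>B. \<forall>x\<in>A. M y x = (\<Sum>i\<in>I. J y i * P i x)"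
    by (elim exE conjE) (rule that, assumption+)
  note PS = PS[rule_format] and JR = JR[rule_format] and PS1 = PS1[rule_format]
    and RJ1 = RJ1[rule_format] and M = M[rule_format]
  have fI: "finite I" using I insert.hyps(1) finite_subset by blast
  have x0I: "x0 \<notin> I" using I insert.hyps(2) by blast
  \<comment> \<open>\<open>c\<close> holds the coordinates of the new column under the retraction
    \<open>R\<close>, and \<open>d\<close> is what remains of the column outside the old image;
    \<open>R\<close> annihilates \<open>d\<close>.\<close>
  define c where "c i = (\<Sum>y\<in>B. R i y * M y x0)" for i
  define d where "d y = M y x0 - (\<Sum>i\<in>I. J y i * c i)" for y
  have prem_x0: "l' y = l x0" if "y \<in> B" "M y x0 \<noteq> 0" for y
    using insert.prems that by blast
  have c_lab: "l i = l x0" if i: "i \<in> I" and ci: "c i \<noteq> 0" for i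
  proof -
    obtain y where "y \<in> B" "R i y * M y x0 \<noteq> 0"
      using ci unfolding c_def by (meson sum.not_neutral_contains_not_neutral)
    then show ?thesis using JR[OF i, of y] prem_x0[of y] by simp
  qed
  have d_lab: "l' y = l x0" if y: "y \<in> B" and dy: "d y \<noteq> 0" for y
  proof (cases "M y x0 = 0")
    case True
    then have "(\<Sum>i\<in>I. J y i * c i) \<noteq> 0"
      using dy by (simp add: d_def)
    then obtain i where "i \<in> I" "J y i * c i \<noteq> 0"
      by (meson sum.not_neutral_contains_not_neutral)
    then show ?thesis using JR[of i y] c_lab[of i] y by simp
  qed (use y prem_x0 in simp)
  have Rd: "(\<Sum>y\<in>B. R k y * d y) = 0" if k: "k \<in> I" for k
  proof -
    have "(\<Sum>y\<in>B. R k y * d y) = c k - (\<Sum>y\<in>B. \<Sum>i\<in>I. R k y * J y i * c i)"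
      by (simp add: d_def c_def right_diff_distrib sum_subtractf sum_distrib_left mult.assoc)
    also have "(\<Sum>y\<in>B. \<Sum>i\<in>I. R k y * J y i * c i) = (\<Sum>i\<in>I. (\<Sum>y\<in>B. R k y * J y i) * c i)"
      by (simp add: sum_distrib_right) (rule sum.swap)
    also have "\<dots> = (\<Sum>i\<in>I. if k = i then c i else 0)"
      by (rule sum.cong) (simp_all add: RJ1[OF k])
    also have "\<dots> = c k" using fI k by simp
    finally show ?thesis by simp
  qed
  have Mx0: "M y x0 = d y + (\<Sum>i\<in>I. J y i * c i)" for y
    by (simp add: d_def)
  show ?case
  proof (cases "\<exists>y0\<in>B. d y0 \<noteq> 0")
    case False
    \<comment> \<open>The new column lies in the old image: \<open>P\<close> acquires it as the
      column \<open>c\<close>, and the section avoids \<open>x0\<close>.\<close>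
    define P' where "P' i x = (if x = x0 then c i else P i x)" for i x
    define S' where "S' x k = (if x = x0 then 0 else S x k)" for x k
    have agree: "P' i x = P i x" "S' x i = S x i" if "x \<in> A" for i x
      using that insert.hyps(2) by (auto simp: P'_def S'_def)
    show ?thesis
      apply (rule exI[of _ I], rule exI[of _ P'], rule exI[of _ S'], rule exI[of _ J], rule exI[of _ R])
      using I PS JR PS1 RJ1 M False c_lab insert.hyps
      by (auto simp: agree P'_def[of _ x0] S'_def[of x0] Mx0)
  next
    case True
    then obtain y0 where y0: "y0 \<in> B" "d y0 \<noteq> 0" by blast
    \<comment> \<open>The image grows by the vector \<open>d\<close>, indexed by \<open>x0\<close>.
      Column \<open>x0\<close> of \<open>S'\<close> subtracts the old components \<open>c\<close>,
      so that \<open>P'\<close> maps it to the new index alone. Row \<open>x0\<close> of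
      \<open>R'\<close> reads coordinate \<open>y0\<close> after removal of the old image and is
      scaled by the pivot \<open>d y0\<close>.\<close>
    define P' where
      "P' i x = (if i = x0 then if x = x0 then 1 else 0 else if x = x0 then c i else P i x)" for i x
    define S' where
      "S' x k = (if k = x0 then if x = x0 then 1 else - (\<Sum>i\<in>I. S x i * c i)
                 else if x = x0 then 0 else S x k)" for x k
    define J' where "J' y i = (if i = x0 then d y else J y i)" for y i
    define R' where
      "R' i y = (if i = x0 then ((if y = y0 then 1 else 0) - (\<Sum>k\<in>I. J y0 k * R k y)) / d y0
                 else R i y)" for i y
    have AI: "x \<in> A \<Longrightarrow> x \<noteq> x0" "i \<in> I \<Longrightarrow> i \<noteq> x0" for x i
      using insert.hyps(2) x0I by auto
    have PS': "(P' i x \<noteq> 0 \<longrightarrow> l i = l x) \<and> (S' x i \<noteq> 0 \<longrightarrow> l x = l i)"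
      if i: "i \<in> insert x0 I" and x: "x \<in> insert x0 A" for i x
    proof -
      have "l x = l x0" if xA: "x \<in> A" and nz: "(\<Sum>i\<in>I. S x i * c i) \<noteq> 0"
      proof -
        obtain i where "i \<in> I" "S x i * c i \<noteq> 0"
          using nz by (meson sum.not_neutral_contains_not_neutral)
        then show ?thesis using PS[of i x] c_lab[of i] xA by simp
      qed
      then show ?thesis
        using i x PS[of i x] c_lab[of i] by (auto simp: P'_def S'_def split: if_splits)
    qed
    have JR': "(J' y i \<noteq> 0 \<longrightarrow> l' y = l i) \<and> (R' i y \<noteq> 0 \<longrightarrow> l i = l' y)"
      if i: "i \<in> insert x0 I" and y: "y \<in> B" for i y
    proof -
      have "l x0 = l' y" if nz: "(\<Sum>k\<in>I. J y0 k * R k y) \<noteq> 0"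
      proof -
        obtain i where "i \<in> I" "J y0 i * R i y \<noteq> 0"
          using nz by (meson sum.not_neutral_contains_not_neutral)
        then show ?thesis using JR[of i y] JR[of i y0] d_lab[OF y0] y0(1) y by simp
      qed
      then show ?thesis
        using i y JR[of i y] d_lab[of y] d_lab[OF y0] y0
        by (auto simp: J'_def R'_def split: if_splits)
    qed
    have PS1': "(\<Sum>x\<in>insert x0 A. P' i x * S' x k) = (if i = k then 1 else 0)"
      if i: "i \<in> insert x0 I" and k: "k \<in> insert x0 I" for i k
    proof -
      have e: "(\<Sum>x\<in>A. P' i x * S' x k) =
          (if i = x0 then 0 else if k = x0 then - c i else if i = k then 1 else 0)"
      proof (cases "i = x0")
        case True
        then show ?thesis using AI(1) by (auto simp: P'_def intro!: sum.neutral)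
      next
        case False
        then have iI: "i \<in> I" using i by simp
        show ?thesis
        proof (cases "k = x0")
          case True
          have "(\<Sum>x\<in>A. P' i x * S' x k) = (\<Sum>x\<in>A. - (\<Sum>j\<in>I. P i x * S x j * c j))"
            by (rule sum.cong) (use AI False True in
                \<open>auto simp: P'_def S'_def sum_distrib_left mult.assoc\<close>)
          also have "\<dots> = - (\<Sum>x\<in>A. \<Sum>j\<in>I. P i x * S x j * c j)"
            by (rule sum_negf)
          also have "(\<Sum>x\<in>A. \<Sum>j\<in>I. P i x * S x j * c j) = (\<Sum>j\<in>I. (\<Sum>x\<in>A. P i x * S x j) * c j)"
            by (simp add: sum_distrib_right) (rule sum.swap)
          also have "\<dots> = (\<Sum>j\<in>I. if i = j then c j else 0)"
            by (rule sum.cong) (simp_all add: PS1[OF iI])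
          finally show ?thesis using fI iI False True by simp
        next
          case k': False
          have "(\<Sum>x\<in>A. P' i x * S' x k) = (\<Sum>x\<in>A. P i x * S x k)"
            by (rule sum.cong) (use AI False k' in \<open>auto simp: P'_def S'_def\<close>)
          then show ?thesis using PS1[OF iI, of k] k k' False by simp
        qed
      qed
      show ?thesis
        using insert.hyps i k x0I by (simp add: e) (auto simp: P'_def S'_def)
    qed
    have RJ1': "(\<Sum>y\<in>B. R' i y * J' y k) = (if i = k then 1 else 0)"
      if i: "i \<in> insert x0 I" and k: "k \<in> insert x0 I" for i k
    proof (cases "i = x0")
      case True
      \<comment> \<open>Stated for an arbitrary vector, since the new row has to be tested on
        \<open>d\<close>, where it gives 1, and on the old columns of \<open>J\<close>, where it
        gives 0.\<close>
      have *: "(\<Sum>y\<in>B. R' x0 y * v y) = (v y0 - (\<Sum>k\<in>I. J y0 k * (\<Sum>y\<in>B. R k y * v y))) / d y0"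
        for v
      proof -
        have "(\<Sum>y\<in>B. R' x0 y * v y)
            = (\<Sum>y\<in>B. ((if y = y0 then v y else 0) - (\<Sum>k\<in>I. J y0 k * (R k y * v y))) / d y0)"
          by (rule sum.cong) (auto simp: R'_def left_diff_distrib sum_distrib_right mult.assoc)
        also have "\<dots> = (v y0 - (\<Sum>y\<in>B. \<Sum>k\<in>I. J y0 k * (R k y * v y))) / d y0"
          using B y0(1) by (simp add: sum_divide_distrib[symmetric] sum_subtractf)
        also have "(\<Sum>y\<in>B. \<Sum>k\<in>I. J y0 k * (R k y * v y)) = (\<Sum>k\<in>I. J y0 k * (\<Sum>y\<in>B. R k y * v y))"
          by (subst sum.swap) (simp add: sum_distrib_left)
        finally show ?thesis .
      qed
      show ?thesis
      proof (cases "k = x0")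
        case k': True
        then show ?thesis using True y0 by (simp add: J'_def * Rd)
      next
        case False
        then have kI: "k \<in> I" using k by simp
        have "(\<Sum>y\<in>B. R' x0 y * J' y k) = (J y0 k - (\<Sum>i\<in>I. if i = k then J y0 i else 0)) / d y0"
          using False kI by (auto simp: J'_def * RJ1 if_distrib cong: if_cong intro!: sum.cong)
        then show ?thesis using True False kI fI by auto
      qed
    next
      case False
      then have iI: "i \<in> I" using i by simp
      then show ?thesis
        using False k RJ1[OF iI, of k] Rd[OF iI] x0I by (cases "k = x0") (auto simp: J'_def R'_def)
    qed
    have M': "M y x = (\<Sum>i\<in>insert x0 I. J' y i * P' i x)" if "y \<in> B" "x \<in> insert x0 A" for y x
    proof -
      have "(\<Sum>i\<in>I. J' y i * P' i x) = (\<Sum>i\<in>I. J y i * (if x = x0 then c i else P i x))"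
        by (rule sum.cong) (use AI in \<open>auto simp: J'_def P'_def\<close>)
      then show ?thesis
        using that fI x0I AI by (auto simp: M Mx0 P'_def[of x0] J'_def[of _ x0])
    qed
    show ?thesis
      apply (rule exI[of _ "insert x0 I"], rule exI[of _ P'], rule exI[of _ S'], rule exI[of _ J'],
          rule exI[of _ R'], intro conjI[OF _ conjI[OF _ conjI[OF _ conjI[OF _ conjI]]]] ballI)
           apply (use I in blast)
          apply (erule (1) PS')
         apply (erule (1) JR')
        apply (erule (1) PS1')
       apply (erule (1) RJ1')
      apply (erule (1) M')
      done
  qed
qed

section \<open>Abelian structure from split images\<close>

context linear_category
begin

lemma homsD: "f \<in> homs C A B \<Longrightarrow> f \<in> Arr C \<and> Dom C f = A \<and> Cod C f = B \<and> A \<in> Ob C \<and> B \<in> Ob C"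
  using dom_ob cod_ob by (auto simp: homs_def)

lemma comp_Zero:
  assumes "A \<in> Ob C" "g \<in> homs C B E" shows "g \<cdot> Zero C A B = Zero C A E"
proof -
  have Z: "Zero C A B \<in> homs C A B" using assms homsD zero_homs by blast
  have "g \<cdot> Zero C A B = g \<cdot> (Zero C A B \<boxplus> (-1) \<star> Zero C A B)"
    using add_neg[OF Z] by simp
  also have "\<dots> = g \<cdot> Zero C A B \<boxplus> (-1) \<star> (g \<cdot> Zero C A B)"
    using comp_add[OF Z smul_homs[OF Z] assms(2)] comp_smul[OF Z assms(2)] by simp
  also have "\<dots> = Zero C A E"
    using add_neg[OF comp_homs[OF Z assms(2)]] .
  finally show ?thesis .
qed

lemma Zero_comp:
  assumes "E \<in> Ob C" "f \<in> homs C A B" shows "Zero C B E \<cdot> f = Zero C A E"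
proof -
  have Z: "Zero C B E \<in> homs C B E" using assms homsD zero_homs by blast
  have "Zero C B E \<cdot> f = (Zero C B E \<boxplus> (-1) \<star> Zero C B E) \<cdot> f"
    using add_neg[OF Z] by simp
  also have "\<dots> = Zero C B E \<cdot> f \<boxplus> (-1) \<star> (Zero C B E \<cdot> f)"
    using add_comp[OF assms(2) Z smul_homs[OF Z]] smul_comp[OF assms(2) Z] by simp
  also have "\<dots> = Zero C A E"
    using add_neg[OF comp_homs[OF assms(2) Z]] .
  finally show ?thesis .
qed

lemma Zero_add: "f \<in> homs C A B \<Longrightarrow> Zero C A B \<boxplus> f = f"
  using add_comm add_zero homsD zero_homs by metis

lemma inverse_arrows_unique:
  assumes "inverse_arrows C f g" "inverse_arrows C f g'" shows "g = g'"
proof -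
  let ?A = "Dom C f" and ?B = "Cod C f"
  have f: "f \<in> homs C ?A ?B" and g: "g \<in> homs C ?B ?A" and g': "g' \<in> homs C ?B ?A"
    using assms by (auto simp: inverse_arrows_def homs_def)
  have "g = g \<cdot> (f \<cdot> g')" using assms comp_id[OF g] by (simp add: inverse_arrows_def)
  also have "\<dots> = (g \<cdot> f) \<cdot> g'" using comp_assoc[OF g' f g] by simp
  also have "\<dots> = g'" using assms id_comp[OF g'] by (simp add: inverse_arrows_def)
  finally show ?thesis .
qed

lemma inv_arrow_eq: "inverse_arrows C f g \<Longrightarrow> inv_arrow C f = g"
  unfolding inv_arrow_def using inverse_arrows_unique by blast

end

text \<open>Semisimplicity in a form that no longer mentions matrices. Applied to an idempotent,
  \<open>split_image\<close> yields a splitting, hence a complement for every retract; kernels and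
  cokernels are such complements.\<close>

locale split_linear_category = linear_category +
  assumes direct_sum: "(\<And>k. k < n \<Longrightarrow> F k \<in> Ob C) \<Longrightarrow> \<exists>A i p. is_direct_sum C A n F i p"
    and split_image: "f \<in> homs C A B \<Longrightarrow> \<exists>I p s j r. p \<in> homs C A I \<and> s \<in> homs C I A
      \<and> j \<in> homs C I B \<and> r \<in> homs C B I \<and> p \<cdot> s = Id C I \<and> r \<cdot> j = Id C I \<and> f = j \<cdot> p"
begin

text \<open>The complement is the image of the idempotent \<open>e\<close>, the identity minus
  \<open>s \<cdot> p\<close>. A split image factorisation of an idempotent is automatically a
  splitting of it.\<close>

lemma complement:
  assumes p: "p \<in> homs C A I" and s: "s \<in> homs C I A" and ps: "p \<cdot> s = Id C I"
  obtains K k q where "k \<in> homs C K A" "q \<in> homs C A K" "q \<cdot> k = Id C K"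
    "p \<cdot> k = Zero C K I" "q \<cdot> s = Zero C I K" "k \<cdot> q \<boxplus> s \<cdot> p = Id C A"
proof -
  have A: "A \<in> Ob C" and I: "I \<in> Ob C" using homsD[OF p] by auto
  have IA: "Id C A \<in> homs C A A" using id_homs[OF A] .
  have sp: "s \<cdot> p \<in> homs C A A" using comp_homs[OF p s] .
  have nsp: "(-1) \<star> (s \<cdot> p) \<in> homs C A A" using smul_homs[OF sp] .
  define e where "e = Id C A \<boxplus> (-1) \<star> (s \<cdot> p)"
  have e: "e \<in> homs C A A" unfolding e_def using add_homs[OF IA nsp] .
  have "p \<cdot> (s \<cdot> p) = p" using comp_assoc[OF p s p] ps id_comp[OF p] by simp
  then have pe: "p \<cdot> e = Zero C A I"
    unfolding e_def using comp_add[OF IA nsp p] comp_smul[OF sp p] comp_id[OF p] add_neg[OF p] by simp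
  have "(s \<cdot> p) \<cdot> s = s" using comp_assoc[OF s p s] ps comp_id[OF s] by simp
  then have es: "e \<cdot> s = Zero C I A"
    unfolding e_def using add_comp[OF s IA nsp] smul_comp[OF s sp] id_comp[OF s] add_neg[OF s] by simp
  have "(s \<cdot> p) \<cdot> e = Zero C A A" using comp_assoc[OF e p s] pe comp_Zero[OF A s] by simp
  then have "((-1) \<star> (s \<cdot> p)) \<cdot> e = Zero C A A"
    using smul_comp[OF e sp] add_neg[OF zero_homs[OF A A]] Zero_add[OF smul_homs[OF zero_homs[OF A A]]]
    by metis
  then have ee: "e \<cdot> e = e"
    using add_comp[OF e IA nsp] id_comp[OF e] add_zero[OF e] by (simp add: e_def[symmetric])
  obtain K q s2 k r2 where q: "q \<in> homs C A K" and s2: "s2 \<in> homs C K A" and k: "k \<in> homs C K A"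
    and r2: "r2 \<in> homs C A K" and qs2: "q \<cdot> s2 = Id C K" and r2k: "r2 \<cdot> k = Id C K" and ekq: "e = k \<cdot> q"
    using split_image[OF e] by blast
  have K: "K \<in> Ob C" using homsD[OF q] by auto
  have qk': "q \<cdot> k \<in> homs C K K" using comp_homs[OF k q] .
  \<comment> \<open>Idempotency of \<open>e = k \<cdot> q\<close> gives
    \<open>k \<cdot> q \<cdot> k \<cdot> q = k \<cdot> q\<close>. Cancelling \<open>q\<close> by its
    section \<open>s2\<close>, and afterwards \<open>k\<close> by its retraction \<open>r2\<close>,
    leaves \<open>q \<cdot> k = Id C K\<close>.\<close>
  have kqk: "k \<cdot> (q \<cdot> k) = k"
  proof -
    have "e \<cdot> k = (e \<cdot> k) \<cdot> (q \<cdot> s2)" using qs2 comp_id[OF comp_homs[OF k e]] by simp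
    also have "\<dots> = (e \<cdot> (k \<cdot> q)) \<cdot> s2"
      using comp_assoc[OF s2 q comp_homs[OF k e]] comp_assoc[OF q k e] by simp
    also have "\<dots> = k \<cdot> (q \<cdot> s2)" using ekq ee comp_assoc[OF s2 q k] by simp
    finally show ?thesis using qs2 comp_id[OF k] comp_assoc[OF k q k] ekq by simp
  qed
  have qk: "q \<cdot> k = Id C K"
    using comp_assoc[OF qk' k r2] r2k id_comp[OF qk'] kqk by simp
  have pk: "p \<cdot> k = Zero C K I"
  proof -
    have "p \<cdot> k = p \<cdot> (e \<cdot> k)" using kqk comp_assoc[OF k q k] ekq by simp
    also have "\<dots> = (p \<cdot> e) \<cdot> k" using comp_assoc[OF k e p] by simp
    also have "\<dots> = Zero C K I" using pe Zero_comp[OF I k] by simp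
    finally show ?thesis .
  qed
  have qs: "q \<cdot> s = Zero C I K"
  proof -
    have "q = q \<cdot> e" using id_comp[OF q] qk comp_assoc[OF q k q] ekq by simp
    then have "q \<cdot> s = q \<cdot> (e \<cdot> s)" using comp_assoc[OF s e q] by simp
    then show ?thesis using es comp_Zero[OF I q] by simp
  qed
  have "k \<cdot> q \<boxplus> s \<cdot> p = Id C A \<boxplus> ((-1) \<star> (s \<cdot> p) \<boxplus> s \<cdot> p)"
    using ekq e_def add_assoc[OF IA nsp sp] by simp
  then have "k \<cdot> q \<boxplus> s \<cdot> p = Id C A"
    using add_comm[OF nsp sp] add_neg[OF sp] add_zero[OF IA] by simp
  with k q qk pk qs show ?thesis using that by blast
qed

lemma decompose_in:
  assumes "k \<in> homs C K A" "q \<in> homs C A K" "s \<in> homs C I A" "p \<in> homs C A I"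
    and "k \<cdot> q \<boxplus> s \<cdot> p = Id C A" and u: "u \<in> homs C X A"
  shows "k \<cdot> (q \<cdot> u) \<boxplus> s \<cdot> (p \<cdot> u) = u"
  using id_comp[OF u] add_comp[OF u comp_homs[OF assms(2,1)] comp_homs[OF assms(4,3)]]
    comp_assoc[OF u assms(2,1)] comp_assoc[OF u assms(4,3)] assms(5) by simp

lemma decompose_out:
  assumes "k \<in> homs C K A" "q \<in> homs C A K" "s \<in> homs C I A" "p \<in> homs C A I"
    and "k \<cdot> q \<boxplus> s \<cdot> p = Id C A" and u: "u \<in> homs C A X"
  shows "(u \<cdot> k) \<cdot> q \<boxplus> (u \<cdot> s) \<cdot> p = u"
  using comp_id[OF u] comp_add[OF comp_homs[OF assms(2,1)] comp_homs[OF assms(4,3)] u]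
    comp_assoc[OF assms(2,1) u] comp_assoc[OF assms(4,3) u] assms(5) by simp

text \<open>As \<open>j\<close> is a split monomorphism, \<open>f\<close> kills exactly what
  \<open>p\<close> kills, and the kernel of the retraction \<open>p\<close> is the complement of
  \<open>s\<close>.\<close>

lemma ker:
  assumes "f \<in> Arr C" shows "\<exists>k. is_kernel C f k"
proof -
  define A B where "A = Dom C f" and "B = Cod C f"
  have f: "f \<in> homs C A B" using assms by (simp add: homs_def A_def B_def)
  obtain I p s j r where p: "p \<in> homs C A I" and s: "s \<in> homs C I A" and j: "j \<in> homs C I B"
    and r: "r \<in> homs C B I" and ps: "p \<cdot> s = Id C I" and rj: "r \<cdot> j = Id C I" and fjp: "f = j \<cdot> p"
    using split_image[OF f] by blast
  obtain K k q where k: "k \<in> homs C K A" and q: "q \<in> homs C A K" and qk: "q \<cdot> k = Id C K"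
    and pk: "p \<cdot> k = Zero C K I" and dec: "k \<cdot> q \<boxplus> s \<cdot> p = Id C A"
    using complement[OF p s ps] by metis
  have K: "K \<in> Ob C" and A: "A \<in> Ob C" and I: "I \<in> Ob C" using homsD[OF k] homsD[OF p] by auto
  have "is_kernel C f k"
    unfolding is_kernel_def A_def[symmetric] B_def[symmetric]
  proof (intro conjI allI ballI impI)
    show "k \<in> Arr C" "Cod C k = A" using homsD[OF k] by auto
    have "f \<cdot> k = j \<cdot> (p \<cdot> k)" unfolding fjp using comp_assoc[OF k p j] .
    then show "f \<cdot> k = Zero C (Dom C k) B" using pk comp_Zero[OF K j] homsD[OF k] by simp
    fix X u assume u: "u \<in> homs C X A" and fu: "f \<cdot> u = Zero C X B"
    have X: "X \<in> Ob C" using homsD[OF u] by auto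
    have pu: "p \<cdot> u = Zero C X I"
    proof -
      have "p \<cdot> u = (r \<cdot> j) \<cdot> (p \<cdot> u)" using rj id_comp[OF comp_homs[OF u p]] by simp
      also have "\<dots> = r \<cdot> (f \<cdot> u)"
        unfolding fjp using comp_assoc[OF comp_homs[OF u p] j r] comp_assoc[OF u p j] by simp
      finally show ?thesis using fu comp_Zero[OF X r] by simp
    qed
    have "k \<cdot> (q \<cdot> u) = u"
      using decompose_in[OF k q s p dec u] pu comp_Zero[OF X s]
        add_zero[OF comp_homs[OF comp_homs[OF u q] k]] by simp
    moreover have "v = q \<cdot> u" if "v \<in> homs C X K" "k \<cdot> v = u" for v
      using comp_assoc[OF that(1) k q] qk id_comp[OF that(1)] that(2) by simp
    ultimately show "\<exists>!v. v \<in> homs C X (Dom C k) \<and> k \<cdot> v = u"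
      using comp_homs[OF u q] homsD[OF k] by blast
  qed
  then show ?thesis ..
qed

text \<open>Dual to the kernel: \<open>p\<close> is a split epimorphism, so the cokernel of
  \<open>f\<close> is that of \<open>j\<close>, the projection onto the complement of its
  image.\<close>

lemma coker:
  assumes "f \<in> Arr C" shows "\<exists>k. is_cokernel C f k"
proof -
  define A B where "A = Dom C f" and "B = Cod C f"
  have f: "f \<in> homs C A B" using assms by (simp add: homs_def A_def B_def)
  obtain I p s j r where p: "p \<in> homs C A I" and s: "s \<in> homs C I A" and j: "j \<in> homs C I B"
    and r: "r \<in> homs C B I" and ps: "p \<cdot> s = Id C I" and rj: "r \<cdot> j = Id C I" and fjp: "f = j \<cdot> p"
    using split_image[OF f] by blast
  obtain K k q where k: "k \<in> homs C K B" and q: "q \<in> homs C B K" and qk: "q \<cdot> k = Id C K"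
    and qj: "q \<cdot> j = Zero C I K" and dec: "k \<cdot> q \<boxplus> j \<cdot> r = Id C B"
    using complement[OF r j rj] by metis
  have K: "K \<in> Ob C" and A: "A \<in> Ob C" and I: "I \<in> Ob C" using homsD[OF k] homsD[OF p] by auto
  have "is_cokernel C f q"
    unfolding is_cokernel_def A_def[symmetric] B_def[symmetric]
  proof (intro conjI allI ballI impI)
    show "q \<in> Arr C" "Dom C q = B" using homsD[OF q] by auto
    have "q \<cdot> f = (q \<cdot> j) \<cdot> p" unfolding fjp using comp_assoc[OF p j q] by simp
    then show "q \<cdot> f = Zero C A (Cod C q)" using qj Zero_comp[OF K p] homsD[OF q] by simp
    fix X u assume u: "u \<in> homs C B X" and uf: "u \<cdot> f = Zero C A X"
    have X: "X \<in> Ob C" using homsD[OF u] by auto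
    have uj: "u \<cdot> j = Zero C I X"
    proof -
      have "u \<cdot> j = (u \<cdot> j) \<cdot> (p \<cdot> s)" using ps comp_id[OF comp_homs[OF j u]] by simp
      also have "\<dots> = (u \<cdot> f) \<cdot> s"
        unfolding fjp using comp_assoc[OF s p comp_homs[OF j u]] comp_assoc[OF p j u] by simp
      finally show ?thesis using uf Zero_comp[OF X s] by simp
    qed
    have "(u \<cdot> k) \<cdot> q = u"
      using decompose_out[OF k q j r dec u] uj Zero_comp[OF X r]
        add_zero[OF comp_homs[OF q comp_homs[OF k u]]] by simp
    moreover have "v = u \<cdot> k" if "v \<in> homs C K X" "v \<cdot> q = u" for v
      using comp_assoc[OF k q that(1)] qk comp_id[OF that(1)] that(2) by simp
    ultimately show "\<exists>!v. v \<in> homs C (Cod C q) X \<and> v \<cdot> q = u"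
      using comp_homs[OF k u] homsD[OF q] by blast
  qed
  then show ?thesis ..
qed

text \<open>A monomorphism is the kernel of the projection onto the complement of its image. Vectors
  killed by that projection factor through \<open>j\<close>, and \<open>f \<cdot> s = j\<close>
  lifts them through \<open>f\<close>.\<close>

lemma mono_ker:
  assumes mono: "mono_arrow C f" shows "\<exists>g \<in> Arr C. is_kernel C g f"
proof -
  define A B where "A = Dom C f" and "B = Cod C f"
  have f: "f \<in> homs C A B" using mono by (simp add: mono_arrow_def homs_def A_def B_def)
  obtain I p s j r where p: "p \<in> homs C A I" and s: "s \<in> homs C I A" and j: "j \<in> homs C I B"
    and r: "r \<in> homs C B I" and ps: "p \<cdot> s = Id C I" and rj: "r \<cdot> j = Id C I" and fjp: "f = j \<cdot> p"
    using split_image[OF f] by blast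
  obtain K k q where k: "k \<in> homs C K B" and q: "q \<in> homs C B K"
    and qj: "q \<cdot> j = Zero C I K" and dec: "k \<cdot> q \<boxplus> j \<cdot> r = Id C B"
    using complement[OF r j rj] by metis
  have K: "K \<in> Ob C" using homsD[OF k] by auto
  have fs: "f \<cdot> s = j" unfolding fjp using comp_assoc[OF s p j] ps comp_id[OF j] by simp
  have "is_kernel C q f"
    unfolding is_kernel_def
  proof (intro conjI allI ballI impI)
    show "f \<in> Arr C" "Cod C f = Dom C q" using homsD[OF f] homsD[OF q] by auto
    have "q \<cdot> f = (q \<cdot> j) \<cdot> p" unfolding fjp using comp_assoc[OF p j q] by simp
    then show "q \<cdot> f = Zero C (Dom C f) (Cod C q)"
      using qj Zero_comp[OF K p] homsD[OF q] homsD[OF f] by simp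
    fix X u assume "u \<in> homs C X (Dom C q)" and qu: "q \<cdot> u = Zero C X (Cod C q)"
    then have u: "u \<in> homs C X B" using homsD[OF q] by simp
    have X: "X \<in> Ob C" using homsD[OF u] by auto
    have "j \<cdot> (r \<cdot> u) = u"
      using decompose_in[OF k q j r dec u] qu comp_Zero[OF X k] homsD[OF q]
        Zero_add[OF comp_homs[OF comp_homs[OF u r] j]] by simp
    then have "f \<cdot> (s \<cdot> (r \<cdot> u)) = u" using fs comp_assoc[OF comp_homs[OF u r] s f] by simp
    moreover have "v = s \<cdot> (r \<cdot> u)" if "v \<in> homs C X A" "f \<cdot> v = u" for v
      using mono that calculation comp_homs[OF comp_homs[OF u r] s]
      unfolding mono_arrow_def A_def[symmetric] by metis
    ultimately show "\<exists>!v. v \<in> homs C X (Dom C f) \<and> f \<cdot> v = u"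
      using comp_homs[OF comp_homs[OF u r] s] homsD[OF f] by blast
  qed
  then show ?thesis using homsD[OF q] by blast
qed

text \<open>An epimorphism is the cokernel of the inclusion of the complement \<open>k\<close> of
  \<open>s\<close>; morphisms vanishing on \<open>k\<close> factor through \<open>p\<close>, which
  is \<open>r \<cdot> f\<close>.\<close>

lemma epi_coker:
  assumes epi: "epi_arrow C f" shows "\<exists>g \<in> Arr C. is_cokernel C g f"
proof -
  define A B where "A = Dom C f" and "B = Cod C f"
  have f: "f \<in> homs C A B" using epi by (simp add: epi_arrow_def homs_def A_def B_def)
  obtain I p s j r where p: "p \<in> homs C A I" and s: "s \<in> homs C I A" and j: "j \<in> homs C I B"
    and r: "r \<in> homs C B I" and ps: "p \<cdot> s = Id C I" and rj: "r \<cdot> j = Id C I" and fjp: "f = j \<cdot> p"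
    using split_image[OF f] by blast
  obtain K k q where k: "k \<in> homs C K A" and q: "q \<in> homs C A K"
    and pk: "p \<cdot> k = Zero C K I" and dec: "k \<cdot> q \<boxplus> s \<cdot> p = Id C A"
    using complement[OF p s ps] by metis
  have K: "K \<in> Ob C" using homsD[OF k] by auto
  have rf: "r \<cdot> f = p" unfolding fjp using comp_assoc[OF p j r] rj id_comp[OF p] by simp
  have "is_cokernel C k f"
    unfolding is_cokernel_def
  proof (intro conjI allI ballI impI)
    show "f \<in> Arr C" "Dom C f = Cod C k" using homsD[OF f] homsD[OF k] by auto
    have "f \<cdot> k = j \<cdot> (p \<cdot> k)" unfolding fjp using comp_assoc[OF k p j] by simp
    then show "f \<cdot> k = Zero C (Dom C k) (Cod C f)"
      using pk comp_Zero[OF K j] homsD[OF k] homsD[OF f] by simp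
    fix X u assume "u \<in> homs C (Cod C k) X" and uk: "u \<cdot> k = Zero C (Dom C k) X"
    then have u: "u \<in> homs C A X" using homsD[OF k] by simp
    have X: "X \<in> Ob C" using homsD[OF u] by auto
    have us: "u \<cdot> s \<in> homs C I X" using comp_homs[OF s u] .
    have "(u \<cdot> s) \<cdot> p = u"
      using decompose_out[OF k q s p dec u] uk Zero_comp[OF X q] homsD[OF k]
        Zero_add[OF comp_homs[OF p us]] by simp
    then have "((u \<cdot> s) \<cdot> r) \<cdot> f = u" using rf comp_assoc[OF f r us] by simp
    moreover have "v = (u \<cdot> s) \<cdot> r" if "v \<in> homs C B X" "v \<cdot> f = u" for v
      using epi that calculation comp_homs[OF r us]
      unfolding epi_arrow_def B_def[symmetric] by metis
    ultimately show "\<exists>!v. v \<in> homs C (Cod C f) X \<and> v \<cdot> f = u"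
      using comp_homs[OF r us] homsD[OF f] by blast
  qed
  then show ?thesis using homsD[OF k] by blast
qed

sublocale linear_abelian_category C
  by standard (use direct_sum ker coker mono_ker epi_coker in blast)+

end

lemma sum_delta_mult:
  fixes \<Phi> :: "'b \<Rightarrow> complex"
  assumes "finite S"
  shows "(\<Sum>y\<in>S. (if y = a then 1 else 0) * \<Phi> y) = (if a \<in> S then \<Phi> a else 0)"
    and "(\<Sum>y\<in>S. (if a = y then 1 else 0) * \<Phi> y) = (if a \<in> S then \<Phi> a else 0)"
proof -
  show "(\<Sum>y\<in>S. (if y = a then 1 else 0) * \<Phi> y) = (if a \<in> S then \<Phi> a else 0)"
    using assms by (simp add: if_distrib[where f = "\<lambda>c. c * _"] cong: if_cong)
  then show "(\<Sum>y\<in>S. (if a = y then 1 else 0) * \<Phi> y) = (if a \<in> S then \<Phi> a else 0)"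
    by (simp add: eq_commute)
qed

section \<open>Direct sums, simple objects and Hom spaces of formal sums\<close>

context formal_sums
begin

lemma entry_eqI:
  assumes "f \<in> homs C A B" "g \<in> homs C A B"
    and "\<And>y x. \<lbrakk>y \<in> B; x \<in> A; snd y = snd x\<rbrakk> \<Longrightarrow> entry f y x = entry g y x"
  shows "f = g"
proof -
  have "entry f y x = entry g y x" for y x
    using assms by (cases "y \<in> B \<and> x \<in> A \<and> snd y = snd x") (auto simp: homs_iff fits_entry_eq_0)
  then have "entry f = entry g" by blast
  then show ?thesis using assms(1,2) by (simp add: prod_eq_iff homs_iff)
qed

lemma entry_block_eq: "(M y x \<noteq> 0 \<longrightarrow> snd y = snd x) \<Longrightarrow> y \<in> B \<Longrightarrow> x \<in> A \<Longrightarrow> entry (block A B M) y x = M y x"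
  by (auto simp: entry_block)

text \<open>The index set found by \<open>matrix_split_image\<close> consists of columns, so the
  image is carried by a subset of the summands of \<open>A\<close> and has admissible labels at
  once.\<close>

lemma ex_split_image:
  assumes f: "f \<in> homs C A B"
  shows "\<exists>I p s j r. p \<in> homs C A I \<and> s \<in> homs C I A \<and> j \<in> homs C I B \<and> r \<in> homs C B I
    \<and> p \<cdot> s = Id C I \<and> r \<cdot> j = Id C I \<and> f = j \<cdot> p"
proof -
  have A: "A \<in> fs_ob D" and B: "B \<in> fs_ob D" using f by (auto simp: homs_iff)
  have lab: "\<forall>y\<in>B. \<forall>x\<in>A. entry f y x \<noteq> 0 \<longrightarrow> snd y = snd x"
    using f by (auto simp: homs_iff dest: fitsD)
  from matrix_split_image[OF finite_ob[OF A] finite_ob[OF B] lab]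
  obtain I P S J R where I: "I \<subseteq> A"
    and PS: "\<forall>i\<in>I. \<forall>x\<in>A. (P i x \<noteq> 0 \<longrightarrow> snd i = snd x) \<and> (S x i \<noteq> 0 \<longrightarrow> snd x = snd i)"
    and JR: "\<forall>i\<in>I. \<forall>y\<in>B. (J y i \<noteq> 0 \<longrightarrow> snd y = snd i) \<and> (R i y \<noteq> 0 \<longrightarrow> snd i = snd y)"
    and PS1: "\<forall>i\<in>I. \<forall>k\<in>I. (\<Sum>x\<in>A. P i x * S x k) = (if i = k then 1 else 0)"
    and RJ1: "\<forall>i\<in>I. \<forall>k\<in>I. (\<Sum>y\<in>B. R i y * J y k) = (if i = k then 1 else 0)"
    and M: "\<forall>y\<in>B. \<forall>x\<in>A. entry f y x = (\<Sum>i\<in>I. J y i * P i x)"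
    by (elim exE conjE) (rule that, assumption+)
  have Iob: "I \<in> fs_ob D"
    using fs_ob_subset[OF A I] .
  define p s j r where "p = block A I P" and "s = block I A S" and "j = block I B J" and "r = block B I R"
  have homs: "p \<in> homs C A I" "s \<in> homs C I A" "j \<in> homs C I B" "r \<in> homs C B I"
    using A B Iob by (simp_all add: homs_iff p_def s_def j_def r_def)
  have e: "entry p i x = P i x" "entry s x i = S x i" if "i \<in> I" "x \<in> A" for i x
    using PS that by (auto simp: p_def s_def entry_block_eq)
  have e': "entry j y i = J y i" "entry r i y = R i y" if "i \<in> I" "y \<in> B" for i y
    using JR that by (auto simp: j_def r_def entry_block_eq)
  have Id_entry: "entry (Id C I) y x = (if y = x then 1 else 0)" if "y \<in> I" "x \<in> I" for y x
    using that by (simp add: Id_eq entry_block)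
  have d: "fits p" "fits s" "fits j" "fits r" "fcod p = I" "fcod s = A" "fcod j = B" "fcod r = I"
    using homs by (auto simp: homs_iff)
  have "p \<cdot> s = Id C I"
    by (rule entry_eqI[OF comp_homs[OF homs(2,1)] id_homs])
      (use Iob PS1 in \<open>simp_all add: entry_Comp d e Id_entry\<close>)
  moreover have "r \<cdot> j = Id C I"
    by (rule entry_eqI[OF comp_homs[OF homs(3,4)] id_homs])
      (use Iob RJ1 in \<open>simp_all add: entry_Comp d e' Id_entry\<close>)
  moreover have "f = j \<cdot> p"
    by (rule entry_eqI[OF f comp_homs[OF homs(1,3)]])
      (use M in \<open>simp_all add: entry_Comp d e e'\<close>)
  ultimately show ?thesis using homs by blast
qed

lemma msum_homs:
  "A \<in> fs_ob D \<Longrightarrow> B \<in> fs_ob D \<Longrightarrow> (\<And>k. k < n \<Longrightarrow> f k \<in> homs C A B) \<Longrightarrow> msum C A B f n \<in> homs C A B"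
  by (induction n) (simp_all add: homs_iff)

lemma pull_msum:
  "A \<in> fs_ob D \<Longrightarrow> B \<in> fs_ob D \<Longrightarrow> (\<And>k. k < n \<Longrightarrow> f k \<in> homs C A B)
    \<Longrightarrow> pull (msum C A B f n) \<Phi> x = (\<Sum>k<n. pull (f k) \<Phi> x)"
proof (induction n)
  case (Suc n)
  have "msum C A B f n \<in> homs C A B" by (rule msum_homs) (use Suc.prems in auto)
  moreover have "f n \<in> homs C A B" using Suc.prems by blast
  ultimately show ?case using Suc by (simp add: homs_iff)
qed simp

lemma entry_msum:
  "A \<in> fs_ob D \<Longrightarrow> B \<in> fs_ob D \<Longrightarrow> (\<And>k. k < n \<Longrightarrow> f k \<in> homs C A B)
    \<Longrightarrow> entry (msum C A B f n) y x = (\<Sum>k<n. entry (f k) y x)"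
proof (induction n)
  case (Suc n)
  have "msum C A B f n \<in> homs C A B" by (rule msum_homs) (use Suc.prems in auto)
  moreover have "f n \<in> homs C A B" using Suc.prems by blast
  ultimately show ?case using Suc
    by (auto simp: homs_iff Add_eq entry_block fits_entry_eq_0)
qed (simp add: Zero_eq entry_block)

text \<open>A partition of the summands of \<open>A\<close> into label-preserving copies of the
  \<open>F k\<close> is all that a direct sum decomposition requires: injectivity gives the
  orthogonality relations and covering gives the resolution of the identity. It serves both for
  building new sums and for splitting an object into its summands.\<close>

lemma is_direct_sum_union:
  assumes A: "A \<in> fs_ob D" and F: "\<And>k. k < n \<Longrightarrow> F k \<in> fs_ob D"
    and \<nu>: "\<And>k x. k < n \<Longrightarrow> x \<in> F k \<Longrightarrow> \<nu> k x \<in> A \<and> snd (\<nu> k x) = snd x"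
    and inj: "\<And>k l x y. \<lbrakk>k < n; l < n; x \<in> F k; y \<in> F l; \<nu> k x = \<nu> l y\<rbrakk> \<Longrightarrow> k = l \<and> x = y"
    and cover: "\<And>a. a \<in> A \<Longrightarrow> \<exists>k<n. \<exists>x\<in>F k. a = \<nu> k x"
  shows "is_direct_sum C A n F (\<lambda>k. block (F k) A (\<lambda>a x. if a = \<nu> k x then 1 else 0))
    (\<lambda>k. block A (F k) (\<lambda>x a. if a = \<nu> k x then 1 else 0))"
    (is "is_direct_sum C A n F ?i ?p")
proof -
  have i: "pull (?i k) \<Phi> x = \<Phi> (\<nu> k x)" if "k < n" "x \<in> F k" for k x \<Phi>
    using A that \<nu>[OF that] by (simp add: pull_block sum_delta_mult)
  have p: "pull (?p k) \<Phi> a = (\<Sum>x\<in>F k. if a = \<nu> k x then \<Phi> x else 0)" if "k < n" "a \<in> A" for k a \<Phi>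
    using F[OF that(1)] that \<nu>[OF that(1)] by (auto simp: pull_block sum.inter_filter intro!: sum.cong)
  have ih: "?i k \<in> homs C (F k) A" "?p k \<in> homs C A (F k)" if "k < n" for k
    using A F[OF that] by (simp_all add: homs_iff)
  have ip: "?p k \<cdot> ?i l = (if k = l then Id C (F k) else Zero C (F l) (F k))"
    if kl: "k < n" "l < n" for k l
  proof (rule hom_eqI)
    show "?p k \<cdot> ?i l \<in> homs C (F l) (F k)" using ih kl comp_homs by blast
    show "(if k = l then Id C (F k) else Zero C (F l) (F k)) \<in> homs C (F l) (F k)"
      using F kl by (simp add: homs_iff)
    fix x \<Phi> assume x: "x \<in> F l"
    have "pull (?p k \<cdot> ?i l) \<Phi> x = pull (?p k) \<Phi> (\<nu> l x)"
      using i[OF kl(2) x] by simp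
    also have "\<dots> = (\<Sum>x'\<in>F k. if \<nu> l x = \<nu> k x' then \<Phi> x' else 0)"
      using p[OF kl(1)] \<nu>[OF kl(2) x] by simp
    also have "\<dots> = (if k = l then \<Phi> x else 0)"
    proof (cases "k = l")
      case True
      have "\<nu> l x = \<nu> k x' \<longleftrightarrow> x = x'" if "x' \<in> F k" for x'
        using inj[OF kl(2) kl(1) x that] True by blast
      then have "(\<Sum>x'\<in>F k. if \<nu> l x = \<nu> k x' then \<Phi> x' else 0) = (\<Sum>x'\<in>F k. if x = x' then \<Phi> x' else 0)"
        by (intro sum.cong refl) simp
      then show ?thesis using True x F[OF kl(1)] by simp
    next
      case False
      then have "\<nu> l x \<noteq> \<nu> k x'" if "x' \<in> F k" for x'
        using inj[OF kl(2,1) x that] by blast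
      then show ?thesis using False by simp
    qed
    finally show "pull (?p k \<cdot> ?i l) \<Phi> x = pull (if k = l then Id C (F k) else Zero C (F l) (F k)) \<Phi> x"
      using x F[OF kl(2)] by simp
  qed
  have "msum C A A (\<lambda>k. ?i k \<cdot> ?p k) n = Id C A"
  proof (rule hom_eqI)
    have h: "?i k \<cdot> ?p k \<in> homs C A A" if "k < n" for k using ih[OF that] comp_homs by blast
    show "msum C A A (\<lambda>k. ?i k \<cdot> ?p k) n \<in> homs C A A" by (rule msum_homs[OF A A h])
    show "Id C A \<in> homs C A A" using A by (simp add: homs_iff)
    fix a \<Phi> assume a: "a \<in> A"
    obtain k0 x0 where k0: "k0 < n" "x0 \<in> F k0" "a = \<nu> k0 x0" using cover[OF a] by blast
    have "pull (msum C A A (\<lambda>k. ?i k \<cdot> ?p k) n) \<Phi> a = (\<Sum>k<n. pull (?i k \<cdot> ?p k) \<Phi> a)"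
      by (rule pull_msum[OF A A h])
    also have "\<dots> = (\<Sum>k<n. if k = k0 then \<Phi> a else 0)"
    proof (rule sum.cong[OF refl])
      fix k assume "k \<in> {..<n}"
      then have k: "k < n" by simp
      have "pull (?i k \<cdot> ?p k) \<Phi> a = (\<Sum>x\<in>F k. if a = \<nu> k x then pull (?i k) \<Phi> x else 0)"
        using p[OF k a] by simp
      also have "\<dots> = (\<Sum>x\<in>F k. if x = x0 then if k = k0 then \<Phi> a else 0 else 0)"
      proof (rule sum.cong[OF refl])
        fix x assume x: "x \<in> F k"
        show "(if a = \<nu> k x then pull (?i k) \<Phi> x else 0)
            = (if x = x0 then if k = k0 then \<Phi> a else 0 else 0)"
          using i[OF k x] k0(3) inj[OF k k0(1) x k0(2)] by (cases "a = \<nu> k x") auto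
      qed
      also have "\<dots> = (if k = k0 then \<Phi> a else 0)"
        using F[OF k] k0 by simp
      finally show "pull (?i k \<cdot> ?p k) \<Phi> a = (if k = k0 then \<Phi> a else 0)" .
    qed
    finally show "pull (msum C A A (\<lambda>k. ?i k \<cdot> ?p k) n) \<Phi> a = pull (Id C A) \<Phi> a"
      using k0 A a by simp
  qed
  with ip ih A F show ?thesis
    unfolding is_direct_sum_def by auto
qed

lemma ex_direct_sum_ob:
  assumes F: "\<And>k. k < n \<Longrightarrow> F k \<in> fs_ob D"
  shows "\<exists>A i p. is_direct_sum C A n F i p"
proof -
  define S where "S = Sigma {..<n} F"
  have "finite S" using F unfolding S_def by auto
  then obtain h :: "nat \<times> 's summand \<Rightarrow> nat" where h: "inj_on h S"
    using finite_imp_inj_to_nat_seg by blast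
  \<comment> \<open>Names only have to keep the copies apart; an injection of the finite disjoint
    union into the naturals provides them as leaves.\<close>
  define \<nu> where "\<nu> k x = (Leaf (h (k, x)) :: 's name, snd x)" for k x
  define A where "A = (\<lambda>(k, x). \<nu> k x) ` S"
  have A: "A \<in> fs_ob D"
  proof (rule fs_obI)
    show "finite A" using \<open>finite S\<close> by (simp add: A_def)
    fix a assume "a \<in> A"
    then obtain k x where "k < n" "x \<in> F k" "snd a = snd x" by (auto simp: A_def S_def \<nu>_def)
    then show "snd a \<in> Slab D" using lab_ob[OF F, of k x] by simp
  qed
  have "is_direct_sum C A n F (\<lambda>k. block (F k) A (\<lambda>a x. if a = \<nu> k x then 1 else 0))
    (\<lambda>k. block A (F k) (\<lambda>x a. if a = \<nu> k x then 1 else 0))"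
  proof (rule is_direct_sum_union[OF A F])
    show "\<nu> k x \<in> A \<and> snd (\<nu> k x) = snd x" if "k < n" "x \<in> F k" for k x
      using that by (auto simp: A_def S_def \<nu>_def)
    show "k = l \<and> x = y" if "k < n" "l < n" "x \<in> F k" "y \<in> F l" "\<nu> k x = \<nu> l y" for k l x y
      using that inj_onD[OF h, of "(k, x)" "(l, y)"] by (simp add: \<nu>_def S_def)
    show "\<exists>k<n. \<exists>x\<in>F k. a = \<nu> k x" if "a \<in> A" for a
      using that by (auto simp: A_def S_def)
  qed
  then show ?thesis by blast
qed

sublocale split_linear_category C
  by standard (use ex_direct_sum_ob ex_split_image in \<open>simp_all\<close>)

lemma ex_direct_sum_singletons:
  assumes A: "A \<in> fs_ob D"
  shows "\<exists>n F i p. is_direct_sum C A n F i p \<and> (\<forall>k<n. \<exists>a\<in>A. F k = {a})"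
proof -
  obtain h where h: "bij_betw h {0..<card A} A"
    using ex_bij_betw_nat_finite[of A] A by auto
  have "is_direct_sum C A (card A) (\<lambda>k. {h k})
     (\<lambda>k. block {h k} A (\<lambda>a x. if a = x then 1 else 0)) (\<lambda>k. block A {h k} (\<lambda>x a. if a = x then 1 else 0))"
  proof (rule is_direct_sum_union[OF A])
    show "{h k} \<in> fs_ob D" if "k < card A" for k
      using lab_ob[OF A] that bij_betwE[OF h] by simp
    show "x \<in> A \<and> snd x = snd x" if "k < card A" "x \<in> {h k}" for k x
      using bij_betwE[OF h] that by auto
    show "k = l \<and> x = y" if "k < card A" "l < card A" "x \<in> {h k}" "y \<in> {h l}" "x = y" for k l x y
      using that bij_betw_imp_inj_on[OF h] by (auto dest: inj_onD)
    show "\<exists>k<card A. \<exists>x\<in>{h k}. a = x" if "a \<in> A" for a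
    proof -
      from that have "a \<in> h ` {0..<card A}" using bij_betw_imp_surj_on[OF h] by simp
      then show ?thesis by auto
    qed
  qed
  then show ?thesis using bij_betwE[OF h] by fastforce
qed

text \<open>The endomorphism of a zero object is unique, so its identity matrix is zero and can have
  no diagonal entry.\<close>

lemma zero_object_iff: "zero_object C A \<longleftrightarrow> A = {}"
proof
  assume A: "zero_object C A"
  then have ob: "A \<in> fs_ob D" by (simp add: zero_object_def)
  with A have "Id C A = Zero C A A"
    using id_homs[of A] zero_homs[of A A] unfolding zero_object_def by fastforce
  moreover have "entry (Id C A) a a = 1" "entry (Zero C A A) a a = 0" if "a \<in> A" for a
    using that by (simp_all add: Id_eq Zero_eq entry_block)
  ultimately show "A = {}" by fastforce
next
  assume A: "A = {}"
  have "f = g" if "f \<in> homs C X Y" "g \<in> homs C X Y" "X = {} \<or> Y = {}" for f g X Y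
    using that by (intro entry_eqI[of f X Y g]) auto
  then have "\<exists>!f. f \<in> homs C X Y" if "X \<in> fs_ob D" "Y \<in> fs_ob D" "X = {} \<or> Y = {}" for X Y
    using zero_homs[of X Y] that by (metis Ob_eq)
  then show "zero_object C A"
    unfolding zero_object_def A by simp
qed

text \<open>The inclusion of one summand is a monomorphism from a nonzero object, so simplicity
  makes it invertible and leaves no other summand. Conversely, a nonzero matrix into a single
  summand has a right inverse, which for a monomorphism is two-sided.\<close>

lemma simple_object_iff: "simple_object C A \<longleftrightarrow> (\<exists>x. A = {x} \<and> snd x \<in> Slab D)"
proof
  assume A: "simple_object C A"
  then have ob: "A \<in> fs_ob D" and "A \<noteq> {}"
    using zero_object_iff by (auto simp: simple_object_def)
  then obtain x where x: "x \<in> A" by blast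
  \<comment> \<open>The test monomorphism: inclusion of the chosen summand \<open>x\<close>.\<close>
  define i where "i = block {x} A (\<lambda>a y. if a = y then 1 else 0)"
  have i: "i \<in> homs C {x} A"
    using ob x lab_ob[OF ob x] by (simp add: homs_iff i_def)
  have pull_i: "pull i \<Phi> x = \<Phi> x" for \<Phi>
    using ob x by (simp add: i_def pull_block if_distrib[where f = "\<lambda>c. c * _"] cong: if_cong)
  have "mono_arrow C i"
    unfolding mono_arrow_def
  proof (intro conjI allI ballI impI)
    show "i \<in> Arr C" using i by (simp add: homs_def)
    fix X u v assume "u \<in> homs C X (Dom C i)" "v \<in> homs C X (Dom C i)" and eq: "i \<cdot> u = i \<cdot> v"
    then have u: "u \<in> homs C X {x}" and v: "v \<in> homs C X {x}" using i by (auto simp: homs_iff)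
    have "entry i x x = 1" using x by (simp add: i_def entry_block)
    then have "entry (i \<cdot> w) x y = entry w x y" if "w \<in> homs C X {x}" for w y
      using i that by (simp add: entry_Comp homs_iff)
    then show "u = v"
      using eq u v by (intro entry_eqI[OF u v]) (metis singletonD)
  qed
  then have "iso_arrow C i"
    using A i zero_object_iff unfolding simple_object_def by (auto simp: homs_iff)
  then obtain g where g: "g \<in> homs C A {x}" "i \<cdot> g = Id C A"
    using i by (auto simp: iso_arrow_def inverse_arrows_def homs_iff)
  have "a = x" if "a \<in> A" for a
  proof (rule ccontr)
    assume "a \<noteq> x"
    then have "entry i a x = 0" by (simp add: i_def entry_block)
    then have "entry (i \<cdot> g) a a = 0" using i g(1) unfolding homs_iff by (simp add: entry_Comp)
    moreover have "entry (Id C A) a a = 1" using that by (simp add: Id_eq entry_block)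
    ultimately show False using g(2) by simp
  qed
  then show "\<exists>x. A = {x} \<and> snd x \<in> Slab D" using x lab_ob[OF ob x] by blast
next
  assume "\<exists>x. A = {x} \<and> snd x \<in> Slab D"
  then obtain x where A: "A = {x}" and x: "snd x \<in> Slab D" by blast
  then have ob: "{x} \<in> fs_ob D" by simp
  have "iso_arrow C f" if f: "mono_arrow C f" "Cod C f = A" and nz: "\<not> zero_object C (Dom C f)" for f
  proof -
    define K where "K = fdom f"
    have fh: "f \<in> homs C K {x}" using f A by (auto simp: mono_arrow_def homs_def K_def)
    then have K: "K \<in> fs_ob D" by (simp add: homs_iff)
    \<comment> \<open>If the row were zero then \<open>f\<close> would be zero, and a monomorphism
      would identify the identity of \<open>K\<close> with the zero morphism.\<close>
    obtain k0 where k0: "k0 \<in> K" "entry f x k0 \<noteq> 0"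
    proof (rule ccontr)
      assume "\<not> thesis"
      then have "\<forall>k\<in>K. entry f x k = 0" using that by blast
      then have "f = Zero C K {x}"
        by (intro entry_eqI[OF fh zero_homs]) (use K x in \<open>auto simp: Zero_eq entry_block\<close>)
      then have "f \<cdot> Id C K = f \<cdot> Zero C K K"
        using comp_id[OF fh] comp_Zero[of K, OF _ fh] K by simp
      then have "Id C K = Zero C K K"
        using f(1) id_homs[of K] zero_homs[of K K] K unfolding mono_arrow_def K_def by auto
      moreover obtain k where "k \<in> K" using nz zero_object_iff by (auto simp: K_def)
      then have "entry (Id C K) k k = 1" "entry (Zero C K K) k k = 0"
        by (simp_all add: Id_eq Zero_eq entry_block)
      ultimately show False by simp
    qed
    \<comment> \<open>A right inverse supported at the single column \<open>k0\<close> where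
      \<open>f\<close> does not vanish.\<close>
    define g where "g = block {x} K (\<lambda>k y. if k = k0 then 1 / entry f x k0 else 0)"
    have g: "g \<in> homs C {x} K" using ob K by (simp add: homs_iff g_def)
    have sk: "snd x = snd k0" using fitsD[of f x k0] fh k0(2) by (auto simp: homs_iff)
    have fg: "f \<cdot> g = Id C {x}"
    proof (rule entry_eqI[OF comp_homs[OF g fh] id_homs])
      fix y z assume yz: "y \<in> {x}" "z \<in> {x}"
      have "entry (f \<cdot> g) x x = (\<Sum>k\<in>K. entry f x k * entry g k x)"
        using fh g unfolding homs_iff by (simp add: entry_Comp)
      also have "\<dots> = (\<Sum>k\<in>K. if k = k0 then 1 else 0)"
        by (rule sum.cong) (use k0 sk in \<open>auto simp: entry_block g_def\<close>)
      finally have "entry (f \<cdot> g) x x = (\<Sum>k\<in>K. if k = k0 then 1 else 0)" .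
      then show "entry (f \<cdot> g) y z = entry (Id C {x}) y z"
        using K k0 yz by (simp add: Id_eq entry_block)
    qed (use ob in simp)
    have "f \<cdot> (g \<cdot> f) = f \<cdot> Id C K"
      using comp_assoc[OF fh g fh] fg id_comp[OF fh] comp_id[OF fh] by simp
    then have "g \<cdot> f = Id C K"
      using f(1) comp_homs[OF fh g] id_homs[of K] K unfolding mono_arrow_def K_def by auto
    with fg fh g show ?thesis
      unfolding iso_arrow_def inverse_arrows_def by (auto simp: homs_def)
  qed
  then show "simple_object C A"
    using A ob zero_object_iff by (auto simp: simple_object_def)
qed

text \<open>A nonzero entry exists only between equal labels; the names of the summands do not
  affect the isomorphism class.\<close>

lemma isomorphic_singletons:
  assumes "snd x \<in> Slab D" "snd y \<in> Slab D"
  shows "isomorphic C {x} {y} \<longleftrightarrow> snd x = snd y"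
proof
  assume "isomorphic C {x} {y}"
  then obtain f g where f: "f \<in> homs C {x} {y}" "g \<in> homs C {y} {x}" "g \<cdot> f = Id C {x}"
    by (auto simp: isomorphic_def iso_arrow_def inverse_arrows_def homs_iff)
  have "entry (g \<cdot> f) x x = entry g x y * entry f y x"
    using f(1,2) unfolding homs_iff by (simp add: entry_Comp)
  moreover have "entry (g \<cdot> f) x x = 1" unfolding f(3) by (simp add: Id_eq entry_block)
  ultimately have "entry f y x \<noteq> 0" by auto
  then show "snd x = snd y" using f fitsD[of f y x] by (auto simp: homs_iff)
next
  assume eq: "snd x = snd y"
  have ob: "{x} \<in> fs_ob D" "{y} \<in> fs_ob D" using assms by auto
  define f where "f a b = block {a :: 's summand} {b} (\<lambda>y x. 1)" for a b
  have f: "f a b \<in> homs C {a} {b}" if "{a} \<in> fs_ob D" "{b} \<in> fs_ob D" for a b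
    using that by (simp add: f_def homs_iff)
  have "f b a \<cdot> f a b = Id C {a}" if "{a} \<in> fs_ob D" "{b} \<in> fs_ob D" "snd a = snd b" for a b
    by (rule entry_eqI[OF comp_homs[OF f f] id_homs])
      (use that in \<open>auto simp: entry_Comp f_def entry_block Id_eq\<close>)
  then have "inverse_arrows C (f x y) (f y x)"
    using f ob eq unfolding inverse_arrows_def by (auto simp: homs_iff Arr_eq)
  then show "isomorphic C {x} {y}"
    using f ob unfolding isomorphic_def iso_arrow_def by blast
qed

text \<open>The class of objects is a parameter, so that the statement applies to each homogeneous
  component of the extension as well as to all objects of the pointed category.\<close>

lemma simple_representatives_labels:
  assumes \<S>: "\<S> \<subseteq> fs_ob D" and S: "\<And>i. simple_sum (l i) \<in> \<S>" and "inj l"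
    and cover: "\<And>x. {x} \<in> \<S> \<Longrightarrow> snd x \<in> range l"
  shows "simple_representatives C \<S> UNIV (\<lambda>i. simple_sum (l i))"
proof -
  have l: "l i \<in> Slab D" for i
    using S[of i] \<S> lab_ob[of "simple_sum (l i)"] by auto
  have "\<exists>!i. i \<in> UNIV \<and> isomorphic C {x} (simple_sum (l i))" if x: "{x} \<in> \<S>" for x
  proof -
    obtain i where i: "snd x = l i" using cover[OF x] by blast
    have "isomorphic C {x} (simple_sum (l j)) \<longleftrightarrow> l i = l j" for j
      using isomorphic_singletons[of x "(Leaf 0, l j)"] i l by (simp add: simple_sum_def)
    then show ?thesis using \<open>inj l\<close> by (auto simp: inj_eq)
  qed
  moreover have "simple_object C (simple_sum (l i))" for i
    using l by (auto simp: simple_object_iff simple_sum_def)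
  ultimately show ?thesis
    unfolding simple_representatives_def using S simple_object_iff by (metis)
qed

lemma finite_dimensional_homs:
  assumes A: "A \<in> fs_ob D" and B: "B \<in> fs_ob D"
  shows "\<exists>n b. (\<forall>k<n. b k \<in> homs C A B) \<and>
            (\<forall>f \<in> homs C A B. \<exists>c. f = msum C A B (\<lambda>k. c k \<star> b k) n)"
proof -
  define n where "n = card (B \<times> A)"
  obtain h where h: "bij_betw h {0..<n} (B \<times> A)"
    using ex_bij_betw_nat_finite[of "B \<times> A"] A B by (auto simp: n_def)
  \<comment> \<open>Matrix units for all pairs of summands. Those between different labels are cut
    to zero by \<open>block\<close>, so the family spans without a selection of admissible
    pairs.\<close>
  define b where "b k = block A B (\<lambda>y x. if (y, x) = h k then 1 else 0)" for k
  have b: "b k \<in> homs C A B" for k using A B by (simp add: b_def homs_iff)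
  have "f = msum C A B (\<lambda>k. entry f (fst (h k)) (snd (h k)) \<star> b k) n" if f: "f \<in> homs C A B" for f
  proof (rule entry_eqI[OF f msum_homs[OF A B]])
    show sb: "entry f (fst (h k)) (snd (h k)) \<star> b k \<in> homs C A B" for k
      using smul_homs[OF b] .
    fix y x assume yx: "y \<in> B" "x \<in> A" "snd y = snd x"
    have "entry (msum C A B (\<lambda>k. entry f (fst (h k)) (snd (h k)) \<star> b k) n) y x
        = (\<Sum>k<n. entry (entry f (fst (h k)) (snd (h k)) \<star> b k) y x)"
      by (rule entry_msum[OF A B sb])
    also have "\<dots> = (\<Sum>k\<in>{0..<n}. (\<lambda>p. if p = (y, x) then entry f y x else 0) (h k))"
      using yx by (auto simp: Smul_eq entry_block b_def atLeast0LessThan intro!: sum.cong)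
    also have "\<dots> = (\<Sum>p\<in>B \<times> A. if p = (y, x) then entry f y x else 0)"
      by (rule sum.reindex_bij_betw[OF h])
    also have "\<dots> = entry f y x" using A B yx by simp
    finally show "entry f y x = entry (msum C A B (\<lambda>k. entry f (fst (h k)) (snd (h k)) \<star> b k) n) y x"
      by simp
  qed
  then have "\<forall>f \<in> homs C A B. \<exists>c. f = msum C A B (\<lambda>k. c k \<star> b k) n"
    by (intro ballI exI[of _ "\<lambda>k. entry _ (fst (h k)) (snd (h k))"])
  moreover have "\<forall>k<n. b k \<in> homs C A B" using b by simp
  ultimately show ?thesis by (intro exI conjI)

qed

end

section \<open>Fusion tables\<close>

text \<open>Identities between matrices are stated after multiplication with an arbitrary vector \<open>\<phi>\<close> or
  \<open>\<psi>\<close>, the form in which they arise from \<open>pull\<close>.\<close>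

locale fusion_table =
  fixes D :: "('g, 's) table" and Finv :: "'s \<Rightarrow> 's \<Rightarrow> 's \<Rightarrow> 's \<Rightarrow> 's \<Rightarrow> 's \<Rightarrow> complex"
  assumes finite_labels: "finite (Slab D)"
    and unit_label: "Sunit D \<in> Slab D"
    and fus_label: "t \<in> Fus D a b \<Longrightarrow> t \<in> Slab D"
    and fus_unit_left: "a \<in> Slab D \<Longrightarrow> Fus D (Sunit D) a = {a}"
    and fus_unit_right: "a \<in> Slab D \<Longrightarrow> Fus D a (Sunit D) = {a}"
    and fsym_inverse: "\<lbrakk>a \<in> Slab D; b \<in> Slab D; c \<in> Slab D; t \<in> Fus D a b; u \<in> Fus D t c\<rbrakk> \<Longrightarrow>
      (\<Sum>r\<in>{r \<in> Fus D b c. u \<in> Fus D a r}. Fsym D a b c u t r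
        * (\<Sum>t'\<in>{t' \<in> Fus D a b. u \<in> Fus D t' c}. Finv a b c u r t' * \<phi> t')) = \<phi> t"
    and inverse_fsym: "\<lbrakk>a \<in> Slab D; b \<in> Slab D; c \<in> Slab D; r \<in> Fus D b c; u \<in> Fus D a r\<rbrakk> \<Longrightarrow>
      (\<Sum>t\<in>{t \<in> Fus D a b. u \<in> Fus D t c}. Finv a b c u r t
        * (\<Sum>r'\<in>{r' \<in> Fus D b c. u \<in> Fus D a r'}. Fsym D a b c u t r' * \<phi> r')) = \<phi> r"
    and fsym_unit: "\<lbrakk>a \<in> Slab D; b \<in> Slab D; u \<in> Fus D a b\<rbrakk> \<Longrightarrow> Fsym D a (Sunit D) b u a b = 1"
    and fsym_pentagon: "\<lbrakk>a \<in> Slab D; b \<in> Slab D; c \<in> Slab D; d \<in> Slab D;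
        t \<in> Fus D a b; s \<in> Fus D t c; u \<in> Fus D s d\<rbrakk> \<Longrightarrow>
      (\<Sum>w\<in>{w \<in> Fus D b c. s \<in> Fus D a w}. Fsym D a b c s t w
        * (\<Sum>v\<in>{v \<in> Fus D w d. u \<in> Fus D a v}. Fsym D a w d u s v
          * (\<Sum>r\<in>{r \<in> Fus D c d. v \<in> Fus D b r}. Fsym D b c d v w r * \<psi> r v)))
      = (\<Sum>r\<in>{r \<in> Fus D c d. u \<in> Fus D t r}. Fsym D t c d u s r
        * (\<Sum>v\<in>{v \<in> Fus D b r. u \<in> Fus D a v}. Fsym D a b r u t v * \<psi> r v))"
    and dual_label: "a \<in> Slab D \<Longrightarrow> Sdual D a \<in> Slab D"
    and dual_dual: "a \<in> Slab D \<Longrightarrow> Sdual D (Sdual D a) = a"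
    and unit_fus_dual: "a \<in> Slab D \<Longrightarrow> Sunit D \<in> Fus D a (Sdual D a)"
    and ev_fsym: "a \<in> Slab D \<Longrightarrow> Fsym D a (Sdual D a) a a (Sunit D) (Sunit D) * Sev D a = 1"
    and ev_finv: "a \<in> Slab D \<Longrightarrow>
      Finv (Sdual D a) a (Sdual D a) (Sdual D a) (Sunit D) (Sunit D) * Sev D a = 1"

text \<open>The evaluation rule behind all structure morphisms: the targets that \<open>x\<close>
  can reach are parametrised by a channel set \<open>K\<close>, and the sum over all summands of the
  codomain collapses to a sum over channels.\<close>

lemma pull_block_image:
  assumes "finite B" "x \<in> A" "inj_on h K"
    and "\<And>k. k \<in> K \<Longrightarrow> h k \<in> B \<and> snd (h k) = snd x"
    and "\<And>y. \<lbrakk>y \<in> B; snd y = snd x; M y x \<noteq> 0\<rbrakk> \<Longrightarrow> y \<in> h ` K"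
  shows "pull (block A B M) \<Phi> x = (\<Sum>k\<in>K. M (h k) x * \<Phi> (h k))"
proof -
  have "pull (block A B M) \<Phi> x = (\<Sum>y\<in>{y \<in> B. snd y = snd x}. M y x * \<Phi> y)"
    using assms(1,2) by (simp add: pull_block)
  also have "\<dots> = (\<Sum>y\<in>h ` K. M y x * \<Phi> y)"
    using assms(1,4,5) by (intro sum.mono_neutral_right) auto
  also have "\<dots> = (\<Sum>k\<in>K. M (h k) x * \<Phi> (h k))"
    using assms(3) by (simp add: sum.reindex)
  finally show ?thesis .
qed

lemma pull_block_single:
  assumes "finite B" "x \<in> A" "z \<in> B" "snd z = snd x"
    and "\<And>y. \<lbrakk>y \<in> B; snd y = snd x; M y x \<noteq> 0\<rbrakk> \<Longrightarrow> y = z"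
  shows "pull (block A B M) \<Phi> x = M z x * \<Phi> z"
proof -
  have "pull (block A B M) \<Phi> x = (\<Sum>k\<in>{()}. M z x * \<Phi> z)"
  proof (rule pull_block_image)
    show "y \<in> (\<lambda>_. z) ` {()}" if "y \<in> B" "snd y = snd x" "M y x \<noteq> 0" for y
      using assms(5)[OF that] by simp
  qed (use assms(1-4) in simp_all)
  then show ?thesis by simp
qed

text \<open>Matrices acting on different tensor factors commute; this exchange of sums is what the
  interchange law and naturality of the braiding come down to.\<close>

lemma pull_swap: "pull f (\<lambda>a. pull g (\<lambda>b. \<Phi> a b) y) x = pull g (\<lambda>b. pull f (\<lambda>a. \<Phi> a b) x) y"
  unfolding pull_def sum_distrib_left by (subst sum.swap) (simp add: mult.left_commute)

section \<open>Monoidal structure, duality and fusion axioms from a table\<close>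

locale formal_fusion = formal_sums D C + fusion_table D Finv
  for D :: "('g, 's) table" and C :: "('s fob, 's farr, 'e) tensor_category_scheme" (structure)
    and Finv :: "'s \<Rightarrow> 's \<Rightarrow> 's \<Rightarrow> 's \<Rightarrow> 's \<Rightarrow> 's \<Rightarrow> complex"
begin

lemma finite_fus [simp]: "finite (Fus D a b)"
  using fus_label finite_labels finite_subset by (metis subsetI)

lemma fs_tens_ob [simp]:
  assumes A: "A \<in> fs_ob D" and B: "B \<in> fs_ob D"
  shows "fs_tens D A B \<in> fs_ob D"
proof (rule fs_obI)
  have "fs_tens D A B = (\<lambda>(a, b, u). (Node a b, u)) ` (SIGMA a:A. SIGMA b:B. Fus D (snd a) (snd b))"
    by (force simp: fs_tens_def)
  moreover have "finite (SIGMA a:A. SIGMA b:B. Fus D (snd a) (snd b))"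
    using A B by (intro finite_SigmaI finite_fus) auto
  ultimately show "finite (fs_tens D A B)" by simp
  fix x assume "x \<in> fs_tens D A B"
  then show "snd x \<in> Slab D"
    by (elim fs_tensE) (use fus_label in fastforce)
qed

lemma unit_ob' [simp]: "simple_sum (Sunit D) \<in> fs_ob D"
  using unit_label by (simp add: simple_sum_def)

lemma dual_ob [simp]: "A \<in> fs_ob D \<Longrightarrow> relabel (Sdual D) ` A \<in> fs_ob D"
  by (rule fs_obI) (auto intro!: dual_label dest: lab_ob)

text \<open>A Kronecker product acts on functionals one factor at a time, and the fusion label
  \<open>u\<close> is merely carried along. Pairs with wrong labels contribute nothing because both
  factors satisfy \<open>fits\<close>.\<close>

lemma pull_TensM [simp]:
  assumes f: "fits f" "finite (fcod f)" and g: "fits g" "finite (fcod g)"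
    and fin: "finite (fs_tens D (fcod f) (fcod g))"
    and x: "a \<in> fdom f" "b \<in> fdom g" "u \<in> Fus D (snd a) (snd b)"
  shows "pull (TensM C f g) \<Phi> (Node a b, u) = pull f (\<lambda>a'. pull g (\<lambda>b'. \<Phi> (Node a' b', u)) b) a"
proof -
  let ?K = "{p \<in> fcod f \<times> fcod g. snd (fst p) = snd a \<and> snd (snd p) = snd b}"
  have "pull (TensM C f g) \<Phi> (Node a b, u)
      = (\<Sum>p\<in>?K. entry f (fst p) a * entry g (snd p) b * \<Phi> (Node (fst p) (snd p), u))"
    unfolding TensM_eq
  proof (subst pull_block_image[where h = "\<lambda>p. (Node (fst p) (snd p), u)" and K = ?K])
    fix y assume y: "y \<in> fs_tens D (fcod f) (fcod g)" "snd y = snd (Node a b, u)"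
      "(case (fst (Node a b, u), fst y) of (Node a b, Node a' b') \<Rightarrow> entry f a' a * entry g b' b | _ \<Rightarrow> 0) \<noteq> 0"
    from y(1) obtain a' b' v where y': "y = (Node a' b', v)" "a' \<in> fcod f" "b' \<in> fcod g"
      by (elim fs_tensE)
    with y have "entry f a' a \<noteq> 0" "entry g b' b \<noteq> 0" by auto
    then have "(a', b') \<in> ?K" using f g y' by (auto dest: fitsD)
    then show "y \<in> (\<lambda>p. (Node (fst p) (snd p), u)) ` ?K" using y y' by (force intro: image_eqI[of _ _ "(a', b')"])
  qed (use fin x in \<open>auto simp: inj_on_def prod_eq_iff\<close>)
  also have "\<dots> = (\<Sum>p\<in>fcod f \<times> fcod g. entry f (fst p) a * entry g (snd p) b * \<Phi> (Node (fst p) (snd p), u))"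
  proof (rule sum.mono_neutral_left)
    show "\<forall>p\<in>fcod f \<times> fcod g - ?K. entry f (fst p) a * entry g (snd p) b * \<Phi> (Node (fst p) (snd p), u) = 0"
    proof
      fix p assume "p \<in> fcod f \<times> fcod g - ?K"
      then have "entry f (fst p) a = 0 \<or> entry g (snd p) b = 0"
        using fitsD[OF f(1), of "fst p" a] fitsD[OF g(1), of "snd p" b] by blast
      then show "entry f (fst p) a * entry g (snd p) b * \<Phi> (Node (fst p) (snd p), u) = 0" by auto
    qed
  qed (use f g in auto)
  finally show ?thesis
    by (simp add: pull_def sum.cartesian_product sum_distrib_left mult.assoc split_def)
qed

lemma pull_Assoc [simp]:
  assumes ob: "A \<in> fs_ob D" "B \<in> fs_ob D" "E \<in> fs_ob D"
    and x: "a \<in> A" "b \<in> B" "e \<in> E" "t \<in> Fus D (snd a) (snd b)" "u \<in> Fus D t (snd e)"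
  shows "pull (Assoc C A B E) \<Phi> (Node (Node a b, t) e, u)
    = (\<Sum>r\<in>{r \<in> Fus D (snd b) (snd e). u \<in> Fus D (snd a) r}.
        Fsym D (snd a) (snd b) (snd e) u t r * \<Phi> (Node a (Node b e, r), u))"
  unfolding Assoc_eq
  by (subst pull_block_image[where h = "\<lambda>r. (Node a (Node b e, r), u)"
        and K = "{r \<in> Fus D (snd b) (snd e). u \<in> Fus D (snd a) r}"])
    (use ob x in \<open>auto simp: inj_on_def elim!: fs_tensE split: if_splits\<close>)

text \<open>The explicit matrix of the inverse associator. Once \<open>inverse_Assoc\<close> is
  known it replaces every \<open>inv_arrow\<close>, which by itself could not be evaluated on
  summands.\<close>

definition Unassoc :: "'s fob \<Rightarrow> 's fob \<Rightarrow> 's fob \<Rightarrow> 's farr" where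
  "Unassoc A B E = block (fs_tens D A (fs_tens D B E)) (fs_tens D (fs_tens D A B) E)
     (\<lambda>y x. case (x, y) of
         ((Node a (Node b e, r), u), (Node (Node a' b', t) e', u')) \<Rightarrow>
            if a' = a \<and> b' = b \<and> e' = e then Finv (snd a) (snd b) (snd e) u r t else 0
       | _ \<Rightarrow> 0)"

lemma Unassoc_simps [simp]:
  "fdom (Unassoc A B E) = fs_tens D A (fs_tens D B E)"
  "fcod (Unassoc A B E) = fs_tens D (fs_tens D A B) E"
  "fits (Unassoc A B E)"
  by (simp_all add: Unassoc_def)

lemma pull_Unassoc [simp]:
  assumes ob: "A \<in> fs_ob D" "B \<in> fs_ob D" "E \<in> fs_ob D"
    and x: "a \<in> A" "b \<in> B" "e \<in> E" "r \<in> Fus D (snd b) (snd e)" "u \<in> Fus D (snd a) r"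
  shows "pull (Unassoc A B E) \<Phi> (Node a (Node b e, r), u)
    = (\<Sum>t\<in>{t \<in> Fus D (snd a) (snd b). u \<in> Fus D t (snd e)}.
        Finv (snd a) (snd b) (snd e) u r t * \<Phi> (Node (Node a b, t) e, u))"
  unfolding Unassoc_def
  by (subst pull_block_image[where h = "\<lambda>t. (Node (Node a b, t) e, u)"
        and K = "{t \<in> Fus D (snd a) (snd b). u \<in> Fus D t (snd e)}"])
    (use ob x in \<open>auto simp: inj_on_def elim!: fs_tensE split: if_splits\<close>)

lemma pull_LUnit [simp]:
  assumes "A \<in> fs_ob D" "a \<in> A" "u \<in> Fus D (Sunit D) (snd a)"
  shows "pull (LUnit C A) \<Phi> (Node (Leaf 0, Sunit D) a, u) = \<Phi> a"
  unfolding LUnit_eq using assms fus_unit_left[OF lab_ob[OF assms(1,2)]]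
  by (subst pull_block_single[where z = a]) (auto split: if_splits)

lemma pull_RUnit [simp]:
  assumes "A \<in> fs_ob D" "a \<in> A" "u \<in> Fus D (snd a) (Sunit D)"
  shows "pull (RUnit C A) \<Phi> (Node a (Leaf 0, Sunit D), u) = \<Phi> a"
  unfolding RUnit_eq using assms fus_unit_right[OF lab_ob[OF assms(1,2)]]
  by (subst pull_block_single[where z = a]) (auto split: if_splits)

lemma pull_Ev [simp]:
  assumes "A \<in> fs_ob D" "a' \<in> relabel (Sdual D) ` A" "a \<in> A" "u \<in> Fus D (snd a') (snd a)"
  shows "pull (Ev C A) \<Phi> (Node a' a, u)
    = (if a' = relabel (Sdual D) a \<and> u = Sunit D then Sev D (snd a) * \<Phi> (Leaf 0, Sunit D) else 0)"
proof -
  have "{y \<in> simple_sum (Sunit D). snd y = u} = (if u = Sunit D then {(Leaf 0, Sunit D)} else {})"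
    by auto
  then show ?thesis
    using assms unfolding Ev_eq by (simp add: pull_block)
qed

lemma inj_on_relabel_dual: "A \<in> fs_ob D \<Longrightarrow> inj_on (relabel (Sdual D)) A"
  by (rule inj_onI) (metis lab_ob dual_dual relabel_def prod.collapse snd_relabel fst_relabel)

lemma relabel_dual_eq_iff:
  "A \<in> fs_ob D \<Longrightarrow> a \<in> A \<Longrightarrow> b \<in> A \<Longrightarrow> relabel (Sdual D) a = relabel (Sdual D) b \<longleftrightarrow> a = b"
  using inj_on_relabel_dual inj_on_eq_iff by metis

lemma pull_Coev [simp]:
  assumes A: "A \<in> fs_ob D"
  shows "pull (Coev C A) \<Phi> (Leaf 0, Sunit D) = (\<Sum>a\<in>A. \<Phi> (Node a (relabel (Sdual D) a), Sunit D))"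
  unfolding Coev_eq
  by (subst pull_block_image[where h = "\<lambda>a. (Node a (relabel (Sdual D) a), Sunit D)" and K = A])
    (use A unit_fus_dual lab_ob in \<open>auto simp: inj_on_def elim!: fs_tensE split: if_splits\<close>)

lemma tens_homs_eqI:
  assumes "f \<in> homs C (fs_tens D A B) X" "g \<in> homs C (fs_tens D A B) X"
    and "A \<in> fs_ob D" "B \<in> fs_ob D"
    and "\<And>a b u \<Phi>. \<lbrakk>a \<in> A; b \<in> B; snd a \<in> Slab D; snd b \<in> Slab D; u \<in> Slab D;
        u \<in> Fus D (snd a) (snd b)\<rbrakk> \<Longrightarrow> pull f \<Phi> (Node a b, u) = pull g \<Phi> (Node a b, u)"
  shows "f = g"
proof (rule hom_eqI[OF assms(1,2)])
  fix x \<Phi> assume x: "x \<in> fs_tens D A B"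
  from x show "pull f \<Phi> x = pull g \<Phi> x"
    by (rule fs_tensE)
      (use assms(3-5) in \<open>metis lab_ob fus_label\<close>)
qed

lemma tens_tens_left_homs_eqI:
  assumes "f \<in> homs C (fs_tens D (fs_tens D A B) E) X" "g \<in> homs C (fs_tens D (fs_tens D A B) E) X"
    and "A \<in> fs_ob D" "B \<in> fs_ob D" "E \<in> fs_ob D"
    and "\<And>a b t e u \<Phi>. \<lbrakk>a \<in> A; b \<in> B; e \<in> E; snd a \<in> Slab D; snd b \<in> Slab D; snd e \<in> Slab D;
        t \<in> Slab D; u \<in> Slab D; t \<in> Fus D (snd a) (snd b); u \<in> Fus D t (snd e)\<rbrakk>
        \<Longrightarrow> pull f \<Phi> (Node (Node a b, t) e, u) = pull g \<Phi> (Node (Node a b, t) e, u)"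
  shows "f = g"
proof (rule tens_homs_eqI[OF assms(1,2)])
  fix x e u \<Phi> assume x: "x \<in> fs_tens D A B" and "e \<in> E" "snd x \<in> Slab D" "snd e \<in> Slab D" "u \<in> Slab D"
    "u \<in> Fus D (snd x) (snd e)"
  then show "pull f \<Phi> (Node x e, u) = pull g \<Phi> (Node x e, u)"
    using assms(3-6) by (elim fs_tensE) (simp add: lab_ob)
qed (use assms in simp_all)

lemma tens_tens_right_homs_eqI:
  assumes "f \<in> homs C (fs_tens D A (fs_tens D B E)) X" "g \<in> homs C (fs_tens D A (fs_tens D B E)) X"
    and "A \<in> fs_ob D" "B \<in> fs_ob D" "E \<in> fs_ob D"
    and "\<And>a b t e u \<Phi>. \<lbrakk>a \<in> A; b \<in> B; e \<in> E; snd a \<in> Slab D; snd b \<in> Slab D; snd e \<in> Slab D;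
        t \<in> Slab D; u \<in> Slab D; t \<in> Fus D (snd b) (snd e); u \<in> Fus D (snd a) t\<rbrakk>
        \<Longrightarrow> pull f \<Phi> (Node a (Node b e, t), u) = pull g \<Phi> (Node a (Node b e, t), u)"
  shows "f = g"
proof (rule tens_homs_eqI[OF assms(1,2)])
  fix x a u \<Phi> assume x: "x \<in> fs_tens D B E" and "a \<in> A" "snd a \<in> Slab D" "snd x \<in> Slab D" "u \<in> Slab D"
    "u \<in> Fus D (snd a) (snd x)"
  then show "pull f \<Phi> (Node a x, u) = pull g \<Phi> (Node a x, u)"
    using assms(3-6) by (elim fs_tensE) (simp add: lab_ob)
qed (use assms in simp_all)

lemma inverse_arrowsI:
  "f \<in> homs C A B \<Longrightarrow> g \<in> homs C B A \<Longrightarrow> g \<cdot> f = Id C A \<Longrightarrow> f \<cdot> g = Id C B \<Longrightarrow> inverse_arrows C f g"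
  by (auto simp: inverse_arrows_def homs_def)

lemma inverse_Assoc:
  assumes ob: "A \<in> fs_ob D" "B \<in> fs_ob D" "E \<in> fs_ob D"
  shows "inverse_arrows C (Assoc C A B E) (Unassoc A B E)"
proof (rule inverse_arrowsI)
  show "Unassoc A B E \<cdot> Assoc C A B E = Id C (fs_tens D (fs_tens D A B) E)"
    by (rule tens_tens_left_homs_eqI[of _ A B E "fs_tens D (fs_tens D A B) E"])
      (use ob in \<open>simp_all add: homs_iff fsym_inverse\<close>)
  show "Assoc C A B E \<cdot> Unassoc A B E = Id C (fs_tens D A (fs_tens D B E))"
    by (rule tens_tens_right_homs_eqI[of _ A B E "fs_tens D A (fs_tens D B E)"])
      (use ob in \<open>simp_all add: homs_iff inverse_fsym\<close>)
qed (use ob in \<open>simp_all add: homs_iff\<close>)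

lemma inv_Assoc [simp]:
  "A \<in> fs_ob D \<Longrightarrow> B \<in> fs_ob D \<Longrightarrow> E \<in> fs_ob D \<Longrightarrow> inv_arrow C (Assoc C A B E) = Unassoc A B E"
  by (rule inv_arrow_eq[OF inverse_Assoc])

lemma iso_LUnit:
  assumes A: "A \<in> fs_ob D" shows "iso_arrow C (LUnit C A)"
proof -
  define g where "g = block A (fs_tens D (simple_sum (Sunit D)) A)
    (\<lambda>y x. case fst y of Node e a \<Rightarrow> if a = x then 1 else 0 | _ \<Rightarrow> 0)"
  have [simp]: "fdom g = A" "fcod g = fs_tens D (simple_sum (Sunit D)) A" "fits g"
    by (simp_all add: g_def)
  have [simp]: "pull g \<Phi> a = \<Phi> (Node (Leaf 0, Sunit D) a, snd a)" if "a \<in> A" for \<Phi> a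
    unfolding g_def using A that
    by (subst pull_block_single[where z = "(Node (Leaf 0, Sunit D) a, snd a)"])
      (auto simp: fus_unit_left lab_ob elim!: fs_tensE split: if_splits)
  have "inverse_arrows C (LUnit C A) g"
  proof (rule inverse_arrowsI)
    show "g \<cdot> LUnit C A = Id C (fs_tens D (simple_sum (Sunit D)) A)"
      by (rule tens_homs_eqI[of _ "simple_sum (Sunit D)" A "fs_tens D (simple_sum (Sunit D)) A"])
        (use A in \<open>auto simp: homs_iff fus_unit_left\<close>)
    show "LUnit C A \<cdot> g = Id C A"
      by (rule hom_eqI[of _ A A])
        (use A in \<open>auto simp: homs_iff lab_ob fus_unit_left\<close>)
  qed (use A in \<open>simp_all add: homs_iff\<close>)
  then show ?thesis unfolding iso_arrow_def ..
qed

lemma iso_RUnit: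
  assumes A: "A \<in> fs_ob D" shows "iso_arrow C (RUnit C A)"
proof -
  define g where "g = block A (fs_tens D A (simple_sum (Sunit D)))
    (\<lambda>y x. case fst y of Node a e \<Rightarrow> if a = x then 1 else 0 | _ \<Rightarrow> 0)"
  have [simp]: "fdom g = A" "fcod g = fs_tens D A (simple_sum (Sunit D))" "fits g"
    by (simp_all add: g_def)
  have [simp]: "pull g \<Phi> a = \<Phi> (Node a (Leaf 0, Sunit D), snd a)" if "a \<in> A" for \<Phi> a
    unfolding g_def using A that
    by (subst pull_block_single[where z = "(Node a (Leaf 0, Sunit D), snd a)"])
      (auto simp: fus_unit_right lab_ob elim!: fs_tensE split: if_splits)
  have "inverse_arrows C (RUnit C A) g"
  proof (rule inverse_arrowsI)
    show "g \<cdot> RUnit C A = Id C (fs_tens D A (simple_sum (Sunit D)))"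
      by (rule tens_homs_eqI[of _ A "simple_sum (Sunit D)" "fs_tens D A (simple_sum (Sunit D))"])
        (use A in \<open>auto simp: homs_iff fus_unit_right\<close>)
    show "RUnit C A \<cdot> g = Id C A"
      by (rule hom_eqI[of _ A A])
        (use A in \<open>auto simp: homs_iff lab_ob fus_unit_right\<close>)
  qed (use A in \<open>simp_all add: homs_iff\<close>)
  then show ?thesis unfolding iso_arrow_def ..
qed

sublocale monoidal_category C
proof
  fix A A' A'' B B' B'' E E' F f f' g g' h c
  show "Unit C \<in> Ob C" by simp
  show "\<lbrakk>A \<in> Ob C; B \<in> Ob C\<rbrakk> \<Longrightarrow> A \<boxtimes> B \<in> Ob C" by simp
  show "\<lbrakk>f \<in> homs C A A'; g \<in> homs C B B'\<rbrakk> \<Longrightarrow> f \<odot> g \<in> homs C (A \<boxtimes> B) (A' \<boxtimes> B')"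
    by (simp add: homs_iff)
  show "\<lbrakk>A \<in> Ob C; B \<in> Ob C\<rbrakk> \<Longrightarrow> Id C A \<odot> Id C B = Id C (A \<boxtimes> B)"
    by (rule tens_homs_eqI[of _ A B "fs_tens D A B"]) (simp_all add: homs_iff)
  show "\<lbrakk>f \<in> homs C A A'; f' \<in> homs C A' A''; g \<in> homs C B B'; g' \<in> homs C B' B''\<rbrakk>
          \<Longrightarrow> (f' \<cdot> f) \<odot> (g' \<cdot> g) = (f' \<odot> g') \<cdot> (f \<odot> g)"
    by (rule tens_homs_eqI[of _ A B "fs_tens D A'' B''"]) (auto simp: homs_iff pull_swap[of f' g])
  show "\<lbrakk>f \<in> homs C A A'; f' \<in> homs C A A'; g \<in> homs C B B'\<rbrakk>
          \<Longrightarrow> (f \<boxplus> f') \<odot> g = (f \<odot> g) \<boxplus> (f' \<odot> g)"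
    by (rule tens_homs_eqI[of _ A B "fs_tens D A' B'"]) (auto simp: homs_iff)
  show "\<lbrakk>f \<in> homs C A A'; g \<in> homs C B B'; g' \<in> homs C B B'\<rbrakk>
          \<Longrightarrow> f \<odot> (g \<boxplus> g') = (f \<odot> g) \<boxplus> (f \<odot> g')"
    by (rule tens_homs_eqI[of _ A B "fs_tens D A' B'"]) (auto simp: homs_iff pull_add)
  show "\<lbrakk>f \<in> homs C A A'; g \<in> homs C B B'\<rbrakk> \<Longrightarrow> (c \<star> f) \<odot> g = c \<star> (f \<odot> g)"
    by (rule tens_homs_eqI[of _ A B "fs_tens D A' B'"]) (auto simp: homs_iff)
  show "\<lbrakk>f \<in> homs C A A'; g \<in> homs C B B'\<rbrakk> \<Longrightarrow> f \<odot> (c \<star> g) = c \<star> (f \<odot> g)"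
    by (rule tens_homs_eqI[of _ A B "fs_tens D A' B'"]) (auto simp: homs_iff pull_scale)
  show "\<lbrakk>A \<in> Ob C; B \<in> Ob C; E \<in> Ob C\<rbrakk>
          \<Longrightarrow> Assoc C A B E \<in> homs C ((A \<boxtimes> B) \<boxtimes> E) (A \<boxtimes> (B \<boxtimes> E))"
    by (simp add: homs_iff)
  show "\<lbrakk>A \<in> Ob C; B \<in> Ob C; E \<in> Ob C\<rbrakk> \<Longrightarrow> iso_arrow C (Assoc C A B E)"
    using inverse_Assoc by (auto simp: iso_arrow_def)
  show "\<lbrakk>f \<in> homs C A A'; g \<in> homs C B B'; h \<in> homs C E E'\<rbrakk>
          \<Longrightarrow> Assoc C A' B' E' \<cdot> ((f \<odot> g) \<odot> h) = (f \<odot> (g \<odot> h)) \<cdot> Assoc C A B E"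
    by (rule tens_tens_left_homs_eqI[of _ A B E "fs_tens D A' (fs_tens D B' E')"])
      (auto simp: homs_iff pull_sum pull_scale)
  show "A \<in> Ob C \<Longrightarrow> LUnit C A \<in> homs C (Unit C \<boxtimes> A) A"
    "A \<in> Ob C \<Longrightarrow> RUnit C A \<in> homs C (A \<boxtimes> Unit C) A"
    by (simp_all add: homs_iff)
  show "A \<in> Ob C \<Longrightarrow> iso_arrow C (LUnit C A)" "A \<in> Ob C \<Longrightarrow> iso_arrow C (RUnit C A)"
    by (simp_all add: iso_LUnit iso_RUnit)
  show "f \<in> homs C A A' \<Longrightarrow> LUnit C A' \<cdot> (Id C (Unit C) \<odot> f) = f \<cdot> LUnit C A"
    by (rule tens_homs_eqI[of _ "simple_sum (Sunit D)" A A']) (auto simp: homs_iff)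
  show "f \<in> homs C A A' \<Longrightarrow> RUnit C A' \<cdot> (f \<odot> Id C (Unit C)) = f \<cdot> RUnit C A"
    by (rule tens_homs_eqI[of _ A "simple_sum (Sunit D)" A']) (auto simp: homs_iff)
  show "\<lbrakk>A \<in> Ob C; B \<in> Ob C\<rbrakk>
          \<Longrightarrow> (Id C A \<odot> LUnit C B) \<cdot> Assoc C A (Unit C) B = RUnit C A \<odot> Id C B"
    by (rule tens_tens_left_homs_eqI[of _ A "simple_sum (Sunit D)" B "fs_tens D A B"])
      (auto simp: homs_iff fus_unit_left fus_unit_right fsym_unit Collect_conv_if)
  assume ob: "A \<in> Ob C" "B \<in> Ob C" "E \<in> Ob C" "F \<in> Ob C"
  show "(Id C A \<odot> Assoc C B E F) \<cdot> Assoc C A (B \<boxtimes> E) F \<cdot> (Assoc C A B E \<odot> Id C F)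
             = Assoc C A B (E \<boxtimes> F) \<cdot> Assoc C (A \<boxtimes> B) E F"
  proof (rule tens_homs_eqI[where X = "fs_tens D A (fs_tens D B (fs_tens D E F))"])
    fix x e u \<Phi> assume x: "x \<in> fs_tens D (fs_tens D A B) E" "e \<in> F" "snd e \<in> Slab D"
      "u \<in> Fus D (snd x) (snd e)"
    then obtain y c s where y: "x = (Node y c, s)" "y \<in> fs_tens D A B" "c \<in> E" "s \<in> Fus D (snd y) (snd c)"
      by (metis fs_tensE)
    then obtain a b t where ab: "y = (Node a b, t)" "a \<in> A" "b \<in> B" "t \<in> Fus D (snd a) (snd b)"
      by (metis fs_tensE)
    have lab: "snd a \<in> Slab D" "snd b \<in> Slab D" "snd c \<in> Slab D" "snd e \<in> Slab D"
      using x y ab ob lab_ob by auto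
    show "pull ((Id C A \<odot> Assoc C B E F) \<cdot> Assoc C A (B \<boxtimes> E) F \<cdot> (Assoc C A B E \<odot> Id C F)) \<Phi> (Node x e, u)
        = pull (Assoc C A B (E \<boxtimes> F) \<cdot> Assoc C (A \<boxtimes> B) E F) \<Phi> (Node x e, u)"
      using x y ab ob fsym_pentagon[OF lab, of t s u "\<lambda>r v. \<Phi> (Node a (Node b (Node c e, r), v), u)"]
      by simp
  qed (use ob in \<open>simp_all add: homs_iff\<close>)
qed

lemma dual_unit_label: "a \<in> Slab D \<Longrightarrow> Sunit D \<in> Fus D (Sdual D a) a"
  using unit_fus_dual[OF dual_label, of a] dual_dual by simp

text \<open>In each zigzag the coevaluation runs over all summands \<open>b\<close>, while the
  evaluation keeps only the one matched with the given summand, in the channel of the unit. The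
  scalar that survives is \<open>ev_fsym\<close> in the first and \<open>ev_finv\<close> in the
  second zigzag.\<close>

lemma is_dual_Dual:
  assumes A: "A \<in> fs_ob D"
  shows "is_dual C A (relabel (Sdual D) ` A) (Ev C A) (Coev C A)"
  unfolding is_dual_def
proof (intro conjI)
  let ?A' = "relabel (Sdual D) ` A"
  have lab: "a \<in> A \<Longrightarrow> snd a \<in> Slab D" for a using A lab_ob by blast
  show "RUnit C A \<cdot> (Id C A \<odot> Ev C A) \<cdot> Assoc C A ?A' A \<cdot> (Coev C A \<odot> Id C A) = LUnit C A"
  proof (rule tens_homs_eqI[where X = A])
    fix x a u \<Phi> assume "x \<in> simple_sum (Sunit D)" and a: "a \<in> A" "snd a \<in> Slab D"
      and "u \<in> Fus D (snd x) (snd a)"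
    then have x: "x = (Leaf 0, Sunit D)" and u: "u = snd a" by (auto simp: fus_unit_left)
    have "pull (RUnit C A \<cdot> (Id C A \<odot> Ev C A) \<cdot> Assoc C A ?A' A \<cdot> (Coev C A \<odot> Id C A)) \<Phi> (Node x a, u)
      = (\<Sum>b\<in>A. \<Sum>r\<in>{r \<in> Fus D (Sdual D (snd b)) (snd a). u \<in> Fus D (snd b) r}.
          Fsym D (snd b) (Sdual D (snd b)) (snd a) u (Sunit D) r
            * (if b = a \<and> r = Sunit D then Sev D (snd a) * \<Phi> b else 0))"
      using A a x u lab by (simp add: fus_unit_left fus_unit_right unit_fus_dual relabel_dual_eq_iff cong: conj_cong if_cong)
    also have "\<dots> = (\<Sum>b\<in>A. if b = a then \<Phi> a else 0)"
    proof (rule sum.cong[OF refl])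
      fix b assume b: "b \<in> A"
      let ?R = "{r \<in> Fus D (Sdual D (snd b)) (snd a). u \<in> Fus D (snd b) r}"
      have "finite ?R" by simp
      moreover have "Sunit D \<in> ?R" if "b = a"
        using a u that by (simp add: dual_unit_label fus_unit_right)
      ultimately show "(\<Sum>r\<in>?R. Fsym D (snd b) (Sdual D (snd b)) (snd a) u (Sunit D) r
            * (if b = a \<and> r = Sunit D then Sev D (snd a) * \<Phi> b else 0)) = (if b = a then \<Phi> a else 0)"
        using ev_fsym[OF a(2)] u by (auto simp: if_distrib[where f = "\<lambda>c. _ * c"] mult.assoc[symmetric] cong: if_cong)
    qed
    also have "\<dots> = pull (LUnit C A) \<Phi> (Node x a, u)"
      using A a x u by (simp add: fus_unit_left)
    finally show "pull (RUnit C A \<cdot> (Id C A \<odot> Ev C A) \<cdot> Assoc C A ?A' A \<cdot> (Coev C A \<odot> Id C A)) \<Phi> (Node x a, u)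
      = pull (LUnit C A) \<Phi> (Node x a, u)" .
  qed (use A in \<open>simp_all add: homs_iff\<close>)
  show "LUnit C ?A' \<cdot> (Ev C A \<odot> Id C ?A') \<cdot> inv_arrow C (Assoc C ?A' A ?A') \<cdot> (Id C ?A' \<odot> Coev C A) = RUnit C ?A'"
  proof (rule tens_homs_eqI[where X = ?A'])
    fix x a u \<Phi> assume "x \<in> simple_sum (Sunit D)" and "a \<in> ?A'" and "u \<in> Fus D (snd a) (snd x)"
    then obtain a0 where a0: "a0 \<in> A" "a = relabel (Sdual D) a0" by blast
    have a0L: "snd a0 \<in> Slab D" using lab a0 by blast
    have x: "x = (Leaf 0, Sunit D)" and u: "u = Sdual D (snd a0)"
      using \<open>x \<in> simple_sum (Sunit D)\<close> \<open>u \<in> _\<close> a0 a0L by (auto simp: fus_unit_right dual_label)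
    have "pull (LUnit C ?A' \<cdot> (Ev C A \<odot> Id C ?A') \<cdot> inv_arrow C (Assoc C ?A' A ?A') \<cdot> (Id C ?A' \<odot> Coev C A)) \<Phi> (Node a x, u)
      = (\<Sum>b\<in>A. \<Sum>r\<in>{r \<in> Fus D (Sdual D (snd a0)) (snd b). u \<in> Fus D r (Sdual D (snd b))}.
          Finv (Sdual D (snd a0)) (snd b) (Sdual D (snd b)) u (Sunit D) r
            * (if a0 = b \<and> r = Sunit D then Sev D (snd b) * \<Phi> (relabel (Sdual D) b) else 0))"
      using A a0 a0L x u lab
      by (simp add: fus_unit_left fus_unit_right unit_fus_dual relabel_dual_eq_iff dual_label
          cong: conj_cong if_cong)
    also have "\<dots> = (\<Sum>b\<in>A. if b = a0 then \<Phi> a else 0)"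
    proof (rule sum.cong[OF refl])
      fix b assume b: "b \<in> A"
      let ?R = "{r \<in> Fus D (Sdual D (snd a0)) (snd b). u \<in> Fus D r (Sdual D (snd b))}"
      have "finite ?R" by simp
      moreover have "Sunit D \<in> ?R" if "b = a0"
        using a0L u that by (simp add: dual_unit_label fus_unit_left dual_label)
      ultimately show "(\<Sum>r\<in>?R. Finv (Sdual D (snd a0)) (snd b) (Sdual D (snd b)) u (Sunit D) r
            * (if a0 = b \<and> r = Sunit D then Sev D (snd b) * \<Phi> (relabel (Sdual D) b) else 0))
          = (if b = a0 then \<Phi> a else 0)"
        using ev_finv[OF a0L] u a0(2) by (auto simp: if_distrib[where f = "\<lambda>c. _ * c"] mult.assoc[symmetric] cong: if_cong)
    qed
    also have "\<dots> = pull (RUnit C ?A') \<Phi> (Node a x, u)"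
      using A a0 a0L x u by (simp add: fus_unit_right dual_label)
    finally show "pull (LUnit C ?A' \<cdot> (Ev C A \<odot> Id C ?A') \<cdot> inv_arrow C (Assoc C ?A' A ?A') \<cdot> (Id C ?A' \<odot> Coev C A)) \<Phi> (Node a x, u)
      = pull (RUnit C ?A') \<Phi> (Node a x, u)" .
  qed (use A in \<open>simp_all add: homs_iff\<close>)
qed (use A in \<open>simp_all add: homs_iff\<close>)

lemma Dual_Dual: "A \<in> fs_ob D \<Longrightarrow> relabel (Sdual D) ` relabel (Sdual D) ` A = A"
  using lab_ob[of A] by (force simp: image_image relabel_def dual_dual)

sublocale fusion_category C
proof
  fix A B
  show "A \<in> Ob C \<Longrightarrow> \<exists>n F i p. is_direct_sum C A n F i p \<and> (\<forall>k<n. simple_object C (F k))"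
    using ex_direct_sum_singletons[of A] lab_ob[of A] simple_object_iff by (metis Ob_eq)
  show "\<exists>S. finite S \<and> S \<subseteq> {A. simple_object C A} \<and>
          (\<forall>A. simple_object C A \<longrightarrow> (\<exists>B \<in> S. isomorphic C A B))"
  proof (intro exI conjI allI impI)
    show "finite (simple_sum ` Slab D)" using finite_labels by simp
    show "simple_sum ` Slab D \<subseteq> {A. simple_object C A}"
      by (auto simp: simple_object_iff simple_sum_def)
    fix A assume "simple_object C A"
    then obtain x where x: "A = {x}" "snd x \<in> Slab D" by (auto simp: simple_object_iff)
    then have "isomorphic C A (simple_sum (snd x))"
      using isomorphic_singletons[of x "(Leaf 0, snd x)"] by (simp add: simple_sum_def)
    then show "\<exists>B \<in> simple_sum ` Slab D. isomorphic C A B" using x by blast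
  qed
  show "\<lbrakk>A \<in> Ob C; B \<in> Ob C\<rbrakk> \<Longrightarrow> \<exists>n b. (\<forall>k<n. b k \<in> homs C A B) \<and>
            (\<forall>f \<in> homs C A B. \<exists>c. f = msum C A B (\<lambda>k. c k \<star> b k) n)"
    using finite_dimensional_homs[of A B] by simp
  show "simple_object C (Unit C)"
    using unit_label by (auto simp: simple_object_iff simple_sum_def)
  show "\<exists>c. f = c \<star> Id C (Unit C)" if f: "f \<in> homs C (Unit C) (Unit C)" for f
    by (rule exI[of _ "entry f (Leaf 0, Sunit D) (Leaf 0, Sunit D)"], rule entry_eqI[OF f])
      (use f in \<open>auto simp: homs_iff Smul_eq Id_eq entry_block\<close>)
  show "A \<in> Ob C \<Longrightarrow> is_dual C A (Dual C A) (Ev C A) (Coev C A)"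
    using is_dual_Dual by simp
  \<comment> \<open>Label duality is a strict involution, so \<open>A\<close> is the chosen dual of
    its own dual, and the duality data of the latter make it a dual on the other side.\<close>
  show "\<exists>A' e c. A' \<in> Ob C \<and> is_dual C A' A e c" if A: "A \<in> Ob C"
    using is_dual_Dual[of "relabel (Sdual D) ` A"] A Dual_Dual[of A]
    by (intro exI[of _ "relabel (Sdual D) ` A"] exI conjI) simp_all
qed

end

section \<open>Crossed tables\<close>

text \<open>The crossed axioms read off on simple labels. Since morphisms preserve labels, a twist
  needs a label fixed by its own degree (\<open>act_deg\<close>), and a braiding needs source and
  target with the same channels (\<open>fus_crossed\<close>). Equation \<open>tau_fsym\<close> can
  be demanded channel by channel because the action is diagonal in the channels.\<close>

locale crossed_table = group G + fusion_table D Finv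
  for G :: "('g, 'b) monoid_scheme" and D :: "('g, 's) table"
    and Finv :: "'s \<Rightarrow> 's \<Rightarrow> 's \<Rightarrow> 's \<Rightarrow> 's \<Rightarrow> 's \<Rightarrow> complex" +
  assumes finite_group: "finite (carrier G)"
    and act_label: "\<lbrakk>h \<in> carrier G; a \<in> Slab D\<rbrakk> \<Longrightarrow> Sact D h a \<in> Slab D"
    and act_one_label: "a \<in> Slab D \<Longrightarrow> Sact D \<one>\<^bsub>G\<^esub> a = a"
    and act_mult_label: "\<lbrakk>h \<in> carrier G; k \<in> carrier G; a \<in> Slab D\<rbrakk>
        \<Longrightarrow> Sact D (h \<otimes>\<^bsub>G\<^esub> k) a = Sact D h (Sact D k a)"
    and act_unit_label: "h \<in> carrier G \<Longrightarrow> Sact D h (Sunit D) = Sunit D"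
    and fus_act: "h \<in> carrier G \<Longrightarrow> Fus D (Sact D h a) (Sact D h b) = Sact D h ` Fus D a b"
    and tau_one: "\<lbrakk>a \<in> Slab D; b \<in> Slab D; t \<in> Fus D a b\<rbrakk> \<Longrightarrow> Stau D \<one>\<^bsub>G\<^esub> a b t = 1"
    and tau_mult: "\<lbrakk>h \<in> carrier G; k \<in> carrier G; a \<in> Slab D; b \<in> Slab D; t \<in> Fus D a b\<rbrakk>
        \<Longrightarrow> Stau D (h \<otimes>\<^bsub>G\<^esub> k) a b t
          = Stau D k a b t * Stau D h (Sact D k a) (Sact D k b) (Sact D k t)"
    and tau_unit_left: "\<lbrakk>h \<in> carrier G; a \<in> Slab D\<rbrakk> \<Longrightarrow> Stau D h (Sunit D) a a = 1"
    and tau_unit_right: "\<lbrakk>h \<in> carrier G; a \<in> Slab D\<rbrakk> \<Longrightarrow> Stau D h a (Sunit D) a = 1"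
    and tau_fsym: "\<lbrakk>h \<in> carrier G; a \<in> Slab D; b \<in> Slab D; c \<in> Slab D;
        t \<in> Fus D a b; u \<in> Fus D t c; r \<in> Fus D b c; u \<in> Fus D a r\<rbrakk>
        \<Longrightarrow> Stau D h t c u * (Stau D h a b t *
            Fsym D (Sact D h a) (Sact D h b) (Sact D h c) (Sact D h u) (Sact D h t) (Sact D h r))
          = Fsym D a b c u t r * (Stau D h a r u * Stau D h b c r)"
    and deg_carrier: "a \<in> Slab D \<Longrightarrow> Sdeg D a \<in> carrier G"
    and deg_unit: "Sdeg D (Sunit D) = \<one>\<^bsub>G\<^esub>"
    and deg_fus: "\<lbrakk>a \<in> Slab D; b \<in> Slab D; t \<in> Fus D a b\<rbrakk> \<Longrightarrow> Sdeg D t = Sdeg D a \<otimes>\<^bsub>G\<^esub> Sdeg D b"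
    and deg_act: "\<lbrakk>h \<in> carrier G; a \<in> Slab D\<rbrakk>
        \<Longrightarrow> Sdeg D (Sact D h a) = h \<otimes>\<^bsub>G\<^esub> Sdeg D a \<otimes>\<^bsub>G\<^esub> inv\<^bsub>G\<^esub> h"
    and act_deg: "a \<in> Slab D \<Longrightarrow> Sact D (Sdeg D a) a = a"
    and fus_crossed: "a \<in> Slab D \<Longrightarrow> Fus D (Sact D (Sdeg D a) b) a = Fus D a b"
    and braid_nonzero: "\<lbrakk>a \<in> Slab D; b \<in> Slab D; t \<in> Fus D a b\<rbrakk> \<Longrightarrow> Sbraid D a b t \<noteq> 0"
    and braid_act_label: "\<lbrakk>h \<in> carrier G; a \<in> Slab D; b \<in> Slab D; t \<in> Fus D a b\<rbrakk>
        \<Longrightarrow> Sbraid D a b t * Stau D h (Sact D (Sdeg D a) b) a t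
          = Stau D h a b t * Sbraid D (Sact D h a) (Sact D h b) (Sact D h t)"
    and braid_fus_right: "\<lbrakk>a \<in> Slab D; b \<in> Slab D; c \<in> Slab D; t \<in> Fus D a b; u \<in> Fus D t c;
        h = Sdeg D a\<rbrakk> \<Longrightarrow>
      (\<Sum>r\<in>{r \<in> Fus D b c. u \<in> Fus D a r}. Fsym D a b c u t r * (Sbraid D a r u * (Stau D h b c r *
        (\<Sum>v\<in>{v \<in> Fus D (Sact D h c) a. u \<in> Fus D (Sact D h b) v}.
          Fsym D (Sact D h b) (Sact D h c) a u (Sact D h r) v * \<phi> v))))
      = Sbraid D a b t * (\<Sum>v\<in>{v \<in> Fus D a c. u \<in> Fus D (Sact D h b) v}.
          Fsym D (Sact D h b) a c u t v * (Sbraid D a c v * \<phi> v))"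
    and braid_fus_left: "\<lbrakk>a \<in> Slab D; b \<in> Slab D; c \<in> Slab D; t \<in> Fus D a b; u \<in> Fus D t c;
        c' = Sact D (Sdeg D b) c; c'' = Sact D (Sdeg D a) c'\<rbrakk> \<Longrightarrow>
      (\<Sum>r\<in>{r \<in> Fus D b c. u \<in> Fus D a r}. Fsym D a b c u t r * (Sbraid D b c r *
        (\<Sum>s\<in>{s \<in> Fus D a c'. u \<in> Fus D s b}. Finv a c' b u r s * (Sbraid D a c' s *
          (\<Sum>t'\<in>{t' \<in> Fus D a b. u \<in> Fus D c'' t'}. Fsym D c'' a b u s t' * \<phi> t')))))
      = Sbraid D t c u * \<phi> t"
    and twist_nonzero: "a \<in> Slab D \<Longrightarrow> Stwist D a \<noteq> 0"
    and twist_unit_label: "Stwist D (Sunit D) = 1"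
    and twist_act_label: "\<lbrakk>h \<in> carrier G; a \<in> Slab D\<rbrakk> \<Longrightarrow> Stwist D (Sact D h a) = Stwist D a"
    and twist_fus: "\<lbrakk>a \<in> Slab D; b \<in> Slab D; t \<in> Fus D a b\<rbrakk>
        \<Longrightarrow> Stwist D t * Stau D (Sdeg D t) a b t
          = Sbraid D a b t * (Sbraid D (Sact D (Sdeg D a) b) a t * (Stwist D a * Stwist D b))"
    and twist_dual: "a \<in> Slab D \<Longrightarrow>
        Stwist D (Sdual D a) = Stwist D a * Stau D (inv\<^bsub>G\<^esub> (Sdeg D a)) a (Sdual D a) (Sunit D)"

section \<open>The group action on formal sums\<close>

locale formal_crossed = crossed_table G D Finv
  for G :: "('g, 'b) monoid_scheme" and D :: "('g, 's) table"
    and Finv :: "'s \<Rightarrow> 's \<Rightarrow> 's \<Rightarrow> 's \<Rightarrow> 's \<Rightarrow> 's \<Rightarrow> complex"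
    and C :: "('g, 's fob, 's farr, 'e) action_category_scheme" (structure) +
  assumes truncate_action_eq: "action_category.truncate C = fs_action_category G D"
begin

sublocale formal_fusion D C Finv
proof unfold_locales
  have "tensor_category.truncate C = tensor_category.truncate (action_category.truncate C)"
    by (simp add: tensor_category.truncate_def action_category.truncate_def)
  then show "tensor_category.truncate C = fs_tensor_category D"
    by (simp add: truncate_action_eq fs_action_category_def tensor_category.truncate_def
        tensor_category.extend_def)
qed

lemma Act_eq [simp]: "Act C = fs_act D"
  and ActM_eq: "ActM C h f = block (fs_act D h (fdom f)) (fs_act D h (fcod f))
       (\<lambda>y x. entry f (relabel (Sact D (inv\<^bsub>G\<^esub> h)) y) (relabel (Sact D (inv\<^bsub>G\<^esub> h)) x))"
  and ActT_eq: "ActT C h A B = block (fs_act D h (fs_tens D A B)) (fs_tens D (fs_act D h A) (fs_act D h B))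
       (\<lambda>y x. case (fst x, fst y) of
           (Node a b, Node a' b') \<Rightarrow>
              if a' = relabel (Sact D h) a \<and> b' = relabel (Sact D h) b
              then Stau D h (snd a) (snd b) (Sact D (inv\<^bsub>G\<^esub> h) (snd x)) else 0
         | _ \<Rightarrow> 0)"
  using truncate_action_eq
  by (simp_all add: action_category.truncate_def fs_action_category_def tensor_category.extend_def
      action_category.fields_def fun_eq_iff)

lemma action_simps [simp]:
  "fdom (ActM C h f) = fs_act D h (fdom f)" "fcod (ActM C h f) = fs_act D h (fcod f)" "fits (ActM C h f)"
  "fdom (ActT C h A B) = fs_act D h (fs_tens D A B)"
  "fcod (ActT C h A B) = fs_tens D (fs_act D h A) (fs_act D h B)" "fits (ActT C h A B)"
  "fdom (fs_braid D h A B) = fs_tens D A B" "fcod (fs_braid D h A B) = fs_tens D (fs_act D h B) A"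
  "fits (fs_braid D h A B)"
  "fdom (fs_twist D h A) = A" "fcod (fs_twist D h A) = fs_act D h A" "fits (fs_twist D h A)"
  by (simp_all add: ActM_eq ActT_eq fs_braid_def fs_twist_def)

lemma act_inv_label [simp]:
  assumes "h \<in> carrier G" "a \<in> Slab D"
  shows "Sact D (inv\<^bsub>G\<^esub> h) (Sact D h a) = a" "Sact D h (Sact D (inv\<^bsub>G\<^esub> h) a) = a"
  using act_mult_label[of "inv\<^bsub>G\<^esub> h" h a] act_mult_label[of h "inv\<^bsub>G\<^esub> h" a] assms
  by (simp_all add: act_one_label)

lemma act_label_eq_iff [simp]:
  "h \<in> carrier G \<Longrightarrow> a \<in> Slab D \<Longrightarrow> b \<in> Slab D \<Longrightarrow> Sact D h a = Sact D h b \<longleftrightarrow> a = b"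
  using act_inv_label(1) by metis

lemma relabel_act_eq_iff:
  "h \<in> carrier G \<Longrightarrow> snd a \<in> Slab D \<Longrightarrow> snd b \<in> Slab D
    \<Longrightarrow> relabel (Sact D h) a = relabel (Sact D h) b \<longleftrightarrow> a = b"
  by (auto simp: relabel_def prod_eq_iff)

lemma fus_label' [simp]: "t \<in> Fus D a b \<Longrightarrow> t \<in> Slab D"
  by (rule fus_label)

lemma act_label' [simp]: "h \<in> carrier G \<Longrightarrow> a \<in> Slab D \<Longrightarrow> Sact D h a \<in> Slab D"
  by (rule act_label)

lemma fus_act_mem [simp]:
  "h \<in> carrier G \<Longrightarrow> t \<in> Fus D a b \<Longrightarrow> Sact D h t \<in> Fus D (Sact D h a) (Sact D h b)"
  by (simp add: fus_act)

lemma fus_act_iff [simp]: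
  "h \<in> carrier G \<Longrightarrow> a \<in> Slab D \<Longrightarrow> b \<in> Slab D \<Longrightarrow> t \<in> Slab D
    \<Longrightarrow> Sact D h t \<in> Fus D (Sact D h a) (Sact D h b) \<longleftrightarrow> t \<in> Fus D a b"
  using fus_label by (force simp: fus_act)

text \<open>The group permutes labels compatibly with fusion, so a channel sum over translated
  labels can be reindexed. This aligns the associators before and after the action.\<close>

lemma sum_act_channels [simp]:
  assumes "h \<in> carrier G" "a \<in> Slab D" "b \<in> Slab D" "c \<in> Slab D" "u \<in> Slab D"
  shows "(\<Sum>r\<in>{r \<in> Fus D (Sact D h b) (Sact D h c). Sact D h u \<in> Fus D (Sact D h a) r}. f r)
    = (\<Sum>r\<in>{r \<in> Fus D b c. u \<in> Fus D a r}. f (Sact D h r))"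
proof -
  have "{r \<in> Fus D (Sact D h b) (Sact D h c). Sact D h u \<in> Fus D (Sact D h a) r}
      = Sact D h ` {r \<in> Fus D b c. u \<in> Fus D a r}"
    using assms by (auto simp: fus_act[of h b c])
  moreover have "inj_on (Sact D h) {r \<in> Fus D b c. u \<in> Fus D a r}"
    using assms by (auto simp: inj_on_def)
  ultimately show ?thesis by (simp add: sum.reindex)
qed

lemma fs_act_ob [simp]: "h \<in> carrier G \<Longrightarrow> A \<in> fs_ob D \<Longrightarrow> fs_act D h A \<in> fs_ob D"
  unfolding fs_act_def by (rule fs_obI) (auto dest: lab_ob)

lemma relabel_mem_fs_act [simp]: "a \<in> A \<Longrightarrow> relabel (Sact D h) a \<in> fs_act D h A"
  by (simp add: fs_act_def)

lemma Pair_mem_fs_act [simp]: "(n, s) \<in> A \<Longrightarrow> (n, Sact D h s) \<in> fs_act D h A"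
  using relabel_mem_fs_act[of "(n, s)" A h] by simp

lemma fs_act_tensE:
  assumes "x \<in> fs_act D h (fs_tens D A B)"
  obtains a b u where "x = (Node a b, Sact D h u)" "a \<in> A" "b \<in> B" "u \<in> Fus D (snd a) (snd b)"
  using assms by (auto simp: fs_act_def elim!: fs_tensE)

lemma act_homs_eqI:
  assumes "f \<in> homs C (fs_act D h A) X" "g \<in> homs C (fs_act D h A) X" and A: "A \<in> fs_ob D"
    and "\<And>a \<Phi>. \<lbrakk>a \<in> A; snd a \<in> Slab D\<rbrakk>
      \<Longrightarrow> pull f \<Phi> (relabel (Sact D h) a) = pull g \<Phi> (relabel (Sact D h) a)"
  shows "f = g"
proof (rule hom_eqI[OF assms(1,2)])
  fix x \<Phi> assume "x \<in> fs_act D h A"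
  then show "pull f \<Phi> x = pull g \<Phi> x"
    using assms(4) lab_ob[OF A] by (auto simp del: relabel_Pair simp: fs_act_def)
qed

lemma act_tens_homs_eqI:
  assumes "f \<in> homs C (fs_act D h (fs_tens D A B)) X" "g \<in> homs C (fs_act D h (fs_tens D A B)) X"
    and "A \<in> fs_ob D" "B \<in> fs_ob D"
    and "\<And>a b u \<Phi>. \<lbrakk>a \<in> A; b \<in> B; snd a \<in> Slab D; snd b \<in> Slab D; u \<in> Slab D;
        u \<in> Fus D (snd a) (snd b)\<rbrakk>
      \<Longrightarrow> pull f \<Phi> (Node a b, Sact D h u) = pull g \<Phi> (Node a b, Sact D h u)"
  shows "f = g"
proof (rule act_homs_eqI[OF assms(1,2)])
  fix x \<Phi> assume x: "x \<in> fs_tens D A B"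
  from x show "pull f \<Phi> (relabel (Sact D h) x) = pull g \<Phi> (relabel (Sact D h) x)"
    by (rule fs_tensE) (use assms(3-5) in \<open>simp add: lab_ob\<close>)
qed (use assms in simp)

lemma relabel_inv_act [simp]:
  "h \<in> carrier G \<Longrightarrow> snd a \<in> Slab D \<Longrightarrow> relabel (Sact D (inv\<^bsub>G\<^esub> h)) (relabel (Sact D h) a) = a"
  by (simp add: relabel_def)

text \<open>\<open>ActM\<close> conjugates a matrix by the relabelling, which is injective on
  admissible labels and therefore a bijection of summands.\<close>

lemma pull_ActM:
  assumes h: "h \<in> carrier G" and f: "fits f" "fdom f \<in> fs_ob D" "fcod f \<in> fs_ob D"
    and x: "x \<in> fdom f"
  shows "pull (ActM C h f) \<Phi> (relabel (Sact D h) x) = pull f (\<lambda>y. \<Phi> (relabel (Sact D h) y)) x"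
proof -
  let ?K = "{y \<in> fcod f. snd y = snd x}"
  have lab: "snd y \<in> Slab D" if "y \<in> fcod f \<or> y \<in> fdom f" for y
    using that f lab_ob by blast
  have "pull (ActM C h f) \<Phi> (relabel (Sact D h) x) = (\<Sum>y\<in>?K. entry f y x * \<Phi> (relabel (Sact D h) y))"
    unfolding ActM_eq
  proof (subst pull_block_image[where h = "relabel (Sact D h)" and K = ?K])
    show "finite (fs_act D h (fcod f))" using f h by simp
    show "relabel (Sact D h) x \<in> fs_act D h (fdom f)" using x by simp
    show "inj_on (relabel (Sact D h)) ?K"
      by (rule inj_onI) (use relabel_act_eq_iff[OF h lab lab] in simp)
    show "relabel (Sact D h) k \<in> fs_act D h (fcod f) \<and>
         snd (relabel (Sact D h) k) = snd (relabel (Sact D h) x)" if "k \<in> ?K" for k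
      using that by simp
    show "y \<in> relabel (Sact D h) ` ?K"
      if y: "y \<in> fs_act D h (fcod f)" "snd y = snd (relabel (Sact D h) x)" for y
    proof -
      from y(1) obtain z where z: "z \<in> fcod f" "y = relabel (Sact D h) z" by (auto simp: fs_act_def)
      with y(2) have "snd z = snd x" using h lab[of z] lab[of x] x by simp
      with z show ?thesis by blast
    qed
    show "(\<Sum>k\<in>?K. entry f (relabel (Sact D (inv\<^bsub>G\<^esub> h)) (relabel (Sact D h) k))
        (relabel (Sact D (inv\<^bsub>G\<^esub> h)) (relabel (Sact D h) x)) * \<Phi> (relabel (Sact D h) k))
      = (\<Sum>y\<in>?K. entry f y x * \<Phi> (relabel (Sact D h) y))"
      by (rule sum.cong[OF refl]) (use h lab x in simp)
  qed
  also have "\<dots> = pull f (\<lambda>y. \<Phi> (relabel (Sact D h) y)) x"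
    unfolding pull_def
  proof (rule sum.mono_neutral_left)
    show "\<forall>y\<in>fcod f - ?K. entry f y x * \<Phi> (relabel (Sact D h) y) = 0"
      using fitsD[OF f(1)] by (intro ballI) (metis (mono_tags, lifting) DiffE mem_Collect_eq mult_zero_left)
  qed (use f in auto)
  finally show ?thesis .
qed

lemma pull_ActM_relabel [simp]:
  "h \<in> carrier G \<Longrightarrow> fits f \<Longrightarrow> fdom f \<in> fs_ob D \<Longrightarrow> fcod f \<in> fs_ob D \<Longrightarrow> x \<in> fdom f
    \<Longrightarrow> pull (ActM C h f) \<Phi> (relabel (Sact D h) x) = pull f (\<lambda>y. \<Phi> (relabel (Sact D h) y)) x"
  by (rule pull_ActM)

text \<open>The simplifier pushes \<open>relabel\<close> into explicit pairs, hence this second form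
  matching the result of that rewriting.\<close>

lemma pull_ActM_Pair [simp]:
  "h \<in> carrier G \<Longrightarrow> fits f \<Longrightarrow> fdom f \<in> fs_ob D \<Longrightarrow> fcod f \<in> fs_ob D \<Longrightarrow> (n, s) \<in> fdom f
    \<Longrightarrow> pull (ActM C h f) \<Phi> (n, Sact D h s) = pull f (\<lambda>y. \<Phi> (relabel (Sact D h) y)) (n, s)"
  using pull_ActM[of h f "(n, s)"] by simp

lemma pull_ActT [simp]:
  assumes "h \<in> carrier G" "A \<in> fs_ob D" "B \<in> fs_ob D" "a \<in> A" "b \<in> B" "t \<in> Fus D (snd a) (snd b)"
  shows "pull (ActT C h A B) \<Phi> (Node a b, Sact D h t)
    = Stau D h (snd a) (snd b) t * \<Phi> (Node (relabel (Sact D h) a) (relabel (Sact D h) b), Sact D h t)"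
proof -
  have lab: "snd a \<in> Slab D" "snd b \<in> Slab D" "t \<in> Slab D" using assms lab_ob by auto
  show ?thesis
    unfolding ActT_eq
    by (subst pull_block_single[where z = "(Node (relabel (Sact D h) a) (relabel (Sact D h) b), Sact D h t)"])
      (use assms lab in \<open>auto elim!: fs_tensE split: if_splits\<close>)
qed

abbreviation grade :: "'g \<Rightarrow> 's fob set" where
  "grade h \<equiv> {A \<in> fs_ob D. \<forall>a\<in>A. Sdeg D (snd a) = h}"

lemma pull_braid [simp]:
  assumes "h \<in> carrier G" "A \<in> fs_ob D" "B \<in> fs_ob D" "a \<in> A" "b \<in> B" "t \<in> Fus D (snd a) (snd b)"
    "Sdeg D (snd a) = h"
  shows "pull (fs_braid D h A B) \<Phi> (Node a b, t)
    = Sbraid D (snd a) (snd b) t * \<Phi> (Node (relabel (Sact D h) b) a, t)"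
proof -
  have lab: "snd a \<in> Slab D" "snd b \<in> Slab D" "t \<in> Slab D" using assms lab_ob by auto
  show ?thesis
    unfolding fs_braid_def
    by (subst pull_block_single[where z = "(Node (relabel (Sact D h) b) a, t)"])
      (use assms lab fus_crossed[OF lab(1)] in \<open>auto elim!: fs_tensE split: if_splits\<close>)
qed

lemma relabel_deg:
  "A \<in> fs_ob D \<Longrightarrow> a \<in> A \<Longrightarrow> Sdeg D (snd a) = h \<Longrightarrow> relabel (Sact D h) a = a"
  using act_deg[OF lab_ob, of A a] by (auto simp: relabel_def)

lemma pull_twist [simp]:
  assumes "h \<in> carrier G" "A \<in> fs_ob D" "a \<in> A" "Sdeg D (snd a) = h"
  shows "pull (fs_twist D h A) \<Phi> a = Stwist D (snd a) * \<Phi> (relabel (Sact D h) a)"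
  unfolding fs_twist_def
  by (subst pull_block_single[where z = "relabel (Sact D h) a"])
    (use assms act_deg[OF lab_ob[OF assms(2,3)]] in \<open>auto split: if_splits\<close>)

lemma relabel_relabel_act:
  "h \<in> carrier G \<Longrightarrow> k \<in> carrier G \<Longrightarrow> snd a \<in> Slab D
    \<Longrightarrow> relabel (Sact D h) (relabel (Sact D k) a) = relabel (Sact D (h \<otimes>\<^bsub>G\<^esub> k)) a"
  by (simp add: relabel_def act_mult_label)

lemma fs_act_one [simp]: "A \<in> fs_ob D \<Longrightarrow> fs_act D \<one>\<^bsub>G\<^esub> A = A"
  using lab_ob[of A] by (force simp: fs_act_def relabel_def act_one_label image_iff)

lemma relabel_act_one [simp]: "snd a \<in> Slab D \<Longrightarrow> relabel (Sact D \<one>\<^bsub>G\<^esub>) a = a"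
  by (simp add: relabel_def act_one_label)

lemma fs_act_mult:
  "h \<in> carrier G \<Longrightarrow> k \<in> carrier G \<Longrightarrow> A \<in> fs_ob D \<Longrightarrow> fs_act D (h \<otimes>\<^bsub>G\<^esub> k) A = fs_act D h (fs_act D k A)"
  unfolding fs_act_def image_image by (rule image_cong) (simp_all add: relabel_relabel_act lab_ob)

lemma fs_act_unit [simp]: "h \<in> carrier G \<Longrightarrow> fs_act D h (simple_sum (Sunit D)) = simple_sum (Sunit D)"
  by (simp add: fs_act_def simple_sum_def act_unit_label)

lemma fs_act_deg: "A \<in> grade h \<Longrightarrow> fs_act D h A = A"
  using relabel_deg[of A] by (force simp: fs_act_def image_iff simp del: relabel_Pair)

text \<open>\<open>tau_mult\<close> for the inverse of \<open>h\<close> followed by \<open>h\<close>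
  exhibits a factor whose product with this component is 1.\<close>

lemma tau_nonzero:
  assumes "h \<in> carrier G" "a \<in> Slab D" "b \<in> Slab D" "t \<in> Fus D a b"
  shows "Stau D h a b t \<noteq> 0"
  using tau_mult[of "inv\<^bsub>G\<^esub> h" h a b t] tau_one[of a b t] assms by auto

lemma iso_ActT:
  assumes h: "h \<in> carrier G" and A: "A \<in> fs_ob D" and B: "B \<in> fs_ob D"
  shows "iso_arrow C (ActT C h A B)"
proof -
  define g where "g = block (fs_tens D (fs_act D h A) (fs_act D h B)) (fs_act D h (fs_tens D A B))
       (\<lambda>y x. case (fst x, fst y) of
           (Node a b, Node a' b') \<Rightarrow>
              if a = relabel (Sact D h) a' \<and> b = relabel (Sact D h) b'
              then inverse (Stau D h (snd a') (snd b') (Sact D (inv\<^bsub>G\<^esub> h) (snd x))) else 0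
         | _ \<Rightarrow> 0)"
  have [simp]: "fdom g = fs_tens D (fs_act D h A) (fs_act D h B)"
    "fcod g = fs_act D h (fs_tens D A B)" "fits g"
    by (simp_all add: g_def)
  have pull_g [simp]: "pull g \<Phi> (Node (relabel (Sact D h) a) (relabel (Sact D h) b), Sact D h t)
      = inverse (Stau D h (snd a) (snd b) t) * \<Phi> (Node a b, Sact D h t)"
    if x: "a \<in> A" "b \<in> B" "t \<in> Fus D (snd a) (snd b)" for a b t \<Phi>
  proof -
    have lab: "snd a \<in> Slab D" "snd b \<in> Slab D" "t \<in> Slab D" using x A B lab_ob by auto
    have labs: "(n, s) \<in> A \<Longrightarrow> s \<in> Slab D" "(n, s) \<in> B \<Longrightarrow> s \<in> Slab D" for n s
      using A B lab_ob by fastforce+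
    obtain n s m r where ab: "a = (n, s)" "b = (m, r)" by (metis prod.collapse)
    show ?thesis
      unfolding g_def
      by (subst pull_block_single[where z = "(Node a b, Sact D h t)"])
        (use x h A B lab labs in \<open>auto simp: ab elim!: fs_act_tensE split: if_splits\<close>)
  qed
  have "inverse_arrows C (ActT C h A B) g"
  proof (rule inverse_arrowsI)
    show "g \<cdot> ActT C h A B = Id C (fs_act D h (fs_tens D A B))"
      by (rule act_tens_homs_eqI[of _ h A B "fs_act D h (fs_tens D A B)"])
        (use h A B in \<open>simp_all add: homs_iff tau_nonzero\<close>)
    show "ActT C h A B \<cdot> g = Id C (fs_tens D (fs_act D h A) (fs_act D h B))"
    proof (rule tens_homs_eqI[of _ "fs_act D h A" "fs_act D h B" "fs_tens D (fs_act D h A) (fs_act D h B)"])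
      fix x y u \<Phi> assume x: "x \<in> fs_act D h A" "y \<in> fs_act D h B" "u \<in> Fus D (snd x) (snd y)"
      then obtain a b where ab: "a \<in> A" "b \<in> B" "x = relabel (Sact D h) a" "y = relabel (Sact D h) b"
        by (auto simp: fs_act_def)
      have lab: "snd a \<in> Slab D" "snd b \<in> Slab D" using ab A B lab_ob by auto
      obtain t where t: "t \<in> Fus D (snd a) (snd b)" "u = Sact D h t"
        using x(3) lab h by (auto simp: ab fus_act)
      show "pull (ActT C h A B \<cdot> g) \<Phi> (Node x y, u)
          = pull (Id C (fs_tens D (fs_act D h A) (fs_act D h B))) \<Phi> (Node x y, u)"
        using ab t lab h A B by (simp add: tau_nonzero)
    qed (use h A B in \<open>simp_all add: homs_iff\<close>)
  qed (use h A B in \<open>simp_all add: homs_iff\<close>)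
  then show ?thesis unfolding iso_arrow_def ..
qed

sublocale tensor_action G C
proof
  fix h k f f' c A A' B B' E
  show "finite (carrier G)" by (rule finite_group)
  show "h \<in> carrier G \<Longrightarrow> A \<in> Ob C \<Longrightarrow> Act C h A \<in> Ob C" by simp
  show "\<lbrakk>h \<in> carrier G; f \<in> homs C A B\<rbrakk> \<Longrightarrow> ActM C h f \<in> homs C (Act C h A) (Act C h B)"
    by (simp add: homs_iff)
  show "\<lbrakk>h \<in> carrier G; A \<in> Ob C\<rbrakk> \<Longrightarrow> ActM C h (Id C A) = Id C (Act C h A)"
    by (rule act_homs_eqI[of _ h A "fs_act D h A"]) (simp_all add: homs_iff)
  show "\<lbrakk>h \<in> carrier G; f \<in> homs C A B; f' \<in> homs C B E\<rbrakk> \<Longrightarrow> ActM C h (f' \<cdot> f) = ActM C h f' \<cdot> ActM C h f"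
    by (rule act_homs_eqI[of _ h A "fs_act D h E"]) (auto simp: homs_iff)
  show "\<lbrakk>h \<in> carrier G; f \<in> homs C A B; f' \<in> homs C A B\<rbrakk> \<Longrightarrow> ActM C h (f \<boxplus> f') = ActM C h f \<boxplus> ActM C h f'"
    by (rule act_homs_eqI[of _ h A "fs_act D h B"]) (auto simp: homs_iff)
  show "\<lbrakk>h \<in> carrier G; f \<in> homs C A B\<rbrakk> \<Longrightarrow> ActM C h (c \<star> f) = c \<star> ActM C h f"
    by (rule act_homs_eqI[of _ h A "fs_act D h B"]) (auto simp: homs_iff)
  show "\<lbrakk>h \<in> carrier G; A \<in> Ob C; B \<in> Ob C\<rbrakk>
          \<Longrightarrow> ActT C h A B \<in> homs C (Act C h (A \<boxtimes> B)) (Act C h A \<boxtimes> Act C h B)"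
    by (simp add: homs_iff)
  show "\<lbrakk>h \<in> carrier G; A \<in> Ob C; B \<in> Ob C\<rbrakk> \<Longrightarrow> iso_arrow C (ActT C h A B)"
    by (simp add: iso_ActT)
  show "\<lbrakk>h \<in> carrier G; f \<in> homs C A A'; f' \<in> homs C B B'\<rbrakk>
          \<Longrightarrow> ActT C h A' B' \<cdot> ActM C h (f \<odot> f') = (ActM C h f \<odot> ActM C h f') \<cdot> ActT C h A B"
    by (rule act_tens_homs_eqI[of _ h A B "fs_tens D (fs_act D h A') (fs_act D h B')"])
      (auto simp: homs_iff pull_scale)
  show "\<lbrakk>h \<in> carrier G; A \<in> Ob C; B \<in> Ob C; E \<in> Ob C\<rbrakk>
          \<Longrightarrow> Assoc C (Act C h A) (Act C h B) (Act C h E)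
                \<cdot> (ActT C h A B \<odot> Id C (Act C h E)) \<cdot> ActT C h (A \<boxtimes> B) E
             = (Id C (Act C h A) \<odot> ActT C h B E) \<cdot> ActT C h A (B \<boxtimes> E) \<cdot> ActM C h (Assoc C A B E)"
  proof (rule act_tens_homs_eqI[of _ h "fs_tens D A B" E
        "fs_tens D (fs_act D h A) (fs_tens D (fs_act D h B) (fs_act D h E))"])
    assume h: "h \<in> carrier G" and ob: "A \<in> Ob C" "B \<in> Ob C" "E \<in> Ob C"
    fix x e u \<Phi> assume x: "x \<in> fs_tens D A B" "e \<in> E" "snd e \<in> Slab D" "u \<in> Fus D (snd x) (snd e)"
    then obtain a b t where y: "x = (Node a b, t)" "a \<in> A" "b \<in> B" "t \<in> Fus D (snd a) (snd b)"
      by (metis fs_tensE)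
    have lab: "snd a \<in> Slab D" "snd b \<in> Slab D" "snd e \<in> Slab D"
      using x y ob lab_ob by auto
    show "pull (Assoc C (Act C h A) (Act C h B) (Act C h E)
                \<cdot> (ActT C h A B \<odot> Id C (Act C h E)) \<cdot> ActT C h (A \<boxtimes> B) E) \<Phi> (Node x e, Sact D h u)
        = pull ((Id C (Act C h A) \<odot> ActT C h B E) \<cdot> ActT C h A (B \<boxtimes> E) \<cdot> ActM C h (Assoc C A B E))
            \<Phi> (Node x e, Sact D h u)"
      using x y ob h lab tau_fsym[OF h lab]
      by (simp add: sum_distrib_left mult.assoc[symmetric])
  qed (simp_all add: homs_iff)
  show "h \<in> carrier G \<Longrightarrow> Act C h (Unit C) = Unit C" by simp
  show "\<lbrakk>h \<in> carrier G; A \<in> Ob C\<rbrakk> \<Longrightarrow> LUnit C (Act C h A) \<cdot> ActT C h (Unit C) A = ActM C h (LUnit C A)"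
    by (rule act_tens_homs_eqI[of _ h "simple_sum (Sunit D)" A "fs_act D h A"])
      (auto simp: homs_iff fus_unit_left tau_unit_left act_unit_label)
  show "\<lbrakk>h \<in> carrier G; A \<in> Ob C\<rbrakk> \<Longrightarrow> RUnit C (Act C h A) \<cdot> ActT C h A (Unit C) = ActM C h (RUnit C A)"
    by (rule act_tens_homs_eqI[of _ h A "simple_sum (Sunit D)" "fs_act D h A"])
      (auto simp: homs_iff fus_unit_right tau_unit_right act_unit_label)
  show "A \<in> Ob C \<Longrightarrow> Act C \<one>\<^bsub>G\<^esub> A = A" by simp
  show act_one: "ActM C \<one>\<^bsub>G\<^esub> f = f" if "f \<in> Arr C" for f
  proof (rule hom_eqI)
    show "f \<in> homs C (fdom f) (fcod f)" "ActM C \<one>\<^bsub>G\<^esub> f \<in> homs C (fdom f) (fcod f)"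
      using that by (auto simp: Arr_eq homs_iff)
    fix x \<Phi> assume x: "x \<in> fdom f"
    have f: "fits f" "fdom f \<in> fs_ob D" "fcod f \<in> fs_ob D" using that by (auto simp: Arr_eq)
    have "pull (ActM C \<one>\<^bsub>G\<^esub> f) \<Phi> (relabel (Sact D \<one>\<^bsub>G\<^esub>) x) = pull f \<Phi> x"
      using x f lab_ob by (subst pull_ActM) (auto simp: lab_ob)
    then show "pull (ActM C \<one>\<^bsub>G\<^esub> f) \<Phi> x = pull f \<Phi> x" using x f lab_ob[of "fdom f" x] by simp
  qed
  show "\<lbrakk>A \<in> Ob C; B \<in> Ob C\<rbrakk> \<Longrightarrow> ActT C \<one>\<^bsub>G\<^esub> A B = Id C (A \<boxtimes> B)"
  proof (rule tens_homs_eqI[of _ A B "fs_tens D A B"])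
    assume ob: "A \<in> Ob C" "B \<in> Ob C"
    fix a b u \<Phi> assume x: "a \<in> A" "b \<in> B" "snd a \<in> Slab D" "snd b \<in> Slab D" "u \<in> Slab D"
      "u \<in> Fus D (snd a) (snd b)"
    show "pull (ActT C \<one>\<^bsub>G\<^esub> A B) \<Phi> (Node a b, u) = pull (Id C (A \<boxtimes> B)) \<Phi> (Node a b, u)"
      using pull_ActT[of "\<one>\<^bsub>G\<^esub>" A B a b u \<Phi>] x ob by (simp add: act_one_label tau_one)
  qed (simp_all add: homs_iff)
  show "\<lbrakk>h \<in> carrier G; k \<in> carrier G; A \<in> Ob C\<rbrakk> \<Longrightarrow> Act C (h \<otimes>\<^bsub>G\<^esub> k) A = Act C h (Act C k A)"
    by (simp add: fs_act_mult)
  show "ActM C (h \<otimes>\<^bsub>G\<^esub> k) f = ActM C h (ActM C k f)"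
    if hk: "h \<in> carrier G" "k \<in> carrier G" and "f \<in> Arr C" for f
  proof (rule act_homs_eqI)
    have f: "fits f" "fdom f \<in> fs_ob D" "fcod f \<in> fs_ob D" using that by (auto simp: Arr_eq)
    show "ActM C (h \<otimes>\<^bsub>G\<^esub> k) f \<in> homs C (fs_act D (h \<otimes>\<^bsub>G\<^esub> k) (fdom f)) (fs_act D h (fs_act D k (fcod f)))"
      "ActM C h (ActM C k f) \<in> homs C (fs_act D (h \<otimes>\<^bsub>G\<^esub> k) (fdom f)) (fs_act D h (fs_act D k (fcod f)))"
      using hk f by (auto simp: homs_iff fs_act_mult)
    show "fdom f \<in> fs_ob D" by (rule f)
    fix x \<Phi> assume x: "x \<in> fdom f" "snd x \<in> Slab D"
    have "pull (ActM C h (ActM C k f)) \<Phi> (relabel (Sact D h) (relabel (Sact D k) x))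
        = pull f (\<lambda>y. \<Phi> (relabel (Sact D h) (relabel (Sact D k) y))) x"
      using hk f x by simp
    then show "pull (ActM C (h \<otimes>\<^bsub>G\<^esub> k) f) \<Phi> (relabel (Sact D (h \<otimes>\<^bsub>G\<^esub> k)) x)
        = pull (ActM C h (ActM C k f)) \<Phi> (relabel (Sact D (h \<otimes>\<^bsub>G\<^esub> k)) x)"
      using hk f x lab_ob[OF f(3)] by (simp add: relabel_relabel_act)
  qed
  show "\<lbrakk>h \<in> carrier G; k \<in> carrier G; A \<in> Ob C; B \<in> Ob C\<rbrakk>
          \<Longrightarrow> ActT C (h \<otimes>\<^bsub>G\<^esub> k) A B = ActT C h (Act C k A) (Act C k B) \<cdot> ActM C h (ActT C k A B)"
  proof (rule act_tens_homs_eqI[of _ "h \<otimes>\<^bsub>G\<^esub> k" A B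
        "fs_tens D (fs_act D h (fs_act D k A)) (fs_act D h (fs_act D k B))"])
    assume hk: "h \<in> carrier G" "k \<in> carrier G" and ob: "A \<in> Ob C" "B \<in> Ob C"
    fix a b u \<Phi> assume x: "a \<in> A" "b \<in> B" "snd a \<in> Slab D" "snd b \<in> Slab D" "u \<in> Slab D"
      "u \<in> Fus D (snd a) (snd b)"
    show "pull (ActT C (h \<otimes>\<^bsub>G\<^esub> k) A B) \<Phi> (Node a b, Sact D (h \<otimes>\<^bsub>G\<^esub> k) u)
        = pull (ActT C h (Act C k A) (Act C k B) \<cdot> ActM C h (ActT C k A B)) \<Phi> (Node a b, Sact D (h \<otimes>\<^bsub>G\<^esub> k) u)"
    proof -
      have "pull (ActT C (h \<otimes>\<^bsub>G\<^esub> k) A B) \<Phi> (Node a b, Sact D (h \<otimes>\<^bsub>G\<^esub> k) u)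
          = Stau D (h \<otimes>\<^bsub>G\<^esub> k) (snd a) (snd b) u * \<Phi> (Node (relabel (Sact D (h \<otimes>\<^bsub>G\<^esub> k)) a)
            (relabel (Sact D (h \<otimes>\<^bsub>G\<^esub> k)) b), Sact D (h \<otimes>\<^bsub>G\<^esub> k) u)"
        using x hk ob by simp
      moreover have "pull (ActT C h (Act C k A) (Act C k B) \<cdot> ActM C h (ActT C k A B)) \<Phi>
            (Node a b, Sact D h (Sact D k u))
          = Stau D k (snd a) (snd b) u * (Stau D h (Sact D k (snd a)) (Sact D k (snd b)) (Sact D k u)
            * \<Phi> (Node (relabel (Sact D (h \<otimes>\<^bsub>G\<^esub> k)) a) (relabel (Sact D (h \<otimes>\<^bsub>G\<^esub> k)) b), Sact D h (Sact D k u)))"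
        using x hk ob by (simp add: relabel_relabel_act)
      ultimately show ?thesis
        using tau_mult[OF hk x(3,4,6)] act_mult_label[OF hk x(5)] by simp
    qed
  qed (simp_all add: homs_iff fs_act_mult)
qed

end

section \<open>Crossed braiding, twist and ribbon condition\<close>

context formal_crossed
begin

lemma fus_crossed_mem [simp]:
  "Sdeg D a = h \<Longrightarrow> a \<in> Slab D \<Longrightarrow> u \<in> Fus D a b \<Longrightarrow> u \<in> Fus D (Sact D h b) a"
  using fus_crossed by blast

lemma relabel_act_mult:
  "h \<in> carrier G \<Longrightarrow> k \<in> carrier G \<Longrightarrow> snd a \<in> Slab D
    \<Longrightarrow> relabel (Sact D (h \<otimes>\<^bsub>G\<^esub> k)) a = relabel (Sact D h) (relabel (Sact D k) a)"
  by (simp add: relabel_relabel_act)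

lemma fs_act_inv [simp]:
  assumes "h \<in> carrier G" "A \<in> fs_ob D"
  shows "fs_act D (inv\<^bsub>G\<^esub> h) (fs_act D h A) = A" "fs_act D h (fs_act D (inv\<^bsub>G\<^esub> h) A) = A"
  using assms fs_act_mult[of "inv\<^bsub>G\<^esub> h" h A] fs_act_mult[of h "inv\<^bsub>G\<^esub> h" A] by simp_all

lemma fs_braid_homs:
  "h \<in> carrier G \<Longrightarrow> A \<in> fs_ob D \<Longrightarrow> B \<in> fs_ob D
    \<Longrightarrow> fs_braid D h A B \<in> homs C (fs_tens D A B) (fs_tens D (fs_act D h B) A)"
  by (simp add: homs_iff)

lemma iso_braid:
  assumes h: "h \<in> carrier G" and A: "A \<in> grade h" and B: "B \<in> fs_ob D"
  shows "iso_arrow C (fs_braid D h A B)"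
proof -
  have A': "A \<in> fs_ob D" "\<And>a. a \<in> A \<Longrightarrow> Sdeg D (snd a) = h" using A by auto
  define g where "g = block (fs_tens D (fs_act D h B) A) (fs_tens D A B)
     (\<lambda>y x. case (fst x, fst y) of
         (Node b' a', Node a b) \<Rightarrow>
            if a' = a \<and> b' = relabel (Sact D h) b then inverse (Sbraid D (snd a) (snd b) (snd x)) else 0
       | _ \<Rightarrow> 0)"
  have [simp]: "fdom g = fs_tens D (fs_act D h B) A" "fcod g = fs_tens D A B" "fits g"
    by (simp_all add: g_def)
  have pull_g [simp]: "pull g \<Phi> (Node (relabel (Sact D h) b) a, t)
      = inverse (Sbraid D (snd a) (snd b) t) * \<Phi> (Node a b, t)"
    if x: "a \<in> A" "b \<in> B" "t \<in> Fus D (snd a) (snd b)" for a b t \<Phi>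
  proof -
    have lab: "snd a \<in> Slab D" "snd b \<in> Slab D" "t \<in> Slab D" using x A' B lab_ob by auto
    have labs: "(n, s) \<in> B \<Longrightarrow> s \<in> Slab D" for n s
      using B lab_ob by fastforce
    obtain n s m r where ab: "a = (n, s)" "b = (m, r)" by (metis prod.collapse)
    show ?thesis
      unfolding g_def
      by (subst pull_block_single[where z = "(Node a b, t)"])
        (use x h A' B lab labs in \<open>auto simp: ab elim!: fs_tensE split: if_splits\<close>)
  qed
  have "inverse_arrows C (fs_braid D h A B) g"
  proof (rule inverse_arrowsI)
    show "g \<cdot> fs_braid D h A B = Id C (fs_tens D A B)"
      by (rule tens_homs_eqI[of _ A B "fs_tens D A B"])
        (use h A' B in \<open>simp_all add: homs_iff braid_nonzero\<close>)
    show "fs_braid D h A B \<cdot> g = Id C (fs_tens D (fs_act D h B) A)"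
    proof (rule tens_homs_eqI[of _ "fs_act D h B" A "fs_tens D (fs_act D h B) A"])
      fix y a u \<Phi> assume x: "y \<in> fs_act D h B" "a \<in> A" "snd a \<in> Slab D" "u \<in> Fus D (snd y) (snd a)"
      then obtain b where b: "b \<in> B" "y = relabel (Sact D h) b" by (auto simp: fs_act_def)
      have lab: "snd b \<in> Slab D" using b B lab_ob by auto
      have u: "u \<in> Fus D (snd a) (snd b)" using x b fus_crossed[of "snd a" "snd b"] A' by simp
      show "pull (fs_braid D h A B \<cdot> g) \<Phi> (Node y a, u)
          = pull (Id C (fs_tens D (fs_act D h B) A)) \<Phi> (Node y a, u)"
        using x b u lab h A' B by (simp add: braid_nonzero)
    qed (use h A' B in \<open>simp_all add: homs_iff\<close>)
  qed (use h A' B in \<open>simp_all add: homs_iff\<close>)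
  then show ?thesis unfolding iso_arrow_def ..
qed

lemma fs_braid_natural:
  assumes h: "h \<in> carrier G" and X: "X \<in> grade h" "X' \<in> grade h"
    and f: "f \<in> homs C X X'" "f' \<in> homs C Y Y'"
  shows "fs_braid D h X' Y' \<cdot> (f \<odot> f') = (ActM C h f' \<odot> f) \<cdot> fs_braid D h X Y"
proof (rule tens_homs_eqI[of _ X Y "fs_tens D (fs_act D h Y') X'"])
  fix a b u \<Phi> assume x: "a \<in> X" "b \<in> Y" "snd a \<in> Slab D" "snd b \<in> Slab D" "u \<in> Fus D (snd a) (snd b)"
  show "pull (fs_braid D h X' Y' \<cdot> (f \<odot> f')) \<Phi> (Node a b, u)
      = pull ((ActM C h f' \<odot> f) \<cdot> fs_braid D h X Y) \<Phi> (Node a b, u)"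
    using h X f x by (auto simp: homs_iff pull_scale pull_swap[of f f'])
qed (use h X f in \<open>simp_all add: homs_iff\<close>)

lemma fs_braid_act:
  assumes hk: "h \<in> carrier G" "k \<in> carrier G" and X: "X \<in> grade h" and Y: "Y \<in> fs_ob D"
  shows "ActT C k (fs_act D h Y) X \<cdot> ActM C k (fs_braid D h X Y)
     = fs_braid D (k \<otimes>\<^bsub>G\<^esub> h \<otimes>\<^bsub>G\<^esub> inv\<^bsub>G\<^esub> k) (fs_act D k X) (fs_act D k Y) \<cdot> ActT C k X Y"
proof (rule act_tens_homs_eqI[of _ k X Y "fs_tens D (fs_act D k (fs_act D h Y)) (fs_act D k X)"])
  have ob: "X \<in> fs_ob D" using X by simp
  have e: "fs_act D (k \<otimes>\<^bsub>G\<^esub> h \<otimes>\<^bsub>G\<^esub> inv\<^bsub>G\<^esub> k) (fs_act D k Y) = fs_act D k (fs_act D h Y)"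
    using hk Y by (simp add: fs_act_mult)
  show "ActT C k (fs_act D h Y) X \<cdot> ActM C k (fs_braid D h X Y)
      \<in> homs C (fs_act D k (fs_tens D X Y)) (fs_tens D (fs_act D k (fs_act D h Y)) (fs_act D k X))"
    "fs_braid D (k \<otimes>\<^bsub>G\<^esub> h \<otimes>\<^bsub>G\<^esub> inv\<^bsub>G\<^esub> k) (fs_act D k X) (fs_act D k Y) \<cdot> ActT C k X Y
      \<in> homs C (fs_act D k (fs_tens D X Y)) (fs_tens D (fs_act D k (fs_act D h Y)) (fs_act D k X))"
    using hk ob Y by (simp_all add: homs_iff e)
  fix a b u \<Phi> assume x: "a \<in> X" "b \<in> Y" "snd a \<in> Slab D" "snd b \<in> Slab D" "u \<in> Slab D"
    "u \<in> Fus D (snd a) (snd b)"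
  have d: "Sdeg D (snd a) = h" using X x by blast
  show "pull (ActT C k (fs_act D h Y) X \<cdot> ActM C k (fs_braid D h X Y)) \<Phi> (Node a b, Sact D k u)
     = pull (fs_braid D (k \<otimes>\<^bsub>G\<^esub> h \<otimes>\<^bsub>G\<^esub> inv\<^bsub>G\<^esub> k) (fs_act D k X) (fs_act D k Y) \<cdot> ActT C k X Y) \<Phi>
        (Node a b, Sact D k u)"
  proof -
    have "pull (ActT C k (fs_act D h Y) X \<cdot> ActM C k (fs_braid D h X Y)) \<Phi> (Node a b, Sact D k u)
        = Sbraid D (snd a) (snd b) u * (Stau D k (Sact D h (snd b)) (snd a) u
          * \<Phi> (Node (relabel (Sact D k) (relabel (Sact D h) b)) (relabel (Sact D k) a), Sact D k u))"
      using hk ob Y x d by simp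
    moreover have "pull (fs_braid D (k \<otimes>\<^bsub>G\<^esub> h \<otimes>\<^bsub>G\<^esub> inv\<^bsub>G\<^esub> k) (fs_act D k X) (fs_act D k Y) \<cdot> ActT C k X Y) \<Phi>
          (Node a b, Sact D k u)
        = Stau D k (snd a) (snd b) u * (Sbraid D (Sact D k (snd a)) (Sact D k (snd b)) (Sact D k u)
          * \<Phi> (Node (relabel (Sact D (k \<otimes>\<^bsub>G\<^esub> h \<otimes>\<^bsub>G\<^esub> inv\<^bsub>G\<^esub> k)) (relabel (Sact D k) b))
              (relabel (Sact D k) a), Sact D k u))"
      using hk ob Y x d by (simp add: deg_act)
    ultimately show ?thesis
      using hk x d braid_act_label[OF hk(2) x(3,4,6)]
      by (simp add: relabel_act_mult mult.assoc[symmetric])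
  qed
qed (use X Y in simp_all)

text \<open>The first hexagon with its two outer inverse associators moved to the other side. Only
  forward associators occur, so on a generic summand it is literally
  \<open>braid_fus_right\<close>.\<close>

lemma fs_braid_tens_right_assoc:
  assumes h: "h \<in> carrier G" and X: "X \<in> grade h" and Y: "Y \<in> fs_ob D" and Z: "Z \<in> fs_ob D"
  shows "Assoc C (fs_act D h Y) (fs_act D h Z) X
      \<cdot> ((ActT C h Y Z \<odot> Id C X) \<cdot> fs_braid D h X (fs_tens D Y Z)) \<cdot> Assoc C X Y Z
    = (Id C (fs_act D h Y) \<odot> fs_braid D h X Z) \<cdot> Assoc C (fs_act D h Y) X Z
      \<cdot> (fs_braid D h X Y \<odot> Id C Z)"
proof (rule tens_tens_left_homs_eqI[of _ X Y Z "fs_tens D (fs_act D h Y) (fs_tens D (fs_act D h Z) X)"])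
  have ob: "X \<in> fs_ob D" using X by simp
  fix a b t e u \<Phi> assume x: "a \<in> X" "b \<in> Y" "e \<in> Z" "snd a \<in> Slab D" "snd b \<in> Slab D" "snd e \<in> Slab D"
    "t \<in> Slab D" "u \<in> Slab D" "t \<in> Fus D (snd a) (snd b)" "u \<in> Fus D t (snd e)"
  have d: "Sdeg D (snd a) = h" using X x by blast
  show "pull (Assoc C (fs_act D h Y) (fs_act D h Z) X
      \<cdot> ((ActT C h Y Z \<odot> Id C X) \<cdot> fs_braid D h X (fs_tens D Y Z)) \<cdot> Assoc C X Y Z) \<Phi> (Node (Node a b, t) e, u)
    = pull ((Id C (fs_act D h Y) \<odot> fs_braid D h X Z) \<cdot> Assoc C (fs_act D h Y) X Z
      \<cdot> (fs_braid D h X Y \<odot> Id C Z)) \<Phi> (Node (Node a b, t) e, u)"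
    using h ob Y Z x d braid_fus_right[OF x(4,5,6,9,10) d[symmetric],
        of "\<lambda>v. \<Phi> (Node (relabel (Sact D h) b) (Node (relabel (Sact D h) e) a, v), u)"]
    by simp
qed (use h X Y Z in \<open>simp_all add: homs_iff\<close>)

text \<open>Moves associators across an equation; it restores the inverse associators of both the
  crossed and the ordinary hexagons.\<close>

lemma conjugate_inverses:
  assumes a: "inverse_arrows C a u" and b: "inverse_arrows C b v"
    and m: "m \<in> homs C (Cod C a) (Dom C b)" and eq: "(b \<cdot> m) \<cdot> a = n"
  shows "m = v \<cdot> n \<cdot> u"
proof -
  have ah: "a \<in> homs C (Dom C a) (Cod C a)" and uh: "u \<in> homs C (Cod C a) (Dom C a)"
    and bh: "b \<in> homs C (Dom C b) (Cod C b)" and vh: "v \<in> homs C (Cod C b) (Dom C b)"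
    using a b by (auto simp: inverse_arrows_def homs_def)
  have bm: "b \<cdot> m \<in> homs C (Cod C a) (Cod C b)" by (rule comp_homs[OF m bh])
  have "v \<cdot> n \<cdot> u = v \<cdot> (n \<cdot> u)"
    unfolding eq[symmetric] by (rule comp_assoc[OF uh comp_homs[OF ah bm] vh])
  also have "n \<cdot> u = b \<cdot> m"
    unfolding eq[symmetric] using comp_assoc[OF uh ah bm] a comp_id[OF bm] by (simp add: inverse_arrows_def)
  also have "v \<cdot> (b \<cdot> m) = m"
    using comp_assoc[OF m bh vh] b id_comp[OF m] by (simp add: inverse_arrows_def)
  finally show ?thesis by simp
qed

lemma fs_braid_tens_right:
  assumes h: "h \<in> carrier G" and X: "X \<in> grade h" and Y: "Y \<in> fs_ob D" and Z: "Z \<in> fs_ob D"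
  shows "(ActT C h Y Z \<odot> Id C X) \<cdot> fs_braid D h X (fs_tens D Y Z)
    = inv_arrow C (Assoc C (fs_act D h Y) (fs_act D h Z) X)
      \<cdot> (Id C (fs_act D h Y) \<odot> fs_braid D h X Z) \<cdot> Assoc C (fs_act D h Y) X Z
      \<cdot> (fs_braid D h X Y \<odot> Id C Z) \<cdot> inv_arrow C (Assoc C X Y Z)"
proof -
  have ob: "X \<in> fs_ob D" using X by simp
  have m: "(ActT C h Y Z \<odot> Id C X) \<cdot> fs_braid D h X (fs_tens D Y Z)
      \<in> homs C (Cod C (Assoc C X Y Z)) (Dom C (Assoc C (fs_act D h Y) (fs_act D h Z) X))"
    using h ob Y Z by (simp add: homs_iff)
  have c2: "fs_braid D h X Y \<odot> Id C Z \<in> homs C (fs_tens D (fs_tens D X Y) Z) (fs_tens D (fs_tens D (fs_act D h Y) X) Z)"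
    and as: "Assoc C (fs_act D h Y) X Z \<in> homs C (fs_tens D (fs_tens D (fs_act D h Y) X) Z)
      (fs_tens D (fs_act D h Y) (fs_tens D X Z))"
    and c1: "Id C (fs_act D h Y) \<odot> fs_braid D h X Z \<in> homs C (fs_tens D (fs_act D h Y) (fs_tens D X Z))
      (fs_tens D (fs_act D h Y) (fs_tens D (fs_act D h Z) X))"
    and U: "Unassoc (fs_act D h Y) (fs_act D h Z) X \<in> homs C (fs_tens D (fs_act D h Y) (fs_tens D (fs_act D h Z) X))
      (fs_tens D (fs_tens D (fs_act D h Y) (fs_act D h Z)) X)"
    using h ob Y Z by (simp_all add: homs_iff)
  have "Unassoc (fs_act D h Y) (fs_act D h Z) X \<cdot> ((Id C (fs_act D h Y) \<odot> fs_braid D h X Z)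
        \<cdot> Assoc C (fs_act D h Y) X Z \<cdot> (fs_braid D h X Y \<odot> Id C Z))
      = Unassoc (fs_act D h Y) (fs_act D h Z) X \<cdot> (Id C (fs_act D h Y) \<odot> fs_braid D h X Z)
        \<cdot> Assoc C (fs_act D h Y) X Z \<cdot> (fs_braid D h X Y \<odot> Id C Z)"
    using comp_assoc[OF c2 comp_homs[OF as c1] U] comp_assoc[OF as c1 U] by simp
  with conjugate_inverses[OF inverse_Assoc inverse_Assoc m fs_braid_tens_right_assoc[OF h X Y Z]]
  show ?thesis using h ob Y Z by simp
qed

lemma tens_grade:
  assumes "X \<in> grade h" "Y \<in> grade k"
  shows "fs_tens D X Y \<in> grade (h \<otimes>\<^bsub>G\<^esub> k)"
proof -
  have "Sdeg D (snd x) = h \<otimes>\<^bsub>G\<^esub> k" if x: "x \<in> fs_tens D X Y" for x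
  proof -
    from x obtain a b u where ab: "x = (Node a b, u)" "a \<in> X" "b \<in> Y" "u \<in> Fus D (snd a) (snd b)"
      by (metis fs_tensE)
    then show ?thesis
      using deg_fus[of "snd a" "snd b" u] assms lab_ob[of X a] lab_ob[of Y b] by auto
  qed
  then show ?thesis using assms by simp
qed

lemma act_grade:
  assumes h: "h \<in> carrier G" and X: "X \<in> grade k"
  shows "fs_act D h X \<in> grade (h \<otimes>\<^bsub>G\<^esub> k \<otimes>\<^bsub>G\<^esub> inv\<^bsub>G\<^esub> h)"
proof -
  have "Sdeg D (snd x) = h \<otimes>\<^bsub>G\<^esub> k \<otimes>\<^bsub>G\<^esub> inv\<^bsub>G\<^esub> h" if x: "x \<in> fs_act D h X" for x
  proof -
    from x obtain a where a: "a \<in> X" "x = relabel (Sact D h) a" by (auto simp: fs_act_def)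
    then show ?thesis using deg_act[OF h, of "snd a"] X lab_ob[of X a] by simp
  qed
  then show ?thesis using h X by simp
qed

text \<open>The single inverse associator is evaluated through \<open>Unassoc\<close>, which is how
  \<open>Finv\<close> enters \<open>braid_fus_left\<close>.\<close>

lemma fs_braid_tens_left:
  assumes hk: "h \<in> carrier G" "k \<in> carrier G" and X: "X \<in> grade h" and Y: "Y \<in> grade k" and Z: "Z \<in> fs_ob D"
  shows "fs_braid D (h \<otimes>\<^bsub>G\<^esub> k) (fs_tens D X Y) Z
    = Assoc C (fs_act D (h \<otimes>\<^bsub>G\<^esub> k) Z) X Y
      \<cdot> (fs_braid D h X (fs_act D k Z) \<odot> Id C Y) \<cdot> inv_arrow C (Assoc C X (fs_act D k Z) Y)
      \<cdot> (Id C X \<odot> fs_braid D k Y Z) \<cdot> Assoc C X Y Z"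
proof (rule tens_tens_left_homs_eqI[of _ X Y Z "fs_tens D (fs_act D h (fs_act D k Z)) (fs_tens D X Y)"])
  have ob: "X \<in> fs_ob D" "Y \<in> fs_ob D" using X Y by auto
  fix a b t e u \<Phi> assume x: "a \<in> X" "b \<in> Y" "e \<in> Z" "snd a \<in> Slab D" "snd b \<in> Slab D" "snd e \<in> Slab D"
    "t \<in> Slab D" "u \<in> Slab D" "t \<in> Fus D (snd a) (snd b)" "u \<in> Fus D t (snd e)"
  have d: "Sdeg D (snd a) = h" "Sdeg D (snd b) = k" using X Y x by blast+
  have dt: "Sdeg D t = h \<otimes>\<^bsub>G\<^esub> k" using deg_fus[OF x(4,5,9)] d by simp
  show "pull (fs_braid D (h \<otimes>\<^bsub>G\<^esub> k) (fs_tens D X Y) Z) \<Phi> (Node (Node a b, t) e, u)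
    = pull (Assoc C (fs_act D (h \<otimes>\<^bsub>G\<^esub> k) Z) X Y
      \<cdot> (fs_braid D h X (fs_act D k Z) \<odot> Id C Y) \<cdot> inv_arrow C (Assoc C X (fs_act D k Z) Y)
      \<cdot> (Id C X \<odot> fs_braid D k Y Z) \<cdot> Assoc C X Y Z) \<Phi> (Node (Node a b, t) e, u)"
    using hk ob Z x d dt braid_fus_left[OF x(4,5,6,9,10) refl refl,
        of "\<lambda>t'. \<Phi> (Node (relabel (Sact D h) (relabel (Sact D k) e)) (Node a b, t'), u)"]
    by (simp add: fs_act_mult relabel_act_mult)
qed (use hk X Y Z in \<open>simp_all add: homs_iff fs_act_mult\<close>)

lemma iso_twist:
  assumes h: "h \<in> carrier G" and A: "A \<in> grade h"
  shows "iso_arrow C (fs_twist D h A)"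
proof -
  have A': "A \<in> fs_ob D" "\<And>a. a \<in> A \<Longrightarrow> Sdeg D (snd a) = h" "fs_act D h A = A"
    using A fs_act_deg by auto
  define g where "g = block A A (\<lambda>y x. if y = x then inverse (Stwist D (snd x)) else 0)"
  have [simp]: "fdom g = A" "fcod g = A" "fits g"
    by (simp_all add: g_def)
  have [simp]: "pull g \<Phi> a = inverse (Stwist D (snd a)) * \<Phi> a" if "a \<in> A" for \<Phi> a
    unfolding g_def using A'(1) that
    by (subst pull_block_single[where z = a]) (auto split: if_splits)
  have nz: "Stwist D (snd a) \<noteq> 0" if "a \<in> A" for a using that A'(1) lab_ob twist_nonzero by blast
  have "inverse_arrows C (fs_twist D h A) g"
  proof (rule inverse_arrowsI[of _ A A])
    show "g \<cdot> fs_twist D h A = Id C A"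
      by (rule hom_eqI[of _ A A]) (use h A' nz relabel_deg[OF A'(1)] in \<open>simp_all add: homs_iff del: relabel_Pair\<close>)
    show "fs_twist D h A \<cdot> g = Id C A"
      by (rule hom_eqI[of _ A A]) (use h A' nz relabel_deg[OF A'(1)] in \<open>simp_all add: homs_iff del: relabel_Pair\<close>)
  qed (use h A' in \<open>simp_all add: homs_iff\<close>)
  then show ?thesis unfolding iso_arrow_def ..
qed

lemma fs_twist_natural:
  assumes h: "h \<in> carrier G" and X: "X \<in> grade h" "X' \<in> grade h" and f: "f \<in> homs C X X'"
  shows "fs_twist D h X' \<cdot> f = ActM C h f \<cdot> fs_twist D h X"
proof (rule hom_eqI[of _ X "fs_act D h X'"])
  fix a \<Phi> assume a: "a \<in> X"
  show "pull (fs_twist D h X' \<cdot> f) \<Phi> a = pull (ActM C h f \<cdot> fs_twist D h X) \<Phi> a"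
    using h X f a by (simp add: homs_iff pull_scale)
qed (use h X f in \<open>simp_all add: homs_iff\<close>)

lemma fs_twist_unit: "fs_twist D \<one>\<^bsub>G\<^esub> (simple_sum (Sunit D)) = Id C (simple_sum (Sunit D))"
proof (rule hom_eqI[of _ "simple_sum (Sunit D)" "simple_sum (Sunit D)"])
  fix a \<Phi> assume "a \<in> simple_sum (Sunit D)"
  then have a: "a = (Leaf 0, Sunit D)" by simp
  have "pull (fs_twist D \<one>\<^bsub>G\<^esub> (simple_sum (Sunit D))) \<Phi> a = Stwist D (snd a) * \<Phi> (relabel (Sact D \<one>\<^bsub>G\<^esub>) a)"
    by (rule pull_twist) (simp_all add: a deg_unit)
  then show "pull (fs_twist D \<one>\<^bsub>G\<^esub> (simple_sum (Sunit D))) \<Phi> a = pull (Id C (simple_sum (Sunit D))) \<Phi> a"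
    by (simp add: a twist_unit_label act_unit_label)
qed (simp_all add: homs_iff)

lemma fs_twist_tens:
  assumes hk: "h \<in> carrier G" "k \<in> carrier G" and X: "X \<in> grade h" and Y: "Y \<in> grade k"
  shows "ActT C (h \<otimes>\<^bsub>G\<^esub> k) X Y \<cdot> fs_twist D (h \<otimes>\<^bsub>G\<^esub> k) (fs_tens D X Y)
    = (ActM C (h \<otimes>\<^bsub>G\<^esub> k \<otimes>\<^bsub>G\<^esub> inv\<^bsub>G\<^esub> h) (fs_twist D h X) \<odot> ActM C h (fs_twist D k Y))
      \<cdot> fs_braid D (h \<otimes>\<^bsub>G\<^esub> k \<otimes>\<^bsub>G\<^esub> inv\<^bsub>G\<^esub> h) (fs_act D h Y) X \<cdot> fs_braid D h X Y"
proof (rule tens_homs_eqI[of _ X Y "fs_tens D (fs_act D (h \<otimes>\<^bsub>G\<^esub> k) X) (fs_act D (h \<otimes>\<^bsub>G\<^esub> k) Y)"])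
  have ob: "X \<in> fs_ob D" "Y \<in> fs_ob D" using X Y by auto
  show "(ActM C (h \<otimes>\<^bsub>G\<^esub> k \<otimes>\<^bsub>G\<^esub> inv\<^bsub>G\<^esub> h) (fs_twist D h X) \<odot> ActM C h (fs_twist D k Y))
      \<cdot> fs_braid D (h \<otimes>\<^bsub>G\<^esub> k \<otimes>\<^bsub>G\<^esub> inv\<^bsub>G\<^esub> h) (fs_act D h Y) X \<cdot> fs_braid D h X Y
    \<in> homs C (fs_tens D X Y) (fs_tens D (fs_act D (h \<otimes>\<^bsub>G\<^esub> k) X) (fs_act D (h \<otimes>\<^bsub>G\<^esub> k) Y))"
    using hk ob by (simp add: homs_iff fs_act_mult)
  fix a b u \<Phi> assume x: "a \<in> X" "b \<in> Y" "snd a \<in> Slab D" "snd b \<in> Slab D" "u \<in> Slab D"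
    "u \<in> Fus D (snd a) (snd b)"
  have d: "Sdeg D (snd a) = h" "Sdeg D (snd b) = k" using X Y x by blast+
  have du: "Sdeg D u = h \<otimes>\<^bsub>G\<^esub> k" using deg_fus[OF x(3,4,6)] d by simp
  have "pull (ActT C (h \<otimes>\<^bsub>G\<^esub> k) X Y \<cdot> fs_twist D (h \<otimes>\<^bsub>G\<^esub> k) (fs_tens D X Y)) \<Phi> (Node a b, u)
      = Stwist D u * (Stau D (h \<otimes>\<^bsub>G\<^esub> k) (snd a) (snd b) u
          * \<Phi> (Node (relabel (Sact D (h \<otimes>\<^bsub>G\<^esub> k)) a) (relabel (Sact D (h \<otimes>\<^bsub>G\<^esub> k)) b), Sact D (h \<otimes>\<^bsub>G\<^esub> k) u))"
    using hk ob x du by simp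
  moreover have "Sact D (h \<otimes>\<^bsub>G\<^esub> k) u = u" using act_deg[OF x(5)] du by simp
  moreover have "pull ((ActM C (h \<otimes>\<^bsub>G\<^esub> k \<otimes>\<^bsub>G\<^esub> inv\<^bsub>G\<^esub> h) (fs_twist D h X) \<odot> ActM C h (fs_twist D k Y))
      \<cdot> fs_braid D (h \<otimes>\<^bsub>G\<^esub> k \<otimes>\<^bsub>G\<^esub> inv\<^bsub>G\<^esub> h) (fs_act D h Y) X \<cdot> fs_braid D h X Y) \<Phi> (Node a b, u)
    = Sbraid D (snd a) (snd b) u * (Sbraid D (Sact D h (snd b)) (snd a) u * (Stwist D (snd a) * (Stwist D (snd b)
        * \<Phi> (Node (relabel (Sact D (h \<otimes>\<^bsub>G\<^esub> k \<otimes>\<^bsub>G\<^esub> inv\<^bsub>G\<^esub> h)) (relabel (Sact D h) a))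
            (relabel (Sact D h) (relabel (Sact D k) b)), u))))"
    using hk ob x d by (simp add: deg_act)
  ultimately show "pull (ActT C (h \<otimes>\<^bsub>G\<^esub> k) X Y \<cdot> fs_twist D (h \<otimes>\<^bsub>G\<^esub> k) (fs_tens D X Y)) \<Phi> (Node a b, u)
    = pull ((ActM C (h \<otimes>\<^bsub>G\<^esub> k \<otimes>\<^bsub>G\<^esub> inv\<^bsub>G\<^esub> h) (fs_twist D h X) \<odot> ActM C h (fs_twist D k Y))
      \<cdot> fs_braid D (h \<otimes>\<^bsub>G\<^esub> k \<otimes>\<^bsub>G\<^esub> inv\<^bsub>G\<^esub> h) (fs_act D h Y) X \<cdot> fs_braid D h X Y) \<Phi> (Node a b, u)"
    using twist_fus[OF x(3,4,6)] hk x d du by (simp add: relabel_act_mult mult.assoc[symmetric])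
qed (use hk X Y in \<open>simp_all add: homs_iff\<close>)

lemma fs_twist_act:
  assumes hk: "h \<in> carrier G" "k \<in> carrier G" and Y: "Y \<in> grade k"
  shows "ActM C h (fs_twist D k Y) = fs_twist D (h \<otimes>\<^bsub>G\<^esub> k \<otimes>\<^bsub>G\<^esub> inv\<^bsub>G\<^esub> h) (fs_act D h Y)"
proof (rule act_homs_eqI[of _ h Y "fs_act D h (fs_act D k Y)"])
  have ob: "Y \<in> fs_ob D" using Y by simp
  show "fs_twist D (h \<otimes>\<^bsub>G\<^esub> k \<otimes>\<^bsub>G\<^esub> inv\<^bsub>G\<^esub> h) (fs_act D h Y) \<in> homs C (fs_act D h Y) (fs_act D h (fs_act D k Y))"
    using hk ob by (simp add: homs_iff fs_act_mult)
  fix a \<Phi> assume a: "a \<in> Y" "snd a \<in> Slab D"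
  have d: "Sdeg D (snd a) = k" using Y a by blast
  have "pull (fs_twist D (h \<otimes>\<^bsub>G\<^esub> k \<otimes>\<^bsub>G\<^esub> inv\<^bsub>G\<^esub> h) (fs_act D h Y)) \<Phi> (relabel (Sact D h) a)
      = Stwist D (snd a) * \<Phi> (relabel (Sact D (h \<otimes>\<^bsub>G\<^esub> k \<otimes>\<^bsub>G\<^esub> inv\<^bsub>G\<^esub> h)) (relabel (Sact D h) a))"
    using hk ob a d by (simp add: deg_act twist_act_label)
  moreover have "pull (ActM C h (fs_twist D k Y)) \<Phi> (relabel (Sact D h) a)
      = Stwist D (snd a) * \<Phi> (relabel (Sact D h) (relabel (Sact D k) a))"
    using hk ob a d by simp
  ultimately show "pull (ActM C h (fs_twist D k Y)) \<Phi> (relabel (Sact D h) a)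
      = pull (fs_twist D (h \<otimes>\<^bsub>G\<^esub> k \<otimes>\<^bsub>G\<^esub> inv\<^bsub>G\<^esub> h) (fs_act D h Y)) \<Phi> (relabel (Sact D h) a)"
    using hk a by (simp add: relabel_act_mult)
qed (use hk Y in \<open>simp_all add: homs_iff\<close>)

text \<open>The unit is a channel of a label times its dual, so the two degrees multiply to the
  neutral element.\<close>

lemma deg_dual:
  assumes "a \<in> Slab D"
  shows "Sdeg D (Sdual D a) = inv\<^bsub>G\<^esub> (Sdeg D a)"
  using deg_fus[OF assms dual_label[OF assms] unit_fus_dual[OF assms]] assms
  by (metis deg_unit deg_carrier dual_label inv_equality inv_comm)

text \<open>Summands of degree \<open>h\<close> are fixed by \<open>h\<close> and by its inverse.
  Both sides then become the same sum over the summands of \<open>X\<close>, and comparing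
  coefficients is \<open>twist_dual\<close>.\<close>

lemma fs_ribbon:
  assumes h: "h \<in> carrier G" and X: "X \<in> grade h"
  shows "(Id C X \<odot> fs_twist D (inv\<^bsub>G\<^esub> h) (relabel (Sdual D) ` X)) \<cdot> Coev C X
    = ActT C (inv\<^bsub>G\<^esub> h) (fs_act D h X) (relabel (Sdual D) ` X)
      \<cdot> ActM C (inv\<^bsub>G\<^esub> h) (fs_twist D h X \<odot> Id C (relabel (Sdual D) ` X)) \<cdot> ActM C (inv\<^bsub>G\<^esub> h) (Coev C X)"
proof (rule hom_eqI[of _ "simple_sum (Sunit D)" "fs_tens D X (fs_act D (inv\<^bsub>G\<^esub> h) (relabel (Sdual D) ` X))"])
  have ob: "X \<in> fs_ob D" using X by simp
  have i: "inv\<^bsub>G\<^esub> h \<in> carrier G" using h by simp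
  let ?X' = "relabel (Sdual D) ` X"
  show "ActT C (inv\<^bsub>G\<^esub> h) (fs_act D h X) ?X'
      \<cdot> ActM C (inv\<^bsub>G\<^esub> h) (fs_twist D h X \<odot> Id C ?X') \<cdot> ActM C (inv\<^bsub>G\<^esub> h) (Coev C X)
      \<in> homs C (simple_sum (Sunit D)) (fs_tens D X (fs_act D (inv\<^bsub>G\<^esub> h) ?X'))"
    using h ob by (simp add: homs_iff)
  fix x \<Phi> assume "x \<in> simple_sum (Sunit D)"
  then have x: "x = (Leaf 0, Sunit D)" by simp
  have lab: "snd a \<in> Slab D" "Sdeg D (snd a) = h" "Sdeg D (Sdual D (snd a)) = inv\<^bsub>G\<^esub> h"
    "relabel (Sact D h) a = a" "relabel (Sact D (inv\<^bsub>G\<^esub> h)) a = a" if "a \<in> X" for a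
  proof -
    show l: "snd a \<in> Slab D" and d: "Sdeg D (snd a) = h" using that X lab_ob[OF ob that] by auto
    show "Sdeg D (Sdual D (snd a)) = inv\<^bsub>G\<^esub> h" using deg_dual l d by simp
    show r: "relabel (Sact D h) a = a" using relabel_deg ob that d by simp
    show "relabel (Sact D (inv\<^bsub>G\<^esub> h)) a = a" using relabel_inv_act[OF h l] r by simp
  qed
  have "pull ((Id C X \<odot> fs_twist D (inv\<^bsub>G\<^esub> h) ?X') \<cdot> Coev C X) \<Phi> x
      = (\<Sum>a\<in>X. Stwist D (Sdual D (snd a))
          * \<Phi> (Node a (relabel (Sact D (inv\<^bsub>G\<^esub> h)) (relabel (Sdual D) a)), Sunit D))"
    using h i ob by (simp add: x lab unit_fus_dual)
  \<comment> \<open>The unit summand is written as its own relabelling, because \<open>ActM\<close>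
    is evaluated at relabelled summands only.\<close>
  moreover have "pull (ActT C (inv\<^bsub>G\<^esub> h) (fs_act D h X) ?X'
      \<cdot> ActM C (inv\<^bsub>G\<^esub> h) (fs_twist D h X \<odot> Id C ?X') \<cdot> ActM C (inv\<^bsub>G\<^esub> h) (Coev C X)) \<Phi>
        (relabel (Sact D (inv\<^bsub>G\<^esub> h)) x)
      = (\<Sum>a\<in>X. Stwist D (snd a) * (Stau D (inv\<^bsub>G\<^esub> h) (snd a) (Sdual D (snd a)) (Sunit D)
          * \<Phi> (Node a (relabel (Sact D (inv\<^bsub>G\<^esub> h)) (relabel (Sdual D) a)), Sact D (inv\<^bsub>G\<^esub> h) (Sunit D))))"
    using h i ob fs_act_deg[OF X] by (simp add: x lab unit_fus_dual)
  ultimately show "pull ((Id C X \<odot> fs_twist D (inv\<^bsub>G\<^esub> h) ?X') \<cdot> Coev C X) \<Phi> x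
    = pull (ActT C (inv\<^bsub>G\<^esub> h) (fs_act D h X) ?X'
      \<cdot> ActM C (inv\<^bsub>G\<^esub> h) (fs_twist D h X \<odot> Id C ?X') \<cdot> ActM C (inv\<^bsub>G\<^esub> h) (Coev C X)) \<Phi> x"
    using i by (simp add: x act_unit_label) (rule sum.cong[OF refl], simp add: twist_dual lab mult.assoc)
qed (use h X in \<open>simp_all add: homs_iff\<close>)

end

section \<open>Grading and the crossed ribbon fusion category\<close>

locale formal_crossed_category = formal_crossed G D Finv C
  for G :: "('g, 'b) monoid_scheme" and D :: "('g, 's) table"
    and Finv :: "'s \<Rightarrow> 's \<Rightarrow> 's \<Rightarrow> 's \<Rightarrow> 's \<Rightarrow> 's \<Rightarrow> complex"
    and C :: "('g, 's fob, 's farr, 'e) crossed_category_scheme" (structure) +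
  assumes Grade_eq: "Grade C = (\<lambda>h. {A \<in> fs_ob D. \<forall>a\<in>A. Sdeg D (snd a) = h})"
    and Braid_eq: "Braid C = fs_braid D"
    and Twist_eq: "Twist C = fs_twist D"
    and deg_surj: "h \<in> carrier G \<Longrightarrow> \<exists>a\<in>Slab D. Sdeg D a = h"
begin

text \<open>The diagonal entry 1 at a summand \<open>a\<close> is a sum of contributions passing
  through the \<open>F k\<close>; a nonzero one passes through a summand with the same label, whose
  degree is known.\<close>

lemma grade_summand:
  assumes ds: "is_direct_sum C A n F i p" and F: "\<And>k. k < n \<Longrightarrow> F k \<in> grade h"
  shows "A \<in> grade h"
proof -
  have A: "A \<in> fs_ob D" using ds by (simp add: is_direct_sum_def)
  have ip: "i k \<in> homs C (F k) A \<and> p k \<in> homs C A (F k)" if "k < n" for k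
    using ds that by (simp add: is_direct_sum_def)
  have "Sdeg D (snd a) = h" if a: "a \<in> A" for a
  proof -
    have "entry (msum C A A (\<lambda>k. i k \<cdot> p k) n) a a = (\<Sum>k<n. entry (i k \<cdot> p k) a a)"
      by (rule entry_msum[OF A A]) (use ip comp_homs in blast)
    moreover have "entry (msum C A A (\<lambda>k. i k \<cdot> p k) n) a a = 1"
      using ds a by (simp add: is_direct_sum_def Id_eq entry_block)
    ultimately have "(\<Sum>k<n. entry (i k \<cdot> p k) a a) \<noteq> 0" by simp
    then obtain k where k: "k < n" "entry (i k \<cdot> p k) a a \<noteq> 0"
      by (meson lessThan_iff sum.not_neutral_contains_not_neutral)
    have "entry (i k \<cdot> p k) a a = (\<Sum>y \<in> F k. entry (i k) a y * entry (p k) y a)"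
      using ip[OF k(1)] unfolding homs_iff by (simp add: entry_Comp)
    with k(2) have "(\<Sum>y \<in> F k. entry (i k) a y * entry (p k) y a) \<noteq> 0" by simp
    then obtain y where "y \<in> F k" "entry (i k) a y * entry (p k) y a \<noteq> 0"
      by (meson sum.not_neutral_contains_not_neutral)
    then have y: "y \<in> F k" "entry (p k) y a \<noteq> 0" by auto
    then have "snd y = snd a" using fitsD[of "p k" y a] ip[OF k(1)] by (auto simp: homs_iff)
    then show ?thesis using F[OF k(1)] y(1) by force
  qed
  then show ?thesis using A by simp
qed

sublocale crossed_ribbon_fusion_category G C
proof
  fix h k X X' Y Y' Z A B f f' n F i p
  show "h \<in> carrier G \<Longrightarrow> Grade C h \<subseteq> Ob C" by (auto simp: Grade_eq)
  show "f = Zero C A B" if "h \<noteq> k" "A \<in> Grade C h" "B \<in> Grade C k" and f: "f \<in> homs C A B"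
  proof (rule entry_eqI[OF f zero_homs])
    fix y x assume "y \<in> B" "x \<in> A" "snd y = snd x"
    then have False using that by (auto simp: Grade_eq)
    then show "entry f y x = entry (Zero C A B) y x" ..
  qed (use that in \<open>auto simp: Grade_eq\<close>)
  show "\<exists>n F i p. is_direct_sum C A n F i p \<and> (\<forall>k<n. \<exists>h \<in> carrier G. F k \<in> Grade C h)" if A: "A \<in> Ob C"
  proof -
    obtain n F i p where ds: "is_direct_sum C A n F i p" "\<forall>k<n. \<exists>a\<in>A. F k = {a}"
      using ex_direct_sum_singletons[of A] A by auto
    have "\<exists>h \<in> carrier G. F k \<in> Grade C h" if k: "k < n" for k
    proof -
      obtain a where a: "a \<in> A" "F k = {a}" using ds(2) k by blast
      then have "snd a \<in> Slab D" using A lab_ob by simp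
      then show ?thesis using a deg_carrier by (auto simp: Grade_eq)
    qed
    with ds(1) show ?thesis by blast
  qed
  show "A \<in> Grade C h" if ds: "is_direct_sum C A n F i p" and F: "\<And>k. k < n \<Longrightarrow> F k \<in> Grade C h"
  proof -
    have "F k \<in> grade h" if "k < n" for k using F[OF that] unfolding Grade_eq .
    then have "A \<in> grade h" by (rule grade_summand[OF ds])
    then show ?thesis unfolding Grade_eq .
  qed
  show "\<exists>A \<in> Grade C h. \<not> zero_object C A" if h: "h \<in> carrier G"
  proof -
    obtain a where "a \<in> Slab D" "Sdeg D a = h" using deg_surj[OF h] by blast
    then show ?thesis by (intro bexI[of _ "simple_sum a"]) (auto simp: Grade_eq zero_object_iff simple_sum_def)
  qed
  show "Unit C \<in> Grade C \<one>\<^bsub>G\<^esub>" by (simp add: Grade_eq deg_unit)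
  show "\<lbrakk>h \<in> carrier G; k \<in> carrier G; A \<in> Grade C h; B \<in> Grade C k\<rbrakk> \<Longrightarrow> A \<boxtimes> B \<in> Grade C (h \<otimes>\<^bsub>G\<^esub> k)"
    using tens_grade[of A h B k] unfolding Grade_eq Tens_eq by simp
  show "\<lbrakk>h \<in> carrier G; k \<in> carrier G; A \<in> Grade C k\<rbrakk>
      \<Longrightarrow> Act C h A \<in> Grade C (h \<otimes>\<^bsub>G\<^esub> k \<otimes>\<^bsub>G\<^esub> inv\<^bsub>G\<^esub> h)"
    using act_grade[of h A k] unfolding Grade_eq Act_eq by simp
  show "\<lbrakk>h \<in> carrier G; X \<in> Grade C h; Y \<in> Ob C\<rbrakk> \<Longrightarrow> Braid C h X Y \<in> homs C (X \<boxtimes> Y) (Act C h Y \<boxtimes> X)"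
    using fs_braid_homs[of h X Y] by (simp add: Grade_eq Braid_eq)
  show "\<lbrakk>h \<in> carrier G; X \<in> Grade C h; Y \<in> Ob C\<rbrakk> \<Longrightarrow> iso_arrow C (Braid C h X Y)"
    using iso_braid[of h X Y] by (simp add: Grade_eq Braid_eq)
  show "\<lbrakk>h \<in> carrier G; X \<in> Grade C h; X' \<in> Grade C h; f \<in> homs C X X'; f' \<in> homs C Y Y'\<rbrakk>
      \<Longrightarrow> Braid C h X' Y' \<cdot> (f \<odot> f') = (ActM C h f' \<odot> f) \<cdot> Braid C h X Y"
    using fs_braid_natural[of h X X' f f' Y Y'] unfolding Grade_eq Braid_eq by simp
  show "\<lbrakk>h \<in> carrier G; k \<in> carrier G; X \<in> Grade C h; Y \<in> Ob C\<rbrakk>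
      \<Longrightarrow> ActT C k (Act C h Y) X \<cdot> ActM C k (Braid C h X Y)
        = Braid C (k \<otimes>\<^bsub>G\<^esub> h \<otimes>\<^bsub>G\<^esub> inv\<^bsub>G\<^esub> k) (Act C k X) (Act C k Y) \<cdot> ActT C k X Y"
    using fs_braid_act[of h k X Y] unfolding Grade_eq Braid_eq by simp
  show "\<lbrakk>h \<in> carrier G; X \<in> Grade C h; Y \<in> Ob C; Z \<in> Ob C\<rbrakk>
          \<Longrightarrow> (ActT C h Y Z \<odot> Id C X) \<cdot> Braid C h X (Y \<boxtimes> Z)
             = inv_arrow C (Assoc C (Act C h Y) (Act C h Z) X)
               \<cdot> (Id C (Act C h Y) \<odot> Braid C h X Z) \<cdot> Assoc C (Act C h Y) X Z
               \<cdot> (Braid C h X Y \<odot> Id C Z) \<cdot> inv_arrow C (Assoc C X Y Z)"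
    using fs_braid_tens_right[of h X Y Z] unfolding Grade_eq Braid_eq by simp
  show "\<lbrakk>h \<in> carrier G; k \<in> carrier G; X \<in> Grade C h; Y \<in> Grade C k; Z \<in> Ob C\<rbrakk>
          \<Longrightarrow> Braid C (h \<otimes>\<^bsub>G\<^esub> k) (X \<boxtimes> Y) Z
             = Assoc C (Act C (h \<otimes>\<^bsub>G\<^esub> k) Z) X Y
               \<cdot> (Braid C h X (Act C k Z) \<odot> Id C Y) \<cdot> inv_arrow C (Assoc C X (Act C k Z) Y)
               \<cdot> (Id C X \<odot> Braid C k Y Z) \<cdot> Assoc C X Y Z"
    using fs_braid_tens_left[of h k X Y Z] unfolding Grade_eq Braid_eq by simp
  show "\<lbrakk>h \<in> carrier G; X \<in> Grade C h\<rbrakk> \<Longrightarrow> Twist C h X \<in> homs C X (Act C h X)"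
    by (simp add: Grade_eq Twist_eq homs_iff)
  show "\<lbrakk>h \<in> carrier G; X \<in> Grade C h\<rbrakk> \<Longrightarrow> iso_arrow C (Twist C h X)"
    using iso_twist[of h X] by (simp add: Grade_eq Twist_eq)
  show "\<lbrakk>h \<in> carrier G; X \<in> Grade C h; X' \<in> Grade C h; f \<in> homs C X X'\<rbrakk>
          \<Longrightarrow> Twist C h X' \<cdot> f = ActM C h f \<cdot> Twist C h X"
    using fs_twist_natural[of h X X' f] unfolding Grade_eq Twist_eq by simp
  show "Twist C \<one>\<^bsub>G\<^esub> (Unit C) = Id C (Unit C)"
    using fs_twist_unit by (simp add: Twist_eq)
  show "\<lbrakk>h \<in> carrier G; k \<in> carrier G; X \<in> Grade C h; Y \<in> Grade C k\<rbrakk>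
          \<Longrightarrow> ActT C (h \<otimes>\<^bsub>G\<^esub> k) X Y \<cdot> Twist C (h \<otimes>\<^bsub>G\<^esub> k) (X \<boxtimes> Y)
             = (ActM C (h \<otimes>\<^bsub>G\<^esub> k \<otimes>\<^bsub>G\<^esub> inv\<^bsub>G\<^esub> h) (Twist C h X) \<odot> ActM C h (Twist C k Y))
               \<cdot> Braid C (h \<otimes>\<^bsub>G\<^esub> k \<otimes>\<^bsub>G\<^esub> inv\<^bsub>G\<^esub> h) (Act C h Y) X \<cdot> Braid C h X Y"
    using fs_twist_tens[of h k X Y] unfolding Grade_eq Twist_eq Braid_eq by simp
  show "\<lbrakk>h \<in> carrier G; k \<in> carrier G; Y \<in> Grade C k\<rbrakk>
          \<Longrightarrow> ActM C h (Twist C k Y) = Twist C (h \<otimes>\<^bsub>G\<^esub> k \<otimes>\<^bsub>G\<^esub> inv\<^bsub>G\<^esub> h) (Act C h Y)"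
    using fs_twist_act[of h k Y] unfolding Grade_eq Twist_eq by simp
  show "\<lbrakk>h \<in> carrier G; X \<in> Grade C h\<rbrakk>
          \<Longrightarrow> (Id C X \<odot> Twist C (inv\<^bsub>G\<^esub> h) (Dual C X)) \<cdot> Coev C X
             = ActT C (inv\<^bsub>G\<^esub> h) (Act C h X) (Dual C X)
               \<cdot> ActM C (inv\<^bsub>G\<^esub> h) (Twist C h X \<odot> Id C (Dual C X)) \<cdot> ActM C (inv\<^bsub>G\<^esub> h) (Coev C X)"
    using fs_ribbon[of h X] unfolding Grade_eq Twist_eq by simp
qed

end

section \<open>Traces and quantum dimensions\<close>

context formal_crossed
begin

text \<open>Endomorphisms of the unit determine their scalar, so the definite descriptions in
  \<open>quantum_dim\<close> and \<open>ribbon_trace\<close> can be resolved.\<close>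

lemma unit_scalar_unique:
  "(THE d. c \<star> Id C (simple_sum (Sunit D)) = d \<star> Id C (simple_sum (Sunit D))) = c"
proof (rule the_equality)
  show "c \<star> Id C (simple_sum (Sunit D)) = c \<star> Id C (simple_sum (Sunit D))" ..
  fix d assume "c \<star> Id C (simple_sum (Sunit D)) = d \<star> Id C (simple_sum (Sunit D))"
  then have "pull (c \<star> Id C (simple_sum (Sunit D))) (\<lambda>_. 1) (Leaf 0, Sunit D)
      = pull (d \<star> Id C (simple_sum (Sunit D))) (\<lambda>_. 1) (Leaf 0, Sunit D)" by simp
  then show "d = c" by simp
qed

text \<open>The endomorphism \<open>f\<close> is left open: with the twist it gives the quantum
  dimension, and with the twist after a double braiding it gives an entry of the S-matrix.\<close>

lemma trace_single:
  assumes h: "h \<in> carrier G" and x: "snd x \<in> Slab D" "Sdeg D (snd x) = h"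
    and f: "f \<in> homs C {x} {x}" and pull_f: "\<And>\<Phi>. pull f \<Phi> x = c * \<Phi> x"
  shows "Ev C {x} \<cdot> fs_braid D h {x} (relabel (Sdual D) ` {x})
      \<cdot> (f \<odot> Id C (relabel (Sdual D) ` {x})) \<cdot> Coev C {x}
    = (c * (Sbraid D (snd x) (Sdual D (snd x)) (Sunit D) * Sev D (snd x))) \<star> Id C (simple_sum (Sunit D))"
proof -
  let ?y = "relabel (Sdual D) x"
  have ob: "{x} \<in> fs_ob D" "{?y} \<in> fs_ob D" using x dual_label by auto
  \<comment> \<open>The dual summand is fixed by its own degree, the inverse of \<open>h\<close>,
    and hence by \<open>h\<close> itself; this is what makes the composite well typed.\<close>
  have "Sdeg D (snd ?y) = inv\<^bsub>G\<^esub> h" using deg_dual x by simp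
  then have "relabel (Sact D (inv\<^bsub>G\<^esub> h)) ?y = ?y" using relabel_deg[OF ob(2)] by simp
  then have y: "relabel (Sact D h) ?y = ?y"
    using relabel_inv_act[of "inv\<^bsub>G\<^esub> h" ?y] h x dual_label by simp
  then have act: "fs_act D h {?y} = {?y}" by (simp add: fs_act_def)
  have [simp]: "fdom f = {x}" "fcod f = {x}" "fits f" using f by (auto simp: homs_iff)
  show ?thesis
  proof (rule hom_eqI[of _ "simple_sum (Sunit D)" "simple_sum (Sunit D)"])
    fix z \<Phi> assume "z \<in> simple_sum (Sunit D)"
    then have z: "z = (Leaf 0, Sunit D)" by simp
    show "pull (Ev C {x} \<cdot> fs_braid D h {x} (relabel (Sdual D) ` {x})
      \<cdot> (f \<odot> Id C (relabel (Sdual D) ` {x})) \<cdot> Coev C {x}) \<Phi> z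
    = pull ((c * (Sbraid D (snd x) (Sdual D (snd x)) (Sunit D) * Sev D (snd x))) \<star> Id C (simple_sum (Sunit D))) \<Phi> z"
      using h x ob y act pull_f by (simp add: z unit_fus_dual dual_unit_label)
  qed (use h ob act in \<open>simp_all add: homs_iff\<close>)
qed

end

context formal_crossed_category
begin

lemma quantum_dim_single:
  assumes h: "h \<in> carrier G" and x: "snd x \<in> Slab D" "Sdeg D (snd x) = h"
  shows "quantum_dim C h {x}
    = Stwist D (snd x) * (Sbraid D (snd x) (Sdual D (snd x)) (Sunit D) * Sev D (snd x))"
proof -
  have ob: "{x} \<in> fs_ob D" using x by simp
  have act: "fs_act D h {x} = {x}" using fs_act_deg[of "{x}" h] x by simp
  have tw: "fs_twist D h {x} \<in> homs C {x} {x}" using h ob act by (simp add: homs_iff)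
  have "pull (fs_twist D h {x}) \<Phi> x = Stwist D (snd x) * \<Phi> x" for \<Phi>
    using h ob x relabel_deg[OF ob, of x h] by simp
  from trace_single[OF h x tw this] show ?thesis
    unfolding quantum_dim_def by (simp add: Braid_eq Twist_eq unit_scalar_unique)
qed

end

section \<open>Braided and modular categories in trivial degree\<close>

text \<open>All labels sit in the neutral degree, where the acting element is the identity. The
  crossed axioms at that element become the ordinary braiding, twist and ribbon axioms, while the
  whole group still acts.\<close>

locale formal_braided_category = formal_crossed G D Finv C
  for G :: "('g, 'b) monoid_scheme" and D :: "('g, 's) table"
    and Finv :: "'s \<Rightarrow> 's \<Rightarrow> 's \<Rightarrow> 's \<Rightarrow> 's \<Rightarrow> 's \<Rightarrow> complex"
    and C :: "('g, 's fob, 's farr, 'e) braided_category_scheme" (structure) +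
  assumes Brd_eq: "Brd C = fs_braid D \<one>\<^bsub>G\<^esub>"
    and Twi_eq: "Twi C = fs_twist D \<one>\<^bsub>G\<^esub>"
    and deg_one: "a \<in> Slab D \<Longrightarrow> Sdeg D a = \<one>\<^bsub>G\<^esub>"
begin

lemma grade_one: "A \<in> fs_ob D \<Longrightarrow> A \<in> grade \<one>\<^bsub>G\<^esub>"
  using lab_ob deg_one by auto

lemma actt_one': "A \<in> fs_ob D \<Longrightarrow> B \<in> fs_ob D \<Longrightarrow> ActT C \<one>\<^bsub>G\<^esub> A B = Id C (fs_tens D A B)"
  using actt_one[of A B] by simp

sublocale braided_tensor_category_with_action G C
proof
  fix h X X' Y Y' Z f f'
  show "\<lbrakk>X \<in> Ob C; Y \<in> Ob C\<rbrakk> \<Longrightarrow> Brd C X Y \<in> homs C (X \<boxtimes> Y) (Y \<boxtimes> X)"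
    by (simp add: Brd_eq homs_iff)
  show "\<lbrakk>X \<in> Ob C; Y \<in> Ob C\<rbrakk> \<Longrightarrow> iso_arrow C (Brd C X Y)"
    using iso_braid[OF _ grade_one] by (simp add: Brd_eq)
  show "Brd C X' Y' \<cdot> (f \<odot> f') = (f' \<odot> f) \<cdot> Brd C X Y" if f: "f \<in> homs C X X'" and f': "f' \<in> homs C Y Y'"
    using fs_braid_natural[OF one_closed grade_one grade_one f f'] f f' actm_one[of f']
    by (simp add: Brd_eq homs_iff Arr_eq)
  show "Assoc C Y Z X \<cdot> Brd C X (Y \<boxtimes> Z) \<cdot> Assoc C X Y Z
      = (Id C Y \<odot> Brd C X Z) \<cdot> Assoc C Y X Z \<cdot> (Brd C X Y \<odot> Id C Z)"
    if ob: "X \<in> Ob C" "Y \<in> Ob C" "Z \<in> Ob C"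
  proof -
    have "(ActT C \<one>\<^bsub>G\<^esub> Y Z \<odot> Id C X) \<cdot> fs_braid D \<one>\<^bsub>G\<^esub> X (fs_tens D Y Z) = fs_braid D \<one>\<^bsub>G\<^esub> X (fs_tens D Y Z)"
      using ob tensm_id[of "fs_tens D Y Z" X]
        id_comp[of "fs_braid D \<one>\<^bsub>G\<^esub> X (fs_tens D Y Z)" "fs_tens D X (fs_tens D Y Z)" "fs_tens D (fs_tens D Y Z) X"]
      by (simp add: actt_one' homs_iff)
    then show ?thesis
      using fs_braid_tens_right_assoc[OF one_closed grade_one, of X Y Z] ob by (simp add: Brd_eq)
  qed
  show "inv_arrow C (Assoc C Z X Y) \<cdot> Brd C (X \<boxtimes> Y) Z \<cdot> inv_arrow C (Assoc C X Y Z)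
      = (Brd C X Z \<odot> Id C Y) \<cdot> inv_arrow C (Assoc C X Z Y) \<cdot> (Id C X \<odot> Brd C Y Z)"
    if ob: "X \<in> Ob C" "Y \<in> Ob C" "Z \<in> Ob C"
  proof -
    let ?n = "(fs_braid D \<one>\<^bsub>G\<^esub> X Z \<odot> Id C Y) \<cdot> Unassoc X Z Y \<cdot> (Id C X \<odot> fs_braid D \<one>\<^bsub>G\<^esub> Y Z)"
    have n: "?n \<in> homs C (fs_tens D X (fs_tens D Y Z)) (fs_tens D (fs_tens D Z X) Y)"
      using ob by (simp add: homs_iff)
    have c1: "fs_braid D \<one>\<^bsub>G\<^esub> X Z \<odot> Id C Y \<in> homs C (fs_tens D (fs_tens D X Z) Y) (fs_tens D (fs_tens D Z X) Y)"
      and U: "Unassoc X Z Y \<in> homs C (fs_tens D X (fs_tens D Z Y)) (fs_tens D (fs_tens D X Z) Y)"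
      and c2: "Id C X \<odot> fs_braid D \<one>\<^bsub>G\<^esub> Y Z \<in> homs C (fs_tens D X (fs_tens D Y Z)) (fs_tens D X (fs_tens D Z Y))"
      and a: "Assoc C Z X Y \<in> homs C (fs_tens D (fs_tens D Z X) Y) (fs_tens D Z (fs_tens D X Y))"
      using ob by (simp_all add: homs_iff)
    have "fs_braid D \<one>\<^bsub>G\<^esub> (fs_tens D X Y) Z = Assoc C Z X Y \<cdot> (fs_braid D \<one>\<^bsub>G\<^esub> X Z \<odot> Id C Y)
        \<cdot> Unassoc X Z Y \<cdot> (Id C X \<odot> fs_braid D \<one>\<^bsub>G\<^esub> Y Z) \<cdot> Assoc C X Y Z"
      using fs_braid_tens_left[OF one_closed one_closed grade_one grade_one, of X Y Z] ob by simp
    also have "\<dots> = Assoc C Z X Y \<cdot> ?n \<cdot> Assoc C X Y Z"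
      using comp_assoc[OF c2 comp_homs[OF U c1] a] comp_assoc[OF U c1 a] by simp
    finally have eq: "(Assoc C Z X Y \<cdot> ?n) \<cdot> Assoc C X Y Z = fs_braid D \<one>\<^bsub>G\<^esub> (fs_tens D X Y) Z" by simp
    have "?n = Unassoc Z X Y \<cdot> fs_braid D \<one>\<^bsub>G\<^esub> (fs_tens D X Y) Z \<cdot> Unassoc X Y Z"
      by (rule conjugate_inverses[OF inverse_Assoc inverse_Assoc _ eq]) (use ob n in simp_all)
    then show ?thesis using ob by (simp add: Brd_eq)
  qed
  show "ActT C h Y X \<cdot> ActM C h (Brd C X Y) = Brd C (Act C h X) (Act C h Y) \<cdot> ActT C h X Y"
    if h: "h \<in> carrier G" and ob: "X \<in> Ob C" "Y \<in> Ob C"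
    using fs_braid_act[OF one_closed h grade_one, of X Y] h ob by (simp add: Brd_eq)
qed

text \<open>Everything except nondegeneracy of the S-matrix is a specialisation of the crossed twist
  and ribbon identities.\<close>

lemma modular_categoryI:
  assumes "\<And>S v Y. \<lbrakk>simple_representatives C (Ob C) S (\<lambda>X. X);
      \<And>X. X \<in> S \<Longrightarrow> (\<Sum>Y \<in> S. S_matrix C X Y * v Y) = 0; Y \<in> S\<rbrakk> \<Longrightarrow> v Y = 0"
  shows "modular_category C"
proof
  fix X Y f
  show "X \<in> Ob C \<Longrightarrow> Twi C X \<in> homs C X X" by (simp add: Twi_eq homs_iff)
  show "X \<in> Ob C \<Longrightarrow> iso_arrow C (Twi C X)"
    using iso_twist[OF one_closed grade_one] by (simp add: Twi_eq)
  show "Twi C Y \<cdot> f = f \<cdot> Twi C X" if f: "f \<in> homs C X Y"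
    using fs_twist_natural[OF one_closed grade_one grade_one f] f actm_one[of f]
    by (simp add: Twi_eq homs_iff Arr_eq)
  show "Twi C (X \<boxtimes> Y) = (Twi C X \<odot> Twi C Y) \<cdot> Brd C Y X \<cdot> Brd C X Y" if ob: "X \<in> Ob C" "Y \<in> Ob C"
  proof -
    have t: "fs_twist D \<one>\<^bsub>G\<^esub> X \<in> Arr C" "fs_twist D \<one>\<^bsub>G\<^esub> Y \<in> Arr C" using ob by (simp_all add: Arr_eq)
    have "Id C (fs_tens D X Y) \<cdot> fs_twist D \<one>\<^bsub>G\<^esub> (fs_tens D X Y) = fs_twist D \<one>\<^bsub>G\<^esub> (fs_tens D X Y)"
      using ob by (intro id_comp[of _ "fs_tens D X Y"]) (simp add: homs_iff)
    then show ?thesis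
      using fs_twist_tens[OF one_closed one_closed grade_one grade_one, of X Y] ob t actm_one
      by (simp add: Twi_eq Brd_eq actt_one')
  qed
  show "(Id C X \<odot> Twi C (Dual C X)) \<cdot> Coev C X = (Twi C X \<odot> Id C (Dual C X)) \<cdot> Coev C X" if ob: "X \<in> Ob C"
  proof -
    let ?f = "(fs_twist D \<one>\<^bsub>G\<^esub> X \<odot> Id C (relabel (Sdual D) ` X)) \<cdot> Coev C X"
    have a: "fs_twist D \<one>\<^bsub>G\<^esub> X \<odot> Id C (relabel (Sdual D) ` X) \<in> Arr C" "Coev C X \<in> Arr C"
      and c: "Coev C X \<in> homs C (simple_sum (Sunit D)) (fs_tens D X (relabel (Sdual D) ` X))"
      and d: "fs_twist D \<one>\<^bsub>G\<^esub> X \<odot> Id C (relabel (Sdual D) ` X)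
        \<in> homs C (fs_tens D X (relabel (Sdual D) ` X)) (fs_tens D X (relabel (Sdual D) ` X))"
      using ob by (simp_all add: Arr_eq homs_iff)
    have "(Id C X \<odot> fs_twist D \<one>\<^bsub>G\<^esub> (relabel (Sdual D) ` X)) \<cdot> Coev C X
        = Id C (fs_tens D X (relabel (Sdual D) ` X)) \<cdot> (fs_twist D \<one>\<^bsub>G\<^esub> X \<odot> Id C (relabel (Sdual D) ` X)) \<cdot> Coev C X"
      using fs_ribbon[OF one_closed grade_one, of X] ob a actm_one by (simp add: actt_one')
    also have "\<dots> = ?f" using id_comp[OF d] by simp
    finally show ?thesis by (simp add: Twi_eq)
  qed
qed (rule assms)

text \<open>With only one fusion channel the tensor product is again a single summand, so the double
  braiding is a scalar and \<open>trace_single\<close> applies.\<close>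

lemma S_matrix_single:
  assumes x: "snd x \<in> Slab D" and y: "snd y \<in> Slab D" and u: "Fus D (snd x) (snd y) = {u}"
  shows "S_matrix C {x} {y} = Stwist D u * (Sbraid D (snd x) (snd y) u * Sbraid D (snd y) (snd x) u)
      * (Sbraid D u (Sdual D u) (Sunit D) * Sev D u)"
proof -
  have ob: "{x} \<in> fs_ob D" "{y} \<in> fs_ob D" using x y by auto
  have uL: "u \<in> Slab D" using u fus_label by blast
  have u': "Fus D (snd y) (snd x) = {u}"
    using fus_crossed[OF x, of "snd y"] y u by (simp add: deg_one[OF x] act_one_label)
  let ?z = "(Node x y, u)" and ?z' = "(Node y x, u)"
  have t: "fs_tens D {x} {y} = {?z}" "fs_tens D {y} {x} = {?z'}"
    using u u' by (auto simp: fs_tens_def)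
  have zob: "{?z} \<in> fs_ob D" "{?z'} \<in> fs_ob D" using uL by auto
  let ?f = "fs_twist D \<one>\<^bsub>G\<^esub> {?z} \<cdot> (fs_braid D \<one>\<^bsub>G\<^esub> {y} {x} \<cdot> fs_braid D \<one>\<^bsub>G\<^esub> {x} {y})"
  have f: "?f \<in> homs C {?z} {?z}"
    using ob zob t by (simp add: homs_iff)
  have "pull ?f \<Phi> ?z = Stwist D u * (Sbraid D (snd x) (snd y) u * Sbraid D (snd y) (snd x) u) * \<Phi> ?z" for \<Phi>
    using ob zob t u u' x y uL deg_one by (simp add: act_one_label)
  from trace_single[OF one_closed _ _ f this] show ?thesis
    using uL deg_one unfolding S_matrix_def ribbon_trace_def
    by (simp add: Brd_eq Twi_eq t unit_scalar_unique)
qed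

end

section \<open>Cocycle identities and Gauss sums\<close>

lemma mod2_add_self [simp]: "x + x = (0 :: 'a::ab_group_add mod2)"
  by transfer (auto simp: mod2_rel_def)

lemma mod2_add_left_self [simp]: "x + (x + y) = (y :: 'a::ab_group_add mod2)"
  by (simp add: add.assoc[symmetric])

text \<open>\<Gamma>/2\<Gamma> has exponent two, so all signs disappear from computations with
  classes.\<close>

lemma mod2_uminus [simp]: "- x = (x :: 'a::ab_group_add mod2)"
  by (rule minus_unique) simp

lemma mod2_minus [simp]: "x - y = (x + y :: 'a::ab_group_add mod2)"
  by (simp add: minus_mod2_def)

lemma cls_add [simp]: "cls (a + b) = cls a + cls b"
  by transfer (auto simp: mod2_rel_def intro: exI[of _ 0])

lemma cls_uminus [simp]: "cls (- a) = cls a"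
  by transfer (auto simp: mod2_rel_def intro: exI[of _ "- _"])

lemma cls_zero [simp]: "cls 0 = 0"
  by transfer (auto simp: mod2_rel_def intro: exI[of _ 0])

lemma cls_minus [simp]: "cls (a - b) = cls a + cls b"
  using cls_add[of a "- b"] by simp

lemma cls_eq_iff: "cls a = cls b \<longleftrightarrow> (\<exists>c. a - b = c + c)"
  by transfer (simp add: mod2_rel_def)

lemma ex_cls: "\<exists>a. cls a = x"
  by transfer (use equivp_reflp[OF equivp_mod2_rel] in blast)

lemma sum_cls_shift:
  fixes f :: "'a::{ab_group_add, finite} \<Rightarrow> complex"
  shows "(\<Sum>r | cls r = x + cls s. f r) = (\<Sum>r | cls r = x. f (r + s))"
  by (rule sum.reindex_bij_witness[of _ "\<lambda>r. r + s" "\<lambda>r. r - s"]) (auto simp: ac_simps)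

lemma sum_cls_uminus:
  fixes f :: "'a::{ab_group_add, finite} \<Rightarrow> complex"
  shows "(\<Sum>r | cls r = x. f r) = (\<Sum>r | cls r = x. f (- r))"
  by (rule sum.reindex_bij_witness[of _ uminus uminus]) auto

lemma card_cls: "card {r :: 'a::{ab_group_add, finite}. cls r = x} = card_double TYPE('a)"
proof -
  obtain a :: 'a where a: "cls a = x" using ex_cls by blast
  have "bij_betw (\<lambda>r. r - a) {r. cls r = cls a} (range (\<lambda>c. c + c))"
    by (rule bij_betwI[of _ _ _ "\<lambda>r. r + a"]) (auto dest: cls_eq_iff[THEN iffD1])
  then show ?thesis by (simp add: bij_betw_same_card card_double_def a)
qed

lemma card_double_pos: "card_double TYPE('a::{ab_group_add, finite}) > 0"
  by (simp add: card_double_def card_gt_0_iff)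

section \<open>Sign calculus for the cocycle and the square root\<close>

locale sqrt_cocycle =
  fixes Q q :: "'a::{ab_group_add, finite} \<Rightarrow> complex"
    and \<sigma> :: "'a \<Rightarrow> 'a \<Rightarrow> complex" and \<omega> :: "'a \<Rightarrow> 'a \<Rightarrow> 'a \<Rightarrow> complex" and \<delta> :: "'a mod2"
  assumes form: "discriminant_form Q"
    and cocycle: "special_abelian_cocycle Q \<sigma> \<omega>"
    and datum: "sqrt_datum Q \<sigma> \<omega> q \<delta>"
begin

abbreviation w :: "'a mod2 \<Rightarrow> 'a \<Rightarrow> 'a \<Rightarrow> complex" where "w \<equiv> on_cls \<omega>"

lemma sigma_nonzero [simp]: "\<sigma> a b \<noteq> 0"
  and sigma_diag: "\<sigma> a a = Q a"
  and sigma_zero [simp]: "\<sigma> a 0 = 1" "\<sigma> 0 a = 1"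
  and sigma_commute: "\<sigma> a b = \<sigma> b a"
  and omega_sigma: "\<omega> a b c = \<sigma> a (b + c) * inverse (\<sigma> a b) * inverse (\<sigma> a c)"
  and omega_add: "\<omega> (a + a') b c = \<omega> a b c * \<omega> a' b c"
  and omega_sign: "\<omega> a b c = 1 \<or> \<omega> a b c = -1"
  using cocycle unfolding special_abelian_cocycle_def by blast+

lemma omega_sq [simp]: "\<omega> a b c * \<omega> a b c = 1"
  using omega_sign[of a b c] by auto

text \<open>Being a homomorphism to {1, -1} in its first argument, \<omega> is trivial on doubled
  elements. So all representatives of a class give the same value and the description in
  \<open>on_cls\<close> denotes it.\<close>

lemma omega_eq_w: "\<omega> a b c = w (cls a) b c"
proof -
  have "\<omega> a' b c = \<omega> a b c" if "cls a' = cls a" for a'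
  proof -
    obtain d where "a' = a + (d + d)"
      using \<open>cls a' = cls a\<close> by (metis cls_eq_iff add.commute diff_add_cancel)
    then show ?thesis by (simp add: omega_add)
  qed
  then have "w (cls a) b c = \<omega> a b c"
    unfolding on_cls_def by (intro the_equality) blast+
  then show ?thesis ..
qed

lemma w_add [simp]: "w (x + y) b c = w x b c * w y b c"
proof -
  obtain a a' where "cls a = x" "cls a' = y" using ex_cls by metis
  then show ?thesis using omega_add[of a a' b c] by (simp add: omega_eq_w)
qed

lemma w_sq [simp]: "w x b c * w x b c = 1" "w x b c * (w x b c * z) = z"
proof -
  obtain a where "cls a = x" using ex_cls by metis
  then show "w x b c * w x b c = 1" using omega_sq[of a b c] by (simp add: omega_eq_w)
  then show "w x b c * (w x b c * z) = z" by (simp add: mult.assoc[symmetric])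
qed

lemma w_nonzero [simp]: "w x b c \<noteq> 0"
  using w_sq(1)[of x b c] by force

lemma inverse_w [simp]: "inverse (w x b c) = w x b c"
  using w_sq(1)[of x b c] by (simp add: inverse_unique)

lemma w_zero [simp]: "w 0 b c = 1" "w x b 0 = 1" "w x 0 c = 1"
proof -
  show "w 0 b c = 1" using w_add[of 0 0 b c] by simp
  obtain a where "cls a = x" using ex_cls by metis
  then show "w x b 0 = 1" "w x 0 c = 1"
    using omega_sigma[of a b 0] omega_sigma[of a 0 c] by (simp_all add: omega_eq_w)
qed

lemma sigma_add: "\<sigma> a (b + c) = w (cls a) b c * (\<sigma> a b * \<sigma> a c)"
  using omega_sigma[of a b c] by (simp add: omega_eq_w field_simps)

lemma sigma_add_left: "\<sigma> (b + c) a = w (cls a) b c * (\<sigma> b a * \<sigma> c a)"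
  using sigma_add[of a b c] by (simp add: sigma_commute)

lemma w_commute: "w x b c = w x c b"
proof -
  obtain a where "cls a = x" using ex_cls by metis
  then show ?thesis
    using omega_sigma[of a b c] omega_sigma[of a c b] by (simp add: omega_eq_w add.commute mult_ac)
qed

text \<open>For a fixed class, \<open>w x\<close> is the coboundary of \<sigma>(a, .) for any
  representative \<open>a\<close>, hence a 2-cocycle. As its values are their own inverses, the
  identity can be solved for one factor and used as a rewrite rule.\<close>

lemma w_assoc: "w x (b + c) d = w x b c * (w x c d * w x b (c + d))"
proof -
  obtain a where a: "cls a = x" using ex_cls by metis
  have "w x (b + c) d * w x b c = w x c d * w x b (c + d)"
    unfolding a[symmetric] omega_eq_w[symmetric] by (simp add: omega_sigma add.assoc field_simps)
  then have "w x b c * (w x (b + c) d * w x b c) = w x b c * (w x c d * w x b (c + d))" by simp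
  then show ?thesis by (simp add: mult_ac)
qed

text \<open>The cocycle identity for the triple (-b, b, c), one of whose factors has first entry 0
  and is trivial.\<close>

lemma w_neg_cancel: "w x (- b) (b + c) = w x b (- b) * w x b c"
  using w_assoc[of x "- b" b c] w_commute[of x "- b" b] by (simp add: mult_ac) (metis mult.assoc w_sq(1) mult.commute mult_1)

text \<open>Written through \<sigma>(a, .), the values at b+c and at -b-c cancel between the three
  factors on the left, and those at b, -b, c and -c remain, since \<sigma>(a, 0) = 1.\<close>

lemma w_neg_add: "w x (b + c) (- b - c) = w x b c * (w x (- b) (- c) * (w x b (- b) * w x c (- c)))"
proof -
  obtain a where a: "cls a = x" using ex_cls by metis
  have "\<omega> a (b + c) (- b - c) * (\<omega> a b c * (\<omega> a (- b) (- c))) = \<omega> a b (- b) * \<omega> a c (- c)"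
    by (simp add: omega_sigma field_simps)
  then have *: "w x (b + c) (- b - c) * (w x b c * (w x (- b) (- c))) = w x b (- b) * w x c (- c)"
    by (simp add: omega_eq_w a)
  have "w x b c * (w x (- b) (- c) * (w x (b + c) (- b - c) * (w x b c * (w x (- b) (- c)))))
     = w x (b + c) (- b - c)" by (simp add: mult_ac)
  then show ?thesis unfolding * by simp
qed

lemma sigma_neg_right: "\<sigma> a (- b) = w (cls a) b (- b) * inverse (\<sigma> a b)"
proof -
  have "1 = w (cls a) b (- b) * (\<sigma> a b * \<sigma> a (- b))" using sigma_add[of a b "- b"] by simp
  then have "w (cls a) b (- b) * inverse (\<sigma> a b)
      = w (cls a) b (- b) * inverse (\<sigma> a b) * (w (cls a) b (- b) * (\<sigma> a b * \<sigma> a (- b)))" by simp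
  then show ?thesis by (simp add: mult_ac field_simps)
qed

lemma sigma_neg_left: "\<sigma> (- b) a = w (cls a) b (- b) * inverse (\<sigma> b a)"
  using sigma_neg_right[of a b] by (simp add: sigma_commute)

lemma q_nonzero [simp]: "q a \<noteq> 0"
  and q_sq: "q a * q a = \<sigma> a a"
  and q_add: "q (a + b) = q a * (q b * (\<sigma> a b * (w (cls a) a b * (w (cls b) a b * w \<delta> a b))))"
proof -
  have d: "q a \<noteq> 0" "(q a)^2 = Q a"
    "q (a + b) * inverse (q a) * inverse (q b) = \<sigma> a b * \<omega> (a + b) a b * w \<delta> a b" for a b
    using datum unfolding sqrt_datum_def by blast+
  show "q a \<noteq> 0" "q a * q a = \<sigma> a a" using d(1,2)[of a] by (simp_all add: sigma_diag power2_eq_square)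
  show "q (a + b) = q a * (q b * (\<sigma> a b * (w (cls a) a b * (w (cls b) a b * w \<delta> a b))))"
    using d(3)[of a b] d(1)[of a] d(1)[of b] by (simp add: omega_eq_w field_simps)
qed

lemma q_zero [simp]: "q 0 = 1"
  using q_add[of 0 0] q_nonzero[of 0] by simp

text \<open>From 1 = q(a + -a) and the fact that \<sigma>(a, -a) is q(a)^(-2) up to sign:
  \<open>q\<close> is even up to an explicit sign.\<close>

lemma q_neg: "q (- a) = q a * (w (cls a) a (- a) * w \<delta> a (- a))"
proof -
  have "1 = q a * (q (- a) * (\<sigma> a (- a) * w \<delta> a (- a)))"
    using q_add[of a "- a"] by simp
  also have "\<dots> = q a * (q (- a) * (w (cls a) a (- a) * (inverse (q a * q a) * w \<delta> a (- a))))"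
    by (simp add: sigma_neg_right q_sq mult_ac)
  finally have "q a * (w (cls a) a (- a) * w \<delta> a (- a)) * 1 = q a * (w (cls a) a (- a) * w \<delta> a (- a))
      * (q a * (q (- a) * (w (cls a) a (- a) * (inverse (q a * q a) * w \<delta> a (- a)))))" by simp
  also have "\<dots> = q (- a)" by (simp add: field_simps)
  finally show ?thesis by simp
qed

text \<open>Expanding \<sigma>(a+b, a+b) in both arguments produces every sign twice, so the signs
  cancel although \<sigma> itself is not bimultiplicative.\<close>

lemma bilinear_sigma: "assoc_bilinear Q a b = \<sigma> a b * \<sigma> a b"
  unfolding assoc_bilinear_def sigma_diag[symmetric] sigma_add sigma_add_left
  by (simp add: sigma_commute[of b a] field_simps)

lemma bilinear_nondegenerate: "(\<And>b. \<sigma> a b * \<sigma> a b = 1) \<Longrightarrow> a = 0"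
  using form unfolding discriminant_form_def bilinear_sigma by blast

lemma bilinear_add: "\<sigma> a (b + c) * \<sigma> a (b + c) = (\<sigma> a b * \<sigma> a b) * (\<sigma> a c * \<sigma> a c)"
  by (simp add: sigma_add mult_ac)

text \<open>All cosets have $|2\Gamma|$ elements; the coset \<open>\<delta>\<close> is used so that the type of the constants
  determines the group.\<close>

definition N :: complex where "N = of_nat (card {r. cls r = \<delta>})"

definition \<nu> :: complex where "\<nu> = complex_of_real (1 / sqrt (real (card {r. cls r = \<delta>})))"

lemma N_eq: "of_nat (card {r :: 'a. cls r = x}) = N"
  by (simp add: N_def card_cls)

lemma nu_eq: "complex_of_real (1 / sqrt (real (card_double TYPE('a)))) = \<nu>"
  by (simp add: \<nu>_def card_cls)

lemma N_nonzero [simp]: "N \<noteq> 0"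
  using card_double_pos[where 'a = 'a] by (simp add: N_def card_cls)

lemma nu_sq: "\<nu> * \<nu> * N = 1"
proof -
  have "\<nu> * \<nu> = complex_of_real (1 / real (card_double TYPE('a)))"
    by (simp add: \<nu>_def card_cls flip: of_real_mult)
  then show ?thesis using card_double_pos[where 'a = 'a] by (simp add: N_def card_cls)
qed

lemma nu_nonzero [simp]: "\<nu> \<noteq> 0"
  using nu_sq by force

section \<open>Orthogonality on cosets of 2\<Gamma> and Gauss sums\<close>

text \<open>For t' = t + 2c the summand is, up to a sign constant on the class \<open>x\<close>, the
  character \<sigma>(2c, .). Its value at d+d is B_Q(2c, d), which differs from 1 for some
  \<open>d\<close> when 2c is nonzero. Translation by d+d preserves the class and multiplies the sum
  by that value, so the sum vanishes.\<close>

lemma sigma_orthogonal: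
  assumes t: "cls t = cls t'"
  shows "(\<Sum>r | cls r = x. inverse (\<sigma> t r) * \<sigma> t' r) = (if t = t' then N else 0)"
proof (cases "t = t'")
  case True
  then show ?thesis by (simp add: N_eq)
next
  case False
  obtain c where c: "t' - t = c + c" using t cls_eq_iff by metis
  then have t': "t' = t + (c + c)" by (simp add: algebra_simps)
  have "c + c \<noteq> 0" using False t' by auto
  then obtain d where d: "\<sigma> (c + c) d * \<sigma> (c + c) d \<noteq> 1" using bilinear_nondegenerate by blast
  let ?S = "\<Sum>r | cls r = x. \<sigma> (c + c) r"
  have dd: "\<sigma> (c + c) (d + d) = \<sigma> (c + c) d * \<sigma> (c + c) d"
    by (simp only: sigma_add cls_add mod2_add_self w_zero mult_1)
  have "?S = (\<Sum>r | cls r = x. \<sigma> (c + c) (r + (d + d)))"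
    using sum_cls_shift[where x = x and s = "d + d" and f = "\<sigma> (c + c)"] by simp
  also have "\<dots> = \<sigma> (c + c) (d + d) * ?S"
    by (simp only: sigma_add[of "c + c" _ "d + d"] cls_add mod2_add_self w_zero mult_1 sum_distrib_left mult.commute)
  finally have "?S = 0" using d dd by (metis mult_cancel_right1)
  moreover have "inverse (\<sigma> t r) * \<sigma> t' r = w x t (c + c) * \<sigma> (c + c) r" if "cls r = x" for r
    unfolding t' using that by (simp only: sigma_add_left[of t "c + c"]) simp
  then have "(\<Sum>r | cls r = x. inverse (\<sigma> t r) * \<sigma> t' r) = w x t (c + c) * ?S"
    by (simp add: sum_distrib_left)
  ultimately show ?thesis using False by simp
qed

lemma sigma_orthogonal':
  assumes "cls t = cls t'"
  shows "(\<Sum>r | cls r = x. \<sigma> t r * inverse (\<sigma> t' r)) = (if t = t' then N else 0)"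
  using sigma_orthogonal[of t' t x] assms by (simp add: mult.commute eq_commute)

definition gsum :: complex where "gsum = (\<Sum>a | cls a = \<delta>. inverse (q a))"

text \<open>Completing the square: in q(r+s) the signs for the classes of \<open>r\<close>,
  \<open>s\<close> and \<delta> multiply to 1 precisely because the class of \<open>r\<close> is
  \<delta> plus that of \<open>s\<close>. Translation by \<open>s\<close> carries this class to
  \<delta>, where the Gauss sum lives.\<close>

lemma gauss_shift:
  assumes "x = \<delta> + cls s"
  shows "(\<Sum>r | cls r = x. inverse (q r) * inverse (\<sigma> r s)) = q s * gsum"
proof -
  have "{a. cls a = \<delta>} = {a. cls a = x + cls s}" using assms by (simp add: ac_simps)
  then have "gsum = (\<Sum>a | cls a = x + cls s. inverse (q a))" by (simp only: gsum_def)
  also have "\<dots> = (\<Sum>r | cls r = x. inverse (q (r + s)))"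
    using sum_cls_shift[where x = x and s = s and f = "\<lambda>a. inverse (q a)"]  .
  also have "\<dots> = (\<Sum>r | cls r = x. inverse (q s) * (inverse (q r) * inverse (\<sigma> r s)))"
    by (rule sum.cong[OF refl]) (use assms in \<open>simp add: q_add mult_ac\<close>)
  finally show ?thesis by (simp add: sum_distrib_left[symmetric])
qed

text \<open>\<open>gauss_shift\<close> at t - v. The signs from expanding \<sigma>(r, t - v) depend
  on \<open>r\<close> only through its class and leave the sum; \<open>q_neg\<close> absorbs them at
  the end.\<close>

lemma gauss_minus:
  assumes "x = \<delta> + cls t + cls v"
  shows "(\<Sum>r | cls r = x. inverse (q r) * (inverse (\<sigma> t r) * \<sigma> r v)) = q t * (q v * (inverse (\<sigma> t v) * gsum))"
proof -
  have "(\<Sum>r | cls r = x. inverse (q r) * (inverse (\<sigma> t r) * \<sigma> r v))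
      = (\<Sum>r | cls r = x. w x t (- v) * (w x v (- v) * (inverse (q r) * inverse (\<sigma> r (t + - v)))))"
    by (rule sum.cong[OF refl])
      (simp only: sigma_add[of _ t "- v"], simp add: sigma_neg_right sigma_commute[of t] mult_ac)
  also have "\<dots> = w x t (- v) * (w x v (- v) * (q (t + - v) * gsum))"
    using gauss_shift[of x "t + - v"] assms by (simp only: sum_distrib_left[symmetric]) (simp add: ac_simps)
  also have "\<dots> = q t * (q v * (inverse (\<sigma> t v) * gsum))"
    by (simp only: q_add[of t "- v"]) (simp add: assms q_neg sigma_neg_right mult_ac)
  finally show ?thesis .
qed

text \<open>The class is stable under negation. Replacing r by -r inverts both \<sigma> factors up
  to signs and reduces the sum to \<open>gauss_shift\<close> at t + v.\<close>

lemma gauss_plus: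
  assumes "x = \<delta> + cls t + cls v"
  shows "(\<Sum>r | cls r = x. inverse (q r) * (\<sigma> t r * \<sigma> r v)) = q t * (q v * (\<sigma> t v * gsum))"
proof -
  have "(\<Sum>r | cls r = x. inverse (q r) * (\<sigma> t r * \<sigma> r v))
      = (\<Sum>r | cls r = x. inverse (q (- r)) * (\<sigma> t (- r) * \<sigma> (- r) v))"
    by (rule sum_cls_uminus)
  also have "\<dots> = (\<Sum>r | cls r = x. w x t v * (inverse (q r) * inverse (\<sigma> r (t + v))))"
    by (rule sum.cong[OF refl])
      (simp add: assms q_neg sigma_neg_right sigma_neg_left sigma_add sigma_commute[of t] mult_ac)
  also have "\<dots> = w x t v * (q (t + v) * gsum)"
    using gauss_shift[of x "t + v"] assms by (simp only: sum_distrib_left[symmetric]) (simp add: ac_simps)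
  also have "\<dots> = q t * (q v * (\<sigma> t v * gsum))"
    by (simp add: assms q_add mult_ac)
  finally show ?thesis .
qed

text \<open>For s in 2\<Gamma> the sums in \<open>gauss_shift\<close> are the Fourier coefficients
  of 1/q on the coset \<delta>. Were they all zero, Fourier inversion would give 1/q(t) = 0. This
  makes \<alpha> nonzero, hence the braiding and the twist invertible.\<close>

lemma gauss_nonzero: "gsum \<noteq> 0"
proof
  assume gsum: "gsum = 0"
  obtain t where t: "cls t = \<delta>" using ex_cls by blast
  have "0 = (\<Sum>s | cls s = 0. \<sigma> t s * (\<Sum>r | cls r = \<delta>. inverse (q r) * inverse (\<sigma> r s)))"
    using gauss_shift[of \<delta>] gsum by simp
  also have "\<dots> = (\<Sum>r | cls r = \<delta>. \<Sum>s | cls s = 0. inverse (q r) * (\<sigma> t s * inverse (\<sigma> r s)))"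
    by (subst sum.swap) (simp add: sum_distrib_left mult_ac)
  also have "\<dots> = (\<Sum>r | cls r = \<delta>. if r = t then inverse (q r) * N else 0)"
    by (rule sum.cong[OF refl]) (use t in \<open>auto simp: sum_distrib_left[symmetric] sigma_orthogonal'\<close>)
  also have "\<dots> = inverse (q t) * N" using t by simp
  finally show False by simp
qed

end

section \<open>The table of the extension\<close>

locale crossed_extension = group G + sqrt_cocycle Q q \<sigma> \<omega> \<delta>
  for G :: "('g, 'b) monoid_scheme" and g :: 'g
    and Q q :: "'a::{ab_group_add, finite} \<Rightarrow> complex"
    and \<sigma> :: "'a \<Rightarrow> 'a \<Rightarrow> complex" and \<omega> :: "'a \<Rightarrow> 'a \<Rightarrow> 'a \<Rightarrow> complex" and \<delta> :: "'a mod2"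
    and \<epsilon> \<alpha> \<beta> :: complex +
  assumes carrier: "carrier G = {\<one>\<^bsub>G\<^esub>, g}" and nontrivial: "g \<noteq> \<one>\<^bsub>G\<^esub>"
    and sign: "\<epsilon> \<in> {1, -1}"
    and alpha: "\<alpha>^2 = \<epsilon> * gauss_sum \<delta> (\<lambda>a. inverse (q a))"
    and beta: "\<beta> \<in> {inverse \<alpha>, - inverse \<alpha>}"
begin

lemma g_carrier [simp]: "g \<in> carrier G"
  by (simp add: carrier)

lemma g_mult_g [simp]: "g \<otimes>\<^bsub>G\<^esub> g = \<one>\<^bsub>G\<^esub>"
  using m_closed[OF g_carrier g_carrier] nontrivial l_cancel_one[OF g_carrier g_carrier]
  by (auto simp: carrier)

lemma inv_g [simp]: "inv\<^bsub>G\<^esub> g = g"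
  by (rule inv_equality) simp_all

lemma eps_sq [simp]: "\<epsilon> * \<epsilon> = 1" "\<epsilon> * (\<epsilon> * z) = z"
  using sign by auto

lemma alpha_sq: "\<alpha> * \<alpha> = \<epsilon> * (\<nu> * gsum)"
  using alpha unfolding power2_eq_square gauss_sum_def nu_eq gsum_def .

lemma eps_nonzero [simp]: "\<epsilon> \<noteq> 0"
  using sign by auto

lemma alpha_nonzero [simp]: "\<alpha> \<noteq> 0"
  using alpha_sq gauss_nonzero by auto

lemma beta_sq: "\<beta> * \<beta> = inverse (\<alpha> * \<alpha>)"
  using beta by auto

lemma beta_nonzero [simp]: "\<beta> \<noteq> 0"
  using beta by auto

abbreviation D where "D \<equiv> extension_table G g \<sigma> \<omega> q \<delta> \<epsilon> \<alpha> \<beta>"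

text \<open>On three X's the associator is a genuine matrix, and orthogonality makes its inverse the
  same kernel with \<sigma> in place of its inverse. All other associators have a single channel and
  are inverted as scalars.\<close>

definition Finv :: "'a label \<Rightarrow> 'a label \<Rightarrow> 'a label \<Rightarrow> 'a label \<Rightarrow> 'a label \<Rightarrow> 'a label \<Rightarrow> complex" where
  "Finv a b c u r t = (if a \<in> range Xs \<and> b \<in> range Xs \<and> c \<in> range Xs
     then \<epsilon> * \<nu> * \<sigma> (val t) (val r) else inverse (label_assoc \<sigma> \<omega> \<delta> \<epsilon> a b c u t r))"

lemma D_simps [simp]:
  "Slab D = UNIV" "Sunit D = Cs 0" "Fus D = label_fus \<delta>" "Fsym D = label_assoc \<sigma> \<omega> \<delta> \<epsilon>"
  "Sdual D = label_dual \<delta>" "Sev D = label_ev \<omega> \<epsilon>" "Sact D = label_act G"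
  "Stau D h s s' t = (if h = \<one>\<^bsub>G\<^esub> then 1 else label_tau \<omega> \<delta> s s' t)"
  "Sdeg D (Cs a) = \<one>\<^bsub>G\<^esub>" "Sdeg D (Xs x) = g" "Sbraid D = label_braid \<sigma> \<omega> q \<alpha>"
  "Stwist D = label_twist \<sigma> \<beta>"
  by (simp_all add: extension_table_def)

lemma label_act_simps [simp]:
  "label_act G \<one>\<^bsub>G\<^esub> s = s" "label_act G g (Cs a) = Cs (- a)" "label_act G g (Xs x) = Xs x"
  using nontrivial by (simp_all add: label_act_def)

text \<open>As an image under \<open>Cs\<close> the channel set matches \<open>sum_Cs\<close>, which
  turns sums over labels into sums over group elements.\<close>

lemma fus_XX: "label_fus \<delta> (Xs x) (Xs y) = Cs ` {t. cls t = \<delta> + x + y}"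
  by auto

declare label_fus.simps(4) [simp del]
declare fus_XX [simp]

lemma sum_Cs: "(\<Sum>r\<in>{r. r \<in> Cs ` {t. cls t = k} \<and> P r}. f r) = (\<Sum>t | cls t = k \<and> P (Cs t). f (Cs t))"
  for f :: "'a label \<Rightarrow> complex"
proof -
  have "{r. r \<in> Cs ` {t. cls t = k} \<and> P r} = Cs ` {t. cls t = k \<and> P (Cs t)}" by auto
  moreover have "inj_on Cs {t. cls t = k \<and> P (Cs t)}" by (auto simp: inj_on_def)
  ultimately show ?thesis by (metis (no_types, lifting) sum.reindex comp_apply sum.cong)
qed

text \<open>A linear equation in \<Gamma> selects at most one channel; what remains of the
  constraint is a condition on classes.\<close>

lemma sum_solve:
  fixes f :: "'a \<Rightarrow> complex"
  shows "(\<Sum>t | cls t = k \<and> v = a + t. f t) = (if cls v = k + cls a then f (v - a) else 0)"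
    and "(\<Sum>t | cls t = k \<and> v = t + a. f t) = (if cls v = k + cls a then f (v - a) else 0)"
    and "(\<Sum>t | cls t = k \<and> v = t - a. f t) = (if cls v = k + cls a then f (v + a) else 0)"
    and "(\<Sum>t | cls t = k \<and> v = t. f t) = (if cls v = k then f v else 0)"
proof -
  have "{t. cls t = k \<and> v = t - a} = (if cls v = k + cls a then {v + a} else {})"
    by (auto simp: ac_simps)
  then show "(\<Sum>t | cls t = k \<and> v = t - a. f t) = (if cls v = k + cls a then f (v + a) else 0)" by simp
  have "{t. cls t = k \<and> v = t} = (if cls v = k then {v} else {})" by auto
  then show "(\<Sum>t | cls t = k \<and> v = t. f t) = (if cls v = k then f v else 0)" by simp
  have "{t. cls t = k \<and> v = a + t} = (if cls v = k + cls a then {v - a} else {})"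
    by (auto simp: add_ac mult_ac)
  then show "(\<Sum>t | cls t = k \<and> v = a + t. f t) = (if cls v = k + cls a then f (v - a) else 0)" by simp
  then show "(\<Sum>t | cls t = k \<and> v = t + a. f t) = (if cls v = k + cls a then f (v - a) else 0)"
    by (simp add: add.commute)
qed

lemmas mod2_ac = add.assoc[where 'a = "'a mod2"] add.commute[where 'a = "'a mod2"]
  add.left_commute[where 'a = "'a mod2"]

lemmas channel = sum_Cs sum_solve Collect_conv_if Collect_conv_if2

lemma Finv_simps [simp]:
  "Finv (Xs x) (Xs y) (Xs z) u (Cs r) (Cs t) = \<epsilon> * (\<nu> * \<sigma> t r)"
  "Finv (Cs a) b' c' u r' t' = inverse (label_assoc \<sigma> \<omega> \<delta> \<epsilon> (Cs a) b' c' u t' r')"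
  "Finv a' (Cs b) c' u r' t' = inverse (label_assoc \<sigma> \<omega> \<delta> \<epsilon> a' (Cs b) c' u t' r')"
  "Finv a' b' (Cs d) u r' t' = inverse (label_assoc \<sigma> \<omega> \<delta> \<epsilon> a' b' (Cs d) u t' r')"
  by (auto simp: Finv_def)

lemma assoc_XXX [simp]:
  "label_assoc \<sigma> \<omega> \<delta> \<epsilon> (Xs x) (Xs y) (Xs z) u (Cs t) (Cs r) = \<epsilon> * (\<nu> * inverse (\<sigma> t r))"
  by (simp only: label_assoc.simps nu_eq mult.assoc)

declare label_assoc.simps(8) [simp del]

text \<open>The cocycle identity with \<open>c\<close> moved to the front, invoked below at
  explicitly chosen instances to reconcile different bracketings.\<close>

lemma w_cycle: "w x c (a + b) = w x a b * (w x b c * w x a (b + c))"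
  using w_assoc[of x a b c] w_commute[of x "a + b" c] by (simp add: mult_ac)

lemma w_neg_right: "w x c (- b - c) = w x c (- c) * w x (- b) (- c)" "w x c (- c - b) = w x c (- c) * w x (- b) (- c)"
proof -
  show *: "w x c (- c - b) = w x c (- c) * w x (- b) (- c)"
    using w_neg_cancel[of x "- c" "- b"] by (simp add: w_commute mult_ac)
  have e: "- b - c = - c - b" by (simp add: algebra_simps)
  show "w x c (- b - c) = w x c (- c) * w x (- b) (- c)" unfolding e by (rule *)
qed

lemma sigma_cancel [simp]: "\<sigma> a b * (inverse (\<sigma> a b) * z) = z" "inverse (\<sigma> a b) * (\<sigma> a b * z) = z"
  "q a * (inverse (q a) * z) = z" "inverse (q a) * (q a * z) = z"
  by (simp_all add: field_simps)

lemma sum_shift: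
  fixes f :: "'a \<Rightarrow> complex"
  shows "(\<Sum>t | cls t = x + (y + cls s). f t) = (\<Sum>t | cls t = x + y. f (t + s))"
    and "(\<Sum>t | cls t = x + (y + (z + cls s)). f t) = (\<Sum>t | cls t = x + (y + z). f (t + s))"
  using sum_cls_shift[where x = "x + y" and s = s and f = f]
    sum_cls_shift[where x = "x + (y + z)" and s = s and f = f] by (simp_all add: add.assoc)

text \<open>Normal form for scalars: \<sigma> and \<open>q\<close> at sums and negatives become
  values at the individual elements times signs \<open>w\<close>, which then cancel in
  pairs.\<close>

lemmas expand = omega_eq_w sigma_add sigma_add_left sigma_neg_left sigma_neg_right q_add q_neg
  w_commute sigma_commute sum_distrib_left

section \<open>Invertibility of the associator and the pentagon\<close>

text \<open>Fourier inversion on a coset. After exchanging the sums, orthogonality leaves one term,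
  and \<open>nu_sq\<close> together with \<epsilon>^2 = 1 normalises it.\<close>

lemma fsym_inverse_XXX:
  assumes "cls t = k"
  shows "(\<Sum>r | cls r = m. \<epsilon> * (\<nu> * inverse (\<sigma> t r)) * (\<Sum>t' | cls t' = k. \<epsilon> * (\<nu> * \<sigma> t' r) * \<phi> t')) = \<phi> t"
proof -
  have "(\<Sum>r | cls r = m. \<epsilon> * (\<nu> * inverse (\<sigma> t r)) * (\<Sum>t' | cls t' = k. \<epsilon> * (\<nu> * \<sigma> t' r) * \<phi> t'))
      = (\<Sum>t' | cls t' = k. \<Sum>r | cls r = m. \<nu> * \<nu> * \<phi> t' * (inverse (\<sigma> t r) * \<sigma> t' r))"
    by (subst sum.swap) (simp add: sum_distrib_left mult_ac)
  also have "\<dots> = (\<Sum>t' | cls t' = k. if t' = t then \<phi> t else 0)"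
  proof (rule sum.cong[OF refl])
    fix t' assume "t' \<in> {t'. cls t' = k}"
    then have "cls t = cls t'" using assms by simp
    then show "(\<Sum>r | cls r = m. \<nu> * \<nu> * \<phi> t' * (inverse (\<sigma> t r) * \<sigma> t' r)) = (if t' = t then \<phi> t else 0)"
      unfolding sum_distrib_left[symmetric] sigma_orthogonal[OF \<open>cls t = cls t'\<close>] using nu_sq by (simp add: mult_ac)
  qed
  finally show ?thesis using assms by simp
qed

lemma inverse_fsym_XXX:
  assumes "cls r = m"
  shows "(\<Sum>t | cls t = k. \<epsilon> * (\<nu> * \<sigma> t r) * (\<Sum>r' | cls r' = m. \<epsilon> * (\<nu> * inverse (\<sigma> t r')) * \<phi> r')) = \<phi> r"
proof -
  have "(\<Sum>t | cls t = k. \<epsilon> * (\<nu> * \<sigma> t r) * (\<Sum>r' | cls r' = m. \<epsilon> * (\<nu> * inverse (\<sigma> t r')) * \<phi> r'))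
      = (\<Sum>r' | cls r' = m. \<Sum>t | cls t = k. \<nu> * \<nu> * \<phi> r' * (\<sigma> r t * inverse (\<sigma> r' t)))"
    by (subst sum.swap) (simp add: sum_distrib_left mult_ac sigma_commute)
  also have "\<dots> = (\<Sum>r' | cls r' = m. if r' = r then \<phi> r else 0)"
  proof (rule sum.cong[OF refl])
    fix r' assume "r' \<in> {r'. cls r' = m}"
    then have "cls r = cls r'" using assms by simp
    then show "(\<Sum>t | cls t = k. \<nu> * \<nu> * \<phi> r' * (\<sigma> r t * inverse (\<sigma> r' t))) = (if r' = r then \<phi> r else 0)"
      unfolding sum_distrib_left[symmetric] sigma_orthogonal'[OF \<open>cls r = cls r'\<close>] using nu_sq by (simp add: mult_ac)
  qed
  finally show ?thesis using assms by simp
qed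

lemma fsym_inverse:
  assumes "t \<in> label_fus \<delta> a b" "u \<in> label_fus \<delta> t c"
  shows "(\<Sum>r\<in>{r \<in> label_fus \<delta> b c. u \<in> label_fus \<delta> a r}. label_assoc \<sigma> \<omega> \<delta> \<epsilon> a b c u t r
        * (\<Sum>t'\<in>{t' \<in> label_fus \<delta> a b. u \<in> label_fus \<delta> t' c}. Finv a b c u r t' * \<phi> t')) = \<phi> t"
  using assms
  apply (cases a; cases b; cases c)
  apply (auto simp: channel omega_eq_w mod2_ac add_ac mult_ac simp del: sum_constant cong: conj_cong)
  subgoal for x y z t
    using fsym_inverse_XXX[where t = t and k = "x + (y + \<delta>)" and m = "y + (z + \<delta>)" and \<phi> = "\<lambda>t. \<phi> (Cs t)"] by (simp add: mult_ac)
  done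

text \<open>Up to a sign, the inverses of \<sigma>(t, r) and \<sigma>(r, n) combine to that of
  \<sigma>(t+n, r). Orthogonality against \<sigma>(u, r) forces n = u - t, which is the only channel
  on the other side of the pentagon.\<close>

lemma pentagon_XXXX:
  assumes "cls t + k' = cls u"
  shows "(\<Sum>r | cls r = k. \<Sum>n\<in>{n. cls n = k'}. \<nu> * (\<nu> * (\<sigma> u r * (inverse (\<sigma> t r) * (inverse (\<sigma> r n) * \<psi> n)))))
    = w k t (u - t) * \<psi> (u - t)"
proof -
  have "(\<Sum>r | cls r = k. \<Sum>n\<in>{n. cls n = k'}. \<nu> * (\<nu> * (\<sigma> u r * (inverse (\<sigma> t r) * (inverse (\<sigma> r n) * \<psi> n)))))
    = (\<Sum>n | cls n = k'. \<Sum>r | cls r = k. \<nu> * \<nu> * w k t n * \<psi> n * (inverse (\<sigma> (t + n) r) * \<sigma> u r))"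
    by (subst sum.swap, intro sum.cong refl) (auto simp: sigma_add_left sigma_add sigma_commute mult_ac)
  also have "\<dots> = (\<Sum>n | cls n = k'. if n = u - t then w k t n * \<psi> n else 0)"
  proof (rule sum.cong[OF refl])
    fix n assume "n \<in> {n. cls n = k'}"
    then have c: "cls (t + n) = cls u" using assms by simp
    have "t + n = u \<longleftrightarrow> n = u - t" by (auto simp: algebra_simps)
    then show "(\<Sum>r | cls r = k. \<nu> * \<nu> * w k t n * \<psi> n * (inverse (\<sigma> (t + n) r) * \<sigma> u r))
        = (if n = u - t then w k t n * \<psi> n else 0)"
      unfolding sum_distrib_left[symmetric] sigma_orthogonal[OF c] using nu_sq by (simp add: mult_ac)
  qed
  also have "\<dots> = w k t (u - t) * \<psi> (u - t)"
  proof -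
    have "k' = cls t + cls u" by (simp add: assms[symmetric])
    then show ?thesis by (simp add: add.commute)
  qed
  finally show ?thesis .
qed

text \<open>Sixteen cases by component. Most are settled by the sign normal form; the remaining ones
  need one instance of the cocycle identity each or a reindexed sum, except for four X's, where
  \<open>pentagon_XXXX\<close> enters.\<close>

lemma fsym_pentagon:
  assumes "t \<in> label_fus \<delta> a b" "s \<in> label_fus \<delta> t c" "u \<in> label_fus \<delta> s d"
  shows "(\<Sum>v\<in>{v \<in> label_fus \<delta> b c. s \<in> label_fus \<delta> a v}. label_assoc \<sigma> \<omega> \<delta> \<epsilon> a b c s t v
        * (\<Sum>v'\<in>{v' \<in> label_fus \<delta> v d. u \<in> label_fus \<delta> a v'}. label_assoc \<sigma> \<omega> \<delta> \<epsilon> a v d u s v'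
          * (\<Sum>r\<in>{r \<in> label_fus \<delta> c d. v' \<in> label_fus \<delta> b r}. label_assoc \<sigma> \<omega> \<delta> \<epsilon> b c d v' v r * \<psi> r v')))
      = (\<Sum>r\<in>{r \<in> label_fus \<delta> c d. u \<in> label_fus \<delta> t r}. label_assoc \<sigma> \<omega> \<delta> \<epsilon> t c d u s r
        * (\<Sum>v\<in>{v \<in> label_fus \<delta> b r. u \<in> label_fus \<delta> a v}. label_assoc \<sigma> \<omega> \<delta> \<epsilon> a b r u t v * \<psi> r v))"
  using assms
  apply (cases a; cases b; cases c; cases d)
  apply (simp_all add: channel omega_eq_w mod2_ac add.assoc del: sum_constant cong: conj_cong)
  apply (auto simp: channel Collect_conv_if2 expand w_assoc add_ac mult_ac sum_shift simp del: sum_constant)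
         subgoal for a b c d by (simp add: w_cycle[of _ d b c] mult_ac)
        subgoal for a b c y by (simp add: w_cycle[of _ c a b] mult_ac)
       subgoal premises prems for a b x y u
       proof -
         \<comment> \<open>Solving for the internal channel turns the outer label into a sum, to
           which the expansion rules and the cocycle identity apply.\<close>
         define r where "r = u - (a + b)"
         then have u: "u = a + (b + r)" by (simp add: algebra_simps)
         have "cls r = x + (y + \<delta>)" using prems by (simp add: r_def mod2_ac)
         then show ?thesis unfolding u by (simp add: sum_solve Collect_conv_if2 w_cycle[of _ r a b] expand mod2_ac add_ac mult_ac)
       qed
      subgoal premises prems for a x y d s
      proof -
        define r where "r = s - a"
        then have s: "s = a + r" by (simp add: algebra_simps)
        show ?thesis unfolding s by (simp add: w_cycle[of _ d a r] w_commute add_ac mult_ac)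
      qed
     subgoal premises prems for a x y z s
     proof -
       define r where "r = s - a"
       then have s: "s = a + r" by (simp add: algebra_simps)
       show ?thesis unfolding s by (rule sum.cong) (auto simp: expand mult_ac)
     qed
    subgoal for x a b c by (simp add: w_cycle[of _ c a b] mult_ac)
   subgoal for x y a b t by (simp add: w_cycle[of _ b a t] w_cycle[of _ t a b] w_commute add_ac mult_ac)
  subgoal for x y z v t u
    using pentagon_XXXX[where t = t and k' = "z + (v + \<delta>)" and u = u and k = "y + (z + \<delta>)"
        and \<psi> = "\<lambda>n. \<psi> (Cs n) (Xs (y + (z + (v + \<delta>))))"]
    by (simp add: mod2_ac mult_ac)
  done

lemma inverse_fsym:
  assumes "r \<in> label_fus \<delta> b c" "u \<in> label_fus \<delta> a r"
  shows "(\<Sum>t\<in>{t \<in> label_fus \<delta> a b. u \<in> label_fus \<delta> t c}. Finv a b c u r t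
        * (\<Sum>r'\<in>{r' \<in> label_fus \<delta> b c. u \<in> label_fus \<delta> a r'}. label_assoc \<sigma> \<omega> \<delta> \<epsilon> a b c u t r' * \<phi> r')) = \<phi> r"
  using assms
  apply (cases a; cases b; cases c)
  apply (auto simp: channel omega_eq_w mod2_ac add_ac mult_ac simp del: sum_constant cong: conj_cong)
  subgoal for x y z r
    using inverse_fsym_XXX[where r = r and m = "y + (z + \<delta>)" and k = "x + (y + \<delta>)" and \<phi> = "\<lambda>r. \<phi> (Cs r)"] by (simp add: mult_ac)
  done

section \<open>Scalar identities for action, twist and braiding\<close>

text \<open>On three X's this says that \<sigma>(-t, -r) equals \<sigma>(t, r) times the signs of
  (t, -t) on the class of \<open>r\<close> and of (r, -r) on the class of \<open>t\<close>. The
  other cases compare signs through \<open>w_neg_add\<close> and \<open>w_neg_right\<close>.\<close>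

lemma tau_fsym:
  assumes "t \<in> label_fus \<delta> a b" "u \<in> label_fus \<delta> t c" "r \<in> label_fus \<delta> b c" "u \<in> label_fus \<delta> a r"
  shows "label_tau \<omega> \<delta> t c u * (label_tau \<omega> \<delta> a b t * label_assoc \<sigma> \<omega> \<delta> \<epsilon> (label_act G g a)
      (label_act G g b) (label_act G g c) (label_act G g u) (label_act G g t) (label_act G g r))
    = label_assoc \<sigma> \<omega> \<delta> \<epsilon> a b c u t r * (label_tau \<omega> \<delta> a r u * label_tau \<omega> \<delta> b c r)"
  using assms
  apply (cases a; cases b; cases c)
  apply (auto simp: mod2_ac)
  apply (auto simp: expand w_assoc w_neg_add w_neg_right add_ac mult_ac)
  done

lemma fus_act_g: "label_fus \<delta> (label_act G g a) (label_act G g b) = label_act G g ` label_fus \<delta> a b"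
  apply (cases a; cases b)
  apply (auto simp: image_iff mod2_ac)
  subgoal for x y t by (rule exI[of _ "- t"]) simp
  done

lemma braid_act_g:
  assumes "t \<in> label_fus \<delta> a b"
  shows "label_braid \<sigma> \<omega> q \<alpha> a b t * label_tau \<omega> \<delta> (label_act G (Sdeg D a) b) a t
    = label_tau \<omega> \<delta> a b t * label_braid \<sigma> \<omega> q \<alpha> (label_act G g a) (label_act G g b) (label_act G g t)"
  using assms
  apply (cases a; cases b)
  apply (auto simp: mod2_ac)
  apply (auto simp: expand w_assoc w_neg_add w_neg_right add_ac mult_ac)
  done

text \<open>For two X's the equation is q(t)^2 = (\<alpha> q(t))^2 \<beta>^2, which is why \<beta>
  must be an inverse of \<alpha> up to sign. The mixed cases use q(a)^2 = \<sigma>(a, a).\<close>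

lemma twist_fus_label:
  assumes "t \<in> label_fus \<delta> a b"
  shows "label_twist \<sigma> \<beta> t * Stau D (Sdeg D t) a b t
    = label_braid \<sigma> \<omega> q \<alpha> a b t * (label_braid \<sigma> \<omega> q \<alpha> (label_act G (Sdeg D a) b) a t
      * (label_twist \<sigma> \<beta> a * label_twist \<sigma> \<beta> b))"
  using assms nontrivial
  apply (cases a; cases b)
  apply (auto simp: mod2_ac)
  apply (auto simp: expand w_assoc w_neg_add w_neg_right q_sq[symmetric] beta_sq add_ac mult_ac)
  subgoal by (simp add: field_simps)
  done

text \<open>The sum over \<open>r\<close> is \<open>gauss_minus\<close>. It yields one factor
  \<open>gsum\<close>, and \<alpha>^2 = \<epsilon> \<nu> \<open>gsum\<close> exchanges it for the
  two braiding scalars on the right.\<close>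

lemma braid_fus_right_XXX:
  assumes x: "x = \<delta> + cls t + m"
  shows "(\<Sum>r | cls r = x. \<Sum>n\<in>{n. cls n = m}. \<nu> * (\<nu> * (inverse (q r) * (\<phi> n * (\<sigma> r n * inverse (\<sigma> t r))))))
    = (\<Sum>n\<in>{n. cls n = m}. \<alpha> * (\<alpha> * (\<epsilon> * (\<nu> * (q t * (q n * (\<phi> n * inverse (\<sigma> t n))))))))"
proof -
  have "(\<Sum>r | cls r = x. \<Sum>n\<in>{n. cls n = m}. \<nu> * (\<nu> * (inverse (q r) * (\<phi> n * (\<sigma> r n * inverse (\<sigma> t r))))))
    = (\<Sum>n\<in>{n. cls n = m}. \<nu> * \<nu> * \<phi> n * (\<Sum>r | cls r = x. inverse (q r) * (inverse (\<sigma> t r) * \<sigma> r n)))"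
    by (subst sum.swap) (simp add: sum_distrib_left mult_ac)
  also have "\<dots> = (\<Sum>n\<in>{n. cls n = m}. \<epsilon> * \<nu> * (\<alpha> * \<alpha>) * (q t * (q n * (\<phi> n * inverse (\<sigma> t n)))))"
  proof (rule sum.cong[OF refl])
    fix n assume "n \<in> {n. cls n = m}"
    then have "x = \<delta> + cls t + cls n" using x by simp
    from gauss_minus[OF this]
    show "\<nu> * \<nu> * \<phi> n * (\<Sum>r | cls r = x. inverse (q r) * (inverse (\<sigma> t r) * \<sigma> r n))
        = \<epsilon> * \<nu> * (\<alpha> * \<alpha>) * (q t * (q n * (\<phi> n * inverse (\<sigma> t n))))"
      by (simp only: alpha_sq) (simp add: mult_ac)
  qed
  finally show ?thesis by (simp add: mult_ac)
qed

text \<open>The factor \<sigma>(r, n) couples the two inner sums. Reading \<open>gauss_plus\<close>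
  backwards replaces it by a sum over \<open>p\<close> of products in which \<open>r\<close> and
  \<open>n\<close> are separate. The sum over \<open>r\<close> then forces p = t, and the sum over
  \<open>n\<close> undoes the last associator.\<close>

lemma braid_fus_left_XXX:
  assumes t: "cls t = T" and T: "T = \<delta> + k + m"
  shows "(\<Sum>r | cls r = k. \<Sum>n\<in>{n. cls n = m}. \<Sum>v\<in>{v. cls v = T}. \<alpha> * (\<alpha> * (\<epsilon> * (\<nu> * (\<nu> * (\<nu>
      * (q r * (q n * (\<phi> v * (\<sigma> r n * (inverse (\<sigma> t r) * inverse (\<sigma> n v))))))))))))
    = inverse (q t) * \<phi> t"
proof -
  \<comment> \<open>The functional after the last associator, without its constants; summation
    against \<sigma>(t, .) inverts this transform.\<close>
  define \<psi> where "\<psi> n = (\<Sum>v | cls v = T. inverse (\<sigma> n v) * \<phi> v)" for n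
  have "(\<Sum>r | cls r = k. \<Sum>n\<in>{n. cls n = m}. \<Sum>v\<in>{v. cls v = T}. \<alpha> * (\<alpha> * (\<epsilon> * (\<nu> * (\<nu> * (\<nu>
      * (q r * (q n * (\<phi> v * (\<sigma> r n * (inverse (\<sigma> t r) * inverse (\<sigma> n v))))))))))))
    = (\<Sum>r | cls r = k. \<Sum>n | cls n = m. \<epsilon> * (\<nu> * (\<nu> * \<nu>)) * (\<alpha> * \<alpha>)
        * (q r * (q n * \<sigma> r n)) * (inverse (\<sigma> t r) * \<psi> n))"
    by (simp add: \<psi>_def sum_distrib_left mult_ac)
  also have "\<dots> = (\<Sum>r | cls r = k. \<Sum>n | cls n = m. \<Sum>p | cls p = T.
      \<nu> * (\<nu> * (\<nu> * \<nu>)) * inverse (q p) * ((inverse (\<sigma> t r) * \<sigma> p r) * (\<sigma> p n * \<psi> n)))"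
  proof (intro sum.cong refl)
    fix r n assume "r \<in> {r. cls r = k}" "n \<in> {n. cls n = m}"
    then have "T = \<delta> + cls r + cls n" using T by simp
    \<comment> \<open>The factor \<open>gsum\<close> on the right of this identity is supplied by
      \<alpha>^2.\<close>
    note G = gauss_plus[OF this]
    have "\<epsilon> * (\<nu> * (\<nu> * \<nu>)) * (\<alpha> * \<alpha>) * (q r * (q n * \<sigma> r n)) * (inverse (\<sigma> t r) * \<psi> n)
        = \<nu> * (\<nu> * (\<nu> * \<nu>)) * (q r * (q n * (\<sigma> r n * gsum))) * (inverse (\<sigma> t r) * \<psi> n)"
      by (simp only: alpha_sq) (simp add: mult_ac)
    also have "\<dots> = (\<Sum>p | cls p = T.
      \<nu> * (\<nu> * (\<nu> * \<nu>)) * inverse (q p) * ((inverse (\<sigma> t r) * \<sigma> p r) * (\<sigma> p n * \<psi> n)))"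
      unfolding G[symmetric] by (simp add: sum_distrib_left sum_distrib_right sigma_commute mult_ac)
    finally show "\<epsilon> * (\<nu> * (\<nu> * \<nu>)) * (\<alpha> * \<alpha>) * (q r * (q n * \<sigma> r n)) * (inverse (\<sigma> t r) * \<psi> n)
      = (\<Sum>p | cls p = T. \<nu> * (\<nu> * (\<nu> * \<nu>)) * inverse (q p) * ((inverse (\<sigma> t r) * \<sigma> p r) * (\<sigma> p n * \<psi> n)))" .
  qed
  also have "\<dots> = (\<Sum>r | cls r = k. \<Sum>p | cls p = T. \<Sum>n | cls n = m.
      \<nu> * (\<nu> * (\<nu> * \<nu>)) * inverse (q p) * ((inverse (\<sigma> t r) * \<sigma> p r) * (\<sigma> p n * \<psi> n)))"
    by (rule sum.cong[OF refl], rule sum.swap)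
  also have "\<dots> = (\<Sum>p | cls p = T. \<Sum>r | cls r = k. \<Sum>n | cls n = m.
      \<nu> * (\<nu> * (\<nu> * \<nu>)) * inverse (q p) * ((inverse (\<sigma> t r) * \<sigma> p r) * (\<sigma> p n * \<psi> n)))"
    by (rule sum.swap)
  also have "\<dots> = (\<Sum>p | cls p = T. \<nu> * (\<nu> * (\<nu> * \<nu>)) * inverse (q p)
      * ((\<Sum>r | cls r = k. inverse (\<sigma> t r) * \<sigma> p r) * (\<Sum>n | cls n = m. \<sigma> p n * \<psi> n)))"
    by (simp only: sum_product) (simp only: sum_distrib_left)
  also have "\<dots> = (\<Sum>p | cls p = T. if p = t then \<nu> * (\<nu> * (\<nu> * \<nu>)) * inverse (q t) * (N * (\<Sum>n | cls n = m. \<sigma> t n * \<psi> n)) else 0)"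
    by (rule sum.cong[OF refl]) (use t in \<open>auto simp: sigma_orthogonal\<close>)
  also have "\<dots> = inverse (q t) * (\<nu> * \<nu> * N) * (\<nu> * \<nu> * (\<Sum>n | cls n = m. \<sigma> t n * \<psi> n))"
    using t by (simp add: mult_ac)
  also have "\<nu> * \<nu> * (\<Sum>n | cls n = m. \<sigma> t n * \<psi> n) = \<phi> t"
    using inverse_fsym_XXX[OF t, where k = m and \<phi> = \<phi>]
    by (simp add: \<psi>_def sum_distrib_left sigma_commute mult_ac)
  finally show ?thesis by (simp add: nu_sq)
qed

lemma braid_fus_right_label:
  assumes "t \<in> label_fus \<delta> a b" "u \<in> label_fus \<delta> t c"
  defines "h \<equiv> Sdeg D a"
  shows "(\<Sum>r\<in>{r \<in> label_fus \<delta> b c. u \<in> label_fus \<delta> a r}. label_assoc \<sigma> \<omega> \<delta> \<epsilon> a b c u t r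
        * (label_braid \<sigma> \<omega> q \<alpha> a r u * (Stau D h b c r *
        (\<Sum>v\<in>{v \<in> label_fus \<delta> (label_act G h c) a. u \<in> label_fus \<delta> (label_act G h b) v}.
          label_assoc \<sigma> \<omega> \<delta> \<epsilon> (label_act G h b) (label_act G h c) a u (label_act G h r) v * \<phi> v))))
      = label_braid \<sigma> \<omega> q \<alpha> a b t * (\<Sum>v\<in>{v \<in> label_fus \<delta> a c. u \<in> label_fus \<delta> (label_act G h b) v}.
          label_assoc \<sigma> \<omega> \<delta> \<epsilon> (label_act G h b) a c u t v * (label_braid \<sigma> \<omega> q \<alpha> a c v * \<phi> v))"
  using assms nontrivial
  apply (cases a; cases b; cases c)
  apply (simp_all add: channel omega_eq_w mod2_ac add.assoc h_def del: sum_constant cong: conj_cong)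
  apply (auto simp: channel expand w_assoc w_neg_add w_neg_right add_ac mult_ac sum_shift simp del: sum_constant)
     subgoal premises prems for a x y u
     proof -
       define r where "r = u - a"
       then have u: "u = a + r" by (simp add: algebra_simps)
       \<comment> \<open>Expanding \<sigma>(a, a+r) splits off \<sigma>(a, a) = q(a)^2, which
         cancels the two braiding scalars of \<open>a\<close> and leaves a sign.\<close>
       have "\<sigma> a r * w (cls a) a r = inverse (q a) * (inverse (q a) * \<sigma> a (a + r))"
         by (simp add: sigma_add field_simps q_sq)
       with prems show ?thesis unfolding u by simp
     qed
    subgoal for x b y u
      by (simp add: channel Collect_conv_if2 q_add expand w_neg_cancel mod2_ac add_ac mult_ac)
   subgoal for x y c t by (simp add: field_simps q_sq)
  subgoal for x y z t
    using braid_fus_right_XXX[where x = "y + (z + \<delta>)" and t = t and m = "x + (z + \<delta>)" and \<phi> = "\<lambda>n. \<phi> (Cs n)"]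
    by (simp add: mod2_ac mult_ac)
  done

lemma braid_fus_left_label:
  assumes "t \<in> label_fus \<delta> a b" "u \<in> label_fus \<delta> t c"
  defines "c' \<equiv> label_act G (Sdeg D b) c" and "c'' \<equiv> label_act G (Sdeg D a) (label_act G (Sdeg D b) c)"
  shows "(\<Sum>r\<in>{r \<in> label_fus \<delta> b c. u \<in> label_fus \<delta> a r}. label_assoc \<sigma> \<omega> \<delta> \<epsilon> a b c u t r
        * (label_braid \<sigma> \<omega> q \<alpha> b c r *
        (\<Sum>s\<in>{s \<in> label_fus \<delta> a c'. u \<in> label_fus \<delta> s b}. Finv a c' b u r s * (label_braid \<sigma> \<omega> q \<alpha> a c' s *
          (\<Sum>t'\<in>{t' \<in> label_fus \<delta> a b. u \<in> label_fus \<delta> c'' t'}. label_assoc \<sigma> \<omega> \<delta> \<epsilon> c'' a b u s t' * \<phi> t')))))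
      = label_braid \<sigma> \<omega> q \<alpha> t c u * \<phi> t"
  using assms nontrivial
  apply (cases a; cases b; cases c)
  apply (simp_all add: channel omega_eq_w mod2_ac add.assoc c'_def c''_def del: sum_constant cong: conj_cong)
  apply (auto simp: channel expand w_assoc w_neg_add w_neg_right add_ac mult_ac sum_shift simp del: sum_constant)
     subgoal premises prems for a x y u
     proof -
       define r where "r = u - a"
       then have u: "u = a + r" by (simp add: algebra_simps)
       have c: "cls r = x + (y + \<delta>)" using prems by (simp add: r_def mod2_ac)
       \<comment> \<open>The class of \<open>r\<close> contains \<delta>, which cancels the
         \<delta>-sign of \<open>q_add\<close>, while \<sigma>(a, a) = q(a)^2 turns the inverse of
         q(a) into q(a).\<close>
       have "inverse (q a) * (\<sigma> a a * (q r * (\<sigma> a r * (w x a r * (w y a r * w (cls a) a r))))) = q (a + r)"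
         by (simp add: q_add q_sq[symmetric] c mod2_ac mult_ac)
       with prems show ?thesis unfolding u by simp
     qed
     subgoal premises prems for x a y u
     proof -
       define r where "r = u - a"
       then have u: "u = a + r" by (simp add: algebra_simps)
       have c: "cls r = x + (y + \<delta>)" using prems by (simp add: r_def mod2_ac)
       have "inverse (q a) * (\<sigma> a a * (q r * (\<sigma> a r * (w x a r * (w y a r * w (cls a) a r))))) = q (a + r)"
         by (simp add: q_add q_sq[symmetric] c mod2_ac mult_ac)
       with prems show ?thesis unfolding u by simp
     qed
   subgoal for x y c t by (simp add: field_simps q_sq)
  subgoal for x y z t
    using braid_fus_left_XXX[where T = "x + (y + \<delta>)" and t = t and k = "y + (z + \<delta>)" and m = "x + (z + \<delta>)" and \<phi> = "\<lambda>n. \<phi> (Cs n)"]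
    by (simp add: mod2_ac mult_ac)
  done

lemma carrier_cases: "h \<in> carrier G \<Longrightarrow> (h = \<one>\<^bsub>G\<^esub> \<Longrightarrow> P) \<Longrightarrow> (h = g \<Longrightarrow> P) \<Longrightarrow> P"
  by (auto simp: carrier)

lemma nu_sqrt: "\<nu> * complex_of_real (sqrt (real (card_double TYPE('a)))) = 1"
  using card_double_pos[where 'a = 'a] unfolding nu_eq[symmetric] by (simp flip: of_real_mult)

text \<open>Strict composition at g g = 1. The sign for the negated label agrees with the original
  one by symmetry of \<omega> in its last two arguments, and signs square to 1.\<close>

lemma tau_tau: "t \<in> label_fus \<delta> a b \<Longrightarrow> label_tau \<omega> \<delta> a b t
    * label_tau \<omega> \<delta> (label_act G g a) (label_act G g b) (label_act G g t) = 1"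
  by (cases a; cases b) (auto simp: omega_eq_w w_commute mult_ac)

lemma crossed_table_extension: "crossed_table G D Finv"
proof
  fix a b c d h k t s u r v \<phi> \<psi> c' c''
  show "finite (Slab D)"
  proof -
    have "finite (range (cls :: 'a \<Rightarrow> 'a mod2))" by simp
    moreover have "range cls = (UNIV :: 'a mod2 set)" using ex_cls by (metis UNIV_eq_I rangeI)
    ultimately have "finite (UNIV :: 'a mod2 set)" by metis
    then have "finite (range Cs \<union> range Xs :: 'a label set)" by simp
    moreover have "range Cs \<union> range Xs = (UNIV :: 'a label set)"
      by (intro equalityI subset_UNIV subsetI) (metis UnI1 UnI2 rangeI sum_label.exhaust)
    ultimately show ?thesis by (metis D_simps(1))
  qed
  show "Sunit D \<in> Slab D" "t \<in> Fus D a b \<Longrightarrow> t \<in> Slab D" "Sdual D a \<in> Slab D" "Sact D h a \<in> Slab D"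
    by simp_all
  show "Fus D (Sunit D) a = {a}" "Fus D a (Sunit D) = {a}" by (cases a; simp)+
  show "\<lbrakk>t \<in> Fus D a b; u \<in> Fus D t c\<rbrakk> \<Longrightarrow>
      (\<Sum>r\<in>{r \<in> Fus D b c. u \<in> Fus D a r}. Fsym D a b c u t r
        * (\<Sum>t'\<in>{t' \<in> Fus D a b. u \<in> Fus D t' c}. Finv a b c u r t' * \<phi> t')) = \<phi> t"
    using fsym_inverse[of t a b u c \<phi>] by simp
  show "\<lbrakk>r \<in> Fus D b c; u \<in> Fus D a r\<rbrakk> \<Longrightarrow>
      (\<Sum>t\<in>{t \<in> Fus D a b. u \<in> Fus D t c}. Finv a b c u r t
        * (\<Sum>r'\<in>{r' \<in> Fus D b c. u \<in> Fus D a r'}. Fsym D a b c u t r' * \<phi> r')) = \<phi> r"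
    using inverse_fsym[of r b c u a \<phi>] by simp
  show "u \<in> Fus D a b \<Longrightarrow> Fsym D a (Sunit D) b u a b = 1"
    by (cases a; cases b) (auto simp: omega_eq_w)
  show "\<lbrakk>t \<in> Fus D a b; s \<in> Fus D t c; u \<in> Fus D s d\<rbrakk> \<Longrightarrow>
      (\<Sum>w\<in>{w \<in> Fus D b c. s \<in> Fus D a w}. Fsym D a b c s t w
        * (\<Sum>v\<in>{v \<in> Fus D w d. u \<in> Fus D a v}. Fsym D a w d u s v
          * (\<Sum>r\<in>{r \<in> Fus D c d. v \<in> Fus D b r}. Fsym D b c d v w r * \<psi> r v)))
      = (\<Sum>r\<in>{r \<in> Fus D c d. u \<in> Fus D t r}. Fsym D t c d u s r
        * (\<Sum>v\<in>{v \<in> Fus D b r. u \<in> Fus D a v}. Fsym D a b r u t v * \<psi> r v))"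
    using fsym_pentagon[of t a b s c u d \<psi>] by simp
  show "Sdual D (Sdual D a) = a" by (cases a) simp_all
  show "Sunit D \<in> Fus D a (Sdual D a)" by (cases a) (auto simp: mod2_ac)
  show "Fsym D a (Sdual D a) a a (Sunit D) (Sunit D) * Sev D a = 1"
    using nu_sqrt by (cases a) (simp_all add: omega_eq_w mult_ac)
  show "Finv (Sdual D a) a (Sdual D a) (Sdual D a) (Sunit D) (Sunit D) * Sev D a = 1"
    using nu_sqrt by (cases a) (simp_all add: omega_eq_w w_commute mult_ac)
  show "finite (carrier G)" by (simp add: carrier)
  show "Sact D \<one>\<^bsub>G\<^esub> a = a" by simp
  show "\<lbrakk>h \<in> carrier G; k \<in> carrier G\<rbrakk> \<Longrightarrow> Sact D (h \<otimes>\<^bsub>G\<^esub> k) a = Sact D h (Sact D k a)"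
    by (cases a) (auto elim!: carrier_cases)
  show "h \<in> carrier G \<Longrightarrow> Sact D h (Sunit D) = Sunit D" by (auto elim!: carrier_cases)
  show "h \<in> carrier G \<Longrightarrow> Fus D (Sact D h a) (Sact D h b) = Sact D h ` Fus D a b"
    using fus_act_g[of a b] by (auto elim!: carrier_cases simp del: fus_XX)
  show "t \<in> Fus D a b \<Longrightarrow> Stau D \<one>\<^bsub>G\<^esub> a b t = 1" by simp
  show "\<lbrakk>h \<in> carrier G; k \<in> carrier G; t \<in> Fus D a b\<rbrakk>
        \<Longrightarrow> Stau D (h \<otimes>\<^bsub>G\<^esub> k) a b t = Stau D k a b t * Stau D h (Sact D k a) (Sact D k b) (Sact D k t)"
    using nontrivial tau_tau[of t a b] by (auto elim!: carrier_cases)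
  show "h \<in> carrier G \<Longrightarrow> Stau D h (Sunit D) a a = 1" "h \<in> carrier G \<Longrightarrow> Stau D h a (Sunit D) a = 1"
    using nontrivial by (cases a; auto elim!: carrier_cases simp: omega_eq_w)+
  show "\<lbrakk>h \<in> carrier G; t \<in> Fus D a b; u \<in> Fus D t c; r \<in> Fus D b c; u \<in> Fus D a r\<rbrakk>
        \<Longrightarrow> Stau D h t c u * (Stau D h a b t *
            Fsym D (Sact D h a) (Sact D h b) (Sact D h c) (Sact D h u) (Sact D h t) (Sact D h r))
          = Fsym D a b c u t r * (Stau D h a r u * Stau D h b c r)"
    using nontrivial tau_fsym[of t a b u c r] by (auto elim!: carrier_cases)
  show "Sdeg D a \<in> carrier G" "Sdeg D (Sunit D) = \<one>\<^bsub>G\<^esub>" by (cases a; simp)+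
  show "t \<in> Fus D a b \<Longrightarrow> Sdeg D t = Sdeg D a \<otimes>\<^bsub>G\<^esub> Sdeg D b"
    by (cases a; cases b) auto
  show "h \<in> carrier G \<Longrightarrow> Sdeg D (Sact D h a) = h \<otimes>\<^bsub>G\<^esub> Sdeg D a \<otimes>\<^bsub>G\<^esub> inv\<^bsub>G\<^esub> h"
    by (cases a) (auto elim!: carrier_cases)
  show "Sact D (Sdeg D a) a = a" by (cases a) simp_all
  show "Fus D (Sact D (Sdeg D a) b) a = Fus D a b"
    by (cases a; cases b) (simp_all add: add.commute mod2_ac)
  show "t \<in> Fus D a b \<Longrightarrow> Sbraid D a b t \<noteq> 0"
    by (cases a; cases b) auto
  show "\<lbrakk>h \<in> carrier G; t \<in> Fus D a b\<rbrakk>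
        \<Longrightarrow> Sbraid D a b t * Stau D h (Sact D (Sdeg D a) b) a t
          = Stau D h a b t * Sbraid D (Sact D h a) (Sact D h b) (Sact D h t)"
    using nontrivial braid_act_g[of t a b] by (auto elim!: carrier_cases)
  show "\<lbrakk>t \<in> Fus D a b; u \<in> Fus D t c; h = Sdeg D a\<rbrakk> \<Longrightarrow>
      (\<Sum>r\<in>{r \<in> Fus D b c. u \<in> Fus D a r}. Fsym D a b c u t r * (Sbraid D a r u * (Stau D h b c r *
        (\<Sum>v\<in>{v \<in> Fus D (Sact D h c) a. u \<in> Fus D (Sact D h b) v}.
          Fsym D (Sact D h b) (Sact D h c) a u (Sact D h r) v * \<phi> v))))
      = Sbraid D a b t * (\<Sum>v\<in>{v \<in> Fus D a c. u \<in> Fus D (Sact D h b) v}.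
          Fsym D (Sact D h b) a c u t v * (Sbraid D a c v * \<phi> v))"
    using braid_fus_right_label[of t a b u c \<phi>] by simp
  show "\<lbrakk>t \<in> Fus D a b; u \<in> Fus D t c; c' = Sact D (Sdeg D b) c; c'' = Sact D (Sdeg D a) c'\<rbrakk> \<Longrightarrow>
      (\<Sum>r\<in>{r \<in> Fus D b c. u \<in> Fus D a r}. Fsym D a b c u t r * (Sbraid D b c r *
        (\<Sum>s\<in>{s \<in> Fus D a c'. u \<in> Fus D s b}. Finv a c' b u r s * (Sbraid D a c' s *
          (\<Sum>t'\<in>{t' \<in> Fus D a b. u \<in> Fus D c'' t'}. Fsym D c'' a b u s t' * \<phi> t')))))
      = Sbraid D t c u * \<phi> t"
    using braid_fus_left_label[of t a b u c \<phi>] by simp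
  show "Stwist D a \<noteq> 0" "Stwist D (Sunit D) = 1" by (cases a; simp)+
  show "h \<in> carrier G \<Longrightarrow> Stwist D (Sact D h a) = Stwist D a"
    by (cases a) (auto elim!: carrier_cases simp: sigma_neg_left sigma_neg_right)
  show "t \<in> Fus D a b \<Longrightarrow> Stwist D t * Stau D (Sdeg D t) a b t
          = Sbraid D a b t * (Sbraid D (Sact D (Sdeg D a) b) a t * (Stwist D a * Stwist D b))"
    using twist_fus_label[of t a b] by simp
  show "Stwist D (Sdual D a) = Stwist D a * Stau D (inv\<^bsub>G\<^esub> (Sdeg D a)) a (Sdual D a) (Sunit D)"
    using nontrivial by (cases a) (auto simp: sigma_neg_left sigma_neg_right)
qed

section \<open>The table of the pointed category\<close>

abbreviation V where "V \<equiv> vect_table G \<sigma> \<omega>"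

text \<open>The associator takes values in {1, -1} and is its own inverse.\<close>

definition Vinv :: "'a label \<Rightarrow> 'a label \<Rightarrow> 'a label \<Rightarrow> 'a label \<Rightarrow> 'a label \<Rightarrow> 'a label \<Rightarrow> complex" where
  "Vinv a b c u r t = w (cls (val a)) (val b) (val c)"

lemma V_simps [simp]:
  "Slab V = range Cs" "Sunit V = Cs 0" "Fus V s s' = {Cs (val s + val s')}"
  "Fsym V s s' s'' u t r = w (cls (val s)) (val s') (val s'')"
  "Sdual V s = Cs (- val s)" "Sev V s = w (cls (val s)) (- val s) (val s)"
  "Sact V h s = (if h = \<one>\<^bsub>G\<^esub> then s else Cs (- val s))"
  "Stau V h s s' t = (if h = \<one>\<^bsub>G\<^esub> then 1 else w (cls (val s)) (val s') (- val s'))"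
  "Sdeg V s = \<one>\<^bsub>G\<^esub>" "Sbraid V s s' t = \<sigma> (val s) (val s')" "Stwist V s = \<sigma> (val s) (val s)"
  by (simp_all add: vect_table_def omega_eq_w)

text \<open>Every fusion product has a single channel, so each axiom is one scalar identity between
  signs and values of \<sigma>.\<close>

lemma crossed_table_vect: "crossed_table G V Vinv"
  apply unfold_locales
  apply (auto simp: Vinv_def Collect_conv_if add_ac w_neg_add w_neg_right sigma_neg_left
      sigma_neg_right carrier mult_ac elim!: carrier_cases simp del: sum_constant)
  apply (simp_all add: w_commute sigma_add sigma_add_left sigma_commute mult_ac)
  subgoal for \<psi> x a b c using w_cycle[of "cls x" c a b] by (simp add: w_commute add_ac mult_ac)
  done

end

section \<open>The extension and its neutral component\<close>

lemma truncate_extend: "action_category.truncate (action_category.extend r m) = r"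
  for r :: "('g, 'o, 'm) action_category"
  by (cases r) (simp add: action_category.truncate_def action_category.extend_def)

lemma fs_crossed_category_simps:
  "action_category.truncate (fs_crossed_category G D) = fs_action_category G D"
  "Grade (fs_crossed_category G D) = (\<lambda>h. {A \<in> fs_ob D. \<forall>a\<in>A. Sdeg D (snd a) = h})"
  "Braid (fs_crossed_category G D) = fs_braid D" "Twist (fs_crossed_category G D) = fs_twist D"
  unfolding fs_crossed_category_def
  by (simp_all add: truncate_extend) (simp_all add: action_category.extend_def crossed_category.fields_def)

lemma fs_braided_category_simps:
  "action_category.truncate (fs_braided_category G D) = fs_action_category G D"
  "Brd (fs_braided_category G D) = fs_braid D \<one>\<^bsub>G\<^esub>" "Twi (fs_braided_category G D) = fs_twist D \<one>\<^bsub>G\<^esub>"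
  unfolding fs_braided_category_def
  by (simp_all add: truncate_extend) (simp_all add: action_category.extend_def braided_category.fields_def)

lemma block_cong:
  "A = A' \<Longrightarrow> B = B' \<Longrightarrow> (\<And>y x. y \<in> B' \<Longrightarrow> x \<in> A' \<Longrightarrow> M y x = M' y x) \<Longrightarrow> block A B M = block A' B' M'"
  unfolding block_def by (auto simp: fun_eq_iff)

text \<open>Both categories are built from tables over the same label type. An object of
  \<open>B\<close> has only labels of degree one, so equality of the two structures is agreement of
  the tables on those labels, transported through the common matrix formulas.\<close>

lemma neutral_component_eqI:
  assumes "formal_crossed_category G D Finv C" "formal_braided_category G V Vinv B"
    and lab: "Slab V = {s \<in> Slab D. Sdeg D s = \<one>\<^bsub>G\<^esub>}" and unit: "Sunit V = Sunit D"
    and fus: "\<And>a b. a \<in> Slab V \<Longrightarrow> b \<in> Slab V \<Longrightarrow> Fus V a b = Fus D a b"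
    and fsym: "\<And>a b c u t r. a \<in> Slab V \<Longrightarrow> b \<in> Slab V \<Longrightarrow> c \<in> Slab V \<Longrightarrow> Fsym V a b c u t r = Fsym D a b c u t r"
    and act: "\<And>h a. h \<in> carrier G \<Longrightarrow> a \<in> Slab V \<Longrightarrow> Sact V h a = Sact D h a"
    and tau: "\<And>h a b t. h \<in> carrier G \<Longrightarrow> a \<in> Slab V \<Longrightarrow> b \<in> Slab V \<Longrightarrow> Stau V h a b t = Stau D h a b t"
    and braid: "\<And>a b t. a \<in> Slab V \<Longrightarrow> b \<in> Slab V \<Longrightarrow> Sbraid V a b t = Sbraid D a b t"
  shows "neutral_component_eq G C B"
proof -
  have ob_iff: "A \<in> fs_ob V \<longleftrightarrow> A \<in> fs_ob D \<and> (\<forall>a\<in>A. Sdeg D (snd a) = \<one>\<^bsub>G\<^esub>)" for A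
    by (auto simp: fs_ob_def lab)
  interpret C: formal_crossed_category G D Finv C by fact
  interpret B: formal_braided_category G V Vinv B by fact
  have ob: "A \<in> fs_ob V \<longleftrightarrow> A \<in> Grade C \<one>\<^bsub>G\<^esub>" for A by (simp add: C.Grade_eq ob_iff)
  have obD: "A \<in> fs_ob V \<Longrightarrow> A \<in> fs_ob D" for A by (simp add: ob_iff)
  have tens [simp]: "fs_tens V X Y = fs_tens D X Y" if "X \<in> fs_ob V" "Y \<in> fs_ob V" for X Y
    unfolding fs_tens_def
    by (intro Collect_cong ex_cong1 conj_cong refl) (use that in \<open>simp add: fus B.lab_ob\<close>)
  have actA [simp]: "fs_act V h A = fs_act D h A" if "h \<in> carrier G" "A \<in> fs_ob V" for h A
    unfolding fs_act_def by (rule image_cong[OF refl]) (use that in \<open>simp add: relabel_def act B.lab_ob\<close>)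
  have tens_ob [simp]: "fs_tens D X Y \<in> fs_ob V" if "X \<in> fs_ob V" "Y \<in> fs_ob V" for X Y
    using B.fs_tens_ob[OF that] that by simp
  have act_ob [simp]: "fs_act D h A \<in> fs_ob V" if "h \<in> carrier G" "A \<in> fs_ob V" for h A
    using B.fs_act_ob[OF that] that by simp
  have rel: "relabel (Sact V h) x = relabel (Sact D h) x" if "h \<in> carrier G" "A \<in> fs_ob V" "x \<in> A" for h A x
    using that by (simp add: relabel_def act B.lab_ob)
  have lab': "s \<in> Slab V" if "A \<in> fs_ob V" "(n, s) \<in> A" for A n s
    using B.lab_ob[OF that] by simp
  have "Assoc B X Y Z = Assoc C X Y Z" if "X \<in> fs_ob V" "Y \<in> fs_ob V" "Z \<in> fs_ob V" for X Y Z
    unfolding B.Assoc_eq C.Assoc_eq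
    by (rule block_cong) (use that lab' in \<open>auto intro!: fsym elim!: fs_tensE\<close>)
  moreover have "LUnit B X = LUnit C X" "RUnit B X = RUnit C X" if "X \<in> fs_ob V" for X
    unfolding B.LUnit_eq C.LUnit_eq B.RUnit_eq C.RUnit_eq
    using that B.unit_ob' by (simp_all add: unit)
  moreover have "ActM B h f = ActM C h f" if "h \<in> carrier G" "f \<in> Arr B" for h f
    unfolding B.ActM_eq C.ActM_eq
  proof (rule block_cong)
    have f: "fdom f \<in> fs_ob V" "fcod f \<in> fs_ob V" and h: "h \<in> carrier G" "inv\<^bsub>G\<^esub> h \<in> carrier G"
      using that by (simp_all add: B.Arr_eq)
    then show "fs_act V h (fdom f) = fs_act D h (fdom f)" "fs_act V h (fcod f) = fs_act D h (fcod f)" by simp_all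
    fix y x assume "y \<in> fs_act D h (fcod f)" "x \<in> fs_act D h (fdom f)"
    then show "entry f (relabel (Sact V (inv\<^bsub>G\<^esub> h)) y) (relabel (Sact V (inv\<^bsub>G\<^esub> h)) x)
        = entry f (relabel (Sact D (inv\<^bsub>G\<^esub> h)) y) (relabel (Sact D (inv\<^bsub>G\<^esub> h)) x)"
      using rel[OF h(2) act_ob[OF h(1) f(1)]] rel[OF h(2) act_ob[OF h(1) f(2)]] by metis
  qed
  moreover have "ActT B h X Y = ActT C h X Y" if h: "h \<in> carrier G" and ob: "X \<in> fs_ob V" "Y \<in> fs_ob V" for h X Y
    unfolding B.ActT_eq C.ActT_eq
  proof (rule block_cong)
    fix y x assume "x \<in> fs_act D h (fs_tens D X Y)"
    then obtain a b u where x: "x = (Node a b, Sact D h u)" "a \<in> X" "b \<in> Y" "u \<in> Fus D (snd a) (snd b)"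
      by (rule C.fs_act_tensE)
    have "snd x \<in> Slab V" using \<open>x \<in> _\<close> B.lab_ob[of "fs_act D h (fs_tens D X Y)" x] h ob by simp
    then have "Sact V (inv\<^bsub>G\<^esub> h) (snd x) = Sact D (inv\<^bsub>G\<^esub> h) (snd x)" using h act by simp
    then show "(case (fst x, fst y) of
           (Node a b, Node a' b') \<Rightarrow>
              if a' = relabel (Sact V h) a \<and> b' = relabel (Sact V h) b
              then Stau V h (snd a) (snd b) (Sact V (inv\<^bsub>G\<^esub> h) (snd x)) else 0
         | _ \<Rightarrow> 0) = (case (fst x, fst y) of
           (Node a b, Node a' b') \<Rightarrow>
              if a' = relabel (Sact D h) a \<and> b' = relabel (Sact D h) b
              then Stau D h (snd a) (snd b) (Sact D (inv\<^bsub>G\<^esub> h) (snd x)) else 0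
         | _ \<Rightarrow> 0)"
      using x h ob rel[OF h ob(1) x(2)] rel[OF h ob(2) x(3)] by (simp add: tau B.lab_ob split: name.split)
  qed (use h ob in simp_all)
  moreover have "Brd B X Y = Braid C \<one>\<^bsub>G\<^esub> X Y" if ob: "X \<in> fs_ob V" "Y \<in> fs_ob V" for X Y
    unfolding B.Brd_eq C.Braid_eq fs_braid_def
  proof (rule block_cong)
    fix y x assume "x \<in> fs_tens D X Y"
    then obtain a b u where x: "x = (Node a b, u)" "a \<in> X" "b \<in> Y" by (rule fs_tensE)
    then show "(case (fst x, fst y) of
         (Node a b, Node b' a') \<Rightarrow>
            if a' = a \<and> b' = relabel (Sact V \<one>\<^bsub>G\<^esub>) b then Sbraid V (snd a) (snd b) (snd x) else 0
       | _ \<Rightarrow> 0) = (case (fst x, fst y) of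
         (Node a b, Node b' a') \<Rightarrow>
            if a' = a \<and> b' = relabel (Sact D \<one>\<^bsub>G\<^esub>) b then Sbraid D (snd a) (snd b) (snd x) else 0
       | _ \<Rightarrow> 0)"
      using ob rel[OF C.one_closed ob(2) x(3)] by (simp add: braid B.lab_ob split: name.split)
  qed (use ob in simp_all)
  moreover have "f \<in> Arr B \<longleftrightarrow> f \<in> Arr C \<and> Dom C f \<in> Grade C \<one>\<^bsub>G\<^esub> \<and> Cod C f \<in> Grade C \<one>\<^bsub>G\<^esub>" for f
    using obD by (auto simp: B.Arr_eq C.Arr_eq ob)
  ultimately show ?thesis
    unfolding neutral_component_eq_def
    by (auto simp: B.Id_eq C.Id_eq B.Comp_eq C.Comp_eq B.Zero_eq C.Zero_eq B.Add_eq C.Add_eq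
        B.Smul_eq C.Smul_eq B.TensM_eq C.TensM_eq unit ob[symmetric])
qed

section \<open>Fourier inversion on the whole group\<close>

lemma sum_character:
  fixes f :: "'a::{ab_group_add, finite} \<Rightarrow> complex"
  assumes "\<And>a b. f (a + b) = f a * f b" and "f d \<noteq> 1"
  shows "(\<Sum>a\<in>UNIV. f a) = 0"
proof -
  have "(\<Sum>a\<in>UNIV. f a) = (\<Sum>a\<in>UNIV. f (d + a))"
    by (rule sum.reindex_bij_witness[of _ "\<lambda>a. d + a" "\<lambda>a. a - d"]) auto
  also have "\<dots> = f d * (\<Sum>a\<in>UNIV. f a)"
    by (simp add: assms(1) sum_distrib_left[symmetric])
  finally show ?thesis using assms(2) by simp
qed

context sqrt_cocycle
begin

text \<open>Unlike \<sigma>, its square is a nondegenerate bicharacter on all of \<Gamma>. Pairing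
  the hypothesis with the values at -c and summing over \<open>a\<close> isolates |\<Gamma>|
  v(c).\<close>

lemma bilinear_kernel:
  assumes v: "\<And>a. (\<Sum>b\<in>UNIV. \<sigma> a b * \<sigma> a b * v b) = 0"
  shows "v c = 0"
proof -
  have orth: "(\<Sum>a\<in>UNIV. \<sigma> a b * \<sigma> a b) = (if b = 0 then of_nat (card (UNIV :: 'a set)) else 0)" for b
  proof (cases "b = 0")
    case False
    then obtain d where "\<sigma> b d * \<sigma> b d \<noteq> 1" using bilinear_nondegenerate by blast
    then have "(\<Sum>a\<in>UNIV. \<sigma> b a * \<sigma> b a) = 0" by (intro sum_character bilinear_add)
    then show ?thesis using False by (simp add: sigma_commute[of b])
  qed simp
  have "0 = (\<Sum>a\<in>UNIV. \<sigma> a (- c) * \<sigma> a (- c) * (\<Sum>b\<in>UNIV. \<sigma> a b * \<sigma> a b * v b))" by (simp only: v) simp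
  also have "\<dots> = (\<Sum>a\<in>UNIV. \<Sum>b\<in>UNIV. v b * (\<sigma> a (b + - c) * \<sigma> a (b + - c)))"
    by (simp only: bilinear_add sum_distrib_left mult_ac)
  also have "\<dots> = (\<Sum>b\<in>UNIV. v b * (\<Sum>a\<in>UNIV. \<sigma> a (b + - c) * \<sigma> a (b + - c)))"
    by (subst sum.swap) (simp only: sum_distrib_left)
  also have "\<dots> = (\<Sum>b\<in>UNIV. if b = c then v c * of_nat (card (UNIV :: 'a set)) else 0)"
    by (rule sum.cong[OF refl]) (simp add: orth)
  finally show ?thesis by simp
qed

end

section \<open>Neutral component, modularity and quantum dimensions\<close>

context crossed_extension
begin

abbreviation E where "E \<equiv> extension_category G g \<sigma> \<omega> q \<delta> \<epsilon> \<alpha> \<beta>"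

abbreviation B where "B \<equiv> vect_category G \<sigma> \<omega>"

lemma formal_extension: "formal_crossed_category G D Finv E"
proof -
  interpret crossed_table G D Finv by (rule crossed_table_extension)
  show ?thesis
  proof
    show "\<exists>a\<in>Slab D. Sdeg D a = h" if "h \<in> carrier G" for h
      using that D_simps(9)[of 0] D_simps(10)[of 0] by (auto elim!: carrier_cases simp del: D_simps(9,10))
  qed (simp_all add: extension_category_def fs_crossed_category_simps)
qed

lemma formal_vect: "formal_braided_category G V Vinv B"
proof -
  interpret crossed_table G V Vinv by (rule crossed_table_vect)
  show ?thesis
    by unfold_locales (simp_all add: vect_category_def fs_braided_category_simps)
qed

lemma neutral_component_extension: "neutral_component_eq G E B"
proof (rule neutral_component_eqI[OF formal_extension formal_vect])
  show "Slab V = {s \<in> Slab D. Sdeg D s = \<one>\<^bsub>G\<^esub>}"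
  proof -
    have "s \<in> Slab V \<longleftrightarrow> Sdeg D s = \<one>\<^bsub>G\<^esub>" for s
      using nontrivial by (cases s) auto
    then show ?thesis by auto
  qed
qed (auto simp: omega_eq_w elim!: carrier_cases)

text \<open>The twist of a+b cancels against its braiding with the dual and the evaluation, as the
  dimension of this object is 1. What is left is the double braiding, that is B_Q(a, b).\<close>

lemma S_matrix_vect:
  assumes "snd x = Cs a" "snd y = Cs b"
  shows "S_matrix B {x} {y} = \<sigma> a b * \<sigma> a b"
proof -
  interpret B: formal_braided_category G V Vinv B by (rule formal_vect)
  have "S_matrix B {x} {y} = \<sigma> (a + b) (a + b) * (\<sigma> a b * \<sigma> b a)
      * (\<sigma> (a + b) (- (a + b)) * w (cls (a + b)) (- (a + b)) (a + b))"
    using B.S_matrix_single[of x y "Cs (a + b)"] assms by simp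
  also have "\<dots> = \<sigma> a b * \<sigma> a b"
    unfolding sigma_neg_right[of "a + b" "a + b"] w_commute[of _ "- (a + b)"] sigma_commute[of b]
    by (simp del: cls_add w_add add: mult_ac)
  finally show ?thesis .
qed

lemma modular_vect: "modular_category B"
proof -
  interpret B: formal_braided_category G V Vinv B by (rule formal_vect)
  show ?thesis
  proof (rule B.modular_categoryI)
    fix S v Y
    assume rep: "simple_representatives B (Ob B) S (\<lambda>X. X)"
      and v: "\<And>X. X \<in> S \<Longrightarrow> (\<Sum>Y \<in> S. S_matrix B X Y * v Y) = 0" and Y: "Y \<in> S"
    have single: "\<exists>x a. X = {x} \<and> snd x = Cs a" if "X \<in> S" for X
      using rep that unfolding simple_representatives_def B.simple_object_iff by fastforce
    have uniq: "\<exists>!X. X \<in> S \<and> isomorphic B (simple_sum (Cs a)) X" for a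
      using rep unfolding simple_representatives_def B.simple_object_iff by (auto simp: simple_sum_def)
    have iso: "isomorphic B (simple_sum (Cs a)) {x} \<longleftrightarrow> snd x = Cs a" if "{x} \<in> S" for a x
      using B.isomorphic_singletons[of "(Leaf 0, Cs a)" x] single[OF that] by (auto simp: simple_sum_def)
    have "\<exists>!X. X \<in> S \<and> (\<exists>x. X = {x} \<and> snd x = Cs a)" for a
    proof -
      have "(X \<in> S \<and> isomorphic B (simple_sum (Cs a)) X) = (X \<in> S \<and> (\<exists>x. X = {x} \<and> snd x = Cs a))" for X
        using single[of X] iso by blast
      then show ?thesis using uniq[of a] by simp
    qed
    then have ex: "\<exists>x. {x} \<in> S \<and> snd x = Cs a"
      and eq: "{x} \<in> S \<Longrightarrow> {y} \<in> S \<Longrightarrow> snd x = Cs a \<Longrightarrow> snd y = Cs a \<Longrightarrow> {x} = {y}" for a x y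
      by blast+
    \<comment> \<open>The set of representatives is arbitrary and its summands may have any names;
      choosing the member with label \<open>Cs a\<close> for each \<open>a\<close> parametrises it
      by \<Gamma> and reduces the claim to \<open>bilinear_kernel\<close>.\<close>
    then obtain p where p: "\<And>a. {p a} \<in> S" "\<And>a. snd (p a) = Cs a" by metis
    define r where "r a = {p a}" for a
    have inj: "inj r"
    proof (rule injI)
      fix a b assume "r a = r b"
      then have "snd (p a) = snd (p b)" by (simp add: r_def)
      then show "a = b" by (simp add: p(2))
    qed
    have range: "S = range r"
    proof (intro equalityI subsetI)
      fix X assume X: "X \<in> S"
      then obtain x a where x: "X = {x}" "snd x = Cs a" using single by blast
      then have "X = r a" using eq[of x "p a" a] p X by (simp add: r_def)
      then show "X \<in> range r" by simp
    qed (auto simp: r_def p)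
    have "(\<Sum>b\<in>UNIV. \<sigma> a b * \<sigma> a b * v (r b)) = 0" for a
    proof -
      have "S_matrix B (r a) (r b) = \<sigma> a b * \<sigma> a b" for b
        unfolding r_def by (rule S_matrix_vect) (rule p)+
      then show ?thesis using v[of "r a"] p(1)[of a] by (simp add: range sum.reindex[OF inj])
    qed
    then have "v (r c) = 0" for c by (rule bilinear_kernel)
    then show "v Y = 0" using Y range by blast
  qed
qed

lemma vect_represents: "represents_quadratic_form Q B"
proof -
  interpret B: formal_braided_category G V Vinv B by (rule formal_vect)
  have tens: "fs_tens V (simple_sum (Cs a)) (simple_sum (Cs b))
      = {(Node (Leaf 0, Cs a) (Leaf 0, Cs b), Cs (a + b))}" for a b
    by (auto simp: fs_tens_def simple_sum_def)
  have "simple_representatives B (Ob B) UNIV (\<lambda>a. simple_sum (Cs a))"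
    by (rule B.simple_representatives_labels) (auto simp: simple_sum_def inj_def)
  moreover have "isomorphic B (simple_sum (Cs a)) (simple_sum (Cs a))" for a
    using B.isomorphic_singletons[of "(Leaf 0, Cs a)" "(Leaf 0, Cs a)"] by (simp add: simple_sum_def)
  moreover have "isomorphic B (fs_tens V (simple_sum (Cs a)) (simple_sum (Cs b))) (simple_sum (Cs (a + b)))" for a b
    unfolding tens unfolding simple_sum_def by (subst B.isomorphic_singletons) auto
  moreover have "Brd B (simple_sum (Cs a)) (simple_sum (Cs a))
      = Q a \<star>\<^bsub>B\<^esub> Id B (fs_tens V (simple_sum (Cs a)) (simple_sum (Cs a)))" for a
  proof (rule B.hom_eqI)
    let ?X = "simple_sum (Cs a)"
    let ?T = "fs_tens V ?X ?X"
    have X: "?X \<in> fs_ob V" by (simp add: simple_sum_def)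
    have act: "fs_act V \<one>\<^bsub>G\<^esub> ?X = ?X" by (simp add: fs_act_def simple_sum_def relabel_def)
    show "Brd B ?X ?X \<in> homs B ?T ?T" using X by (simp add: B.homs_iff B.Brd_eq act)
    show "Q a \<star>\<^bsub>B\<^esub> Id B ?T \<in> homs B ?T ?T" using X by (simp add: B.homs_iff)
    fix x \<Phi> assume x: "x \<in> ?T"
    then have x': "x = (Node (Leaf 0, Cs a) (Leaf 0, Cs a), Cs (a + a))" by (simp add: tens)
    have "pull (Brd B ?X ?X) \<Phi> x = \<sigma> a a * \<Phi> x"
      unfolding x' B.Brd_eq by (subst B.pull_braid) (simp_all add: X simple_sum_def relabel_def)
    then show "pull (Brd B ?X ?X) \<Phi> x = pull (Q a \<star>\<^bsub>B\<^esub> Id B ?T) \<Phi> x"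
      using x X by (simp add: sigma_diag)
  qed
  ultimately show ?thesis
    unfolding represents_quadratic_form_def by (intro exI[of _ "\<lambda>a. simple_sum (Cs a)"]) simp
qed

text \<open>\<sigma>(a, -a) is the inverse of the twist \<sigma>(a, a) up to exactly the sign
  carried by the evaluation.\<close>

lemma quantum_dim_Cs: "quantum_dim E \<one>\<^bsub>G\<^esub> {(n, Cs a)} = 1"
proof -
  interpret E: formal_crossed_category G D Finv E by (rule formal_extension)
  show ?thesis
    by (subst E.quantum_dim_single)
      (simp_all add: sigma_neg_right omega_eq_w w_commute[of _ "- a"] mult_ac)
qed

text \<open>The trace sees the braiding only on the summand with label 0, where \<open>q\<close> is
  1; the factor \<epsilon> and the square root come from the evaluation.\<close>

lemma quantum_dim_Xs:
  "quantum_dim E g {(n, Xs x)} = \<alpha> * \<beta> * \<epsilon> * complex_of_real (sqrt (real (card_double TYPE('a))))"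
proof -
  interpret E: formal_crossed_category G D Finv E by (rule formal_extension)
  show ?thesis by (subst E.quantum_dim_single) (simp_all add: mult_ac)
qed

lemma quantum_dim_positive_iff:
  "(\<forall>h \<in> carrier G. \<forall>X \<in> Grade E h. simple_object E X \<longrightarrow>
      quantum_dim E h X \<in> \<real> \<and> 0 < Re (quantum_dim E h X)) \<longleftrightarrow> \<alpha> * \<beta> = \<epsilon>"
proof -
  interpret E: formal_crossed_category G D Finv E by (rule formal_extension)
  let ?s = "sqrt (real (card_double TYPE('a)))"
  have s: "?s > 0" using card_double_pos[where 'a = 'a] by simp
  have "\<alpha> * \<beta> \<in> {1, -1}" using beta by auto
  \<comment> \<open>Both \<alpha>\<beta> and \<epsilon> are signs, so their product is a sign
    \<open>c\<close>, and it is 1 exactly when they agree; \<open>c\<close> is the sign of every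
    dimension in the nontrivial component.\<close>
  then obtain c :: real where c: "\<alpha> * \<beta> * \<epsilon> = complex_of_real c" "c = 1 \<and> \<alpha> * \<beta> = \<epsilon> \<or> c = - 1 \<and> \<alpha> * \<beta> \<noteq> \<epsilon>"
    using sign that[of 1] that[of "- 1"] by auto
  have iff: "quantum_dim E g {(n, Xs x)} \<in> \<real> \<and> 0 < Re (quantum_dim E g {(n, Xs x)}) \<longleftrightarrow> \<alpha> * \<beta> = \<epsilon>" for n x
  proof -
    have "quantum_dim E g {(n, Xs x)} = complex_of_real (c * ?s)"
      unfolding quantum_dim_Xs c(1) by simp
    then show ?thesis using c(2) s by (auto simp: zero_less_mult_iff)
  qed
  show ?thesis
  proof
    assume L: "\<forall>h \<in> carrier G. \<forall>X \<in> Grade E h. simple_object E X \<longrightarrow>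
      quantum_dim E h X \<in> \<real> \<and> 0 < Re (quantum_dim E h X)"
    have "{(Leaf 0, Xs 0)} \<in> Grade E g" "simple_object E {(Leaf 0, Xs 0)}"
      by (auto simp: E.Grade_eq E.simple_object_iff)
    with L have "quantum_dim E g {(Leaf 0, Xs 0)} \<in> \<real> \<and> 0 < Re (quantum_dim E g {(Leaf 0, Xs 0)})"
      using g_carrier by blast
    then show "\<alpha> * \<beta> = \<epsilon>" by (simp only: iff)
  next
    assume R: "\<alpha> * \<beta> = \<epsilon>"
    show "\<forall>h \<in> carrier G. \<forall>X \<in> Grade E h. simple_object E X \<longrightarrow>
      quantum_dim E h X \<in> \<real> \<and> 0 < Re (quantum_dim E h X)"
    proof (intro ballI impI)
      fix h X assume X: "X \<in> Grade E h" "simple_object E X"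
      then obtain n s where x: "X = {(n, s)}" by (auto simp: E.simple_object_iff)
      then have h: "Sdeg D s = h" using X(1) by (simp add: E.Grade_eq)
      show "quantum_dim E h X \<in> \<real> \<and> 0 < Re (quantum_dim E h X)"
      proof (cases s)
        case (Cs a)
        then show ?thesis using h by (auto simp: x quantum_dim_Cs)
      next
        case (Xs y)
        then show ?thesis using h R iff[of n y] by (auto simp: x)
      qed
    qed
  qed
qed

lemma simple_representatives_extension:
  "simple_representatives E (Grade E \<one>\<^bsub>G\<^esub>) UNIV (\<lambda>a. simple_sum (Cs a))"
  "simple_representatives E (Grade E g) UNIV (\<lambda>x. simple_sum (Xs x))"
proof -
  interpret E: formal_crossed_category G D Finv E by (rule formal_extension)
  have deg: "Sdeg D s = \<one>\<^bsub>G\<^esub> \<longleftrightarrow> s \<in> range Cs" "Sdeg D s = g \<longleftrightarrow> s \<in> range Xs" for s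
    using nontrivial by (cases s; auto)+
  show "simple_representatives E (Grade E \<one>\<^bsub>G\<^esub>) UNIV (\<lambda>a. simple_sum (Cs a))"
    "simple_representatives E (Grade E g) UNIV (\<lambda>x. simple_sum (Xs x))"
    by (rule E.simple_representatives_labels; auto simp: E.Grade_eq deg simple_sum_def inj_def)+
qed

end

theorem theorem5p12:
  fixes G :: "'g monoid" and g :: 'g
    and Q q :: "'a::{ab_group_add, finite} \<Rightarrow> complex"
    and \<sigma> :: "'a \<Rightarrow> 'a \<Rightarrow> complex" and \<omega> :: "'a \<Rightarrow> 'a \<Rightarrow> 'a \<Rightarrow> complex"
    and \<delta> :: "'a mod2" and \<epsilon> \<alpha> \<beta> :: complex
  assumes "group G" and "carrier G = {\<one>\<^bsub>G\<^esub>, g}" and "g \<noteq> \<one>\<^bsub>G\<^esub>"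
    and "discriminant_form Q"
    and "special_abelian_cocycle Q \<sigma> \<omega>"
    and "sqrt_datum Q \<sigma> \<omega> q \<delta>"
    and "\<epsilon> \<in> {1, -1}"
    and "\<alpha>^2 = \<epsilon> * gauss_sum \<delta> (\<lambda>a. inverse (q a))"
    and "\<beta> \<in> {inverse \<alpha>, - inverse \<alpha>}"
  defines "C \<equiv> extension_category G g \<sigma> \<omega> q \<delta> \<epsilon> \<alpha> \<beta>"
  shows "crossed_ribbon_fusion_category G C
    \<and> simple_representatives C (Grade C \<one>\<^bsub>G\<^esub>) UNIV (\<lambda>a. simple_sum (Cs a))
    \<and> simple_representatives C (Grade C g) UNIV (\<lambda>x. simple_sum (Xs x))
    \<and> braided_crossed_extension G C (vect_category G \<sigma> \<omega>)
    \<and> modular_category (vect_category G \<sigma> \<omega>)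
    \<and> represents_quadratic_form Q (vect_category G \<sigma> \<omega>)
    \<and> ((\<forall>h \<in> carrier G. \<forall>X \<in> Grade C h. simple_object C X \<longrightarrow>
           quantum_dim C h X \<in> \<real> \<and> 0 < Re (quantum_dim C h X))
        \<longleftrightarrow> \<alpha> * \<beta> = \<epsilon>)"
proof -
  interpret crossed_extension G g Q q \<sigma> \<omega> \<delta> \<epsilon> \<alpha> \<beta>
    using assms(1-9) by (intro crossed_extension.intro sqrt_cocycle.intro crossed_extension_axioms.intro)
  interpret E: formal_crossed_category G D Finv C
    using formal_extension unfolding C_def .
  interpret B: formal_braided_category G V Vinv B by (rule formal_vect)
  have "crossed_ribbon_fusion_category G C" "braided_crossed_category G C"
    "braided_tensor_category_with_action G B" by unfold_locales
  then show ?thesis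
    using simple_representatives_extension neutral_component_extension modular_vect vect_represents
      quantum_dim_positive_iff
    unfolding braided_crossed_extension_def C_def by blast
qed

end
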